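(* Let $k$ be an algebraically closed field of characteristic $0$, let $n\ge3$, let $q\in k$ be a primitive $n$-th root of unity, and let $A=k_q[u,v]$, $A'=k_q[u',v']$ with the $U_q(\mathfrak{sl}_2)$-actions and the twisting map $\tau:A\otimes A'\to A'\otimes A$ given in the context. The algebra $A'\otimes^\tau A$ is generated by $u,v,u',v'$, subject to the relations $$r_1:=uv-qvu,\qquad r_2:=u'v'-qv'u',\qquad r_3:=uu'-qu'u,$$ $$r_4:=vu'-q^2u'v-(q-q^3)v'u,\qquad r_5:=uv'-q^2v'u,\qquad r_6:=vv'-qv'v.$$ The smash product $(A'\otimes^\tau A)\# U_q(\mathfrak{sl}_2)$ admits PBW deformations $$\mathcal{D}_{A'\otimes^\tau A,\kappa}=\frac{k\langle u,v,u',v'\rangle\# U_q(\mathfrak{sl}_2)}{(r_i-\kappa(r_i)\mid 1\le i\le 6)}$$ with $$\kappa(r_4)=\alpha K^{ns},\qquad\kappa(r_5)=-q^{-1}\alpha K^{ns},$$ where $\alpha\in k$ is an arbitrary scalar, $s$ an arbitrary integer, and $\kappa(r_i)=0$ for $i=1,2,3,6$.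
   Context: $k_q[u,v]=k\langle u,v\rangle/(uv-qvu)$, and similarly $k_q[u',v']$. $U_q(\mathfrak{sl}_2)$ is the Hopf algebra generated by $K^{\pm1},E,F$ with relations $KK^{-1}=K^{-1}K=1$, $EF-FE=\frac{K-K^{-1}}{q-q^{-1}}$, $KEK^{-1}=q^2E$, $KFK^{-1}=q^{-2}F$, comultiplication $\Delta(K^{\pm1})=K^{\pm1}\otimes K^{\pm1}$, $\Delta(E)=E\otimes1+K\otimes E$, $\Delta(F)=F\otimes K^{-1}+1\otimes F$, counit $\epsilon(K^{\pm1})=1$, $\epsilon(E)=\epsilon(F)=0$, and antipode $S(K^{\pm1})=K^{\mp1}$, $S(E)=-K^{-1}E$, $S(F)=-FK$. It acts on $A$ by $E\cdot u=0$, $E\cdot v=u$, $F\cdot u=v$, $F\cdot v=0$, $K^{\pm1}\cdot u=q^{\pm1}u$, $K^{\pm1}\cdot v=q^{\mp1}v$, making it a module algebra; the action on $A'$ is the same with $u',v'$ in place of $u,v$. A twisting map is a $k$-linear map $\tau:A\otimes A'\to A'\otimes A$ with $\tau(a\otimes1)=1\otimes a$, $\tau(1\otimes a')=a'\otimes1$ and $\tau\circ(m_A\otimes m_{A'})=m_\tau\circ(\tau\otimes\tau)\circ(\mathrm{id}_A\otimes\tau\otimes\mathrm{id}_{A'})$ on $A\otimes A\otimes A'\otimes A'$, where $m_\tau=(m_{A'}\otimes m_A)\circ(\mathrm{id}_{A'}\otimes\tau\otimes\mathrm{id}_A)$; then $A'\otimes^\tau A$ denotes $A'\otimes A$ with multiplication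 $m_\tau$. Here $\tau$ is the twisting map determined by $$\tau(u\otimes u')=q\,u'\otimes u,\quad\tau(u\otimes v')=q^2v'\otimes u,\quad\tau(v\otimes u')=q^2u'\otimes v+(q-q^3)v'\otimes u,\quad\tau(v\otimes v')=q\,v'\otimes v;$$ it is a $U_q(\mathfrak{sl}_2)$-module map, so $A'\otimes^\tau A$ is a $U_q(\mathfrak{sl}_2)$-module algebra. For a Hopf algebra $H$ and an $H$-module algebra $R$, the smash product $R\# H$ is $R\otimes H$ with product $(a\otimes h)(a'\otimes h')=\sum a(h_1\cdot a')\otimes h_2h'$. $\mathcal{D}_{R,\kappa}$ is filtered by giving $H$ degree $0$ and the generators $u,v,u',v'$ degree $1$; it is a PBW deformation of $R\# H$ if its associated graded algebra is isomorphic to $R\# H$ as an $\mathbb{N}$-graded algebra. $\kappa$ is extended linearly to the span $I$ of $r_1,\dots,r_6$. *)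

theory Defs
  imports
    "HOL-Algebra.QuotRing"
    "HOL-Algebra.Module"
    "HOL-Library.Poly_Mapping"
    "HOL-Computational_Algebra.Polynomial"
begin

section \<open>Algebras over a field\<close>

text \<open>
  The ground field is a type \<open>'k\<close>; not necessarily commutative \<open>'k\<close>-algebras are carried by
  the records of type \<open>('k, 'a) module\<close>.  For plain vector spaces the multiplicative fields of the
  record are irrelevant.
\<close>

definition ground :: "('k::field, 'k) module" where
  "ground = \<lparr>carrier = UNIV, monoid.mult = (*), one = 1, zero = 0, add = (+), module.smult = (*)\<rparr>"

definition lspan :: "('k::field, 'a, 'm) module_scheme \<Rightarrow> 'a set \<Rightarrow> 'a set" where
  "lspan M S = \<Inter> {N. submodule N ground M \<and> S \<subseteq> N}"

definition lin_map ::
  "('k::field, 'a, 'm) module_scheme \<Rightarrow> ('k, 'b, 'n) module_scheme \<Rightarrow> ('a \<Rightarrow> 'b) \<Rightarrow> bool" where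
  "lin_map M N f \<longleftrightarrow>
     f \<in> carrier M \<rightarrow> carrier N \<and>
     (\<forall>x\<in>carrier M. \<forall>y\<in>carrier M. f (x \<oplus>\<^bsub>M\<^esub> y) = f x \<oplus>\<^bsub>N\<^esub> f y) \<and>
     (\<forall>c. \<forall>x\<in>carrier M. f (c \<odot>\<^bsub>M\<^esub> x) = c \<odot>\<^bsub>N\<^esub> f x)"

definition alg_iso ::
  "('k::field, 'a, 'm) module_scheme \<Rightarrow> ('k, 'b, 'n) module_scheme \<Rightarrow> ('a \<Rightarrow> 'b) set" where
  "alg_iso A B = {\<phi> \<in> ring_iso A B. lin_map A B \<phi>}"

text \<open>Quotient of an algebra by an ideal, or of a vector space by a subspace.\<close>

definition quot :: "('k, 'a, 'm) module_scheme \<Rightarrow> 'a set \<Rightarrow> ('k, 'a set) module" where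
  "quot M I =
     \<lparr>carrier = a_rcosets\<^bsub>M\<^esub> I, monoid.mult = rcoset_mult M I, one = I +>\<^bsub>M\<^esub> \<one>\<^bsub>M\<^esub>, zero = I,
      add = set_add M, module.smult = (\<lambda>c X. \<Union>x\<in>X. I +>\<^bsub>M\<^esub> (c \<odot>\<^bsub>M\<^esub> x))\<rparr>"

text \<open>The map on a quotient induced by a map that is constant on cosets.\<close>

definition descend :: "('a \<Rightarrow> 'b) \<Rightarrow> 'a set \<Rightarrow> 'b" where
  "descend f X = the_elem (f ` X)"


section \<open>Free algebras\<close>

text \<open>Lists under concatenation form the free monoid, so \<open>'x list \<Rightarrow>\<^sub>0 'k\<close> is the free algebra on \<open>'x\<close>.\<close>

instantiation list :: (type) monoid_add
begin
definition zero_list :: "'a list" where "zero_list = []"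
definition plus_list :: "'a list \<Rightarrow> 'a list \<Rightarrow> 'a list" where "plus_list = (@)"
instance by standard (simp_all add: zero_list_def plus_list_def)
end

definition scale :: "'k::field \<Rightarrow> ('s \<Rightarrow>\<^sub>0 'k) \<Rightarrow> 's \<Rightarrow>\<^sub>0 'k" where
  "scale c x = Poly_Mapping.map ((*) c) x"

definition free_alg :: "('k::field, 'x list \<Rightarrow>\<^sub>0 'k) module" where
  "free_alg =
     \<lparr>carrier = UNIV, monoid.mult = (*), one = 1, zero = 0, add = (+), module.smult = scale\<rparr>"

definition gen :: "'x \<Rightarrow> 'x list \<Rightarrow>\<^sub>0 'k::field" where
  "gen x = Poly_Mapping.single [x] 1"

definition free_lift ::
  "('k::field, 'b, 'm) module_scheme \<Rightarrow> ('x \<Rightarrow> 'b) \<Rightarrow> ('x list \<Rightarrow>\<^sub>0 'k) \<Rightarrow> 'b" where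
  "free_lift B f x =
     (\<Oplus>\<^bsub>B\<^esub> w\<in>Poly_Mapping.keys x.
        Poly_Mapping.lookup x w \<odot>\<^bsub>B\<^esub> foldr (\<lambda>g y. f g \<otimes>\<^bsub>B\<^esub> y) w \<one>\<^bsub>B\<^esub>)"

definition free_hom :: "nat \<Rightarrow> ('x list \<Rightarrow>\<^sub>0 'k::field) set" where
  "free_hom m = {x. \<forall>w\<in>Poly_Mapping.keys x. length w = m}"

definition presented :: "('x list \<Rightarrow>\<^sub>0 'k::field) set \<Rightarrow> ('k, ('x list \<Rightarrow>\<^sub>0 'k) set) module" where
  "presented S = quot free_alg (genideal free_alg S)"

definition cls :: "('x list \<Rightarrow>\<^sub>0 'k::field) set \<Rightarrow> ('x list \<Rightarrow>\<^sub>0 'k) \<Rightarrow> ('x list \<Rightarrow>\<^sub>0 'k) set" where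
  "cls S x = genideal free_alg S +>\<^bsub>free_alg\<^esub> x"

text \<open>\<open>B\<close> is generated by the family \<open>f\<close>, subject to the relations \<open>S\<close>.\<close>

definition has_presentation ::
  "('k::field, 'b, 'm) module_scheme \<Rightarrow> ('x \<Rightarrow> 'b) \<Rightarrow> ('x list \<Rightarrow>\<^sub>0 'k) set \<Rightarrow> bool" where
  "has_presentation B f S \<longleftrightarrow>
     (\<exists>\<phi>\<in>alg_iso (presented S) B. \<forall>x. \<phi> (cls S (gen x)) = f x)"


section \<open>Tensor products\<close>

definition free_vs :: "'s set \<Rightarrow> ('k::field, 's \<Rightarrow>\<^sub>0 'k) module" where
  "free_vs S =
     \<lparr>carrier = {x. Poly_Mapping.keys x \<subseteq> S}, monoid.mult = undefined, one = undefined,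
      zero = 0, add = (+), module.smult = scale\<rparr>"

definition tensor_rels ::
  "('k::field, 'a, 'm) module_scheme \<Rightarrow> ('k, 'b, 'n) module_scheme \<Rightarrow> (('a \<times> 'b) \<Rightarrow>\<^sub>0 'k) set" where
  "tensor_rels M N = lspan (free_vs (carrier M \<times> carrier N))
     ({Poly_Mapping.single (a \<oplus>\<^bsub>M\<^esub> a', b) 1 - Poly_Mapping.single (a, b) 1
         - Poly_Mapping.single (a', b) 1
       | a a' b. a \<in> carrier M \<and> a' \<in> carrier M \<and> b \<in> carrier N} \<union>
      {Poly_Mapping.single (a, b \<oplus>\<^bsub>N\<^esub> b') 1 - Poly_Mapping.single (a, b) 1
         - Poly_Mapping.single (a, b') 1
       | a b b'. a \<in> carrier M \<and> b \<in> carrier N \<and> b' \<in> carrier N} \<union>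
      {Poly_Mapping.single (c \<odot>\<^bsub>M\<^esub> a, b) 1 - Poly_Mapping.single (a, b) c
       | a b c. a \<in> carrier M \<and> b \<in> carrier N} \<union>
      {Poly_Mapping.single (a, c \<odot>\<^bsub>N\<^esub> b) 1 - Poly_Mapping.single (a, b) c
       | a b c. a \<in> carrier M \<and> b \<in> carrier N})"

definition tensor ::
  "('k::field, 'a, 'm) module_scheme \<Rightarrow> ('k, 'b, 'n) module_scheme \<Rightarrow>
   ('k, (('a \<times> 'b) \<Rightarrow>\<^sub>0 'k) set) module" where
  "tensor M N = quot (free_vs (carrier M \<times> carrier N)) (tensor_rels M N)"

definition pure ::
  "('k::field, 'a, 'm) module_scheme \<Rightarrow> ('k, 'b, 'n) module_scheme \<Rightarrow> 'a \<Rightarrow> 'b \<Rightarrow>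
   (('a \<times> 'b) \<Rightarrow>\<^sub>0 'k) set" where
  "pure M N a b =
     tensor_rels M N +>\<^bsub>free_vs (carrier M \<times> carrier N)\<^esub> Poly_Mapping.single (a, b) 1"

text \<open>The linear map on a tensor product, with values in \<open>P\<close>, induced by a bilinear map \<open>f\<close>.\<close>

definition tlift ::
  "('k::field, 'c, 'p) module_scheme \<Rightarrow> ('a \<Rightarrow> 'b \<Rightarrow> 'c) \<Rightarrow> (('a \<times> 'b) \<Rightarrow>\<^sub>0 'k) set \<Rightarrow> 'c" where
  "tlift P f =
     descend (\<lambda>x. \<Oplus>\<^bsub>P\<^esub> p\<in>Poly_Mapping.keys x. Poly_Mapping.lookup x p \<odot>\<^bsub>P\<^esub> f (fst p) (snd p))"

definition tensor_alg ::
  "('k::field, 'a, 'm) module_scheme \<Rightarrow> ('k, 'b, 'n) module_scheme \<Rightarrow>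
   ('k, (('a \<times> 'b) \<Rightarrow>\<^sub>0 'k) set) module" where
  "tensor_alg A B = (tensor A B)
     \<lparr>monoid.mult := (\<lambda>X Y. tlift (tensor A B) (\<lambda>a b. tlift (tensor A B) (\<lambda>a' b'.
                 pure A B (a \<otimes>\<^bsub>A\<^esub> a') (b \<otimes>\<^bsub>B\<^esub> b')) Y) X),
      one := pure A B \<one>\<^bsub>A\<^esub> \<one>\<^bsub>B\<^esub>\<rparr>"


section \<open>Twisted tensor products\<close>

text \<open>
  \<open>twist_mult A' A \<tau>\<close> is the multiplication \<open>m\<^sub>\<tau>\<close> on \<open>A' \<otimes> A\<close>, which sends
  \<open>(a' \<otimes> a, b' \<otimes> b)\<close> to the image of \<open>\<tau> (a \<otimes> b')\<close> under \<open>c' \<otimes> c \<mapsto> a'c' \<otimes> cb\<close>.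
\<close>

definition twist_mult ::
  "('k::field, 'a, 'm) module_scheme \<Rightarrow> ('k, 'b, 'n) module_scheme \<Rightarrow>
   ((('b \<times> 'a) \<Rightarrow>\<^sub>0 'k) set \<Rightarrow> (('a \<times> 'b) \<Rightarrow>\<^sub>0 'k) set) \<Rightarrow>
   (('a \<times> 'b) \<Rightarrow>\<^sub>0 'k) set \<Rightarrow> (('a \<times> 'b) \<Rightarrow>\<^sub>0 'k) set \<Rightarrow> (('a \<times> 'b) \<Rightarrow>\<^sub>0 'k) set" where
  "twist_mult A' A \<tau> X Y =
     tlift (tensor A' A) (\<lambda>a' a. tlift (tensor A' A) (\<lambda>b' b.
       tlift (tensor A' A) (\<lambda>c' c. pure A' A (a' \<otimes>\<^bsub>A'\<^esub> c') (c \<otimes>\<^bsub>A\<^esub> b)) (\<tau> (pure A A' a b'))) Y) X"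

text \<open>
  The last clause is \<open>\<tau> \<circ> (m\<^sub>A \<otimes> m\<^sub>A\<^sub>') = m\<^sub>\<tau> \<circ> (\<tau> \<otimes> \<tau>) \<circ> (id \<otimes> \<tau> \<otimes> id)\<close>, evaluated on
  \<open>a \<otimes> b \<otimes> c \<otimes> d\<close> in \<open>A \<otimes> A \<otimes> A' \<otimes> A'\<close>.
\<close>

definition twisting_map ::
  "('k::field, 'a, 'm) module_scheme \<Rightarrow> ('k, 'b, 'n) module_scheme \<Rightarrow>
   ((('a \<times> 'b) \<Rightarrow>\<^sub>0 'k) set \<Rightarrow> (('b \<times> 'a) \<Rightarrow>\<^sub>0 'k) set) \<Rightarrow> bool" where
  "twisting_map A A' \<tau> \<longleftrightarrow>
     lin_map (tensor A A') (tensor A' A) \<tau> \<and>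
     (\<forall>a\<in>carrier A. \<tau> (pure A A' a \<one>\<^bsub>A'\<^esub>) = pure A' A \<one>\<^bsub>A'\<^esub> a) \<and>
     (\<forall>a'\<in>carrier A'. \<tau> (pure A A' \<one>\<^bsub>A\<^esub> a') = pure A' A a' \<one>\<^bsub>A\<^esub>) \<and>
     (\<forall>a\<in>carrier A. \<forall>b\<in>carrier A. \<forall>c\<in>carrier A'. \<forall>d\<in>carrier A'.
        \<tau> (pure A A' (a \<otimes>\<^bsub>A\<^esub> b) (c \<otimes>\<^bsub>A'\<^esub> d)) =
        tlift (tensor A' A)
          (\<lambda>c' b'. twist_mult A' A \<tau> (\<tau> (pure A A' a c')) (\<tau> (pure A A' b' d)))
          (\<tau> (pure A A' b c)))"

definition twist_alg ::
  "('k::field, 'a, 'm) module_scheme \<Rightarrow> ('k, 'b, 'n) module_scheme \<Rightarrow>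
   ((('b \<times> 'a) \<Rightarrow>\<^sub>0 'k) set \<Rightarrow> (('a \<times> 'b) \<Rightarrow>\<^sub>0 'k) set) \<Rightarrow>
   ('k, (('a \<times> 'b) \<Rightarrow>\<^sub>0 'k) set) module" where
  "twist_alg A' A \<tau> =
     (tensor A' A)\<lparr>monoid.mult := twist_mult A' A \<tau>, one := pure A' A \<one>\<^bsub>A'\<^esub> \<one>\<^bsub>A\<^esub>\<rparr>"


section \<open>Hopf algebras, module algebras and smash products\<close>

record (overloaded) ('k, 'a) hopf = "('k::zero, 'a) module" +
  comult :: "'a \<Rightarrow> (('a \<times> 'a) \<Rightarrow>\<^sub>0 'k) set"
  counit :: "'a \<Rightarrow> 'k"
  antipode :: "'a \<Rightarrow> 'a"

definition module_algebra ::
  "('k::field, 'h, 'p) hopf_scheme \<Rightarrow> ('k, 'a, 'm) module_scheme \<Rightarrow> ('h \<Rightarrow> 'a \<Rightarrow> 'a) \<Rightarrow> bool" where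
  "module_algebra H R act \<longleftrightarrow>
     (\<forall>h\<in>carrier H. lin_map R R (act h)) \<and>
     (\<forall>a\<in>carrier R. lin_map H R (\<lambda>h. act h a)) \<and>
     (\<forall>a\<in>carrier R. act \<one>\<^bsub>H\<^esub> a = a) \<and>
     (\<forall>g\<in>carrier H. \<forall>h\<in>carrier H. \<forall>a\<in>carrier R. act (g \<otimes>\<^bsub>H\<^esub> h) a = act g (act h a)) \<and>
     (\<forall>h\<in>carrier H. act h \<one>\<^bsub>R\<^esub> = counit H h \<odot>\<^bsub>R\<^esub> \<one>\<^bsub>R\<^esub>) \<and>
     (\<forall>h\<in>carrier H. \<forall>a\<in>carrier R. \<forall>b\<in>carrier R.
        act h (a \<otimes>\<^bsub>R\<^esub> b) = tlift R (\<lambda>h1 h2. act h1 a \<otimes>\<^bsub>R\<^esub> act h2 b) (comult H h))"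

text \<open>The diagonal action on a tensor product of \<open>H\<close>-modules.\<close>

definition tensor_act ::
  "('k::field, 'h, 'p) hopf_scheme \<Rightarrow> ('k, 'a, 'm) module_scheme \<Rightarrow> ('k, 'b, 'n) module_scheme \<Rightarrow>
   ('h \<Rightarrow> 'a \<Rightarrow> 'a) \<Rightarrow> ('h \<Rightarrow> 'b \<Rightarrow> 'b) \<Rightarrow>
   'h \<Rightarrow> (('a \<times> 'b) \<Rightarrow>\<^sub>0 'k) set \<Rightarrow> (('a \<times> 'b) \<Rightarrow>\<^sub>0 'k) set" where
  "tensor_act H M N actM actN h =
     tlift (tensor M N) (\<lambda>m n.
       tlift (tensor M N) (\<lambda>h1 h2. pure M N (actM h1 m) (actN h2 n)) (comult H h))"

definition smash ::
  "('k::field, 'a, 'm) module_scheme \<Rightarrow> ('k, 'h, 'p) hopf_scheme \<Rightarrow> ('h \<Rightarrow> 'a \<Rightarrow> 'a) \<Rightarrow>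
   ('k, (('a \<times> 'h) \<Rightarrow>\<^sub>0 'k) set) module" where
  "smash R H act = (tensor R H)
     \<lparr>monoid.mult := (\<lambda>X Y. tlift (tensor R H) (\<lambda>a h. tlift (tensor R H) (\<lambda>a' h'.
                 tlift (tensor R H) (\<lambda>h1 h2.
                   pure R H (a \<otimes>\<^bsub>R\<^esub> act h1 a') (h2 \<otimes>\<^bsub>H\<^esub> h')) (comult H h)) Y) X),
      one := pure R H \<one>\<^bsub>R\<^esub> \<one>\<^bsub>H\<^esub>\<rparr>"


section \<open>Gradings, filtrations and PBW deformations\<close>

text \<open>Gradings and ascending filtrations are families of subspaces indexed by \<open>nat\<close>.\<close>

definition tensor_grading ::
  "('k::field, 'a, 'm) module_scheme \<Rightarrow> ('k, 'b, 'n) module_scheme \<Rightarrow>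
   (nat \<Rightarrow> 'a set) \<Rightarrow> (nat \<Rightarrow> 'b set) \<Rightarrow> nat \<Rightarrow> (('a \<times> 'b) \<Rightarrow>\<^sub>0 'k) set set" where
  "tensor_grading M N G G' m =
     lspan (tensor M N) {pure M N a b | a b. \<exists>i j. a \<in> G i \<and> b \<in> G' j \<and> i + j = m}"

text \<open>In \<open>R # H\<close> the Hopf algebra \<open>H\<close> has degree 0.\<close>

definition smash_grading ::
  "('k::field, 'a, 'm) module_scheme \<Rightarrow> ('k, 'h, 'p) hopf_scheme \<Rightarrow>
   (nat \<Rightarrow> 'a set) \<Rightarrow> nat \<Rightarrow> (('a \<times> 'h) \<Rightarrow>\<^sub>0 'k) set set" where
  "smash_grading R H G m = lspan (tensor R H) {pure R H a h | a h. a \<in> G m \<and> h \<in> carrier H}"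

text \<open>The filtration on \<open>A / J\<close> induced by a grading \<open>G\<close> of \<open>A\<close>.\<close>

definition quot_filtration ::
  "('k::field, 'a, 'm) module_scheme \<Rightarrow> (nat \<Rightarrow> 'a set) \<Rightarrow> 'a set \<Rightarrow> nat \<Rightarrow> 'a set set" where
  "quot_filtration A G J m = (\<lambda>x. J +>\<^bsub>A\<^esub> x) ` lspan A (\<Union>i\<le>m. G i)"

definition filt_pred :: "('k, 'b, 'm) module_scheme \<Rightarrow> (nat \<Rightarrow> 'b set) \<Rightarrow> nat \<Rightarrow> 'b set" where
  "filt_pred B F m = (case m of 0 \<Rightarrow> {\<zero>\<^bsub>B\<^esub>} | Suc i \<Rightarrow> F i)"

definition gr_piece ::
  "('k, 'b, 'm) module_scheme \<Rightarrow> (nat \<Rightarrow> 'b set) \<Rightarrow> nat \<Rightarrow> ('k, 'b set) module" where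
  "gr_piece B F m = quot (B\<lparr>carrier := F m\<rparr>) (filt_pred B F m)"

text \<open>
  The associated graded algebra, the direct sum of the spaces \<open>F\<^sub>m / F\<^sub>m\<^sub>-\<^sub>1\<close>; the product of the
  classes of \<open>x \<in> F\<^sub>i\<close> and \<open>y \<in> F\<^sub>j\<close> is the class of \<open>xy\<close> in \<open>F\<^sub>i\<^sub>+\<^sub>j / F\<^sub>i\<^sub>+\<^sub>j\<^sub>-\<^sub>1\<close>.
\<close>

definition assoc_graded ::
  "('k, 'b, 'm) module_scheme \<Rightarrow> (nat \<Rightarrow> 'b set) \<Rightarrow> ('k, nat \<Rightarrow> 'b set) module" where
  "assoc_graded B F =
     \<lparr>carrier = {f. (\<forall>m. f m \<in> carrier (gr_piece B F m)) \<and>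
                    finite {m. f m \<noteq> \<zero>\<^bsub>gr_piece B F m\<^esub>}},
      monoid.mult = (\<lambda>f g m. \<Oplus>\<^bsub>gr_piece B F m\<^esub> i\<in>{..m}. rcoset_mult B (filt_pred B F m) (f i) (g (m - i))),
      one = (\<lambda>m. if m = 0 then filt_pred B F 0 +>\<^bsub>B\<^esub> \<one>\<^bsub>B\<^esub> else \<zero>\<^bsub>gr_piece B F m\<^esub>),
      zero = (\<lambda>m. \<zero>\<^bsub>gr_piece B F m\<^esub>),
      add = (\<lambda>f g m. f m \<oplus>\<^bsub>gr_piece B F m\<^esub> g m),
      module.smult = (\<lambda>c f m. c \<odot>\<^bsub>gr_piece B F m\<^esub> f m)\<rparr>"

definition gr_grading ::
  "('k, 'b, 'm) module_scheme \<Rightarrow> (nat \<Rightarrow> 'b set) \<Rightarrow> nat \<Rightarrow> (nat \<Rightarrow> 'b set) set" where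
  "gr_grading B F m =
     {f \<in> carrier (assoc_graded B F). \<forall>i. i \<noteq> m \<longrightarrow> f i = \<zero>\<^bsub>gr_piece B F i\<^esub>}"

definition graded_iso ::
  "('k::field, 'a, 'm) module_scheme \<Rightarrow> (nat \<Rightarrow> 'a set) \<Rightarrow>
   ('k, 'b, 'n) module_scheme \<Rightarrow> (nat \<Rightarrow> 'b set) \<Rightarrow> bool" where
  "graded_iso A G B G' \<longleftrightarrow> (\<exists>\<phi>\<in>alg_iso A B. \<forall>m. \<phi> ` G m = G' m)"

text \<open>The filtered algebra \<open>(B, F)\<close> is a PBW deformation of the graded algebra \<open>(S, G)\<close>.\<close>

definition pbw_deformation ::
  "('k::field, 'b, 'm) module_scheme \<Rightarrow> (nat \<Rightarrow> 'b set) \<Rightarrow>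
   ('k, 'a, 'n) module_scheme \<Rightarrow> (nat \<Rightarrow> 'a set) \<Rightarrow> bool" where
  "pbw_deformation B F S G \<longleftrightarrow> graded_iso (assoc_graded B F) (gr_grading B F) S G"

text \<open>
  \<open>deform H act S \<kappa>\<close> is \<open>(T # H) / (r - \<kappa> r | r \<in> S)\<close> for the free algebra \<open>T\<close> on \<open>'x\<close>, with
  \<open>r\<close> and \<open>\<kappa> r\<close> standing for \<open>r \<otimes> 1\<close> and \<open>1 \<otimes> \<kappa> r\<close>.
\<close>

definition deform_ideal ::
  "('k::field, 'h, 'p) hopf_scheme \<Rightarrow> ('h \<Rightarrow> ('x list \<Rightarrow>\<^sub>0 'k) \<Rightarrow> ('x list \<Rightarrow>\<^sub>0 'k)) \<Rightarrow>
   ('x list \<Rightarrow>\<^sub>0 'k) set \<Rightarrow> (('x list \<Rightarrow>\<^sub>0 'k) \<Rightarrow> 'h) \<Rightarrow>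
   ((('x list \<Rightarrow>\<^sub>0 'k) \<times> 'h) \<Rightarrow>\<^sub>0 'k) set set" where
  "deform_ideal H act S \<kappa> = genideal (smash free_alg H act)
     ((\<lambda>r. pure free_alg H r \<one>\<^bsub>H\<^esub> \<ominus>\<^bsub>smash free_alg H act\<^esub> pure free_alg H 1 (\<kappa> r)) ` S)"

definition deform ::
  "('k::field, 'h, 'p) hopf_scheme \<Rightarrow> ('h \<Rightarrow> ('x list \<Rightarrow>\<^sub>0 'k) \<Rightarrow> ('x list \<Rightarrow>\<^sub>0 'k)) \<Rightarrow>
   ('x list \<Rightarrow>\<^sub>0 'k) set \<Rightarrow> (('x list \<Rightarrow>\<^sub>0 'k) \<Rightarrow> 'h) \<Rightarrow>
   ('k, ((('x list \<Rightarrow>\<^sub>0 'k) \<times> 'h) \<Rightarrow>\<^sub>0 'k) set set) module" where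
  "deform H act S \<kappa> = quot (smash free_alg H act) (deform_ideal H act S \<kappa>)"

definition deform_filtration ::
  "('k::field, 'h, 'p) hopf_scheme \<Rightarrow> ('h \<Rightarrow> ('x list \<Rightarrow>\<^sub>0 'k) \<Rightarrow> ('x list \<Rightarrow>\<^sub>0 'k)) \<Rightarrow>
   ('x list \<Rightarrow>\<^sub>0 'k) set \<Rightarrow> (('x list \<Rightarrow>\<^sub>0 'k) \<Rightarrow> 'h) \<Rightarrow>
   nat \<Rightarrow> ((('x list \<Rightarrow>\<^sub>0 'k) \<times> 'h) \<Rightarrow>\<^sub>0 'k) set set set" where
  "deform_filtration H act S \<kappa> =
     quot_filtration (smash free_alg H act) (smash_grading free_alg H free_hom)
       (deform_ideal H act S \<kappa>)"


section \<open>The quantum group \<open>U\<^sub>q(sl\<^sub>2)\<close>\<close>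

datatype uq_gen = gK | gKinv | gE | gF

type_synonym 'k uq = "(uq_gen list \<Rightarrow>\<^sub>0 'k) set"

definition uq_rels :: "'k::field \<Rightarrow> (uq_gen list \<Rightarrow>\<^sub>0 'k) set" where
  "uq_rels q =
     {gen gK * gen gKinv - 1,
      gen gKinv * gen gK - 1,
      gen gE * gen gF - gen gF * gen gE - scale (1 / (q - inverse q)) (gen gK - gen gKinv),
      gen gK * gen gE * gen gKinv - scale (q ^ 2) (gen gE),
      gen gK * gen gF * gen gKinv - scale (inverse (q ^ 2)) (gen gF)}"

definition uq_alg :: "'k::field \<Rightarrow> ('k, 'k uq) module" where
  "uq_alg q = presented (uq_rels q)"

definition uqg :: "'k::field \<Rightarrow> uq_gen \<Rightarrow> 'k uq" where
  "uqg q g = cls (uq_rels q) (gen g)"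

fun uq_comult_gen :: "'k::field \<Rightarrow> uq_gen \<Rightarrow> (('k uq \<times> 'k uq) \<Rightarrow>\<^sub>0 'k) set" where
  "uq_comult_gen q gK = pure (uq_alg q) (uq_alg q) (uqg q gK) (uqg q gK)"
| "uq_comult_gen q gKinv = pure (uq_alg q) (uq_alg q) (uqg q gKinv) (uqg q gKinv)"
| "uq_comult_gen q gE =
     pure (uq_alg q) (uq_alg q) (uqg q gE) \<one>\<^bsub>uq_alg q\<^esub>
       \<oplus>\<^bsub>tensor_alg (uq_alg q) (uq_alg q)\<^esub> pure (uq_alg q) (uq_alg q) (uqg q gK) (uqg q gE)"
| "uq_comult_gen q gF =
     pure (uq_alg q) (uq_alg q) (uqg q gF) (uqg q gKinv)
       \<oplus>\<^bsub>tensor_alg (uq_alg q) (uq_alg q)\<^esub> pure (uq_alg q) (uq_alg q) \<one>\<^bsub>uq_alg q\<^esub> (uqg q gF)"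

fun uq_counit_gen :: "uq_gen \<Rightarrow> 'k::field" where
  "uq_counit_gen gK = 1"
| "uq_counit_gen gKinv = 1"
| "uq_counit_gen gE = 0"
| "uq_counit_gen gF = 0"

fun uq_antipode_gen :: "'k::field \<Rightarrow> uq_gen \<Rightarrow> 'k uq" where
  "uq_antipode_gen q gK = uqg q gKinv"
| "uq_antipode_gen q gKinv = uqg q gK"
| "uq_antipode_gen q gE = \<ominus>\<^bsub>uq_alg q\<^esub> (uqg q gKinv \<otimes>\<^bsub>uq_alg q\<^esub> uqg q gE)"
| "uq_antipode_gen q gF = \<ominus>\<^bsub>uq_alg q\<^esub> (uqg q gF \<otimes>\<^bsub>uq_alg q\<^esub> uqg q gK)"

text \<open>
  Comultiplication and counit are extended as algebra homomorphisms, the antipode as an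
  antihomomorphism, that is, as a homomorphism to the opposite algebra.
\<close>

definition Uq :: "'k::field \<Rightarrow> ('k, 'k uq) hopf" where
  "Uq q = module.extend (uq_alg q) (hopf.fields
     (descend (free_lift (tensor_alg (uq_alg q) (uq_alg q)) (uq_comult_gen q)))
     (descend (free_lift ground uq_counit_gen))
     (descend (free_lift ((uq_alg q)\<lparr>monoid.mult := (\<lambda>x y. y \<otimes>\<^bsub>uq_alg q\<^esub> x)\<rparr>) (uq_antipode_gen q))))"


section \<open>The quantum plane and its twisted square\<close>

text \<open>
  \<open>A = k\<^sub>q[u, v]\<close> and \<open>A' = k\<^sub>q[u', v']\<close> are the same algebra \<open>qplane q\<close> up to the names of the
  generators, with the same action; the position in a tensor product tells the copies apart.
\<close>

datatype plane_gen = gu | gv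

type_synonym 'k plane = "(plane_gen list \<Rightarrow>\<^sub>0 'k) set"

definition qplane_rels :: "'k::field \<Rightarrow> (plane_gen list \<Rightarrow>\<^sub>0 'k) set" where
  "qplane_rels q = {gen gu * gen gv - scale q (gen gv * gen gu)}"

definition qplane :: "'k::field \<Rightarrow> ('k, 'k plane) module" where
  "qplane q = presented (qplane_rels q)"

definition qpg :: "'k::field \<Rightarrow> plane_gen \<Rightarrow> 'k plane" where
  "qpg q g = cls (qplane_rels q) (gen g)"

definition qplane_grading :: "'k::field \<Rightarrow> nat \<Rightarrow> 'k plane set" where
  "qplane_grading q m = cls (qplane_rels q) ` free_hom m"

text \<open>The elements \<open>x\<close>, \<open>y\<close> span the standard two-dimensional representation.\<close>

definition std_action ::
  "'k::field \<Rightarrow> ('k, 'a, 'm) module_scheme \<Rightarrow> ('k uq \<Rightarrow> 'a \<Rightarrow> 'a) \<Rightarrow> 'a \<Rightarrow> 'a \<Rightarrow> bool" where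
  "std_action q R act x y \<longleftrightarrow>
     act (uqg q gE) x = \<zero>\<^bsub>R\<^esub> \<and> act (uqg q gE) y = x \<and>
     act (uqg q gF) x = y \<and> act (uqg q gF) y = \<zero>\<^bsub>R\<^esub> \<and>
     act (uqg q gK) x = q \<odot>\<^bsub>R\<^esub> x \<and> act (uqg q gK) y = inverse q \<odot>\<^bsub>R\<^esub> y \<and>
     act (uqg q gKinv) x = inverse q \<odot>\<^bsub>R\<^esub> x \<and> act (uqg q gKinv) y = q \<odot>\<^bsub>R\<^esub> y"

abbreviation qp_pure :: "'k::field \<Rightarrow> plane_gen \<Rightarrow> plane_gen \<Rightarrow> (('k plane \<times> 'k plane) \<Rightarrow>\<^sub>0 'k) set" where
  "qp_pure q g h \<equiv> pure (qplane q) (qplane q) (qpg q g) (qpg q h)"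

definition tau_on_gens ::
  "'k::field \<Rightarrow> ((('k plane \<times> 'k plane) \<Rightarrow>\<^sub>0 'k) set \<Rightarrow> (('k plane \<times> 'k plane) \<Rightarrow>\<^sub>0 'k) set) \<Rightarrow> bool" where
  "tau_on_gens q \<tau> \<longleftrightarrow>
     (let P = tensor (qplane q) (qplane q) in
      \<tau> (qp_pure q gu gu) = q \<odot>\<^bsub>P\<^esub> qp_pure q gu gu \<and>
      \<tau> (qp_pure q gu gv) = q ^ 2 \<odot>\<^bsub>P\<^esub> qp_pure q gv gu \<and>
      \<tau> (qp_pure q gv gu) =
        (q ^ 2 \<odot>\<^bsub>P\<^esub> qp_pure q gu gv) \<oplus>\<^bsub>P\<^esub> ((q - q ^ 3) \<odot>\<^bsub>P\<^esub> qp_pure q gv gu) \<and>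
      \<tau> (qp_pure q gv gv) = q \<odot>\<^bsub>P\<^esub> qp_pure q gv gv)"

datatype tw_gen = U | V | U' | V'

type_synonym 'k free4 = "tw_gen list \<Rightarrow>\<^sub>0 'k"

fun tw_gens :: "'k::field \<Rightarrow> tw_gen \<Rightarrow> (('k plane \<times> 'k plane) \<Rightarrow>\<^sub>0 'k) set" where
  "tw_gens q U = pure (qplane q) (qplane q) \<one>\<^bsub>qplane q\<^esub> (qpg q gu)"
| "tw_gens q V = pure (qplane q) (qplane q) \<one>\<^bsub>qplane q\<^esub> (qpg q gv)"
| "tw_gens q U' = pure (qplane q) (qplane q) (qpg q gu) \<one>\<^bsub>qplane q\<^esub>"
| "tw_gens q V' = pure (qplane q) (qplane q) (qpg q gv) \<one>\<^bsub>qplane q\<^esub>"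

definition r1 :: "'k::field \<Rightarrow> 'k free4" where
  "r1 q = gen U * gen V - scale q (gen V * gen U)"

definition r2 :: "'k::field \<Rightarrow> 'k free4" where
  "r2 q = gen U' * gen V' - scale q (gen V' * gen U')"

definition r3 :: "'k::field \<Rightarrow> 'k free4" where
  "r3 q = gen U * gen U' - scale q (gen U' * gen U)"

definition r4 :: "'k::field \<Rightarrow> 'k free4" where
  "r4 q = gen V * gen U' - scale (q ^ 2) (gen U' * gen V) - scale (q - q ^ 3) (gen V' * gen U)"

definition r5 :: "'k::field \<Rightarrow> 'k free4" where
  "r5 q = gen U * gen V' - scale (q ^ 2) (gen V' * gen U)"

definition r6 :: "'k::field \<Rightarrow> 'k free4" where
  "r6 q = gen V * gen V' - scale q (gen V' * gen V)"

definition tw_rels :: "'k::field \<Rightarrow> 'k free4 set" where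
  "tw_rels q = {r1 q, r2 q, r3 q, r4 q, r5 q, r6 q}"

end

theory Submission
  imports Defs
begin

text \<open>
  The generators \<open>u, v, u', v'\<close> act by explicit operators on the span of the ordered monomials
  \<open>v'\<^sup>a u'\<^sup>b v\<^sup>c u\<^sup>d \<zeta>\<^sup>z\<close> so that the deformed relations hold with a central variable \<open>\<zeta>\<close>
  in place of \<open>K\<^sup>n\<^sup>s\<close>.  For \<open>\<alpha> = 0\<close> this action and the straightening of words modulo the \<open>r\<^sub>i\<close> show
  that the ordered monomials form a basis both of the algebra presented by the \<open>r\<^sub>i\<close> and of \<open>A' \<otimes> A\<close>
  with the twisted product, which gives the presentation.

  As \<open>q\<^sup>n = 1\<close>, the element \<open>K\<^sup>n\<^sup>s\<close> is central and acts trivially, and the span of the \<open>r\<^sub>i\<close> is a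
  submodule on which \<open>\<kappa>\<close> is equivariant.  Hence the deformation ideal \<open>J\<close> is spanned by the elements
  \<open>a (r - \<kappa>(r)) b \<otimes> h\<close>, on which the action on monomials vanishes once \<open>\<zeta>\<close> is specialised to \<open>K\<^sup>n\<^sup>s\<close>.
  If \<open>X\<close> is homogeneous of degree \<open>m\<close> and \<open>X - W \<in> J\<close> with \<open>W\<close> of lower degree, comparing the parts of
  degree \<open>m\<close> in the monomials shows that \<open>X\<close> vanishes in the undeformed smash product.  So the associated
  graded algebra has no relations beyond the \<open>r\<^sub>i\<close>.
\<close>

section \<open>Vector spaces and linear maps\<close>

text \<open>The coefficient -q^{-1} is forced by equivariance: E.r_6 = F.r_3 = q^{-1} r_4 + r_5, and
  since \<epsilon>(E) = \<epsilon>(F) = 0, the map \<kappa> has to kill this combination. The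
  obstacle is confluence: overlapping relations might produce new relations of lower degree. No
  overlaps are resolved here. Operators on monomials are written down explicitly and shown to
  satisfy the relations; they send the empty monomial to every ordered monomial, so they compute
  normal forms. The variable \<zeta> has degree 2, so every generator raises the total degree by
  exactly one. In the image of a word of length m, the part of degree m in v', u', v, u is then the
  \<zeta>-free part, and it is the undeformed action because \<alpha> always comes with a factor
  \<zeta>. With \<zeta> in place of K^{ns} the operators are defined over k and do not depend on s.
  The twisted product is never expanded for general arguments. A' tensor A embeds into the
  operators, and \<tau>(a tensor c) turns out to represent the composite of a after c; associativity
  is then that of composition.\<close>

locale vs = abelian_group M for M :: "('k::field, 'a, 'm) module_scheme" (structure) +
  assumes smult_closed [simp, intro]: "x \<in> carrier M \<Longrightarrow> c \<odot> x \<in> carrier M"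
    and smult_left: "x \<in> carrier M \<Longrightarrow> (c + d) \<odot> x = c \<odot> x \<oplus> d \<odot> x"
    and smult_right: "x \<in> carrier M \<Longrightarrow> y \<in> carrier M \<Longrightarrow> c \<odot> (x \<oplus> y) = c \<odot> x \<oplus> c \<odot> y"
    and smult_smult: "x \<in> carrier M \<Longrightarrow> c \<odot> (d \<odot> x) = (c * d) \<odot> x"
    and smult_one [simp]: "x \<in> carrier M \<Longrightarrow> 1 \<odot> x = x"
begin

lemma smult_0 [simp]: "x \<in> carrier M \<Longrightarrow> 0 \<odot> x = \<zero>"
  using smult_left[of x 0 0] add.l_cancel_one'[of "0 \<odot> x" "0 \<odot> x"] by simp

lemma smult_zero [simp]: "c \<odot> \<zero> = \<zero>"
  using smult_right[of \<zero> \<zero> c] add.l_cancel_one'[of "c \<odot> \<zero>" "c \<odot> \<zero>"] by simp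

lemma smult_uminus: "x \<in> carrier M \<Longrightarrow> (- c) \<odot> x = \<ominus> (c \<odot> x)"
  using smult_left[of x "- c" c] by (simp add: minus_equality)

lemma uminus_eq: "x \<in> carrier M \<Longrightarrow> \<ominus> x = (- 1) \<odot> x"
  by (simp add: smult_uminus)

lemma minus_zero_iff:
  assumes "x \<in> carrier M" "y \<in> carrier M" shows "x \<ominus> y = \<zero> \<longleftrightarrow> x = y"
proof
  assume "x \<ominus> y = \<zero>"
  then have "x \<oplus> \<ominus> y = \<zero>" by (simp add: a_minus_def)
  from minus_equality[OF this] show "x = y" using assms by simp
qed (use assms in \<open>simp add: a_minus_def r_neg\<close>)

lemma minus_eq_smult: "x \<in> carrier M \<Longrightarrow> y \<in> carrier M \<Longrightarrow> x \<ominus> y = x \<oplus> (- 1) \<odot> y"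
  by (simp add: a_minus_def uminus_eq)

end

text \<open>The axioms are equations and existence statements, which pass to the image of a
  surjection respecting the operations. Quotients (along the coset map) and records that differ only
  in other fields (along the identity) are both obtained this way.\<close>

lemma vs_image:
  fixes M :: "('k::field, 'a, 'm) module_scheme" and Q :: "('k, 'b, 'n) module_scheme"
  assumes "vs M" and im: "f ` carrier M = carrier Q"
    and ad: "\<And>x y. x \<in> carrier M \<Longrightarrow> y \<in> carrier M \<Longrightarrow> f (x \<oplus>\<^bsub>M\<^esub> y) = f x \<oplus>\<^bsub>Q\<^esub> f y"
    and ze: "f \<zero>\<^bsub>M\<^esub> = \<zero>\<^bsub>Q\<^esub>"
    and sm: "\<And>c x. x \<in> carrier M \<Longrightarrow> f (c \<odot>\<^bsub>M\<^esub> x) = c \<odot>\<^bsub>Q\<^esub> f x"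
  shows "vs Q"
proof -
  interpret vs M by fact
  have obt: "\<exists>x'\<in>carrier M. x = f x'" if "x \<in> carrier Q" for x
    using that im by auto
  have cl: "f x \<in> carrier Q" if "x \<in> carrier M" for x using that im by auto
  have "abelian_group Q"
  proof (rule abelian_groupI)
    fix x y assume "x \<in> carrier Q" "y \<in> carrier Q"
    then obtain x' y' where "x' \<in> carrier M" "y' \<in> carrier M" "x = f x'" "y = f y'"
      using obt by metis
    then show "x \<oplus>\<^bsub>Q\<^esub> y \<in> carrier Q" and "x \<oplus>\<^bsub>Q\<^esub> y = y \<oplus>\<^bsub>Q\<^esub> x"
      by (auto simp flip: ad simp: cl a_comm)
  next
    show "\<zero>\<^bsub>Q\<^esub> \<in> carrier Q" by (auto simp flip: ze simp: cl)
  next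
    fix x y z assume "x \<in> carrier Q" "y \<in> carrier Q" "z \<in> carrier Q"
    then obtain x' y' z' where "x' \<in> carrier M" "y' \<in> carrier M" "x = f x'" "y = f y'"
       "z' \<in> carrier M" "z = f z'"
      using obt by metis
    then show "x \<oplus>\<^bsub>Q\<^esub> y \<oplus>\<^bsub>Q\<^esub> z = x \<oplus>\<^bsub>Q\<^esub> (y \<oplus>\<^bsub>Q\<^esub> z)"
      by (auto simp flip: ad simp: a_assoc)
  next
    fix x assume "x \<in> carrier Q"
    then obtain x' where x': "x' \<in> carrier M" "x = f x'" using obt by metis
    then show "\<zero>\<^bsub>Q\<^esub> \<oplus>\<^bsub>Q\<^esub> x = x" by (auto simp flip: ad ze)
    show "\<exists>y\<in>carrier Q. y \<oplus>\<^bsub>Q\<^esub> x = \<zero>\<^bsub>Q\<^esub>"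
      using x' by (intro bexI[of _ "f (\<ominus>\<^bsub>M\<^esub> x')"]) (auto simp flip: ad ze simp: cl l_neg)
  qed
  then interpret Q: abelian_group Q .
  show ?thesis
  proof
    fix x c d assume "x \<in> carrier Q"
    then obtain x' where x': "x' \<in> carrier M" "x = f x'" using obt by metis
    show "c \<odot>\<^bsub>Q\<^esub> x \<in> carrier Q" using x' by (auto simp flip: sm simp: cl)
    show "(c + d) \<odot>\<^bsub>Q\<^esub> x = c \<odot>\<^bsub>Q\<^esub> x \<oplus>\<^bsub>Q\<^esub> d \<odot>\<^bsub>Q\<^esub> x"
      using x' by (auto simp flip: sm ad simp: smult_left)
    show "c \<odot>\<^bsub>Q\<^esub> (d \<odot>\<^bsub>Q\<^esub> x) = (c * d) \<odot>\<^bsub>Q\<^esub> x" and "1 \<odot>\<^bsub>Q\<^esub> x = x"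
      using x' by (auto simp flip: sm simp: smult_smult)
  next
    fix x y c assume "x \<in> carrier Q" "y \<in> carrier Q"
    then obtain x' y' where "x' \<in> carrier M" "y' \<in> carrier M" "x = f x'" "y = f y'"
      using obt by metis
    then show "c \<odot>\<^bsub>Q\<^esub> (x \<oplus>\<^bsub>Q\<^esub> y) = c \<odot>\<^bsub>Q\<^esub> x \<oplus>\<^bsub>Q\<^esub> c \<odot>\<^bsub>Q\<^esub> y"
      by (auto simp flip: ad sm simp: smult_right)
  qed
qed

lemma vs_cong:
  fixes M :: "('k::field, 'a, 'm) module_scheme" and Q :: "('k, 'a, 'n) module_scheme"
  assumes "vs M" "carrier Q = carrier M" "add Q = add M" "zero Q = zero M" "module.smult Q = module.smult M"
  shows "vs Q"
  by (rule vs_image[OF assms(1), of "\<lambda>x. x"]) (simp_all add: assms(2-))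

lemma lin_mapI:
  assumes "\<And>x. x \<in> carrier M \<Longrightarrow> f x \<in> carrier N"
    and "\<And>x y. x \<in> carrier M \<Longrightarrow> y \<in> carrier M \<Longrightarrow> f (x \<oplus>\<^bsub>M\<^esub> y) = f x \<oplus>\<^bsub>N\<^esub> f y"
    and "\<And>c x. x \<in> carrier M \<Longrightarrow> f (c \<odot>\<^bsub>M\<^esub> x) = c \<odot>\<^bsub>N\<^esub> f x"
  shows "lin_map M N f"
  using assms unfolding lin_map_def by auto

lemma lin_map_closed: "lin_map M N f \<Longrightarrow> x \<in> carrier M \<Longrightarrow> f x \<in> carrier N"
  and lin_map_add: "lin_map M N f \<Longrightarrow> x \<in> carrier M \<Longrightarrow> y \<in> carrier M \<Longrightarrow>
    f (x \<oplus>\<^bsub>M\<^esub> y) = f x \<oplus>\<^bsub>N\<^esub> f y"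
  and lin_map_smult: "lin_map M N f \<Longrightarrow> x \<in> carrier M \<Longrightarrow> f (c \<odot>\<^bsub>M\<^esub> x) = c \<odot>\<^bsub>N\<^esub> f x"
  unfolding lin_map_def by auto

lemma lin_map_zero:
  assumes "vs M" "vs N" "lin_map M N f" shows "f \<zero>\<^bsub>M\<^esub> = \<zero>\<^bsub>N\<^esub>"
proof -
  interpret M: vs M by fact
  interpret N: vs N by fact
  show ?thesis using lin_map_smult[OF assms(3), of "\<zero>\<^bsub>M\<^esub>" 0] lin_map_closed[OF assms(3), of "\<zero>\<^bsub>M\<^esub>"]
    by simp
qed

lemma lin_map_minus:
  assumes "vs M" "vs N" "lin_map M N f" "x \<in> carrier M" "y \<in> carrier M"
  shows "f (x \<ominus>\<^bsub>M\<^esub> y) = f x \<ominus>\<^bsub>N\<^esub> f y"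
proof -
  interpret M: vs M by fact
  interpret N: vs N by fact
  show ?thesis
    using assms(4,5) lin_map_closed[OF assms(3)] lin_map_smult[OF assms(3), of y "-1"]
    by (simp add: M.minus_eq_smult N.minus_eq_smult lin_map_add[OF assms(3)])
qed

lemma lin_map_cong:
  assumes "vs M" "lin_map M N f" "\<And>x. x \<in> carrier M \<Longrightarrow> g x = f x"
  shows "lin_map M N g"
proof -
  interpret vs M by fact
  show ?thesis using assms(2,3) unfolding lin_map_def by (auto simp: Pi_iff)
qed

lemma lin_map_id: "lin_map M M (\<lambda>x. x)"
  by (rule lin_mapI) auto

lemma lin_map_comp: "lin_map M N g \<Longrightarrow> lin_map N P f \<Longrightarrow> lin_map M P (\<lambda>x. f (g x))"
  unfolding lin_map_def by (auto simp: Pi_iff)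

lemma lin_map_plus:
  assumes "vs N" "lin_map M N f" "lin_map M N g"
  shows "lin_map M N (\<lambda>x. f x \<oplus>\<^bsub>N\<^esub> g x)"
proof -
  interpret vs N by fact
  note cl = lin_map_closed[OF assms(2)] lin_map_closed[OF assms(3)]
  show ?thesis
    by (rule lin_mapI)
      (simp_all add: cl lin_map_add[OF assms(2)] lin_map_add[OF assms(3)] lin_map_smult[OF assms(2)]
        lin_map_smult[OF assms(3)] smult_right a_ac)
qed

lemma lin_map_scale:
  assumes "vs N" "lin_map M N f"
  shows "lin_map M N (\<lambda>x. c \<odot>\<^bsub>N\<^esub> f x)"
proof -
  interpret vs N by fact
  show ?thesis
    by (rule lin_mapI)
      (simp_all add: lin_map_closed[OF assms(2)] lin_map_add[OF assms(2)] lin_map_smult[OF assms(2)]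
       smult_right smult_smult mult.commute)
qed

lemma lin_map_zero_map: assumes "vs N" shows "lin_map M N (\<lambda>x. \<zero>\<^bsub>N\<^esub>)"
proof -
  interpret vs N by fact
  show ?thesis by (rule lin_mapI) simp_all
qed

lemma lin_map_diff:
  assumes "vs M" "vs N" "lin_map M N f" "lin_map M N g"
  shows "lin_map M N (\<lambda>x. f x \<ominus>\<^bsub>N\<^esub> g x)"
proof -
  interpret vs N by fact
  have "lin_map M N (\<lambda>x. f x \<oplus>\<^bsub>N\<^esub> (- 1) \<odot>\<^bsub>N\<^esub> g x)"
    by (intro lin_map_plus lin_map_scale assms)
  then show ?thesis
    by (rule lin_map_cong[OF assms(1)])
      (simp add: minus_eq_smult lin_map_closed[OF assms(3)] lin_map_closed[OF assms(4)])
qed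

subsection \<open>Subspaces and spans\<close>

lemma ground_carrier [simp]: "carrier ground = UNIV"
  by (simp add: ground_def)

lemma ground_simps [simp]: "x \<oplus>\<^bsub>ground\<^esub> y = x + y" "x \<otimes>\<^bsub>ground\<^esub> y = x * y"
  "\<zero>\<^bsub>ground\<^esub> = 0" "\<one>\<^bsub>ground\<^esub> = 1" "c \<odot>\<^bsub>ground\<^esub> x = c * x"
  by (simp_all add: ground_def)

text \<open>\<open>submodule\<close> asks for the scalars as a ring record; since the carrier of
  \<open>ground\<close> is the whole type, its scalar condition ranges over all of
  \<open>'k\<close>.\<close>

abbreviation subspace :: "('k::field, 'a, 'm) module_scheme \<Rightarrow> 'a set \<Rightarrow> bool" where
  "subspace M N \<equiv> submodule N ground M"

lemma (in vs) subspaceI: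
  assumes "N \<subseteq> carrier M" "\<zero> \<in> N" "\<And>x y. x \<in> N \<Longrightarrow> y \<in> N \<Longrightarrow> x \<oplus> y \<in> N"
    "\<And>c x. x \<in> N \<Longrightarrow> c \<odot> x \<in> N"
  shows "subspace M N"
proof (intro submodule.intro subgroup.intro)
  fix x assume x: "x \<in> N"
  then have "\<ominus> x \<in> N" using assms(1,4) by (auto simp: uminus_eq)
  then show "inv\<^bsub>add_monoid M\<^esub> x \<in> N" by (simp add: a_inv_def)
qed (use assms in \<open>auto simp: submodule_axioms_def\<close>)

lemma subspaceD:
  assumes "subspace M N"
  shows "N \<subseteq> carrier M" "\<zero>\<^bsub>M\<^esub> \<in> N" "x \<in> N \<Longrightarrow> x \<in> carrier M"
    "x \<in> N \<Longrightarrow> y \<in> N \<Longrightarrow> x \<oplus>\<^bsub>M\<^esub> y \<in> N" "x \<in> N \<Longrightarrow> c \<odot>\<^bsub>M\<^esub> x \<in> N"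
    "x \<in> N \<Longrightarrow> \<ominus>\<^bsub>M\<^esub> x \<in> N" "x \<in> N \<Longrightarrow> y \<in> N \<Longrightarrow> x \<ominus>\<^bsub>M\<^esub> y \<in> N"
proof -
  have s: "subgroup N (add_monoid M)" using assms by (rule submodule.axioms)
  note sub = subgroup.subset[OF s] subgroup.one_closed[OF s] subgroup.m_closed[OF s]
    subgroup.m_inv_closed[OF s]
  show "N \<subseteq> carrier M" "\<zero>\<^bsub>M\<^esub> \<in> N" "x \<in> N \<Longrightarrow> x \<in> carrier M"
    "x \<in> N \<Longrightarrow> y \<in> N \<Longrightarrow> x \<oplus>\<^bsub>M\<^esub> y \<in> N"  "x \<in> N \<Longrightarrow> \<ominus>\<^bsub>M\<^esub> x \<in> N"
    "x \<in> N \<Longrightarrow> y \<in> N \<Longrightarrow> x \<ominus>\<^bsub>M\<^esub> y \<in> N"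
    using sub by (auto simp: a_inv_def a_minus_def)
  show "x \<in> N \<Longrightarrow> c \<odot>\<^bsub>M\<^esub> x \<in> N"
    using submodule.smult_closed[OF assms] by simp
qed

lemma (in vs) subspace_carrier: "subspace M (carrier M)"
  by (rule subspaceI) auto

lemma subspace_vs:
  assumes "vs M" "subspace M N" shows "vs (M\<lparr>carrier := N\<rparr>)"
proof -
  interpret vs M by fact
  note s = subspaceD[OF assms(2)]
  have "abelian_group (M\<lparr>carrier := N\<rparr>)"
  proof (rule abelian_groupI)
    fix x assume "x \<in> carrier (M\<lparr>carrier := N\<rparr>)"
    then show "\<exists>y\<in>carrier (M\<lparr>carrier := N\<rparr>). y \<oplus>\<^bsub>M\<lparr>carrier := N\<rparr>\<^esub> x = \<zero>\<^bsub>M\<lparr>carrier := N\<rparr>\<^esub>"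
      using s by (intro bexI[of _ "\<ominus>\<^bsub>M\<^esub> x"]) (auto simp: l_neg)
  qed (use s in \<open>auto simp: a_ac\<close>)
  then interpret N: abelian_group "M\<lparr>carrier := N\<rparr>" .
  show ?thesis
    by standard (use s in \<open>auto simp: smult_left smult_right smult_smult\<close>)
qed

lemma (in vs) subspace_vimage:
  assumes "vs N" "lin_map M N f" "subspace N K"
  shows "subspace M {x \<in> carrier M. f x \<in> K}"
  by (rule subspaceI)
    (auto simp: lin_map_zero[OF vs_axioms assms(1,2)] lin_map_add[OF assms(2)] lin_map_smult[OF assms(2)]
      subspaceD[OF assms(3)])

lemma (in vs) subspace_zero: "subspace M {\<zero>}"
  by (rule subspaceI) auto

lemma subspace_image:
  assumes "vs M" "vs N" "lin_map M N f" "subspace M K"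
  shows "subspace N (f ` K)"
proof -
  interpret M: vs M by fact
  interpret N: vs N by fact
  note s = subspaceD[OF assms(4)]
  show ?thesis
  proof (rule N.subspaceI)
    show "f ` K \<subseteq> carrier N" using s lin_map_closed[OF assms(3)] by auto
    show "\<zero>\<^bsub>N\<^esub> \<in> f ` K" using lin_map_zero[OF assms(1-3)] s(2) by (metis imageI)
    fix x y c assume "x \<in> f ` K"
    then obtain x' where x': "x' \<in> K" "x = f x'" by auto
    show "c \<odot>\<^bsub>N\<^esub> x \<in> f ` K"
      using x' s lin_map_smult[OF assms(3), of x' c] by (metis imageI)
    assume "y \<in> f ` K"
    then obtain y' where y': "y' \<in> K" "y = f y'" by auto
    show "x \<oplus>\<^bsub>N\<^esub> y \<in> f ` K"
      using x' y' s lin_map_add[OF assms(3), of x' y'] by (metis imageI)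
  qed
qed

context vs begin

lemma lspan_subspace: assumes "S \<subseteq> carrier M" shows "subspace M (lspan M S)"
proof (rule subspaceI)
  show "lspan M S \<subseteq> carrier M" using assms subspace_carrier unfolding lspan_def by auto
qed (auto simp: lspan_def subspaceD)

lemma lspan_base: "x \<in> S \<Longrightarrow> x \<in> lspan M S"
  unfolding lspan_def by auto

lemma lspan_minimal: "subspace M N \<Longrightarrow> S \<subseteq> N \<Longrightarrow> lspan M S \<subseteq> N"
  unfolding lspan_def by auto

lemma lspan_closed: "S \<subseteq> carrier M \<Longrightarrow> x \<in> lspan M S \<Longrightarrow> x \<in> carrier M"
  using lspan_subspace subspaceD by blast

lemma lspan_induct [consumes 2, case_names base zero add smult]:
  assumes "x \<in> lspan M S" "S \<subseteq> carrier M"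
    "\<And>x. x \<in> S \<Longrightarrow> P x" "P \<zero>"
    "\<And>x y. x \<in> carrier M \<Longrightarrow> y \<in> carrier M \<Longrightarrow> P x \<Longrightarrow> P y \<Longrightarrow> P (x \<oplus> y)"
    "\<And>c x. x \<in> carrier M \<Longrightarrow> P x \<Longrightarrow> P (c \<odot> x)"
  shows "P x"
proof -
  have "subspace M {x \<in> carrier M. P x}"
    by (rule subspaceI) (use assms in auto)
  then show ?thesis using lspan_minimal[of "{x \<in> carrier M. P x}" S] assms(1-3) by auto
qed

end

lemma lspan_image:
  assumes "vs M" "vs N" "lin_map M N f" "S \<subseteq> carrier M"
  shows "f ` lspan M S = lspan N (f ` S)"
proof -
  interpret M: vs M by fact
  interpret N: vs N by fact
  have fS: "f ` S \<subseteq> carrier N" using assms(4) lin_map_closed[OF assms(3)] by auto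
  show ?thesis
  proof
    have "lspan M S \<subseteq> {x \<in> carrier M. f x \<in> lspan N (f ` S)}"
      using assms(4) N.lspan_base
      by (intro M.lspan_minimal M.subspace_vimage[OF assms(2,3)] N.lspan_subspace fS) blast
    then show "f ` lspan M S \<subseteq> lspan N (f ` S)" by auto
    show "lspan N (f ` S) \<subseteq> f ` lspan M S"
      by (intro N.lspan_minimal subspace_image[OF assms(1-3)] M.lspan_subspace assms(4) image_mono)
        (use M.lspan_base in blast)
  qed
qed

lemma lin_map_eq_on_lspan:
  assumes "vs M" "vs N" "lin_map M N f" "lin_map M N g" "S \<subseteq> carrier M"
    "\<And>x. x \<in> S \<Longrightarrow> f x = g x" "x \<in> lspan M S"
  shows "f x = g x"
proof -
  interpret M: vs M by fact
  show ?thesis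
    using assms(7,5)
    by (induction rule: M.lspan_induct)
      (simp_all add: assms(6) lin_map_zero[OF assms(1,2,3)] lin_map_zero[OF assms(1,2,4)]
       lin_map_add[OF assms(3)] lin_map_add[OF assms(4)] lin_map_smult[OF assms(3)] lin_map_smult[OF assms(4)])
qed

subsection \<open>Quotients\<close>

lemma (in vs) subspace_abelian_subgroup:
  assumes "subspace M I" shows "abelian_subgroup I M"
  using submodule.axioms(1)[OF assms]
  by (intro abelian_subgroupI3 additive_subgroup.intro abelian_group_axioms)

context
  fixes M :: "('k::field, 'a, 'm) module_scheme" (structure) and I
  assumes vsM: "vs M" and subI: "subspace M I"
begin

interpretation vs M by (rule vsM)
interpretation abelian_subgroup I M by (rule subspace_abelian_subgroup[OF subI])

lemma coset_eq_iff: "x \<in> carrier M \<Longrightarrow> y \<in> carrier M \<Longrightarrow> I +> x = I +> y \<longleftrightarrow> x \<ominus> y \<in> I"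
proof -
  assume xy: "x \<in> carrier M" "y \<in> carrier M"
  have "I +> x = I +> y \<longleftrightarrow> x \<in> I +> y"
    using a_rcos_self[OF xy(1)] a_repr_independence'[OF _ xy(2), of x] by metis
  then show ?thesis using a_rcos_module[OF xy(2,1)] by (simp add: a_minus_def)
qed

lemma coset_self: "x \<in> carrier M \<Longrightarrow> x \<in> I +> x"
  by (rule a_rcos_self)

lemma coset_zero_iff: "x \<in> carrier M \<Longrightarrow> I +> x = I \<longleftrightarrow> x \<in> I"
  using coset_self a_rcos_const by auto

lemma coset_mem: "x \<in> carrier M \<Longrightarrow> y \<in> I +> x \<Longrightarrow> y \<in> carrier M \<and> I +> y = I +> x"
  using a_elemrcos_carrier[of x y] a_repr_independence'[of y x]
  by metis

lemma quot_carrier: "carrier (quot M I) = (\<lambda>x. I +> x) ` carrier M"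
  unfolding quot_def A_RCOSETS_def' by auto

lemma quot_zero: "\<zero>\<^bsub>quot M I\<^esub> = I +> \<zero>"
  using coset_zero_iff[of \<zero>] subspaceD(2)[OF subI] by (simp add: quot_def)

lemma quot_add: "x \<in> carrier M \<Longrightarrow> y \<in> carrier M \<Longrightarrow> (I +> x) \<oplus>\<^bsub>quot M I\<^esub> (I +> y) = I +> (x \<oplus> y)"
  unfolding quot_def by (simp add: a_rcos_sum)

text \<open>The union in \<open>quot\<close> runs over all representatives y of one coset. As c y -
  c x = c (y - x) lies in \<open>I\<close>, the united cosets are all equal and the union
  collapses.\<close>

lemma quot_smult: assumes "x \<in> carrier M" shows "c \<odot>\<^bsub>quot M I\<^esub> (I +> x) = I +> (c \<odot> x)"
proof -
  have "I +> (c \<odot> y) = I +> (c \<odot> x)" if "y \<in> I +> x" for y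
  proof -
    have y: "y \<in> carrier M" "y \<ominus> x \<in> I" using coset_mem[OF assms that] coset_eq_iff[of y x] assms by auto
    have "c \<odot> y \<ominus> c \<odot> x = c \<odot> (y \<ominus> x)"
      using y assms by (simp add: minus_eq_smult smult_right smult_smult)
    then show ?thesis using y assms subspaceD(5)[OF subI, of "y \<ominus> x" c] by (simp add: coset_eq_iff)
  qed
  then have "(\<Union>y\<in>I +> x. I +> (c \<odot> y)) = I +> (c \<odot> x)"
    by (intro UN_constant_eq[OF coset_self[OF assms]]) auto
  then show ?thesis by (simp add: quot_def)
qed

lemma quot_vs: "vs (quot M I)"
  by (rule vs_image[OF vsM, of "\<lambda>x. I +> x"])
    (simp_all add: quot_carrier quot_add quot_zero quot_smult)

lemma quot_lin_map: "lin_map M (quot M I) (\<lambda>x. I +> x)"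
  by (rule lin_mapI) (simp_all add: quot_carrier quot_add quot_smult)

text \<open>\<open>descend\<close> extracts the only element of an image set, so the image of a
  coset has to be a singleton: two elements of the coset differ by an element of \<open>I\<close>,
  where \<open>f\<close> vanishes.\<close>

lemma descend_coset:
  assumes "vs N" "lin_map M N f" "\<And>i. i \<in> I \<Longrightarrow> f i = \<zero>\<^bsub>N\<^esub>" "x \<in> carrier M"
  shows "descend f (I +> x) = f x"
proof -
  interpret N: vs N by fact
  have "f y = f x" if "y \<in> I +> x" for y
  proof -
    have y: "y \<in> carrier M" "y \<ominus> x \<in> I" using coset_mem[OF assms(4) that] coset_eq_iff[of y x] assms(4) by auto
    have "f y \<ominus>\<^bsub>N\<^esub> f x = \<zero>\<^bsub>N\<^esub>" using assms(3)[OF y(2)] lin_map_minus[OF vsM assms(1,2) y(1) assms(4)] by simp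
    then show ?thesis using N.minus_zero_iff[OF lin_map_closed[OF assms(2) y(1)] lin_map_closed[OF assms(2,4)]] by simp
  qed
  with coset_self[OF assms(4)] have "f ` (I +> x) = {f x}" by blast
  then show ?thesis by (simp add: descend_def)
qed

lemma descend_lin_map:
  assumes "vs N" "lin_map M N f" "\<And>i. i \<in> I \<Longrightarrow> f i = \<zero>\<^bsub>N\<^esub>"
  shows "lin_map (quot M I) N (descend f)"
proof (rule lin_mapI)
  note d = descend_coset[OF assms]
  fix X Y c assume "X \<in> carrier (quot M I)"
  then obtain x where x: "x \<in> carrier M" "X = I +> x" by (auto simp: quot_carrier)
  show "descend f X \<in> carrier N" using x d lin_map_closed[OF assms(2)] by auto
  show "descend f (c \<odot>\<^bsub>quot M I\<^esub> X) = c \<odot>\<^bsub>N\<^esub> descend f X"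
    using x by (simp add: quot_smult d lin_map_smult[OF assms(2)])
  assume "Y \<in> carrier (quot M I)"
  then obtain y where y: "y \<in> carrier M" "Y = I +> y" by (auto simp: quot_carrier)
  show "descend f (X \<oplus>\<^bsub>quot M I\<^esub> Y) = descend f X \<oplus>\<^bsub>N\<^esub> descend f Y"
    using x y by (simp add: quot_add d lin_map_add[OF assms(2)])
qed

end

subsection \<open>Free vector spaces\<close>

lemma lookup_scale: "Poly_Mapping.lookup (scale c x) k = c * Poly_Mapping.lookup x k"
  unfolding scale_def by (simp add: map.rep_eq when_def)

lemma scale_simps [simp]: "scale c (x + y) = scale c x + scale c y" "scale (c + d) x = scale c x + scale d x"
  "scale c (scale d x) = scale (c * d) x" "scale 1 x = x" "scale 0 x = 0" "scale c 0 = 0"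
  "scale c (Poly_Mapping.single k d) = Poly_Mapping.single k (c * d)"
  "scale c (- x) = - scale c x" "scale c (x - y) = scale c x - scale c y"
  by (auto intro!: poly_mapping_eqI
    simp: lookup_scale lookup_add lookup_minus lookup_uminus lookup_single when_def algebra_simps)

lemma scale_minus_one: "scale (- 1) x = - x" "scale (- c) x = - scale c x"
  by (auto intro!: poly_mapping_eqI simp: lookup_scale)

lemma keys_scale: "Poly_Mapping.keys (scale c x) \<subseteq> Poly_Mapping.keys x"
  by (auto simp: in_keys_iff lookup_scale)

lemma free_vs_simps [simp]: "carrier (free_vs S) = {x. Poly_Mapping.keys x \<subseteq> S}"
  "x \<oplus>\<^bsub>free_vs S\<^esub> y = x + y" "\<zero>\<^bsub>free_vs S\<^esub> = 0" "c \<odot>\<^bsub>free_vs S\<^esub> x = scale c x"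
  by (simp_all add: free_vs_def)

lemma free_vs_vs: "vs (free_vs S)"
proof -
  have "abelian_group (free_vs S :: ('k::field, _) module)"
  proof (rule abelian_groupI)
    fix x :: "'a \<Rightarrow>\<^sub>0 'k" assume "x \<in> carrier (free_vs S)"
    then show "\<exists>y\<in>carrier (free_vs S). y \<oplus>\<^bsub>free_vs S\<^esub> x = \<zero>\<^bsub>free_vs S\<^esub>"
      by (intro bexI[of _ "- x"]) (auto simp: in_keys_iff)
  qed (use keys_add in \<open>fastforce simp: algebra_simps\<close>)+
  then interpret abelian_group "free_vs S :: ('k::field, _) module" .
  show ?thesis by standard (use keys_scale in \<open>fastforce simp: algebra_simps\<close>)+
qed

lemma poly_mapping_single_induct [consumes 1, case_names zero add]:
  assumes "Poly_Mapping.keys x \<subseteq> S" "P 0"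
    "\<And>k c x. k \<in> S \<Longrightarrow> Poly_Mapping.keys x \<subseteq> S \<Longrightarrow> P x \<Longrightarrow> P (Poly_Mapping.single k c + x)"
  shows "P (x :: 'a \<Rightarrow>\<^sub>0 'k::field)"
proof -
  have "finite (Poly_Mapping.keys x)" by simp
  then show ?thesis using assms(1)
  proof (induction "Poly_Mapping.keys x" arbitrary: x rule: finite_induct)
    case empty
    then have "x = 0" by (auto intro!: poly_mapping_eqI simp: in_keys_iff)
    then show ?case using assms(2) by simp
  next
    case (insert k F)
    define y where "y = x - Poly_Mapping.single k (Poly_Mapping.lookup x k)"
    have ky: "Poly_Mapping.keys y = F"
      using insert(2,4) unfolding y_def
      by (auto simp: in_keys_iff lookup_minus lookup_single when_def set_eq_iff split: if_splits)
    have "P y" using insert ky by (intro insert(3)) auto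
    then have "P (Poly_Mapping.single k (Poly_Mapping.lookup x k) + y)"
      using insert ky by (intro assms(3)) auto
    then show ?case by (simp add: y_def)
  qed
qed

text \<open>This sum occurs inside both \<open>free_lift\<close> and \<open>tlift\<close>; isolating
  it gives linearity once for the universal properties of free algebras and of tensor
  products.\<close>

definition lin_ext :: "('k::field, 'b, 'm) module_scheme \<Rightarrow> ('s \<Rightarrow> 'b) \<Rightarrow> ('s \<Rightarrow>\<^sub>0 'k) \<Rightarrow> 'b" where
  "lin_ext P f x = (\<Oplus>\<^bsub>P\<^esub> k\<in>Poly_Mapping.keys x. Poly_Mapping.lookup x k \<odot>\<^bsub>P\<^esub> f k)"

context
  fixes P :: "('k::field, 'b, 'm) module_scheme" (structure) and S and f :: "'s \<Rightarrow> 'b"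
  assumes vsP: "vs P" and f: "f \<in> S \<rightarrow> carrier P"
begin

interpretation vs P by (rule vsP)

text \<open>Cancellation can make the support of x + y smaller than the union of the supports. Over
  a common finite index set, where the additional terms are zero, additivity becomes a termwise
  identity.\<close>

lemma lin_ext_superset:
  assumes "Poly_Mapping.keys x \<subseteq> F" "finite F" "F \<subseteq> S"
  shows "lin_ext P f x = (\<Oplus>k\<in>F. Poly_Mapping.lookup x k \<odot> f k)"
  unfolding lin_ext_def using assms f
  by (intro add.finprod_mono_neutral_cong_left) (auto simp: in_keys_iff Pi_iff)

lemma lin_ext_single: "k \<in> S \<Longrightarrow> lin_ext P f (Poly_Mapping.single k c) = c \<odot> f k"
  using f by (subst lin_ext_superset[of _ "{k}"]) (auto simp: Pi_iff)

lemma lin_ext_zero: "lin_ext P f 0 = \<zero>"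
  by (simp add: lin_ext_def)

lemma lin_ext_lin_map: "lin_map (free_vs S) P (lin_ext P f)"
proof (rule lin_mapI)
  fix x y :: "'s \<Rightarrow>\<^sub>0 'k" and c assume "x \<in> carrier (free_vs S)"
  then have x: "Poly_Mapping.keys x \<subseteq> S" by simp
  show "lin_ext P f x \<in> carrier P"
    unfolding lin_ext_def using f x by (intro finsum_closed) auto
  have cl: "f k \<in> carrier P" if "k \<in> Poly_Mapping.keys x" for k using that x f by auto
  show "lin_ext P f (c \<odot>\<^bsub>free_vs S\<^esub> x) = c \<odot> lin_ext P f x"
  proof -
    have e: "c \<odot> (\<Oplus>k\<in>F. g k) = (\<Oplus>k\<in>F. c \<odot> g k)" if "finite F" "g \<in> F \<rightarrow> carrier P" for F and g :: "'s \<Rightarrow> 'b"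
      using that by (induction F) (auto simp: smult_right Pi_iff)
    show ?thesis
      using x f keys_scale[of c x]
      apply (subst lin_ext_superset[of _ "Poly_Mapping.keys x"])
         apply (simp_all add: lookup_scale)
      apply (subst lin_ext_def)
      apply (subst e)
        apply (auto simp: cl smult_smult intro!: add.finprod_cong')
      done
  qed
  assume "y \<in> carrier (free_vs S)"
  then have y: "Poly_Mapping.keys y \<subseteq> S" by simp
  let ?F = "Poly_Mapping.keys x \<union> Poly_Mapping.keys y"
  have "lin_ext P f (x + y) = (\<Oplus>k\<in>?F. Poly_Mapping.lookup (x + y) k \<odot> f k)"
    using x y keys_add[of x y] by (intro lin_ext_superset) auto
  also have "\<dots> = (\<Oplus>k\<in>?F. Poly_Mapping.lookup x k \<odot> f k \<oplus> Poly_Mapping.lookup y k \<odot> f k)"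
    using x y f by (intro add.finprod_cong') (auto simp: lookup_add smult_left Pi_iff)
  also have "\<dots> = (\<Oplus>k\<in>?F. Poly_Mapping.lookup x k \<odot> f k) \<oplus> (\<Oplus>k\<in>?F. Poly_Mapping.lookup y k \<odot> f k)"
    using x y f by (intro finsum_addf) (auto simp: Pi_iff)
  also have "\<dots> = lin_ext P f x \<oplus> lin_ext P f y"
    using x y by (simp add: lin_ext_superset[of x ?F] lin_ext_superset[of y ?F])
  finally show "lin_ext P f (x \<oplus>\<^bsub>free_vs S\<^esub> y) = lin_ext P f x \<oplus> lin_ext P f y" by simp
qed

lemma lin_ext_unique:
  assumes "lin_map (free_vs S) P g" "\<And>k. k \<in> S \<Longrightarrow> g (Poly_Mapping.single k 1) = f k" "Poly_Mapping.keys x \<subseteq> S"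
  shows "g x = lin_ext P f x"
  using assms(3)
proof (induction rule: poly_mapping_single_induct)
  case zero
  then show ?case using lin_map_zero[OF free_vs_vs vsP assms(1)] by (simp add: lin_ext_zero)
next
  case (add k c x)
  have k: "Poly_Mapping.single k c \<in> carrier (free_vs S)" "Poly_Mapping.single k 1 \<in> carrier (free_vs S)"
    using add by auto
  have "g (Poly_Mapping.single k c) = c \<odot> f k"
    using lin_map_smult[OF assms(1) k(2), of c] assms(2)[OF add(1)] by simp
  then show ?case
    using add k lin_map_add[OF assms(1) k(1), of x] lin_map_add[OF lin_ext_lin_map k(1), of x]
    by (simp add: lin_ext_single)
qed

end

lemma free_vs_eqI:
  assumes "vs P" "lin_map (free_vs S) P f" "lin_map (free_vs S) P g"
    "\<And>k. k \<in> S \<Longrightarrow> f (Poly_Mapping.single k 1) = g (Poly_Mapping.single k 1)" "Poly_Mapping.keys x \<subseteq> S"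
  shows "f x = g x"
proof -
  have *: "(\<lambda>k. g (Poly_Mapping.single k 1)) \<in> S \<rightarrow> carrier P"
    using lin_map_closed[OF assms(3)] by auto
  show ?thesis using lin_ext_unique[OF assms(1) * assms(2), of x] lin_ext_unique[OF assms(1) * assms(3), of x] assms(4,5) by auto
qed

lemma free_vs_lspan:
  fixes x :: "'s \<Rightarrow>\<^sub>0 'k::field"
  assumes "Poly_Mapping.keys x \<subseteq> S" shows "x \<in> lspan (free_vs S) ((\<lambda>k. Poly_Mapping.single k 1) ` S)"
proof -
  interpret vs "free_vs S :: ('k, 's \<Rightarrow>\<^sub>0 'k) module" by (rule free_vs_vs)
  have sp: "subspace (free_vs S) (lspan (free_vs S) ((\<lambda>k. Poly_Mapping.single k (1::'k)) ` S))"
    by (rule lspan_subspace) auto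
  show ?thesis using assms
  proof (induction rule: poly_mapping_single_induct)
    case zero
    then show ?case using subspaceD(2)[OF sp] by simp
  next
    case (add k c x)
    have "Poly_Mapping.single k 1 \<in> lspan (free_vs S) ((\<lambda>k. Poly_Mapping.single k (1::'k)) ` S)"
      by (rule lspan_base) (use add in auto)
    from subspaceD(4)[OF sp subspaceD(5)[OF sp this, of c] add(3)] show ?case
      by (simp only: free_vs_simps scale_simps mult_1_right)
  qed
qed

section \<open>Algebras and presentations\<close>

locale alg = vs A + ring A for A :: "('k::field, 'a, 'm) module_scheme" (structure) +
  assumes smult_mult_left: "x \<in> carrier A \<Longrightarrow> y \<in> carrier A \<Longrightarrow> (c \<odot> x) \<otimes> y = c \<odot> (x \<otimes> y)"
    and smult_mult_right: "x \<in> carrier A \<Longrightarrow> y \<in> carrier A \<Longrightarrow> x \<otimes> (c \<odot> y) = c \<odot> (x \<otimes> y)"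
begin

lemma mult_left_lin: "x \<in> carrier A \<Longrightarrow> lin_map A A (\<lambda>y. x \<otimes> y)"
  by (rule lin_mapI) (simp_all add: r_distr smult_mult_right)

lemma mult_right_lin: "y \<in> carrier A \<Longrightarrow> lin_map A A (\<lambda>x. x \<otimes> y)"
  by (rule lin_mapI) (simp_all add: l_distr smult_mult_left)

lemma ideal_subspace: assumes "ideal I A" shows "subspace A I"
proof -
  interpret ideal I A by fact
  show ?thesis
  proof (rule subspaceI)
    fix c x assume x: "x \<in> I"
    then have "(c \<odot> \<one>) \<otimes> x \<in> I" by (intro I_l_closed) auto
    then show "c \<odot> x \<in> I" using x a_Hcarr by (simp add: smult_mult_left)
  qed (use a_subset in auto)
qed

lemma subspace_idealI:
  assumes "subspace A I" "\<And>a x. a \<in> I \<Longrightarrow> x \<in> carrier A \<Longrightarrow> x \<otimes> a \<in> I"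
    "\<And>a x. a \<in> I \<Longrightarrow> x \<in> carrier A \<Longrightarrow> a \<otimes> x \<in> I"
  shows "ideal I A"
  using assms ring_axioms submodule.axioms(1)[OF assms(1)] by (intro idealI) auto

end

lemma algI:
  assumes "vs A"
    and "\<And>x y. x \<in> carrier A \<Longrightarrow> y \<in> carrier A \<Longrightarrow> x \<otimes>\<^bsub>A\<^esub> y \<in> carrier A"
    and "\<one>\<^bsub>A\<^esub> \<in> carrier A"
    and "\<And>x y z. x \<in> carrier A \<Longrightarrow> y \<in> carrier A \<Longrightarrow> z \<in> carrier A \<Longrightarrow>
      x \<otimes>\<^bsub>A\<^esub> y \<otimes>\<^bsub>A\<^esub> z = x \<otimes>\<^bsub>A\<^esub> (y \<otimes>\<^bsub>A\<^esub> z)"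
    and "\<And>x. x \<in> carrier A \<Longrightarrow> \<one>\<^bsub>A\<^esub> \<otimes>\<^bsub>A\<^esub> x = x" "\<And>x. x \<in> carrier A \<Longrightarrow> x \<otimes>\<^bsub>A\<^esub> \<one>\<^bsub>A\<^esub> = x"
    and l: "\<And>y. y \<in> carrier A \<Longrightarrow> lin_map A A (\<lambda>x. x \<otimes>\<^bsub>A\<^esub> y)"
    and r: "\<And>x. x \<in> carrier A \<Longrightarrow> lin_map A A (\<lambda>y. x \<otimes>\<^bsub>A\<^esub> y)"
  shows "alg A"
proof -
  interpret vs A by fact
  have "ring A"
  proof (rule ringI)
    show "abelian_group A" by (rule abelian_group_axioms)
    show "Group.monoid A" by (rule Group.monoidI) (use assms in auto)
  qed (simp_all add: lin_map_add[OF l] lin_map_add[OF r])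
  then interpret ring A .
  show ?thesis by standard (simp_all add: lin_map_smult[OF l] lin_map_smult[OF r])
qed

definition alg_hom ::
  "('k::field, 'a, 'm) module_scheme \<Rightarrow> ('k, 'b, 'n) module_scheme \<Rightarrow> ('a \<Rightarrow> 'b) \<Rightarrow> bool" where
  "alg_hom A B f \<longleftrightarrow> lin_map A B f \<and> f \<one>\<^bsub>A\<^esub> = \<one>\<^bsub>B\<^esub> \<and>
     (\<forall>x\<in>carrier A. \<forall>y\<in>carrier A. f (x \<otimes>\<^bsub>A\<^esub> y) = f x \<otimes>\<^bsub>B\<^esub> f y)"

lemma alg_hom_lin: "alg_hom A B f \<Longrightarrow> lin_map A B f"
  and alg_hom_one: "alg_hom A B f \<Longrightarrow> f \<one>\<^bsub>A\<^esub> = \<one>\<^bsub>B\<^esub>"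
  and alg_hom_mult: "alg_hom A B f \<Longrightarrow> x \<in> carrier A \<Longrightarrow> y \<in> carrier A \<Longrightarrow>
    f (x \<otimes>\<^bsub>A\<^esub> y) = f x \<otimes>\<^bsub>B\<^esub> f y"
  by (simp_all add: alg_hom_def)

text \<open>The analogue of \<open>vs_image\<close> for products. Quotient algebras, and
  \<open>Uq\<close> with its additional record fields, obtain their axioms from here.\<close>

lemma alg_image:
  fixes A :: "('k::field, 'a, 'm) module_scheme" and Q :: "('k, 'b, 'n) module_scheme"
  assumes "alg A" "vs Q" "alg_hom A Q f" "f ` carrier A = carrier Q"
  shows "alg Q"
proof -
  interpret alg A by fact
  interpret Q: vs Q by fact
  note lin = alg_hom_lin[OF assms(3)]
  note hom = alg_hom_mult[OF assms(3), symmetric] lin_map_smult[OF lin, symmetric] lin_map_add[OF lin, symmetric]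
  have obt: "\<exists>x'\<in>carrier A. x = f x'" if "x \<in> carrier Q" for x
    using that assms(4) by blast
  note cl = lin_map_closed[OF lin]
  have mult: "x \<otimes>\<^bsub>Q\<^esub> y \<in> carrier Q" if "x \<in> carrier Q" "y \<in> carrier Q" for x y
    using obt[OF that(1)] obt[OF that(2)] by (auto simp: hom cl)
  show ?thesis
  proof (rule algI[OF assms(2)])
    show "\<one>\<^bsub>Q\<^esub> \<in> carrier Q" using cl[of "\<one>\<^bsub>A\<^esub>"] by (simp add: alg_hom_one[OF assms(3)])
  next
    fix x y z assume "x \<in> carrier Q" "y \<in> carrier Q" "z \<in> carrier Q"
    then show "x \<otimes>\<^bsub>Q\<^esub> y \<otimes>\<^bsub>Q\<^esub> z = x \<otimes>\<^bsub>Q\<^esub> (y \<otimes>\<^bsub>Q\<^esub> z)"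
      using obt[of x] obt[of y] obt[of z] by (auto simp: hom cl m_assoc)
  next
    fix x assume "x \<in> carrier Q"
    then show "\<one>\<^bsub>Q\<^esub> \<otimes>\<^bsub>Q\<^esub> x = x" "x \<otimes>\<^bsub>Q\<^esub> \<one>\<^bsub>Q\<^esub> = x"
      using obt[of x] by (auto simp: hom cl alg_hom_one[OF assms(3), symmetric])
  next
    fix x assume x: "x \<in> carrier Q"
    show "lin_map Q Q (\<lambda>y. x \<otimes>\<^bsub>Q\<^esub> y)"
    proof (rule lin_mapI)
      fix y z c assume "y \<in> carrier Q"
      then show "x \<otimes>\<^bsub>Q\<^esub> y \<in> carrier Q" "x \<otimes>\<^bsub>Q\<^esub> (c \<odot>\<^bsub>Q\<^esub> y) = c \<odot>\<^bsub>Q\<^esub> (x \<otimes>\<^bsub>Q\<^esub> y)"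
        using x mult obt[of x] obt[of y] by (auto simp: hom cl smult_mult_right)
      assume "z \<in> carrier Q"
      then show "x \<otimes>\<^bsub>Q\<^esub> (y \<oplus>\<^bsub>Q\<^esub> z) = x \<otimes>\<^bsub>Q\<^esub> y \<oplus>\<^bsub>Q\<^esub> x \<otimes>\<^bsub>Q\<^esub> z"
        using x \<open>y \<in> carrier Q\<close> obt[of x] obt[of y] obt[of z] by (auto simp: hom cl r_distr)
    qed
    show "lin_map Q Q (\<lambda>y. y \<otimes>\<^bsub>Q\<^esub> x)"
    proof (rule lin_mapI)
      fix y z c assume "y \<in> carrier Q"
      then show "y \<otimes>\<^bsub>Q\<^esub> x \<in> carrier Q" "(c \<odot>\<^bsub>Q\<^esub> y) \<otimes>\<^bsub>Q\<^esub> x = c \<odot>\<^bsub>Q\<^esub> (y \<otimes>\<^bsub>Q\<^esub> x)"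
        using x mult obt[of x] obt[of y] by (auto simp: hom cl smult_mult_left)
      assume "z \<in> carrier Q"
      then show "(y \<oplus>\<^bsub>Q\<^esub> z) \<otimes>\<^bsub>Q\<^esub> x = y \<otimes>\<^bsub>Q\<^esub> x \<oplus>\<^bsub>Q\<^esub> z \<otimes>\<^bsub>Q\<^esub> x"
        using x \<open>y \<in> carrier Q\<close> obt[of x] obt[of y] obt[of z] by (auto simp: hom cl l_distr)
    qed
  qed (use mult in auto)
qed

lemma ground_vs: "vs ground"
proof -
  have "abelian_group (ground :: ('a, 'a) module)"
  proof (rule abelian_groupI)
    fix x :: 'a assume "x \<in> carrier ground" show "\<exists>y\<in>carrier ground. y \<oplus>\<^bsub>ground\<^esub> x = \<zero>\<^bsub>ground\<^esub>"
      by (intro bexI[of _ "- x"]) auto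
  qed auto
  then interpret abelian_group "ground :: ('a, 'a) module" .
  show ?thesis by standard (auto simp: algebra_simps)
qed

lemma ground_alg: "alg ground"
  by (rule algI[OF ground_vs]) (auto intro!: lin_mapI simp: algebra_simps)

text \<open>Both targets are quotients of \<open>X\<close> by the same congruence, so f x can be
  sent to g x. Applied with \<open>X\<close> a free algebra for the presentation, and with
  \<open>X\<close> the smash product over the free algebra for the associated graded
  algebra.\<close>

lemma alg_iso_of_common_kernel:
  fixes X :: "('k::field, 'x, 'l) module_scheme" and B :: "('k, 'b, 'm) module_scheme"
    and C :: "('k, 'c, 'n) module_scheme"
  assumes "ring X" "vs X" "alg_hom X B f" "f ` carrier X = carrier B" "alg_hom X C g" "g ` carrier X = carrier C"
    and ker: "\<And>x y. x \<in> carrier X \<Longrightarrow> y \<in> carrier X \<Longrightarrow> f x = f y \<longleftrightarrow> g x = g y"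
  shows "\<exists>\<phi>\<in>alg_iso B C. \<forall>x\<in>carrier X. \<phi> (f x) = g x"
proof -
  interpret ring X by fact
  interpret vs X by fact
  note f = alg_hom_mult[OF assms(3)] alg_hom_one[OF assms(3)] lin_map_add[OF alg_hom_lin[OF assms(3)]]
    lin_map_smult[OF alg_hom_lin[OF assms(3)]]
  note g = alg_hom_mult[OF assms(5)] alg_hom_one[OF assms(5)] lin_map_add[OF alg_hom_lin[OF assms(5)]]
    lin_map_smult[OF alg_hom_lin[OF assms(5)]]
  \<comment> \<open>Any preimage will do, since by \<open>ker\<close> the value under
    \<open>g\<close> does not depend on it.\<close>
  define \<phi> where "\<phi> b = g (SOME x. x \<in> carrier X \<and> f x = b)" for b
  have \<phi>: "\<phi> (f x) = g x" if "x \<in> carrier X" for x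
  proof -
    have "(SOME y. y \<in> carrier X \<and> f y = f x) \<in> carrier X \<and> f (SOME y. y \<in> carrier X \<and> f y = f x) = f x"
      by (rule someI[of _ x]) (use that in auto)
    then show ?thesis unfolding \<phi>_def using ker that by blast
  qed
  have obt: "\<exists>x'\<in>carrier X. x = f x'" if "x \<in> carrier B" for x
    using that assms(4) by blast
  have "\<phi> \<in> ring_hom B C"
  proof (rule ring_hom_memI)
    fix x assume "x \<in> carrier B"
    then obtain x' where x': "x' \<in> carrier X" "x = f x'" using obt by blast
    show "\<phi> x \<in> carrier C" using x' \<phi> assms(6) by auto
    fix y assume "y \<in> carrier B"
    then obtain y' where y': "y' \<in> carrier X" "y = f y'" using obt by blast
    have "\<phi> (f (x' \<otimes>\<^bsub>X\<^esub> y')) = g (x' \<otimes>\<^bsub>X\<^esub> y')" "\<phi> (f (x' \<oplus>\<^bsub>X\<^esub> y')) = g (x' \<oplus>\<^bsub>X\<^esub> y')"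
      using x' y' by (auto intro!: \<phi>)
    then show "\<phi> (x \<otimes>\<^bsub>B\<^esub> y) = \<phi> x \<otimes>\<^bsub>C\<^esub> \<phi> y" "\<phi> (x \<oplus>\<^bsub>B\<^esub> y) = \<phi> x \<oplus>\<^bsub>C\<^esub> \<phi> y"
      using x' y' by (simp_all add: f g \<phi>)
  next
    show "\<phi> \<one>\<^bsub>B\<^esub> = \<one>\<^bsub>C\<^esub>" using \<phi>[of "\<one>\<^bsub>X\<^esub>"] by (simp add: f g)
  qed
  moreover have "bij_betw \<phi> (carrier B) (carrier C)"
  proof (rule bij_betw_imageI)
    show "inj_on \<phi> (carrier B)"
    proof (rule inj_onI)
      fix x y assume "x \<in> carrier B" "y \<in> carrier B" and e: "\<phi> x = \<phi> y"
      then obtain x' y' where "x' \<in> carrier X" "x = f x'" "y' \<in> carrier X" "y = f y'"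
        using obt[of x] obt[of y] by auto
      then show "x = y" using e \<phi>[of x'] \<phi>[of y'] ker[of x' y'] by simp
    qed
    show "\<phi> ` carrier B = carrier C"
      unfolding assms(4)[symmetric] assms(6)[symmetric] image_image using \<phi> by simp
  qed
  moreover have "lin_map B C \<phi>"
  proof (rule lin_mapI)
    fix x y c assume "x \<in> carrier B"
    then obtain x' where x': "x' \<in> carrier X" "x = f x'" using obt by blast
    show "\<phi> (c \<odot>\<^bsub>B\<^esub> x) = c \<odot>\<^bsub>C\<^esub> \<phi> x"
      using \<phi>[of "c \<odot>\<^bsub>X\<^esub> x'"] \<phi>[of x'] x' by (simp add: f g)
  qed (fact ring_hom_closed[OF calculation(1)] ring_hom_add[OF calculation(1)])+
  ultimately show ?thesis by (intro bexI[of _ \<phi>] ballI \<phi>) (simp_all add: alg_iso_def ring_iso_def)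
qed

context alg begin

lemma quot_mult: "ideal I A \<Longrightarrow> x \<in> carrier A \<Longrightarrow> y \<in> carrier A \<Longrightarrow>
    (I +> x) \<otimes>\<^bsub>quot A I\<^esub> (I +> y) = I +> (x \<otimes> y)"
  by (simp add: quot_def ideal.rcoset_mult_add)

lemma quot_hom: "ideal I A \<Longrightarrow> alg_hom A (quot A I) (\<lambda>x. I +> x)"
  using quot_lin_map[OF vs_axioms ideal_subspace] quot_mult by (simp add: alg_hom_def quot_def)

lemma quot_alg: assumes "ideal I A" shows "alg (quot A I)"
  by (rule alg_image[OF alg_axioms _ quot_hom[OF assms]])
    (simp_all add: quot_vs[OF vs_axioms ideal_subspace[OF assms]] quot_carrier[OF vs_axioms ideal_subspace[OF assms]])

end

lemma alg_hom_kernel: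
  assumes "alg A" "alg B" "alg_hom A B f"
  shows "ideal {x \<in> carrier A. f x = \<zero>\<^bsub>B\<^esub>} A"
proof -
  interpret A: alg A by fact
  interpret B: alg B by fact
  have "subspace A {x \<in> carrier A. f x \<in> {\<zero>\<^bsub>B\<^esub>}}"
    by (rule A.subspace_vimage[OF B.vs_axioms alg_hom_lin[OF assms(3)] B.subspace_zero])
  then show ?thesis
    by (intro A.subspace_idealI)
      (auto simp: alg_hom_mult[OF assms(3)] lin_map_closed[OF alg_hom_lin[OF assms(3)]])
qed

subsection \<open>Free algebras\<close>

lemma free_alg_simps [simp]: "carrier free_alg = UNIV" "x \<otimes>\<^bsub>free_alg\<^esub> y = x * y"
  "x \<oplus>\<^bsub>free_alg\<^esub> y = x + y" "\<one>\<^bsub>free_alg\<^esub> = 1" "\<zero>\<^bsub>free_alg\<^esub> = 0" "c \<odot>\<^bsub>free_alg\<^esub> x = scale c x"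
  by (simp_all add: free_alg_def)

lemma free_alg_vs: "vs free_alg"
  by (rule vs_cong[OF free_vs_vs[of UNIV]]) (simp_all add: free_alg_def free_vs_def)

lemma free_alg_minus [simp]: "x \<ominus>\<^bsub>free_alg\<^esub> y = x - y"
proof -
  interpret vs free_alg by (rule free_alg_vs)
  show ?thesis by (simp add: minus_eq_smult scale_minus_one)
qed

lemma lin_map_free_alg_iff: "lin_map free_alg P f \<longleftrightarrow> lin_map (free_vs UNIV) P f"
  by (simp_all add: lin_map_def)

lemma free_alg_eqI:
  assumes "vs P" "lin_map free_alg P f" "lin_map free_alg P g"
    "\<And>w. f (Poly_Mapping.single w 1) = g (Poly_Mapping.single w 1)"
  shows "f x = g x"
  using free_vs_eqI[of P UNIV f g x] assms by (simp add: lin_map_free_alg_iff)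

text \<open>\<open>lspan\<close> sees only addition and scalars, and in these
  \<open>free_alg\<close> and \<open>free_vs UNIV\<close> agree.\<close>

lemma free_alg_lspan: "lspan free_alg (range (\<lambda>w. Poly_Mapping.single w 1)) = (UNIV :: ('x list \<Rightarrow>\<^sub>0 'k::field) set)"
proof -
  have "lspan (free_vs UNIV) (range (\<lambda>w. Poly_Mapping.single w (1::'k))) =
      lspan free_alg (range (\<lambda>w. Poly_Mapping.single (w::'x list) (1::'k)))"
    unfolding lspan_def submodule_def subgroup_def submodule_axioms_def
    by (simp add: free_alg_def free_vs_def m_inv_def)
  then show ?thesis using free_vs_lspan[of _ UNIV] by auto
qed

lemma free_alg_subspace_UNIV:
  assumes "subspace free_alg N" "\<And>w. Poly_Mapping.single w 1 \<in> N" shows "x \<in> N"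
  using vs.lspan_minimal[OF free_alg_vs assms(1), of "range (\<lambda>w. Poly_Mapping.single w 1)"] assms(2)
  by (auto simp: free_alg_lspan)

lemma single_Nil: "Poly_Mapping.single [] 1 = 1"
  by (metis single_one zero_list_def)

lemma single_append: "Poly_Mapping.single (v @ w) 1 = Poly_Mapping.single v 1 * Poly_Mapping.single w (1::'k::field)"
  by (simp add: mult_single plus_list_def)

lemma single_Cons: "Poly_Mapping.single (x # w) 1 = gen x * Poly_Mapping.single w (1::'k::field)"
  using single_append[of "[x]" w] by (simp add: gen_def)

lemma scale_conv_mult: "scale c x = Poly_Mapping.single [] c * x"
  unfolding scale_def using mult_map_scale_conv_mult[of c x] by (simp add: zero_list_def)

lemma scale_mult_left: "scale c x * y = scale c (x * (y :: 'x list \<Rightarrow>\<^sub>0 'k::field))"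
  by (simp add: scale_conv_mult mult.assoc)

lemma scale_mult_right: "x * scale c y = scale c (x * (y :: 'x list \<Rightarrow>\<^sub>0 'k::field))"
proof -
  have "x * Poly_Mapping.single [] c = Poly_Mapping.single [] c * x"
    by (rule poly_mapping_single_induct[of x UNIV])
      (simp_all add: algebra_simps mult_single plus_list_def)
  then show ?thesis by (simp add: scale_conv_mult flip: mult.assoc)
qed

lemma free_alg_alg: "alg free_alg"
  by (rule algI[OF free_alg_vs])
    (auto intro!: lin_mapI simp: algebra_simps scale_mult_left scale_mult_right)

definition gen_prod :: "('k::field, 'b, 'm) module_scheme \<Rightarrow> ('x \<Rightarrow> 'b) \<Rightarrow> 'x list \<Rightarrow> 'b" where
  "gen_prod B f w = foldr (\<lambda>g y. f g \<otimes>\<^bsub>B\<^esub> y) w \<one>\<^bsub>B\<^esub>"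

context
  fixes B :: "('k::field, 'b, 'm) module_scheme" (structure) and f :: "'x \<Rightarrow> 'b"
  assumes algB: "alg B" and f: "\<And>x. f x \<in> carrier B"
begin

interpretation alg B by (rule algB)

lemma gen_prod_closed: "gen_prod B f w \<in> carrier B"
  by (induction w) (simp_all add: gen_prod_def f)

lemma gen_prod_append: "gen_prod B f (v @ w) = gen_prod B f v \<otimes> gen_prod B f w"
  using gen_prod_closed by (induction v) (simp_all add: gen_prod_def f m_assoc)

lemma free_lift_conv: "free_lift B f = lin_ext B (gen_prod B f)"
  by (auto simp: free_lift_def lin_ext_def gen_prod_def)

lemma free_lift_lin: "lin_map free_alg B (free_lift B f)"
  unfolding free_lift_conv lin_map_free_alg_iff
  by (rule lin_ext_lin_map[OF vs_axioms]) (simp add: gen_prod_closed)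

lemma free_lift_single: "free_lift B f (Poly_Mapping.single w c) = c \<odot> gen_prod B f w"
  unfolding free_lift_conv by (rule lin_ext_single[OF vs_axioms, of _ UNIV]) (simp_all add: gen_prod_closed)

lemma free_lift_gen: "free_lift B f (gen x) = f x"
  unfolding gen_def by (simp add: free_lift_single gen_prod_def f)

text \<open>Both sides of f(xy) = f(x) f(y) are bilinear in x and y, so it is enough to compare them
  on words, where the claim is \<open>gen_prod_append\<close>.\<close>

lemma free_lift_hom: "alg_hom free_alg B (free_lift B f)"
proof -
  note L = free_lift_lin
  interpret T: alg "free_alg :: ('k, 'x list \<Rightarrow>\<^sub>0 'k) module" by (rule free_alg_alg)
  have single: "free_lift B f (Poly_Mapping.single v 1 * y) =
      free_lift B f (Poly_Mapping.single v 1) \<otimes> free_lift B f y" for v y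
  proof (rule free_alg_eqI[OF vs_axioms, where f = "\<lambda>y. free_lift B f (Poly_Mapping.single v 1 * y)"])
    show "lin_map free_alg B (\<lambda>y. free_lift B f (Poly_Mapping.single v 1 * y))"
      using lin_map_comp[OF T.mult_left_lin[of "Poly_Mapping.single v 1"] L] by simp
    show "lin_map free_alg B (\<lambda>y. free_lift B f (Poly_Mapping.single v 1) \<otimes> free_lift B f y)"
      using lin_map_comp[OF L mult_left_lin] lin_map_closed[OF L] by simp
    show "free_lift B f (Poly_Mapping.single v 1 * Poly_Mapping.single w 1) =
        free_lift B f (Poly_Mapping.single v 1) \<otimes> free_lift B f (Poly_Mapping.single w 1)" for w
      by (simp add: free_lift_single gen_prod_closed gen_prod_append flip: single_append)
  qed
  have "free_lift B f (x * y) = free_lift B f x \<otimes> free_lift B f y" for x y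
  proof (rule free_alg_eqI[OF vs_axioms, where f = "\<lambda>x. free_lift B f (x * y)"])
    show "lin_map free_alg B (\<lambda>x. free_lift B f (x * y))"
      using lin_map_comp[OF T.mult_right_lin[of y] L] by simp
    show "lin_map free_alg B (\<lambda>x. free_lift B f x \<otimes> free_lift B f y)"
      using lin_map_comp[OF L mult_right_lin] lin_map_closed[OF L] by simp
  qed (rule single)
  moreover have "free_lift B f 1 = \<one>"
    using free_lift_single[of "[]" 1] by (simp add: single_Nil gen_prod_def)
  ultimately show ?thesis using L by (simp add: alg_hom_def)
qed

end

lemma free_alg_induct [case_names one gen add scale mult]:
  assumes "P 1" "\<And>g. P (gen g)" "\<And>x y. P x \<Longrightarrow> P y \<Longrightarrow> P (x + y)"
    "\<And>c x. P x \<Longrightarrow> P (scale c x)" "\<And>x y. P x \<Longrightarrow> P y \<Longrightarrow> P (x * y)"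
  shows "P x"
proof -
  have "P (Poly_Mapping.single w 1)" for w
    by (induction w) (simp_all add: single_Nil single_Cons assms)
  moreover have "P 0" using assms(4)[OF assms(1), of 0] by simp
  moreover have "subspace free_alg (Collect P)"
    by (rule vs.subspaceI[OF free_alg_vs]) (auto intro: assms(3,4) \<open>P 0\<close>)
  ultimately have "x \<in> Collect P"
    by (rule_tac free_alg_subspace_UNIV) simp_all
  then show ?thesis by simp
qed

lemma alg_hom_free_eqI:
  assumes "alg B" "alg_hom free_alg B f" "alg_hom free_alg B g" "\<And>x. f (gen x) = g (gen x)"
  shows "f t = g t"
  by (induction t rule: free_alg_induct)
    (simp_all add: assms(4) alg_hom_mult[OF assms(2), simplified] alg_hom_mult[OF assms(3), simplified]
      alg_hom_one[OF assms(2), simplified] alg_hom_one[OF assms(3), simplified]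
      lin_map_add[OF alg_hom_lin[OF assms(2)], simplified] lin_map_add[OF alg_hom_lin[OF assms(3)], simplified]
      lin_map_smult[OF alg_hom_lin[OF assms(2)], simplified] lin_map_smult[OF alg_hom_lin[OF assms(3)], simplified])

subsection \<open>Presented algebras\<close>

context
  fixes S :: "('x list \<Rightarrow>\<^sub>0 'k::field) set"
begin

interpretation T: alg "free_alg :: ('k, 'x list \<Rightarrow>\<^sub>0 'k) module" by (rule free_alg_alg)

lemma genideal_free: "ideal (genideal free_alg S) free_alg"
  by (rule T.genideal_ideal) simp

lemmas genideal_free_subspace = T.ideal_subspace[OF genideal_free]

lemma presented_alg: "alg (presented S)"
  unfolding presented_def by (rule T.quot_alg[OF genideal_free])

lemma cls_hom: "alg_hom free_alg (presented S) (cls S)"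
  unfolding presented_def cls_def by (rule T.quot_hom[OF genideal_free])

lemma presented_carrier: "carrier (presented S) = range (cls S)"
  unfolding presented_def cls_def quot_carrier[OF T.vs_axioms genideal_free_subspace] by simp

lemma cls_closed [simp]: "cls S x \<in> carrier (presented S)"
  by (simp add: presented_carrier)

lemma cls_simps: "cls S (x * y) = cls S x \<otimes>\<^bsub>presented S\<^esub> cls S y"
  "cls S (x + y) = cls S x \<oplus>\<^bsub>presented S\<^esub> cls S y" "cls S 1 = \<one>\<^bsub>presented S\<^esub>"
  "cls S (scale c x) = c \<odot>\<^bsub>presented S\<^esub> cls S x" "cls S 0 = \<zero>\<^bsub>presented S\<^esub>"
  using cls_hom lin_map_zero[OF T.vs_axioms alg.axioms(1)[OF presented_alg] alg_hom_lin[OF cls_hom]]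
  by (simp_all add: alg_hom_def lin_map_def)

lemma cls_eq_iff: "cls S x = cls S y \<longleftrightarrow> x - y \<in> genideal free_alg S"
  unfolding cls_def using coset_eq_iff[OF T.vs_axioms genideal_free_subspace, of x y] by simp

lemma cls_rel: "r \<in> S \<Longrightarrow> cls S r = \<zero>\<^bsub>presented S\<^esub>"
  using cls_eq_iff[of r 0] T.genideal_self[of S] by (auto simp: cls_simps(5))

lemma genideal_free_minimal: "ideal N free_alg \<Longrightarrow> S \<subseteq> N \<Longrightarrow> genideal free_alg S \<subseteq> N"
  by (rule T.genideal_minimal)

lemma presented_induct [consumes 1, case_names one gen add smult mult]:
  assumes "X \<in> carrier (presented S)" "P \<one>\<^bsub>presented S\<^esub>" "\<And>g. P (cls S (gen g))"
    "\<And>x y. x \<in> carrier (presented S) \<Longrightarrow> y \<in> carrier (presented S) \<Longrightarrow> P x \<Longrightarrow> P y \<Longrightarrow> P (x \<oplus>\<^bsub>presented S\<^esub> y)"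
    "\<And>c x. x \<in> carrier (presented S) \<Longrightarrow> P x \<Longrightarrow> P (c \<odot>\<^bsub>presented S\<^esub> x)"
    "\<And>x y. x \<in> carrier (presented S) \<Longrightarrow> y \<in> carrier (presented S) \<Longrightarrow> P x \<Longrightarrow> P y \<Longrightarrow> P (x \<otimes>\<^bsub>presented S\<^esub> y)"
  shows "P X"
proof -
  obtain x where "X = cls S x" using assms(1) by (auto simp: presented_carrier)
  moreover have "P (cls S x)"
    by (induction x rule: free_alg_induct) (simp_all add: cls_simps assms)
  ultimately show ?thesis by simp
qed

context
  fixes B :: "('k, 'b, 'm) module_scheme" and f :: "'x \<Rightarrow> 'b"
  assumes B: "alg B" and f: "\<And>x. f x \<in> carrier B" and rel: "\<And>r. r \<in> S \<Longrightarrow> free_lift B f r = \<zero>\<^bsub>B\<^esub>"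
begin

lemma genideal_free_lift: assumes "i \<in> genideal free_alg S" shows "free_lift B f i = \<zero>\<^bsub>B\<^esub>"
  using genideal_free_minimal[OF alg_hom_kernel[OF free_alg_alg B free_lift_hom[where f = f, OF B f]]] rel assms
  by auto

lemma presented_lift_cls: "descend (free_lift B f) (cls S x) = free_lift B f x"
  unfolding cls_def
  by (rule descend_coset[OF T.vs_axioms genideal_free_subspace alg.axioms(1)[OF B] free_lift_lin[where f = f, OF B f]])
    (simp_all add: genideal_free_lift)

lemma presented_lift_hom: "alg_hom (presented S) B (descend (free_lift B f))"
proof -
  have "lin_map (presented S) B (descend (free_lift B f))"
    unfolding presented_def
    by (rule descend_lin_map[OF T.vs_axioms genideal_free_subspace alg.axioms(1)[OF B] free_lift_lin[where f = f, OF B f]])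
      (simp_all add: genideal_free_lift)
  then show ?thesis
    using free_lift_hom[where f = f, OF B f]
    by (auto simp: alg_hom_def presented_carrier presented_lift_cls simp flip: cls_simps)
qed

lemma presented_lift_gen: "descend (free_lift B f) (cls S (gen x)) = f x"
  by (simp add: presented_lift_cls free_lift_gen[where f = f, OF B f])

end

end

section \<open>Tensor products\<close>

definition bilin :: "('k::field, 'a, 'm) module_scheme \<Rightarrow> ('k, 'b, 'n) module_scheme \<Rightarrow>
    ('k, 'c, 'p) module_scheme \<Rightarrow> ('a \<Rightarrow> 'b \<Rightarrow> 'c) \<Rightarrow> bool" where
  "bilin M N P f \<longleftrightarrow> (\<forall>b\<in>carrier N. lin_map M P (\<lambda>a. f a b)) \<and> (\<forall>a\<in>carrier M. lin_map N P (f a))"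

lemma bilinI:
  assumes "\<And>b. b \<in> carrier N \<Longrightarrow> lin_map M P (\<lambda>a. f a b)" "\<And>a. a \<in> carrier M \<Longrightarrow> lin_map N P (\<lambda>b. f a b)"
  shows "bilin M N P f"
  using assms by (simp add: bilin_def)

lemma bilin_left: "bilin M N P f \<Longrightarrow> b \<in> carrier N \<Longrightarrow> lin_map M P (\<lambda>a. f a b)"
  and bilin_right: "bilin M N P f \<Longrightarrow> a \<in> carrier M \<Longrightarrow> lin_map N P (\<lambda>b. f a b)"
  by (simp_all add: bilin_def)

lemma bilin_closed: "bilin M N P f \<Longrightarrow> a \<in> carrier M \<Longrightarrow> b \<in> carrier N \<Longrightarrow> f a b \<in> carrier P"
  using lin_map_closed[OF bilin_left] .

context
  fixes M :: "('k::field, 'a, 'm) module_scheme" and N :: "('k, 'b, 'n) module_scheme"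
  assumes M: "vs M" and N: "vs N"
begin

interpretation M: vs M by (rule M)
interpretation N: vs N by (rule N)

abbreviation (input) "F \<equiv> free_vs (carrier M \<times> carrier N) :: ('k, ('a \<times> 'b) \<Rightarrow>\<^sub>0 'k) module"

interpretation F: vs F by (rule free_vs_vs)

abbreviation (input) "tensor_gens \<equiv>
     ({Poly_Mapping.single (a \<oplus>\<^bsub>M\<^esub> a', b) 1 - Poly_Mapping.single (a, b) 1
         - Poly_Mapping.single (a', b) 1
       | a a' b. a \<in> carrier M \<and> a' \<in> carrier M \<and> b \<in> carrier N} \<union>
      {Poly_Mapping.single (a, b \<oplus>\<^bsub>N\<^esub> b') 1 - Poly_Mapping.single (a, b) 1
         - Poly_Mapping.single (a, b') 1
       | a b b'. a \<in> carrier M \<and> b \<in> carrier N \<and> b' \<in> carrier N} \<union>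
      {Poly_Mapping.single (c \<odot>\<^bsub>M\<^esub> a, b) 1 - Poly_Mapping.single (a, b) c
       | a b c. a \<in> carrier M \<and> b \<in> carrier N} \<union>
      {Poly_Mapping.single (a, c \<odot>\<^bsub>N\<^esub> b) 1 - Poly_Mapping.single (a, b) c
       | a b c. a \<in> carrier M \<and> b \<in> carrier N} :: (('a \<times> 'b) \<Rightarrow>\<^sub>0 'k) set)"

lemma free_vs_minus: "Poly_Mapping.keys x \<subseteq> S \<Longrightarrow> Poly_Mapping.keys y \<subseteq> S \<Longrightarrow> x \<ominus>\<^bsub>free_vs S\<^esub> y = x - y"
  for x y :: "'s \<Rightarrow>\<^sub>0 'k"
  by (simp add: vs.minus_eq_smult[OF free_vs_vs] scale_minus_one)

lemma tensor_gens_carrier: "tensor_gens \<subseteq> carrier F"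
  by (auto dest!: keys_diff[THEN subsetD] split: if_splits)

lemma tensor_gensI:
  "a \<in> carrier M \<Longrightarrow> a' \<in> carrier M \<Longrightarrow> b \<in> carrier N \<Longrightarrow>
    Poly_Mapping.single (a \<oplus>\<^bsub>M\<^esub> a', b) 1 - Poly_Mapping.single (a, b) 1 - Poly_Mapping.single (a', b) 1 \<in> tensor_gens"
  "a \<in> carrier M \<Longrightarrow> b \<in> carrier N \<Longrightarrow> b' \<in> carrier N \<Longrightarrow>
    Poly_Mapping.single (a, b \<oplus>\<^bsub>N\<^esub> b') 1 - Poly_Mapping.single (a, b) 1 - Poly_Mapping.single (a, b') 1 \<in> tensor_gens"
  "a \<in> carrier M \<Longrightarrow> b \<in> carrier N \<Longrightarrow>
    Poly_Mapping.single (c \<odot>\<^bsub>M\<^esub> a, b) 1 - Poly_Mapping.single (a, b) c \<in> tensor_gens"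
  "a \<in> carrier M \<Longrightarrow> b \<in> carrier N \<Longrightarrow>
    Poly_Mapping.single (a, c \<odot>\<^bsub>N\<^esub> b) 1 - Poly_Mapping.single (a, b) c \<in> tensor_gens"
  by blast+

lemma tensor_rels_subspace: "subspace F (tensor_rels M N)"
  unfolding tensor_rels_def by (rule F.lspan_subspace[OF tensor_gens_carrier])

lemma tensor_vs: "vs (tensor M N)"
  unfolding tensor_def by (rule quot_vs[OF F.vs_axioms tensor_rels_subspace])

interpretation T: vs "tensor M N" by (rule tensor_vs)

lemma pure_closed [simp]: "a \<in> carrier M \<Longrightarrow> b \<in> carrier N \<Longrightarrow> pure M N a b \<in> carrier (tensor M N)"
  unfolding tensor_def pure_def quot_carrier[OF F.vs_axioms tensor_rels_subspace] by auto

lemma pure_eqI: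
  assumes "x - y \<in> tensor_gens" "Poly_Mapping.keys x \<subseteq> carrier M \<times> carrier N" "Poly_Mapping.keys y \<subseteq> carrier M \<times> carrier N"
  shows "tensor_rels M N +>\<^bsub>F\<^esub> x = tensor_rels M N +>\<^bsub>F\<^esub> y"
  using assms(2,3) F.lspan_base[OF assms(1)]
  by (subst coset_eq_iff[OF F.vs_axioms tensor_rels_subspace]) (auto simp: free_vs_minus tensor_rels_def)

lemma coset_add: "Poly_Mapping.keys x \<subseteq> carrier M \<times> carrier N \<Longrightarrow> Poly_Mapping.keys y \<subseteq> carrier M \<times> carrier N \<Longrightarrow>
    tensor_rels M N +>\<^bsub>F\<^esub> (x + y) = (tensor_rels M N +>\<^bsub>F\<^esub> x) \<oplus>\<^bsub>tensor M N\<^esub> (tensor_rels M N +>\<^bsub>F\<^esub> y)"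
  using quot_add[OF F.vs_axioms tensor_rels_subspace, of x y] by (simp add: tensor_def)

lemma coset_scale: "Poly_Mapping.keys x \<subseteq> carrier M \<times> carrier N \<Longrightarrow>
    tensor_rels M N +>\<^bsub>F\<^esub> (scale c x) = c \<odot>\<^bsub>tensor M N\<^esub> (tensor_rels M N +>\<^bsub>F\<^esub> x)"
  using quot_smult[OF F.vs_axioms tensor_rels_subspace, of x c] by (simp add: tensor_def)

lemma coset_single: "a \<in> carrier M \<Longrightarrow> b \<in> carrier N \<Longrightarrow>
    tensor_rels M N +>\<^bsub>F\<^esub> Poly_Mapping.single (a, b) c = c \<odot>\<^bsub>tensor M N\<^esub> pure M N a b"
  using coset_scale[of "Poly_Mapping.single (a, b) 1" c] by (simp add: pure_def)

lemma pure_lin_left: assumes b: "b \<in> carrier N" shows "lin_map M (tensor M N) (\<lambda>a. pure M N a b)"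
proof (rule lin_mapI)
  fix x y c assume x: "x \<in> carrier M"
  show "pure M N x b \<in> carrier (tensor M N)" using x b by simp
  have "pure M N (c \<odot>\<^bsub>M\<^esub> x) b = tensor_rels M N +>\<^bsub>F\<^esub> Poly_Mapping.single (x, b) c"
    unfolding pure_def by (rule pure_eqI[OF tensor_gensI(3)[OF x b]]) (use x b in auto)
  then show "pure M N (c \<odot>\<^bsub>M\<^esub> x) b = c \<odot>\<^bsub>tensor M N\<^esub> pure M N x b"
    by (simp only: coset_single[OF x b])
  assume y: "y \<in> carrier M"
  have "pure M N (x \<oplus>\<^bsub>M\<^esub> y) b = tensor_rels M N +>\<^bsub>F\<^esub> (Poly_Mapping.single (x, b) 1 + Poly_Mapping.single (y, b) 1)"
    using x y b keys_add[of "Poly_Mapping.single (x, b) (1::'k)" "Poly_Mapping.single (y, b) 1"]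
    unfolding pure_def
    by (intro pure_eqI) (unfold diff_diff_eq[symmetric], rule tensor_gensI(1), auto)
  then show "pure M N (x \<oplus>\<^bsub>M\<^esub> y) b = pure M N x b \<oplus>\<^bsub>tensor M N\<^esub> pure M N y b"
    using x y b by (simp add: coset_add) (simp add: pure_def)
qed

lemma pure_lin_right: assumes a: "a \<in> carrier M" shows "lin_map N (tensor M N) (\<lambda>b. pure M N a b)"
proof (rule lin_mapI)
  fix x y c assume x: "x \<in> carrier N"
  show "pure M N a x \<in> carrier (tensor M N)" using x a by simp
  have "pure M N a (c \<odot>\<^bsub>N\<^esub> x) = tensor_rels M N +>\<^bsub>F\<^esub> Poly_Mapping.single (a, x) c"
    unfolding pure_def by (rule pure_eqI[OF tensor_gensI(4)[OF a x]]) (use x a in auto)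
  then show "pure M N a (c \<odot>\<^bsub>N\<^esub> x) = c \<odot>\<^bsub>tensor M N\<^esub> pure M N a x"
    by (simp only: coset_single[OF a x])
  assume y: "y \<in> carrier N"
  have "pure M N a (x \<oplus>\<^bsub>N\<^esub> y) = tensor_rels M N +>\<^bsub>F\<^esub> (Poly_Mapping.single (a, x) 1 + Poly_Mapping.single (a, y) 1)"
    using x y a keys_add[of "Poly_Mapping.single (a, x) (1::'k)" "Poly_Mapping.single (a, y) 1"]
    unfolding pure_def
    by (intro pure_eqI) (unfold diff_diff_eq[symmetric], rule tensor_gensI(2), auto)
  then show "pure M N a (x \<oplus>\<^bsub>N\<^esub> y) = pure M N a x \<oplus>\<^bsub>tensor M N\<^esub> pure M N a y"
    using x y a by (simp add: coset_add) (simp add: pure_def)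
qed

text \<open>There is no case for scalar multiples: c (a tensor b) = (c a) tensor b is again a pure
  tensor, and so is zero.\<close>

lemma tensor_induct [consumes 1, case_names pure add]:
  assumes "t \<in> carrier (tensor M N)"
    "\<And>a b. a \<in> carrier M \<Longrightarrow> b \<in> carrier N \<Longrightarrow> P (pure M N a b)"
    "\<And>x y. x \<in> carrier (tensor M N) \<Longrightarrow> y \<in> carrier (tensor M N) \<Longrightarrow> P x \<Longrightarrow> P y \<Longrightarrow> P (x \<oplus>\<^bsub>tensor M N\<^esub> y)"
  shows "P t"
proof -
  obtain x where x: "Poly_Mapping.keys x \<subseteq> carrier M \<times> carrier N" "t = tensor_rels M N +>\<^bsub>F\<^esub> x"
    using assms(1) unfolding tensor_def quot_carrier[OF F.vs_axioms tensor_rels_subspace] by auto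
  have p: "P (tensor_rels M N +>\<^bsub>F\<^esub> Poly_Mapping.single k c)" if k: "k \<in> carrier M \<times> carrier N" for k c
  proof -
    obtain a b where ab: "k = (a, b)" "a \<in> carrier M" "b \<in> carrier N" using k by auto
    then show ?thesis
      using assms(2)[of "c \<odot>\<^bsub>M\<^esub> a" b] lin_map_smult[OF pure_lin_left[OF ab(3)] ab(2)] by (simp add: coset_single)
  qed
  have "P (tensor_rels M N +>\<^bsub>F\<^esub> x)"
    using x(1)
  proof (induction rule: poly_mapping_single_induct)
    case zero
    then show ?case using p[of "(\<zero>\<^bsub>M\<^esub>, \<zero>\<^bsub>N\<^esub>)" 0] by simp
  next
    case (add k c x)
    have "tensor_rels M N +>\<^bsub>F\<^esub> y \<in> carrier (tensor M N)" if "Poly_Mapping.keys y \<subseteq> carrier M \<times> carrier N" for y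
      using that unfolding tensor_def quot_carrier[OF F.vs_axioms tensor_rels_subspace] by auto
    then show ?case using add p[OF add(1)] by (auto simp: coset_add intro!: assms(3))
  qed
  then show ?thesis using x by simp
qed

lemma tensor_eqI:
  assumes "vs P" "lin_map (tensor M N) P f" "lin_map (tensor M N) P g"
    "\<And>a b. a \<in> carrier M \<Longrightarrow> b \<in> carrier N \<Longrightarrow> f (pure M N a b) = g (pure M N a b)" "t \<in> carrier (tensor M N)"
  shows "f t = g t"
  using assms(5)
  by (induction rule: tensor_induct) (simp_all add: assms(4) lin_map_add[OF assms(2)] lin_map_add[OF assms(3)])

lemma tensor_subspace_induct:
  assumes "subspace (tensor M N) K" "\<And>a b. a \<in> carrier M \<Longrightarrow> b \<in> carrier N \<Longrightarrow> pure M N a b \<in> K"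
    "t \<in> carrier (tensor M N)"
  shows "t \<in> K"
  using assms(3) by (induction rule: tensor_induct) (auto intro: assms(2) subspaceD(4)[OF assms(1)])

context
  fixes P :: "('k, 'c, 'p) module_scheme" and f :: "'a \<Rightarrow> 'b \<Rightarrow> 'c"
  assumes P: "vs P" and f: "bilin M N P f"
begin

interpretation P: vs P by (rule P)

lemma tlift_conv: "tlift P f = descend (lin_ext P (\<lambda>p. f (fst p) (snd p)))"
  by (simp add: tlift_def lin_ext_def[abs_def])

lemma tlift_fun: "(\<lambda>p. f (fst p) (snd p)) \<in> carrier M \<times> carrier N \<rightarrow> carrier P"
  using bilin_closed[OF f] by auto

lemma tlift_ext_lin: "lin_map F P (lin_ext P (\<lambda>p. f (fst p) (snd p)))"
  by (rule lin_ext_lin_map[OF P tlift_fun])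

text \<open>The four families of generators are the defects of additivity and homogeneity in each
  argument, so a bilinear \<open>f\<close> kills them; the kernel is a subspace and thus contains
  their span.\<close>

lemma tlift_rels: assumes "i \<in> tensor_rels M N" shows "lin_ext P (\<lambda>p. f (fst p) (snd p)) i = \<zero>\<^bsub>P\<^esub>"
proof -
  note L = tlift_ext_lin
  let ?L = "lin_ext P (\<lambda>p. f (fst p) (snd p))"
  note single = lin_ext_single[OF P tlift_fun]
  have minus: "?L (x - y) = ?L x \<ominus>\<^bsub>P\<^esub> ?L y" if "Poly_Mapping.keys x \<subseteq> carrier M \<times> carrier N" "Poly_Mapping.keys y \<subseteq> carrier M \<times> carrier N" for x y
    using lin_map_minus[OF F.vs_axioms P L, of x y] that by (simp add: free_vs_minus)
  have minus2: "?L (x - y - z) = ?L x \<ominus>\<^bsub>P\<^esub> ?L y \<ominus>\<^bsub>P\<^esub> ?L z"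
    if "Poly_Mapping.keys x \<subseteq> carrier M \<times> carrier N" "Poly_Mapping.keys y \<subseteq> carrier M \<times> carrier N" "Poly_Mapping.keys z \<subseteq> carrier M \<times> carrier N" for x y z
    using that keys_diff[of x y] by (subst minus) (auto simp: minus)
  note cl = bilin_closed[OF f]
  have z: "x \<oplus>\<^bsub>P\<^esub> y \<ominus>\<^bsub>P\<^esub> x \<ominus>\<^bsub>P\<^esub> y = \<zero>\<^bsub>P\<^esub>" if "x \<in> carrier P" "y \<in> carrier P" for x y
    using that P.r_neg[of "x \<oplus>\<^bsub>P\<^esub> y"] by (simp add: a_minus_def P.minus_add P.a_assoc)
  have "tensor_gens \<subseteq> {x \<in> carrier F. ?L x \<in> {\<zero>\<^bsub>P\<^esub>}}"
  proof (intro subsetI CollectI conjI)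
    fix x assume x: "x \<in> tensor_gens"
    then show "x \<in> carrier F" by (rule subsetD[OF tensor_gens_carrier])
    from x show "?L x \<in> {\<zero>\<^bsub>P\<^esub>}"
    proof (elim UnE)
      assume "x \<in> {Poly_Mapping.single (a \<oplus>\<^bsub>M\<^esub> a', b) 1 - Poly_Mapping.single (a, b) 1
         - Poly_Mapping.single (a', b) 1 | a a' b. a \<in> carrier M \<and> a' \<in> carrier M \<and> b \<in> carrier N}"
      then obtain a a' b where *: "a \<in> carrier M" "a' \<in> carrier M" "b \<in> carrier N"
        and x: "x = Poly_Mapping.single (a \<oplus>\<^bsub>M\<^esub> a', b) 1 - Poly_Mapping.single (a, b) 1 - Poly_Mapping.single (a', b) 1"
        by blast
      show ?thesis unfolding x using *
        by (subst minus2) (auto simp: single cl z lin_map_add[OF bilin_left[OF f]])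
    next
      assume "x \<in> {Poly_Mapping.single (a, b \<oplus>\<^bsub>N\<^esub> b') 1 - Poly_Mapping.single (a, b) 1
         - Poly_Mapping.single (a, b') 1 | a b b'. a \<in> carrier M \<and> b \<in> carrier N \<and> b' \<in> carrier N}"
      then obtain a b b' where *: "a \<in> carrier M" "b \<in> carrier N" "b' \<in> carrier N"
        and x: "x = Poly_Mapping.single (a, b \<oplus>\<^bsub>N\<^esub> b') 1 - Poly_Mapping.single (a, b) 1 - Poly_Mapping.single (a, b') 1"
        by blast
      show ?thesis unfolding x using *
        by (subst minus2) (auto simp: single cl z lin_map_add[OF bilin_right[OF f]])
    next
      assume "x \<in> {Poly_Mapping.single (c \<odot>\<^bsub>M\<^esub> a, b) 1 - Poly_Mapping.single (a, b) c
       | a b c. a \<in> carrier M \<and> b \<in> carrier N}"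
      then obtain a b c where *: "a \<in> carrier M" "b \<in> carrier N"
        and x: "x = Poly_Mapping.single (c \<odot>\<^bsub>M\<^esub> a, b) 1 - Poly_Mapping.single (a, b) c"
        by blast
      show ?thesis unfolding x using *
        by (subst minus) (auto simp: single cl P.minus_zero_iff lin_map_smult[OF bilin_left[OF f]])
    next
      assume "x \<in> {Poly_Mapping.single (a, c \<odot>\<^bsub>N\<^esub> b) 1 - Poly_Mapping.single (a, b) c
       | a b c. a \<in> carrier M \<and> b \<in> carrier N}"
      then obtain a b c where *: "a \<in> carrier M" "b \<in> carrier N"
        and x: "x = Poly_Mapping.single (a, c \<odot>\<^bsub>N\<^esub> b) 1 - Poly_Mapping.single (a, b) c"
        by blast
      show ?thesis unfolding x using *
        by (subst minus) (auto simp: single cl P.minus_zero_iff lin_map_smult[OF bilin_right[OF f]])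
    qed
  qed
  then have "tensor_rels M N \<subseteq> {x \<in> carrier F. ?L x \<in> {\<zero>\<^bsub>P\<^esub>}}"
    unfolding tensor_rels_def
    by (rule F.lspan_minimal[OF F.subspace_vimage[OF P L P.subspace_zero]])
  then show ?thesis using assms by auto
qed

lemma tlift_lin: "lin_map (tensor M N) P (tlift P f)"
  unfolding tlift_conv tensor_def
  by (rule descend_lin_map[OF F.vs_axioms tensor_rels_subspace P tlift_ext_lin tlift_rels])

lemma tlift_pure: assumes "a \<in> carrier M" "b \<in> carrier N" shows "tlift P f (pure M N a b) = f a b"
proof -
  have "tlift P f (pure M N a b) = lin_ext P (\<lambda>p. f (fst p) (snd p)) (Poly_Mapping.single (a, b) 1)"
    unfolding tlift_conv pure_def
    using assms by (intro descend_coset[OF F.vs_axioms tensor_rels_subspace P tlift_ext_lin tlift_rels]) auto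
  also have "\<dots> = f a b" using assms bilin_closed[OF f] by (subst lin_ext_single[OF P tlift_fun]) auto
  finally show ?thesis .
qed

end

lemma tlift_comp:
  assumes P: "vs P" and f: "bilin M N P f" and "vs Q" "lin_map P Q g" "t \<in> carrier (tensor M N)"
  shows "g (tlift P f t) = tlift Q (\<lambda>a b. g (f a b)) t"
proof -
  have b: "bilin M N Q (\<lambda>a b. g (f a b))"
    by (intro bilinI lin_map_comp[OF bilin_left[OF f] assms(4)] lin_map_comp[OF bilin_right[OF f] assms(4)])
  show ?thesis
    by (rule tensor_eqI[OF assms(3) lin_map_comp[OF tlift_lin[OF P f] assms(4)] tlift_lin[OF assms(3) b] _ assms(5)])
      (simp add: tlift_pure[OF P f] tlift_pure[OF assms(3) b])
qed

lemma tlift_cong: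
  assumes "vs P" "bilin M N P f" "\<And>a b. a \<in> carrier M \<Longrightarrow> b \<in> carrier N \<Longrightarrow> g a b = f a b" "t \<in> carrier (tensor M N)"
  shows "tlift P g t = tlift P f t"
proof -
  have b: "bilin M N P g"
    by (intro bilinI lin_map_cong[OF M bilin_left[OF assms(2)]] lin_map_cong[OF N bilin_right[OF assms(2)]]) (auto simp: assms(3))
  show ?thesis
    by (rule tensor_eqI[OF assms(1) tlift_lin[OF assms(1) b] tlift_lin[OF assms(1,2)] _ assms(4)])
      (simp add: tlift_pure[OF assms(1) b] tlift_pure[OF assms(1,2)] assms(3))
qed

end

text \<open>Covers lifts whose bilinear map itself depends linearly on a parameter. This is what
  makes nested uses of \<open>tlift\<close> linear in the argument of the inner lift and in the
  variables bound outside.\<close>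

lemma tlift_param_lin:
  assumes "vs M" "vs N" "vs P" "vs X" "\<And>x. x \<in> carrier X \<Longrightarrow> bilin M N P (f x)"
    "\<And>a b. a \<in> carrier M \<Longrightarrow> b \<in> carrier N \<Longrightarrow> lin_map X P (\<lambda>x. f x a b)" "t \<in> carrier (tensor M N)"
  shows "lin_map X P (\<lambda>x. tlift P (f x) t)"
proof -
  interpret P: vs P by fact
  interpret X: vs X by fact
  note TL = tlift_lin[OF assms(1,2,3,5)] and TP = tlift_pure[OF assms(1,2,3,5)]
  show ?thesis
  proof (rule lin_mapI)
    fix x y c assume x: "x \<in> carrier X"
    show "tlift P (f x) t \<in> carrier P" using lin_map_closed[OF TL[OF x] assms(7)] .
    show "tlift P (f (c \<odot>\<^bsub>X\<^esub> x)) t = c \<odot>\<^bsub>P\<^esub> tlift P (f x) t"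
      by (rule tensor_eqI[OF assms(1-3) TL[OF X.smult_closed[OF x]] lin_map_scale[OF assms(3) TL[OF x]] _ assms(7)])
        (simp add: TP[OF x] TP[OF X.smult_closed[OF x]] lin_map_smult[OF assms(6)] x)
    assume y: "y \<in> carrier X"
    show "tlift P (f (x \<oplus>\<^bsub>X\<^esub> y)) t = tlift P (f x) t \<oplus>\<^bsub>P\<^esub> tlift P (f y) t"
      by (rule tensor_eqI[OF assms(1-3) TL[OF X.add.m_closed[OF x y]] lin_map_plus[OF assms(3) TL[OF x] TL[OF y]] _ assms(7)])
        (simp add: TP[OF x] TP[OF y] TP[OF X.add.m_closed[OF x y]] lin_map_add[OF assms(6)] x y)
  qed
qed

text \<open>The products of \<open>tensor_alg\<close>, \<open>twist_alg\<close> and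
  \<open>smash\<close> and the diagonal action are all nested lifts of maps in four variables; this
  gives their bilinearity and their values on pure tensors in one place.\<close>

lemma
  assumes "vs M" "vs N" "vs M'" "vs N'" "vs P"
    and r: "\<And>a b. a \<in> carrier M \<Longrightarrow> b \<in> carrier N \<Longrightarrow> bilin M' N' P (f a b)"
    and l: "\<And>a b. a \<in> carrier M' \<Longrightarrow> b \<in> carrier N' \<Longrightarrow> bilin M N P (\<lambda>x y. f x y a b)"
  shows tlift_tlift_bilin: "bilin (tensor M N) (tensor M' N') P (\<lambda>X Y. tlift P (\<lambda>a b. tlift P (f a b) Y) X)"
    and tlift_tlift_pure: "\<And>a b a' b'. a \<in> carrier M \<Longrightarrow> b \<in> carrier N \<Longrightarrow> a' \<in> carrier M' \<Longrightarrow> b' \<in> carrier N' \<Longrightarrow>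
      tlift P (\<lambda>a b. tlift P (f a b) (pure M' N' a' b')) (pure M N a b) = f a b a' b'"
    and tlift_tlift_left: "\<And>a b Y. a \<in> carrier M \<Longrightarrow> b \<in> carrier N \<Longrightarrow> Y \<in> carrier (tensor M' N') \<Longrightarrow>
      tlift P (\<lambda>a b. tlift P (f a b) Y) (pure M N a b) = tlift P (f a b) Y"
proof -
  have inner: "bilin M N P (\<lambda>a b. tlift P (f a b) Y)" if Y: "Y \<in> carrier (tensor M' N')" for Y
  proof (rule bilinI)
    fix b assume b: "b \<in> carrier N"
    show "lin_map M P (\<lambda>a. tlift P (f a b) Y)"
      by (rule tlift_param_lin[OF assms(3,4,5,1) r[OF _ b] bilin_left[OF l b] Y])
  next
    fix a assume a: "a \<in> carrier M"
    show "lin_map N P (\<lambda>b. tlift P (f a b) Y)"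
      by (rule tlift_param_lin[OF assms(3,4,5,2) r[OF a] bilin_right[OF l a] Y])
  qed
  show "bilin (tensor M N) (tensor M' N') P (\<lambda>X Y. tlift P (\<lambda>a b. tlift P (f a b) Y) X)"
  proof (rule bilinI)
    show "lin_map (tensor M N) P (\<lambda>X. tlift P (\<lambda>a b. tlift P (f a b) Y) X)"
      if "Y \<in> carrier (tensor M' N')" for Y
      by (rule tlift_lin[OF assms(1,2,5) inner[OF that]])
    show "lin_map (tensor M' N') P (\<lambda>Y. tlift P (\<lambda>a b. tlift P (f a b) Y) X)"
      if "X \<in> carrier (tensor M N)" for X
      by (rule tlift_param_lin[OF assms(1,2,5) tensor_vs[OF assms(3,4)] inner tlift_lin[OF assms(3,4,5) r] that])
  qed
  show left: "tlift P (\<lambda>a b. tlift P (f a b) Y) (pure M N a b) = tlift P (f a b) Y"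
    if "a \<in> carrier M" "b \<in> carrier N" "Y \<in> carrier (tensor M' N')" for a b Y
    by (rule tlift_pure[OF assms(1,2,5) inner[OF that(3)] that(1,2)])
  show "tlift P (\<lambda>a b. tlift P (f a b) (pure M' N' a' b')) (pure M N a b) = f a b a' b'"
    if "a \<in> carrier M" "b \<in> carrier N" "a' \<in> carrier M'" "b' \<in> carrier N'" for a b a' b'
    using that by (simp add: left pure_closed[OF assms(3,4)] tlift_pure[OF assms(3,4,5) r])
qed

lemma bilin_add_left: "bilin M N P f \<Longrightarrow> x \<in> carrier M \<Longrightarrow> y \<in> carrier M \<Longrightarrow> b \<in> carrier N \<Longrightarrow>
    f (x \<oplus>\<^bsub>M\<^esub> y) b = f x b \<oplus>\<^bsub>P\<^esub> f y b"
  and bilin_smult_left: "bilin M N P f \<Longrightarrow> x \<in> carrier M \<Longrightarrow> b \<in> carrier N \<Longrightarrow>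
    f (c \<odot>\<^bsub>M\<^esub> x) b = c \<odot>\<^bsub>P\<^esub> f x b"
  by (simp_all add: bilin_def lin_map_def)

lemma bilin_add_right: "bilin M N P f \<Longrightarrow> a \<in> carrier M \<Longrightarrow> x \<in> carrier N \<Longrightarrow> y \<in> carrier N \<Longrightarrow>
    f a (x \<oplus>\<^bsub>N\<^esub> y) = f a x \<oplus>\<^bsub>P\<^esub> f a y"
  and bilin_smult_right: "bilin M N P f \<Longrightarrow> a \<in> carrier M \<Longrightarrow> x \<in> carrier N \<Longrightarrow>
    f a (c \<odot>\<^bsub>N\<^esub> x) = c \<odot>\<^bsub>P\<^esub> f a x"
  by (simp_all add: bilin_def lin_map_def)

lemma pure_bilin: "vs M \<Longrightarrow> vs N \<Longrightarrow> bilin M N (tensor M N) (pure M N)"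
  by (simp add: bilin_def pure_lin_left pure_lin_right)

lemmas pure_add_left = bilin_add_left[OF pure_bilin]
  and pure_add_right = bilin_add_right[OF pure_bilin]
  and pure_smult_left = bilin_smult_left[OF pure_bilin]
  and pure_smult_right = bilin_smult_right[OF pure_bilin]

text \<open>Lets records with additional or modified fields, such as \<open>Uq\<close> and the
  twisted algebra, be replaced by the underlying vector spaces inside a tensor product.\<close>

lemma tensor_cong:
  assumes "carrier M' = carrier M" "add M' = add M" "module.smult M' = module.smult M"
    "carrier N' = carrier N" "add N' = add N" "module.smult N' = module.smult N"
  shows "tensor M' N' = tensor M N" "pure M' N' = pure M N"
proof -
  have "tensor_rels M' N' = tensor_rels M N" unfolding tensor_rels_def assms ..
  then show "tensor M' N' = tensor M N" "pure M' N' = pure M N"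
    unfolding tensor_def pure_def[abs_def] assms by simp_all
qed

subsection \<open>Tensor products of algebras\<close>

context
  fixes A :: "('k::field, 'a, 'm) module_scheme" and B :: "('k, 'b, 'n) module_scheme"
  assumes A: "alg A" and B: "alg B"
begin

interpretation A: alg A by (rule A)
interpretation B: alg B by (rule B)
interpretation T: vs "tensor A B" by (rule tensor_vs[OF A.vs_axioms B.vs_axioms])

private lemma AB: "vs A" "vs B" by (rule A.vs_axioms B.vs_axioms)+

private lemmas tensor_ind [consumes 1, case_names pure add] = tensor_induct[OF AB]

lemma tensor_alg_simps [simp]: "carrier (tensor_alg A B) = carrier (tensor A B)"
  "\<zero>\<^bsub>tensor_alg A B\<^esub> = \<zero>\<^bsub>tensor A B\<^esub>" "\<one>\<^bsub>tensor_alg A B\<^esub> = pure A B \<one>\<^bsub>A\<^esub> \<one>\<^bsub>B\<^esub>"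
  "x \<oplus>\<^bsub>tensor_alg A B\<^esub> y = x \<oplus>\<^bsub>tensor A B\<^esub> y" "c \<odot>\<^bsub>tensor_alg A B\<^esub> x = c \<odot>\<^bsub>tensor A B\<^esub> x"
  by (simp_all add: tensor_alg_def)

private lemma mult_eq: "X \<otimes>\<^bsub>tensor_alg A B\<^esub> Y = tlift (tensor A B) (\<lambda>a b. tlift (tensor A B) (\<lambda>a' b'.
    pure A B (a \<otimes>\<^bsub>A\<^esub> a') (b \<otimes>\<^bsub>B\<^esub> b')) Y) X"
  by (simp add: tensor_alg_def)

private lemma bl: "a \<in> carrier A \<Longrightarrow> b \<in> carrier B \<Longrightarrow>
    bilin A B (tensor A B) (\<lambda>a' b'. pure A B (a \<otimes>\<^bsub>A\<^esub> a') (b \<otimes>\<^bsub>B\<^esub> b'))"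
  and br: "a' \<in> carrier A \<Longrightarrow> b' \<in> carrier B \<Longrightarrow>
    bilin A B (tensor A B) (\<lambda>a b. pure A B (a \<otimes>\<^bsub>A\<^esub> a') (b \<otimes>\<^bsub>B\<^esub> b'))"
  by (auto intro!: bilinI lin_map_comp[OF A.mult_left_lin pure_lin_left] lin_map_comp[OF B.mult_left_lin pure_lin_right]
      lin_map_comp[OF A.mult_right_lin pure_lin_left] lin_map_comp[OF B.mult_right_lin pure_lin_right] AB)

lemma tensor_alg_mult_pure: "a \<in> carrier A \<Longrightarrow> b \<in> carrier B \<Longrightarrow> a' \<in> carrier A \<Longrightarrow> b' \<in> carrier B \<Longrightarrow>
    pure A B a b \<otimes>\<^bsub>tensor_alg A B\<^esub> pure A B a' b' = pure A B (a \<otimes>\<^bsub>A\<^esub> a') (b \<otimes>\<^bsub>B\<^esub> b')"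
  unfolding mult_eq by (rule tlift_tlift_pure[OF AB AB T.vs_axioms bl br])

lemma tensor_alg_mult_bilin: "bilin (tensor A B) (tensor A B) (tensor A B) (\<lambda>X Y. X \<otimes>\<^bsub>tensor_alg A B\<^esub> Y)"
  unfolding mult_eq by (rule tlift_tlift_bilin[OF AB AB T.vs_axioms bl br])

private lemmas mult_add = bilin_add_left[OF tensor_alg_mult_bilin] bilin_add_right[OF tensor_alg_mult_bilin]
private lemmas mult_closed = bilin_closed[OF tensor_alg_mult_bilin]

private lemma mult_assoc:
  assumes "X \<in> carrier (tensor A B)" "Y \<in> carrier (tensor A B)" "Z \<in> carrier (tensor A B)"
  shows "X \<otimes>\<^bsub>tensor_alg A B\<^esub> Y \<otimes>\<^bsub>tensor_alg A B\<^esub> Z = X \<otimes>\<^bsub>tensor_alg A B\<^esub> (Y \<otimes>\<^bsub>tensor_alg A B\<^esub> Z)"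
  using assms(1)
proof (induction rule: tensor_ind)
  case (pure a b)
  note ab = this
  show ?case using assms(2)
  proof (induction rule: tensor_ind)
    case (pure a' b')
    note ab' = this
    show ?case using assms(3)
    proof (induction rule: tensor_ind)
      case (pure a'' b'')
      then show ?case using ab ab'
        by (simp add: tensor_alg_mult_pure A.m_assoc B.m_assoc)
    qed (use ab ab' in \<open>simp add: mult_add mult_closed pure_closed[OF AB]\<close>)
  qed (use ab assms in \<open>simp add: mult_add mult_closed pure_closed[OF AB]\<close>)
qed (use assms in \<open>simp add: mult_add mult_closed\<close>)

lemma tensor_alg_alg: "alg (tensor_alg A B)"
proof (rule algI)
  show "vs (tensor_alg A B)"
    by (rule vs_cong[OF T.vs_axioms]) (simp_all add: tensor_alg_def)
  show "lin_map (tensor_alg A B) (tensor_alg A B) (\<lambda>x. x \<otimes>\<^bsub>tensor_alg A B\<^esub> y)"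
    if "y \<in> carrier (tensor_alg A B)" for y
    using bilin_left[OF tensor_alg_mult_bilin, of y] that by (simp add: lin_map_def)
  show "lin_map (tensor_alg A B) (tensor_alg A B) (\<lambda>y. x \<otimes>\<^bsub>tensor_alg A B\<^esub> y)"
    if "x \<in> carrier (tensor_alg A B)" for x
    using bilin_right[OF tensor_alg_mult_bilin, of x] that by (simp add: lin_map_def)
  fix x assume "x \<in> carrier (tensor_alg A B)"
  then have x: "x \<in> carrier (tensor A B)" by simp
  then show "\<one>\<^bsub>tensor_alg A B\<^esub> \<otimes>\<^bsub>tensor_alg A B\<^esub> x = x"
    by (induction rule: tensor_ind)
      (simp_all add: tensor_alg_mult_pure mult_add pure_closed[OF AB])
  from x show "x \<otimes>\<^bsub>tensor_alg A B\<^esub> \<one>\<^bsub>tensor_alg A B\<^esub> = x"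
    by (induction rule: tensor_ind)
      (simp_all add: tensor_alg_mult_pure mult_add pure_closed[OF AB])
qed (simp_all add: mult_assoc mult_closed pure_closed[OF AB])

end

section \<open>The quantum group\<close>

lemma Uq_simps [simp]: "carrier (Uq q) = carrier (uq_alg q)" "x \<otimes>\<^bsub>Uq q\<^esub> y = x \<otimes>\<^bsub>uq_alg q\<^esub> y"
  "x \<oplus>\<^bsub>Uq q\<^esub> y = x \<oplus>\<^bsub>uq_alg q\<^esub> y" "\<one>\<^bsub>Uq q\<^esub> = \<one>\<^bsub>uq_alg q\<^esub>" "\<zero>\<^bsub>Uq q\<^esub> = \<zero>\<^bsub>uq_alg q\<^esub>"
  "c \<odot>\<^bsub>Uq q\<^esub> x = c \<odot>\<^bsub>uq_alg q\<^esub> x"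
  by (simp_all add: Uq_def module.extend_def hopf.fields_def)

lemma Uq_comult: "comult (Uq q) = descend (free_lift (tensor_alg (uq_alg q) (uq_alg q)) (uq_comult_gen q))"
  and Uq_counit: "counit (Uq q) = descend (free_lift ground uq_counit_gen)"
  by (simp_all add: Uq_def module.extend_def hopf.fields_def)

lemma tensor_Uq: "tensor M (Uq q) = tensor M (uq_alg q)" "pure M (Uq q) = pure M (uq_alg q)"
  by (rule tensor_cong; simp add: Uq_def module.extend_def hopf.fields_def)+

text \<open>Bookkeeping for \<Delta>(E)\<Delta>(F) - \<Delta>(F)\<Delta>(E): \<open>a\<close>,
  \<open>c\<close>, \<open>d\<close>, \<open>e\<close> are the terms common to both products, while
  \<open>x\<close> and \<open>y\<close> are the two multiples of K tensor K^{-1}, which have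
  opposite coefficients.\<close>

lemma (in alg) commutator_sum:
  assumes "a \<in> carrier A" "b \<in> carrier A" "c \<in> carrier A" "d \<in> carrier A" "e \<in> carrier A"
    "f \<in> carrier A" "x \<in> carrier A" "y \<in> carrier A" "x \<oplus> y = \<zero>"
  shows "(a \<oplus> x \<oplus> b) \<oplus> c \<oplus> (d \<oplus> (e \<oplus> f \<oplus> y)) \<ominus> (a \<oplus> d \<oplus> (c \<oplus> e)) = f \<oplus> b"
proof -
  have "(a \<oplus> x \<oplus> b) \<oplus> c \<oplus> (d \<oplus> (e \<oplus> f \<oplus> y)) = (f \<oplus> b) \<oplus> (a \<oplus> d \<oplus> (c \<oplus> e)) \<oplus> (x \<oplus> y)"
    using assms(1-8) by (simp add: a_ac)
  then show ?thesis using assms by (simp add: a_minus_def a_assoc r_neg)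
qed

text \<open>All that most of the development needs of q: the second condition makes the denominators
  1 - q^2 nonzero. The order of q returns only with the powers of K.\<close>

locale quantum =
  fixes q :: "'k::field"
  assumes q_nonzero: "q \<noteq> 0" and q2: "q\<^sup>2 \<noteq> 1"
begin

abbreviation "H \<equiv> uq_alg q"
abbreviation "k1 \<equiv> uqg q gK"
abbreviation "k' \<equiv> uqg q gKinv"
abbreviation "e \<equiv> uqg q gE"
abbreviation "f \<equiv> uqg q gF"

sublocale H: alg H
  unfolding uq_alg_def by (rule presented_alg)

lemma uqg_closed [simp]: "uqg q g \<in> carrier H"
  by (simp add: uqg_def uq_alg_def)

lemma Uq_alg: "alg (Uq q)"
proof (rule alg_image[OF H.alg_axioms])
  show "vs (Uq q)"
    by (rule vs_cong[OF H.vs_axioms]) (simp_all add: Uq_def module.extend_def hopf.fields_def)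
  show "alg_hom H (Uq q) (\<lambda>x. x)" by (simp add: alg_hom_def lin_map_def)
qed simp

lemma H_induct [consumes 1, case_names one gen add smult mult]:
  assumes "X \<in> carrier H" "P \<one>\<^bsub>H\<^esub>" "\<And>g. P (uqg q g)"
    "\<And>x y. x \<in> carrier H \<Longrightarrow> y \<in> carrier H \<Longrightarrow> P x \<Longrightarrow> P y \<Longrightarrow> P (x \<oplus>\<^bsub>H\<^esub> y)"
    "\<And>c x. x \<in> carrier H \<Longrightarrow> P x \<Longrightarrow> P (c \<odot>\<^bsub>H\<^esub> x)"
    "\<And>x y. x \<in> carrier H \<Longrightarrow> y \<in> carrier H \<Longrightarrow> P x \<Longrightarrow> P y \<Longrightarrow> P (x \<otimes>\<^bsub>H\<^esub> y)"
  shows "P X"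
  using assms unfolding uq_alg_def uqg_def by (rule presented_induct)

lemma uq_relations:
  "k1 \<otimes>\<^bsub>H\<^esub> k' = \<one>\<^bsub>H\<^esub>" "k' \<otimes>\<^bsub>H\<^esub> k1 = \<one>\<^bsub>H\<^esub>"
  "e \<otimes>\<^bsub>H\<^esub> f = f \<otimes>\<^bsub>H\<^esub> e \<oplus>\<^bsub>H\<^esub> (1 / (q - inverse q)) \<odot>\<^bsub>H\<^esub> k1 \<oplus>\<^bsub>H\<^esub> (- (1 / (q - inverse q))) \<odot>\<^bsub>H\<^esub> k'"
  "k1 \<otimes>\<^bsub>H\<^esub> e \<otimes>\<^bsub>H\<^esub> k' = q\<^sup>2 \<odot>\<^bsub>H\<^esub> e" "k1 \<otimes>\<^bsub>H\<^esub> f \<otimes>\<^bsub>H\<^esub> k' = inverse (q\<^sup>2) \<odot>\<^bsub>H\<^esub> f"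
proof -
  have eq: "cls (uq_rels q) x = cls (uq_rels q) y" if "x - y \<in> uq_rels q" for x y
    using cls_rel[OF that] cls_eq_iff[of "uq_rels q" "x - y" 0] by (simp add: cls_simps(5) cls_eq_iff)
  note d = uqg_def uq_alg_def cls_simps[symmetric]
  show "k1 \<otimes>\<^bsub>H\<^esub> k' = \<one>\<^bsub>H\<^esub>" "k' \<otimes>\<^bsub>H\<^esub> k1 = \<one>\<^bsub>H\<^esub>"
   "k1 \<otimes>\<^bsub>H\<^esub> e \<otimes>\<^bsub>H\<^esub> k' = q\<^sup>2 \<odot>\<^bsub>H\<^esub> e" "k1 \<otimes>\<^bsub>H\<^esub> f \<otimes>\<^bsub>H\<^esub> k' = inverse (q\<^sup>2) \<odot>\<^bsub>H\<^esub> f"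
    unfolding d by (rule eq; simp add: uq_rels_def)+
  show "e \<otimes>\<^bsub>H\<^esub> f = f \<otimes>\<^bsub>H\<^esub> e \<oplus>\<^bsub>H\<^esub> (1 / (q - inverse q)) \<odot>\<^bsub>H\<^esub> k1 \<oplus>\<^bsub>H\<^esub> (- (1 / (q - inverse q))) \<odot>\<^bsub>H\<^esub> k'"
    unfolding d by (rule eq) (simp add: uq_rels_def scale_minus_one algebra_simps)
qed

text \<open>The conjugation relations multiplied by K on the right or by K^{-1} on the left, which
  turns them into commutation up to a power of q.\<close>

lemma uq_commute:
  "k1 \<otimes>\<^bsub>H\<^esub> e = q\<^sup>2 \<odot>\<^bsub>H\<^esub> (e \<otimes>\<^bsub>H\<^esub> k1)" "e \<otimes>\<^bsub>H\<^esub> k' = q\<^sup>2 \<odot>\<^bsub>H\<^esub> (k' \<otimes>\<^bsub>H\<^esub> e)"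
  "k1 \<otimes>\<^bsub>H\<^esub> f = inverse (q\<^sup>2) \<odot>\<^bsub>H\<^esub> (f \<otimes>\<^bsub>H\<^esub> k1)" "f \<otimes>\<^bsub>H\<^esub> k' = inverse (q\<^sup>2) \<odot>\<^bsub>H\<^esub> (k' \<otimes>\<^bsub>H\<^esub> f)"
proof -
  have "k1 \<otimes>\<^bsub>H\<^esub> x = k1 \<otimes>\<^bsub>H\<^esub> x \<otimes>\<^bsub>H\<^esub> k' \<otimes>\<^bsub>H\<^esub> k1" "x \<otimes>\<^bsub>H\<^esub> k' = k' \<otimes>\<^bsub>H\<^esub> (k1 \<otimes>\<^bsub>H\<^esub> x \<otimes>\<^bsub>H\<^esub> k')" if "x \<in> carrier H" for x
  proof -
    show "k1 \<otimes>\<^bsub>H\<^esub> x = k1 \<otimes>\<^bsub>H\<^esub> x \<otimes>\<^bsub>H\<^esub> k' \<otimes>\<^bsub>H\<^esub> k1" using that by (simp add: H.m_assoc uq_relations)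
    have "x \<otimes>\<^bsub>H\<^esub> k' = (k' \<otimes>\<^bsub>H\<^esub> k1) \<otimes>\<^bsub>H\<^esub> x \<otimes>\<^bsub>H\<^esub> k'" using that by (simp add: uq_relations)
    then show "x \<otimes>\<^bsub>H\<^esub> k' = k' \<otimes>\<^bsub>H\<^esub> (k1 \<otimes>\<^bsub>H\<^esub> x \<otimes>\<^bsub>H\<^esub> k')" using that by (simp add: H.m_assoc)
  qed
  from this[of e] this[of f] show
    "k1 \<otimes>\<^bsub>H\<^esub> e = q\<^sup>2 \<odot>\<^bsub>H\<^esub> (e \<otimes>\<^bsub>H\<^esub> k1)" "e \<otimes>\<^bsub>H\<^esub> k' = q\<^sup>2 \<odot>\<^bsub>H\<^esub> (k' \<otimes>\<^bsub>H\<^esub> e)"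
    "k1 \<otimes>\<^bsub>H\<^esub> f = inverse (q\<^sup>2) \<odot>\<^bsub>H\<^esub> (f \<otimes>\<^bsub>H\<^esub> k1)" "f \<otimes>\<^bsub>H\<^esub> k' = inverse (q\<^sup>2) \<odot>\<^bsub>H\<^esub> (k' \<otimes>\<^bsub>H\<^esub> f)"
    unfolding uq_relations by (simp_all add: H.smult_mult_left H.smult_mult_right)
qed

abbreviation "HH \<equiv> tensor H H"
abbreviation "TA \<equiv> tensor_alg H H"

sublocale HH: vs HH by (rule tensor_vs[OF H.vs_axioms H.vs_axioms])
sublocale TA: alg TA by (rule tensor_alg_alg[OF H.alg_axioms H.alg_axioms])

lemmas hpure_closed [simp] = pure_closed[OF H.vs_axioms H.vs_axioms]
lemmas TA_simps [simp] = tensor_alg_simps[OF H.alg_axioms H.alg_axioms]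
lemmas TA_mult_pure = tensor_alg_mult_pure[OF H.alg_axioms H.alg_axioms]
lemmas hpure_simps = pure_add_left[OF H.vs_axioms H.vs_axioms] pure_add_right[OF H.vs_axioms H.vs_axioms]
  pure_smult_left[OF H.vs_axioms H.vs_axioms] pure_smult_right[OF H.vs_axioms H.vs_axioms]

lemma uq_comult_gen_closed: "uq_comult_gen q g \<in> carrier TA"
  by (cases g) simp_all

lemma comult_rel:
  assumes "r \<in> uq_rels q" shows "free_lift TA (uq_comult_gen q) r = \<zero>\<^bsub>TA\<^esub>"
proof -
  note hom = free_lift_hom[where f = "uq_comult_gen q", OF TA.alg_axioms uq_comult_gen_closed]
  let ?L = "free_lift TA (uq_comult_gen q)"
  have m: "?L (x * y) = ?L x \<otimes>\<^bsub>TA\<^esub> ?L y" and o: "?L 1 = \<one>\<^bsub>TA\<^esub>" and s: "?L (scale c x) = c \<odot>\<^bsub>HH\<^esub> ?L x"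
    and g: "?L (gen g) = uq_comult_gen q g" and c: "?L x \<in> carrier HH" for x y c g
    using alg_hom_mult[OF hom, of x y] alg_hom_one[OF hom] lin_map_smult[OF alg_hom_lin[OF hom], of x c]
      free_lift_gen[where f = "uq_comult_gen q", OF TA.alg_axioms uq_comult_gen_closed, of g]
      lin_map_closed[OF alg_hom_lin[OF hom], of x]
    by simp_all
  have d: "?L (x - y) = \<zero>\<^bsub>TA\<^esub> \<longleftrightarrow> ?L x = ?L y" for x y
    using lin_map_minus[OF free_alg_vs TA.vs_axioms alg_hom_lin[OF hom], of x y] TA.minus_zero_iff[of "?L x" "?L y"] c by simp
  have mi: "?L (x - y) = ?L x \<ominus>\<^bsub>TA\<^esub> ?L y" for x y
    using lin_map_minus[OF free_alg_vs TA.vs_axioms alg_hom_lin[OF hom], of x y] by simp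
  note dist = TA.l_distr[simplified] TA.r_distr[simplified]
  note simps = dist TA_mult_pure hpure_simps H.m_assoc uq_relations
  let ?c = "1 / (q - inverse q)"
  \<comment> \<open>Expanding gives the mixed term KF tensor EK^{-1}. Its factors contribute q^{-2}
    and q^2, which cancel, so it equals the mixed term FK tensor K^{-1}E of
    \<Delta>(F)\<Delta>(E).\<close>
  have E: "?L (gen gE * gen gF) = (pure H H (f \<otimes>\<^bsub>H\<^esub> e) k' \<oplus>\<^bsub>HH\<^esub> ?c \<odot>\<^bsub>HH\<^esub> pure H H k1 k' \<oplus>\<^bsub>HH\<^esub> (- ?c) \<odot>\<^bsub>HH\<^esub> pure H H k' k')
     \<oplus>\<^bsub>HH\<^esub> pure H H e f \<oplus>\<^bsub>HH\<^esub> (pure H H (f \<otimes>\<^bsub>H\<^esub> k1) (k' \<otimes>\<^bsub>H\<^esub> e)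
     \<oplus>\<^bsub>HH\<^esub> (pure H H k1 (f \<otimes>\<^bsub>H\<^esub> e) \<oplus>\<^bsub>HH\<^esub> ?c \<odot>\<^bsub>HH\<^esub> pure H H k1 k1 \<oplus>\<^bsub>HH\<^esub> (- ?c) \<odot>\<^bsub>HH\<^esub> pure H H k1 k'))"
    using q_nonzero by (simp add: m g dist TA_mult_pure uq_relations(3) uq_commute hpure_simps HH.smult_smult HH.a_ac)
  have F: "?L (gen gF * gen gE) = pure H H (f \<otimes>\<^bsub>H\<^esub> e) k' \<oplus>\<^bsub>HH\<^esub> pure H H (f \<otimes>\<^bsub>H\<^esub> k1) (k' \<otimes>\<^bsub>H\<^esub> e)
     \<oplus>\<^bsub>HH\<^esub> (pure H H e f \<oplus>\<^bsub>HH\<^esub> pure H H k1 (f \<otimes>\<^bsub>H\<^esub> e))"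
    by (simp add: m g dist TA_mult_pure HH.a_ac)
  have EF: "?L (gen gE * gen gF) \<ominus>\<^bsub>TA\<^esub> ?L (gen gF * gen gE) = ?c \<odot>\<^bsub>HH\<^esub> pure H H k1 k1 \<oplus>\<^bsub>HH\<^esub> (- ?c) \<odot>\<^bsub>HH\<^esub> pure H H k' k'"
    unfolding E F by (rule TA.commutator_sum[simplified]) (simp_all add: HH.smult_left[symmetric])
  have "?L (gen gE * gen gF - gen gF * gen gE) = ?L (scale ?c (gen gK - gen gKinv))"
    unfolding mi EF s by (simp add: g TA.minus_eq_smult HH.smult_right HH.smult_smult)
  then have "?L (gen gE * gen gF - gen gF * gen gE - scale ?c (gen gK - gen gKinv)) = \<zero>\<^bsub>TA\<^esub>"
    by (simp only: d)
  moreover have "?L (gen gK * gen gKinv - 1) = \<zero>\<^bsub>TA\<^esub>" "?L (gen gKinv * gen gK - 1) = \<zero>\<^bsub>TA\<^esub>"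
    "?L (gen gK * gen gE * gen gKinv - scale (q\<^sup>2) (gen gE)) = \<zero>\<^bsub>TA\<^esub>"
    "?L (gen gK * gen gF * gen gKinv - scale (inverse (q\<^sup>2)) (gen gF)) = \<zero>\<^bsub>TA\<^esub>"
    unfolding d by (simp_all add: m o s g dist TA_mult_pure hpure_simps uq_relations H.m_assoc HH.smult_right)
  ultimately show ?thesis using assms unfolding uq_rels_def by blast
qed

abbreviation "\<Delta> \<equiv> comult (Uq q)"

lemma comult_hom: "alg_hom H TA \<Delta>"
  unfolding Uq_comult
  using presented_lift_hom[of TA "uq_comult_gen q" "uq_rels q", OF TA.alg_axioms uq_comult_gen_closed comult_rel]
  by (simp add: uq_alg_def)

lemma comult_gen: "\<Delta> (uqg q g) = uq_comult_gen q g"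
  unfolding Uq_comult uqg_def
  by (rule presented_lift_gen[of TA "uq_comult_gen q" "uq_rels q", OF TA.alg_axioms uq_comult_gen_closed comult_rel])

lemma comult_lin: "lin_map H HH \<Delta>"
  using alg_hom_lin[OF comult_hom] by (simp add: lin_map_def)

lemma comult_closed [simp]: "h \<in> carrier H \<Longrightarrow> \<Delta> h \<in> carrier HH"
  by (rule lin_map_closed[OF comult_lin])

lemma counit_rel: "r \<in> uq_rels q \<Longrightarrow> free_lift ground uq_counit_gen r = \<zero>\<^bsub>ground\<^esub>"
proof -
  note hom = free_lift_hom[where f = uq_counit_gen, OF ground_alg, simplified]
  let ?L = "free_lift ground (uq_counit_gen :: _ \<Rightarrow> 'k)"
  have m: "?L (x * y) = ?L x * ?L y" and o: "?L 1 = 1" and s: "?L (scale c x) = c * ?L x"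
    and g: "?L (gen g) = uq_counit_gen g" for x y c g
    using alg_hom_mult[OF hom, of x y] alg_hom_one[OF hom] lin_map_smult[OF alg_hom_lin[OF hom], of x c]
      free_lift_gen[where f = "uq_counit_gen", OF ground_alg, of g]
    by simp_all
  interpret G: vs "ground :: ('k, 'k) module" by (rule ground_vs)
  have d: "?L (x - y) = ?L x - ?L y" for x y
    using lin_map_minus[OF free_alg_vs ground_vs alg_hom_lin[OF hom], of x y] by (simp add: G.minus_eq_smult)
  show "r \<in> uq_rels q \<Longrightarrow> ?L r = \<zero>\<^bsub>ground\<^esub>" unfolding uq_rels_def by (auto simp: m o s g d)
qed

abbreviation "\<epsilon> \<equiv> counit (Uq q)"

lemma counit_gen: "\<epsilon> (uqg q g) = uq_counit_gen g"
  unfolding Uq_counit uqg_def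
  by (rule presented_lift_gen[of ground "uq_counit_gen" "uq_rels q", OF ground_alg _ counit_rel]) simp_all

end

lemma bilin_comp: "bilin M N P g \<Longrightarrow> lin_map P Q h \<Longrightarrow> bilin M N Q (\<lambda>a b. h (g a b))"
  by (auto simp: bilin_def intro: lin_map_comp)

section \<open>Smash products with the quantum group\<close>

locale uq_module = quantum q + R: alg R
  for q :: "'k::field" and R :: "('k, 'a, 'm) module_scheme" and act :: "'k uq \<Rightarrow> 'a \<Rightarrow> 'a" +
  assumes module_algebra: "module_algebra (Uq q) R act"
begin

lemma act_lin: "h \<in> carrier H \<Longrightarrow> lin_map R R (act h)"
  and act_lin_left: "a \<in> carrier R \<Longrightarrow> lin_map H R (\<lambda>h. act h a)"
  and act_one: "a \<in> carrier R \<Longrightarrow> act \<one>\<^bsub>H\<^esub> a = a"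
  and act_mult: "g \<in> carrier H \<Longrightarrow> h \<in> carrier H \<Longrightarrow> a \<in> carrier R \<Longrightarrow> act (g \<otimes>\<^bsub>H\<^esub> h) a = act g (act h a)"
  and act_counit: "h \<in> carrier H \<Longrightarrow> act h \<one>\<^bsub>R\<^esub> = \<epsilon> h \<odot>\<^bsub>R\<^esub> \<one>\<^bsub>R\<^esub>"
  and act_prod: "h \<in> carrier H \<Longrightarrow> a \<in> carrier R \<Longrightarrow> b \<in> carrier R \<Longrightarrow>
    act h (a \<otimes>\<^bsub>R\<^esub> b) = tlift R (\<lambda>h1 h2. act h1 a \<otimes>\<^bsub>R\<^esub> act h2 b) (\<Delta> h)"
  using module_algebra unfolding module_algebra_def by (simp_all add: lin_map_def)

lemma act_bilin: "bilin H R R act"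
  by (simp add: bilin_def act_lin act_lin_left)

lemmas act_closed [simp] = bilin_closed[OF act_bilin]

lemma act_prod_bilin:
  assumes "a \<in> carrier R" "b \<in> carrier R" shows "bilin H H R (\<lambda>h1 h2. act h1 a \<otimes>\<^bsub>R\<^esub> act h2 b)"
  using assms
  by (intro bilinI lin_map_comp[OF act_lin_left R.mult_right_lin] lin_map_comp[OF act_lin_left R.mult_left_lin]) auto

lemma act_gen_prod:
  assumes "a \<in> carrier R" "b \<in> carrier R"
  shows "act k1 (a \<otimes>\<^bsub>R\<^esub> b) = act k1 a \<otimes>\<^bsub>R\<^esub> act k1 b"
    "act k' (a \<otimes>\<^bsub>R\<^esub> b) = act k' a \<otimes>\<^bsub>R\<^esub> act k' b"
    "act e (a \<otimes>\<^bsub>R\<^esub> b) = act e a \<otimes>\<^bsub>R\<^esub> b \<oplus>\<^bsub>R\<^esub> act k1 a \<otimes>\<^bsub>R\<^esub> act e b"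
    "act f (a \<otimes>\<^bsub>R\<^esub> b) = act f a \<otimes>\<^bsub>R\<^esub> act k' b \<oplus>\<^bsub>R\<^esub> a \<otimes>\<^bsub>R\<^esub> act f b"
proof -
  note bl = act_prod_bilin[OF assms]
  note t = tlift_pure[OF H.vs_axioms H.vs_axioms R.vs_axioms bl]
    lin_map_add[OF tlift_lin[OF H.vs_axioms H.vs_axioms R.vs_axioms bl]]
  show "act k1 (a \<otimes>\<^bsub>R\<^esub> b) = act k1 a \<otimes>\<^bsub>R\<^esub> act k1 b"
    "act k' (a \<otimes>\<^bsub>R\<^esub> b) = act k' a \<otimes>\<^bsub>R\<^esub> act k' b"
    "act e (a \<otimes>\<^bsub>R\<^esub> b) = act e a \<otimes>\<^bsub>R\<^esub> b \<oplus>\<^bsub>R\<^esub> act k1 a \<otimes>\<^bsub>R\<^esub> act e b"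
    "act f (a \<otimes>\<^bsub>R\<^esub> b) = act f a \<otimes>\<^bsub>R\<^esub> act k' b \<oplus>\<^bsub>R\<^esub> a \<otimes>\<^bsub>R\<^esub> act f b"
    using assms by (simp_all add: act_prod comult_gen t act_one)
qed

lemma act_gen_unit: "act k1 \<one>\<^bsub>R\<^esub> = \<one>\<^bsub>R\<^esub>" "act k' \<one>\<^bsub>R\<^esub> = \<one>\<^bsub>R\<^esub>" "act e \<one>\<^bsub>R\<^esub> = \<zero>\<^bsub>R\<^esub>" "act f \<one>\<^bsub>R\<^esub> = \<zero>\<^bsub>R\<^esub>"
  by (simp_all add: act_counit counit_gen)

section \<open>Left multiplication operators on R tensor H and associativity of the smash
  product\<close>

abbreviation "RH \<equiv> tensor R H"
abbreviation "S \<equiv> smash R (Uq q) act"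

sublocale RH: vs RH by (rule tensor_vs[OF R.vs_axioms H.vs_axioms])

lemmas rpure_closed [simp] = pure_closed[OF R.vs_axioms H.vs_axioms]
lemmas RH_induct [consumes 1, case_names pure add] = tensor_induct[OF R.vs_axioms H.vs_axioms]
lemmas rpure_lin = pure_lin_left[OF R.vs_axioms H.vs_axioms] pure_lin_right[OF R.vs_axioms H.vs_axioms]

lemma rpure_zero: "h \<in> carrier H \<Longrightarrow> pure R H \<zero>\<^bsub>R\<^esub> h = \<zero>\<^bsub>RH\<^esub>"
  using lin_map_zero[OF R.vs_axioms RH.vs_axioms rpure_lin(1)] .

text \<open>Left multiplication by a tensor h in the smash product splits as \<open>rop a\<close>
  after \<open>hop (\<Delta> h)\<close>, where H tensor H acts factorwise on R tensor H. Allowing an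
  arbitrary tensor \<open>t\<close> lets multiplicativity of \<Delta> become the module law
  \<open>hact_mult\<close>.\<close>

definition "hop t Y = tlift RH (\<lambda>b g. tlift RH (\<lambda>h1 h2. pure R H (act h1 b) (h2 \<otimes>\<^bsub>H\<^esub> g)) t) Y"
definition "rop a Y = tlift RH (\<lambda>b g. pure R H (a \<otimes>\<^bsub>R\<^esub> b) g) Y"

lemma hop_bilin_H: "b \<in> carrier R \<Longrightarrow> g \<in> carrier H \<Longrightarrow> bilin H H RH (\<lambda>h1 h2. pure R H (act h1 b) (h2 \<otimes>\<^bsub>H\<^esub> g))"
  and hop_bilin_R: "h1 \<in> carrier H \<Longrightarrow> h2 \<in> carrier H \<Longrightarrow> bilin R H RH (\<lambda>b g. pure R H (act h1 b) (h2 \<otimes>\<^bsub>H\<^esub> g))"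
  by (auto intro!: bilinI lin_map_comp[OF act_lin_left rpure_lin(1)] lin_map_comp[OF H.mult_right_lin rpure_lin(2)]
      lin_map_comp[OF act_lin rpure_lin(1)] lin_map_comp[OF H.mult_left_lin rpure_lin(2)])

lemmas hop_tlift = tlift_tlift_bilin[OF R.vs_axioms H.vs_axioms H.vs_axioms H.vs_axioms RH.vs_axioms hop_bilin_H hop_bilin_R, folded hop_def]
  tlift_tlift_pure[OF R.vs_axioms H.vs_axioms H.vs_axioms H.vs_axioms RH.vs_axioms hop_bilin_H hop_bilin_R, folded hop_def]

lemma hop_pure: "h1 \<in> carrier H \<Longrightarrow> h2 \<in> carrier H \<Longrightarrow> b \<in> carrier R \<Longrightarrow> g \<in> carrier H \<Longrightarrow>
    hop (pure H H h1 h2) (pure R H b g) = pure R H (act h1 b) (h2 \<otimes>\<^bsub>H\<^esub> g)"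
  by (rule hop_tlift(2))

lemma hop_bilin: "bilin HH RH RH hop"
  using hop_tlift(1) by (auto simp: bilin_def)

lemmas hop_closed [simp] = bilin_closed[OF hop_bilin]
lemmas hop_simps = hop_pure bilin_add_left[OF hop_bilin] bilin_add_right[OF hop_bilin]
  bilin_smult_left[OF hop_bilin] bilin_smult_right[OF hop_bilin]

lemma hop_mult:
  assumes "s \<in> carrier HH" "t \<in> carrier HH" "Y \<in> carrier RH"
  shows "hop (s \<otimes>\<^bsub>TA\<^esub> t) Y = hop s (hop t Y)"
  using assms(1)
proof (induction rule: tensor_induct[OF H.vs_axioms H.vs_axioms, consumes 1, case_names pure add])
  case (pure s1 s2)
  note s = this
  show ?case using assms(2)
  proof (induction rule: tensor_induct[OF H.vs_axioms H.vs_axioms, consumes 1, case_names pure add])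
    case (pure t1 t2)
    note t = this
    show ?case using assms(3)
    proof (induction rule: RH_induct)
      case (pure b g)
      then show ?case using s t by (simp add: TA_mult_pure hop_pure act_mult H.m_assoc)
    qed (use s t in \<open>simp add: TA_mult_pure hop_simps\<close>)
  next
    case (add x y)
    then show ?case using s assms TA.m_closed[of "pure H H s1 s2"] by (simp add: TA.r_distr[simplified] hop_simps)
  qed
next
  case (add x y)
  then show ?case using assms TA.m_closed[of _ t] by (simp add: TA.l_distr[simplified] hop_simps)
qed

abbreviation "hact h \<equiv> hop (\<Delta> h)"

lemma hact_lin: "h \<in> carrier H \<Longrightarrow> lin_map RH RH (hact h)"
  and hact_lin_left: "Y \<in> carrier RH \<Longrightarrow> lin_map H RH (\<lambda>h. hact h Y)"
  using bilin_right[OF hop_bilin] lin_map_comp[OF comult_lin bilin_left[OF hop_bilin]] by simp_all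

lemma hact_mult: "g \<in> carrier H \<Longrightarrow> h \<in> carrier H \<Longrightarrow> Y \<in> carrier RH \<Longrightarrow> hact (g \<otimes>\<^bsub>H\<^esub> h) Y = hact g (hact h Y)"
  by (simp add: alg_hom_mult[OF comult_hom] hop_mult)

lemma hact_one: "Y \<in> carrier RH \<Longrightarrow> hact \<one>\<^bsub>H\<^esub> Y = Y"
  by (induction rule: RH_induct) (simp_all add: alg_hom_one[OF comult_hom] hop_simps act_one)

lemma hact_gen_pure:
  assumes "b \<in> carrier R" "g \<in> carrier H"
  shows "hact k1 (pure R H b g) = pure R H (act k1 b) (k1 \<otimes>\<^bsub>H\<^esub> g)"
    "hact k' (pure R H b g) = pure R H (act k' b) (k' \<otimes>\<^bsub>H\<^esub> g)"
    "hact e (pure R H b g) = pure R H (act e b) g \<oplus>\<^bsub>RH\<^esub> pure R H (act k1 b) (e \<otimes>\<^bsub>H\<^esub> g)"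
    "hact f (pure R H b g) = pure R H (act f b) (k' \<otimes>\<^bsub>H\<^esub> g) \<oplus>\<^bsub>RH\<^esub> pure R H b (f \<otimes>\<^bsub>H\<^esub> g)"
  using assms by (simp_all add: comult_gen hop_simps act_one)

lemma rop_bilin_R: "a \<in> carrier R \<Longrightarrow> bilin R H RH (\<lambda>b g. pure R H (a \<otimes>\<^bsub>R\<^esub> b) g)"
  by (auto intro!: bilinI lin_map_comp[OF R.mult_left_lin rpure_lin(1)] rpure_lin(2))

lemma rop_lin: "a \<in> carrier R \<Longrightarrow> lin_map RH RH (rop a)"
  unfolding rop_def by (rule tlift_lin[OF R.vs_axioms H.vs_axioms RH.vs_axioms rop_bilin_R])

lemma rop_bilin: "bilin R RH RH rop"
proof (rule bilinI)
  fix Y assume Y: "Y \<in> carrier RH"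
  show "lin_map R RH (\<lambda>a. rop a Y)" unfolding rop_def
    by (rule tlift_param_lin[OF R.vs_axioms H.vs_axioms RH.vs_axioms R.vs_axioms rop_bilin_R _ Y])
      (auto intro: lin_map_comp[OF R.mult_right_lin rpure_lin(1)])
qed (use rop_lin in simp)

lemma rop_pure: "a \<in> carrier R \<Longrightarrow> b \<in> carrier R \<Longrightarrow> g \<in> carrier H \<Longrightarrow>
    rop a (pure R H b g) = pure R H (a \<otimes>\<^bsub>R\<^esub> b) g"
  unfolding rop_def by (rule tlift_pure[OF R.vs_axioms H.vs_axioms RH.vs_axioms rop_bilin_R])

lemmas rop_closed [simp] = bilin_closed[OF rop_bilin]
lemmas rop_simps = rop_pure bilin_add_left[OF rop_bilin] bilin_add_right[OF rop_bilin]
  bilin_smult_left[OF rop_bilin] bilin_smult_right[OF rop_bilin]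

lemma rop_mult: "Y \<in> carrier RH \<Longrightarrow> a \<in> carrier R \<Longrightarrow> b \<in> carrier R \<Longrightarrow> rop (a \<otimes>\<^bsub>R\<^esub> b) Y = rop a (rop b Y)"
  by (induction rule: RH_induct) (simp_all add: rop_simps R.m_assoc)

lemma rop_one: "Y \<in> carrier RH \<Longrightarrow> rop \<one>\<^bsub>R\<^esub> Y = Y"
  by (induction rule: RH_induct) (simp_all add: rop_simps)

lemma smash_simps [simp]: "carrier S = carrier RH" "x \<oplus>\<^bsub>S\<^esub> y = x \<oplus>\<^bsub>RH\<^esub> y" "\<zero>\<^bsub>S\<^esub> = \<zero>\<^bsub>RH\<^esub>"
  "c \<odot>\<^bsub>S\<^esub> x = c \<odot>\<^bsub>RH\<^esub> x" "\<one>\<^bsub>S\<^esub> = pure R H \<one>\<^bsub>R\<^esub> \<one>\<^bsub>H\<^esub>"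
  by (simp_all add: smash_def tensor_Uq)

text \<open>\<open>rop a\<close> is linear, so it can be pulled out of the two inner lifts in the
  definition of \<open>smash\<close>; what remains inside is the action of \<Delta>(h).\<close>

lemma smash_mult_eq:
  assumes "X \<in> carrier RH" "Y \<in> carrier RH"
  shows "X \<otimes>\<^bsub>S\<^esub> Y = tlift RH (\<lambda>a h. rop a (hact h Y)) X"
proof -
  have inner: "tlift RH (\<lambda>a' h'. tlift RH (\<lambda>h1 h2. pure R H (a \<otimes>\<^bsub>R\<^esub> act h1 a') (h2 \<otimes>\<^bsub>H\<^esub> h')) (\<Delta> h)) Y = rop a (hact h Y)"
    if ah: "a \<in> carrier R" "h \<in> carrier H" for a h
  proof -
    have b: "bilin R H RH (\<lambda>a' h'. tlift RH (\<lambda>h1 h2. pure R H (act h1 a') (h2 \<otimes>\<^bsub>H\<^esub> h')) (\<Delta> h))"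
    proof (rule bilinI)
      fix h' assume h': "h' \<in> carrier H"
      show "lin_map R RH (\<lambda>a'. tlift RH (\<lambda>h1 h2. pure R H (act h1 a') (h2 \<otimes>\<^bsub>H\<^esub> h')) (\<Delta> h))"
        by (rule tlift_param_lin[OF H.vs_axioms H.vs_axioms RH.vs_axioms R.vs_axioms hop_bilin_H[OF _ h'] bilin_left[OF hop_bilin_R h'] comult_closed[OF ah(2)]])
    next
      fix a' assume a': "a' \<in> carrier R"
      show "lin_map H RH (\<lambda>h'. tlift RH (\<lambda>h1 h2. pure R H (act h1 a') (h2 \<otimes>\<^bsub>H\<^esub> h')) (\<Delta> h))"
        by (rule tlift_param_lin[OF H.vs_axioms H.vs_axioms RH.vs_axioms H.vs_axioms hop_bilin_H[OF a'] bilin_right[OF hop_bilin_R a'] comult_closed[OF ah(2)]])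
    qed
    have "rop a (hact h Y) = tlift RH (\<lambda>a' h'. rop a (tlift RH (\<lambda>h1 h2. pure R H (act h1 a') (h2 \<otimes>\<^bsub>H\<^esub> h')) (\<Delta> h))) Y"
      unfolding hop_def by (rule tlift_comp[OF R.vs_axioms H.vs_axioms RH.vs_axioms b RH.vs_axioms rop_lin[OF ah(1)] assms(2)])
    also have "\<dots> = tlift RH (\<lambda>a' h'. tlift RH (\<lambda>h1 h2. pure R H (a \<otimes>\<^bsub>R\<^esub> act h1 a') (h2 \<otimes>\<^bsub>H\<^esub> h')) (\<Delta> h)) Y"
    proof (rule tlift_cong[OF R.vs_axioms H.vs_axioms RH.vs_axioms _ _ assms(2), symmetric])
      show "bilin R H RH (\<lambda>a' h'. rop a (tlift RH (\<lambda>h1 h2. pure R H (act h1 a') (h2 \<otimes>\<^bsub>H\<^esub> h')) (\<Delta> h)))"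
        by (rule bilin_comp[OF b rop_lin[OF ah(1)]])
    next
      fix a' h' assume a'h': "a' \<in> carrier R" "h' \<in> carrier H"
      have "rop a (tlift RH (\<lambda>h1 h2. pure R H (act h1 a') (h2 \<otimes>\<^bsub>H\<^esub> h')) (\<Delta> h)) =
          tlift RH (\<lambda>h1 h2. rop a (pure R H (act h1 a') (h2 \<otimes>\<^bsub>H\<^esub> h'))) (\<Delta> h)"
        by (rule tlift_comp[OF H.vs_axioms H.vs_axioms RH.vs_axioms hop_bilin_H[OF a'h'] RH.vs_axioms rop_lin[OF ah(1)] comult_closed[OF ah(2)]])
      also have "\<dots> = tlift RH (\<lambda>h1 h2. pure R H (a \<otimes>\<^bsub>R\<^esub> act h1 a') (h2 \<otimes>\<^bsub>H\<^esub> h')) (\<Delta> h)"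
        by (rule tlift_cong[OF H.vs_axioms H.vs_axioms RH.vs_axioms
              bilin_comp[OF hop_bilin_H[OF a'h'] rop_lin[OF ah(1)]] _ comult_closed[OF ah(2)], symmetric])
          (simp add: rop_pure ah a'h')
      finally show "tlift RH (\<lambda>h1 h2. pure R H (a \<otimes>\<^bsub>R\<^esub> act h1 a') (h2 \<otimes>\<^bsub>H\<^esub> h')) (\<Delta> h) =
        rop a (tlift RH (\<lambda>h1 h2. pure R H (act h1 a') (h2 \<otimes>\<^bsub>H\<^esub> h')) (\<Delta> h))" by (rule sym)
    qed
    finally show ?thesis by (rule sym)
  qed
  have "bilin R H RH (\<lambda>a h. rop a (hact h Y))"
    by (intro bilinI lin_map_comp[OF hact_lin_left rop_lin] bilin_left[OF rop_bilin] assms)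
      (simp_all add: assms)
  from tlift_cong[OF R.vs_axioms H.vs_axioms RH.vs_axioms this inner assms(1)]
  show ?thesis by (simp add: smash_def tensor_Uq)
qed

lemma smash_bilin_aux: "Y \<in> carrier RH \<Longrightarrow> bilin R H RH (\<lambda>a h. rop a (hact h Y))"
  by (intro bilinI lin_map_comp[OF hact_lin_left rop_lin] bilin_left[OF rop_bilin]) simp_all

lemma smash_mult_pure: "a \<in> carrier R \<Longrightarrow> h \<in> carrier H \<Longrightarrow> Y \<in> carrier RH \<Longrightarrow>
    pure R H a h \<otimes>\<^bsub>S\<^esub> Y = rop a (hact h Y)"
  by (simp add: smash_mult_eq tlift_pure[OF R.vs_axioms H.vs_axioms RH.vs_axioms smash_bilin_aux])

lemma smash_mult_bilin: "bilin RH RH RH (\<lambda>X Y. X \<otimes>\<^bsub>S\<^esub> Y)"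
proof (rule bilinI)
  fix Y assume Y: "Y \<in> carrier RH"
  show "lin_map RH RH (\<lambda>X. X \<otimes>\<^bsub>S\<^esub> Y)"
    by (rule lin_map_cong[OF RH.vs_axioms tlift_lin[OF R.vs_axioms H.vs_axioms RH.vs_axioms smash_bilin_aux[OF Y]]])
      (simp add: smash_mult_eq Y)
next
  fix X assume X: "X \<in> carrier RH"
  show "lin_map RH RH (\<lambda>Y. X \<otimes>\<^bsub>S\<^esub> Y)"
    by (rule lin_map_cong[OF RH.vs_axioms tlift_param_lin[OF R.vs_axioms H.vs_axioms RH.vs_axioms RH.vs_axioms smash_bilin_aux _ X]])
      (auto simp: smash_mult_eq X intro!: lin_map_comp[OF hact_lin rop_lin])
qed

lemmas smash_mult_simps = smash_mult_pure bilin_add_left[OF smash_mult_bilin] bilin_add_right[OF smash_mult_bilin]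
  bilin_smult_left[OF smash_mult_bilin] bilin_smult_right[OF smash_mult_bilin]
lemmas smash_mult_closed = bilin_closed[OF smash_mult_bilin]

lemma rop_smash:
  assumes "W \<in> carrier RH" "a \<in> carrier R" "Z \<in> carrier RH"
  shows "rop a W \<otimes>\<^bsub>S\<^esub> Z = rop a (W \<otimes>\<^bsub>S\<^esub> Z)"
  using assms
  by (induction rule: RH_induct) (simp_all add: rop_simps smash_mult_simps rop_mult smash_mult_closed)

text \<open>The rule h(bY) = sum (h_1 b)(h_2 Y), stated only for generators, whose coproducts have
  at most two terms. Together with \<open>hact_mult\<close> it carries the induction in
  \<open>hact_smash\<close>, so coassociativity of \<Delta> is never formulated.\<close>

lemma hact_gen_rop:
  assumes "Y \<in> carrier RH" "b \<in> carrier R"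
  shows "hact k1 (rop b Y) = rop (act k1 b) (hact k1 Y)" (is ?K)
    "hact k' (rop b Y) = rop (act k' b) (hact k' Y)" (is ?K')
    "hact e (rop b Y) = rop (act e b) Y \<oplus>\<^bsub>RH\<^esub> rop (act k1 b) (hact e Y)" (is ?E)
    "hact f (rop b Y) = rop (act f b) (hact k' Y) \<oplus>\<^bsub>RH\<^esub> rop b (hact f Y)" (is ?F)
proof -
  note c = comult_closed[OF uqg_closed]
  note s = hop_simps(2-) rop_simps hact_gen_pure act_gen_prod pure_add_left[OF R.vs_axioms H.vs_axioms]
  have "?K \<and> ?K' \<and> ?E \<and> ?F" using assms
  proof (induction rule: RH_induct)
    case (pure x g)
    then show ?case by (simp add: s RH.a_ac)
  next
    case (add x y)
    then have ih: "hact k1 (rop b x) = rop (act k1 b) (hact k1 x)"  "hact k1 (rop b y) = rop (act k1 b) (hact k1 y)"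
      "hact k' (rop b x) = rop (act k' b) (hact k' x)" "hact k' (rop b y) = rop (act k' b) (hact k' y)"
      "hact e (rop b x) = rop (act e b) x \<oplus>\<^bsub>RH\<^esub> rop (act k1 b) (hact e x)"
      "hact e (rop b y) = rop (act e b) y \<oplus>\<^bsub>RH\<^esub> rop (act k1 b) (hact e y)"
      "hact f (rop b x) = rop (act f b) (hact k' x) \<oplus>\<^bsub>RH\<^esub> rop b (hact f x)"
      "hact f (rop b y) = rop (act f b) (hact k' y) \<oplus>\<^bsub>RH\<^esub> rop b (hact f y)"
      by blast+
    show ?case using add(1,2) assms(2) by (simp add: s ih c RH.a_ac)
  qed
  then show ?K ?K' ?E ?F by blast+
qed

text \<open>With \<open>rop_smash\<close>, this is the whole content of associativity: both
  constituents of a left multiplication commute with right multiplications. Products of generators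
  are handled one factor at a time, hence W is arbitrary in the induction.\<close>

lemma hact_smash:
  assumes "h \<in> carrier H" "W \<in> carrier RH" "Z \<in> carrier RH"
  shows "hact h W \<otimes>\<^bsub>S\<^esub> Z = hact h (W \<otimes>\<^bsub>S\<^esub> Z)"
  using assms(1,2)
proof (induction arbitrary: W rule: H_induct)
  case one
  then show ?case using assms by (simp add: hact_one smash_mult_closed)
next
  case (gen g)
  from gen show ?case
  proof (induction rule: RH_induct)
    case (pure b x)
    then show ?case using assms
      by (cases g) (simp_all add: hact_gen_pure smash_mult_simps hact_gen_rop hact_mult smash_mult_closed)
  next
    case (add x y)
    then show ?case using assms by (simp add: smash_mult_simps hop_simps smash_mult_closed)
  qed
next
  case (add x y)
  then show ?case using assms
    by (simp add: lin_map_add[OF hact_lin_left] smash_mult_simps smash_mult_closed)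
next
  case (smult c x)
  then show ?case using assms
    by (simp add: lin_map_smult[OF hact_lin_left] smash_mult_simps smash_mult_closed)
next
  case (mult x y)
  then show ?case using assms by (simp add: hact_mult smash_mult_closed)
qed

lemma hact_unit:
  assumes "h \<in> carrier H" "g \<in> carrier H"
  shows "hact h (pure R H \<one>\<^bsub>R\<^esub> g) = pure R H \<one>\<^bsub>R\<^esub> (h \<otimes>\<^bsub>H\<^esub> g)"
  using assms
proof (induction arbitrary: g rule: H_induct)
  case (gen x)
  then show ?case by (cases x) (simp_all add: hact_gen_pure act_gen_unit rpure_zero)
next
  case (add x y)
  then show ?case by (simp add: lin_map_add[OF hact_lin_left] H.l_distr pure_add_right[OF R.vs_axioms H.vs_axioms])
next
  case (smult c x)
  then show ?case by (simp add: lin_map_smult[OF hact_lin_left] H.smult_mult_left pure_smult_right[OF R.vs_axioms H.vs_axioms])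
qed (simp_all add: hact_one hact_mult H.m_assoc)

lemma smash_alg: "alg S"
proof (rule algI)
  show "vs S" by (rule vs_cong[OF RH.vs_axioms]) (simp_all add: smash_def tensor_Uq)
  fix X assume "X \<in> carrier S"
  then have X: "X \<in> carrier RH" by simp
  then show "\<one>\<^bsub>S\<^esub> \<otimes>\<^bsub>S\<^esub> X = X" by (simp add: smash_mult_pure hact_one rop_one)
  from X show "X \<otimes>\<^bsub>S\<^esub> \<one>\<^bsub>S\<^esub> = X"
    by (induction rule: RH_induct) (simp_all add: smash_mult_simps hact_unit rop_simps)
  fix Y Z assume "Y \<in> carrier S" "Z \<in> carrier S"
  then have YZ: "Y \<in> carrier RH" "Z \<in> carrier RH" by simp_all
  from X show "X \<otimes>\<^bsub>S\<^esub> Y \<otimes>\<^bsub>S\<^esub> Z = X \<otimes>\<^bsub>S\<^esub> (Y \<otimes>\<^bsub>S\<^esub> Z)"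
    by (induction rule: RH_induct)
      (simp_all add: YZ smash_mult_simps smash_mult_closed rop_smash hact_smash)
next
  show "lin_map S S (\<lambda>x. x \<otimes>\<^bsub>S\<^esub> y)" if "y \<in> carrier S" for y
    using bilin_left[OF smash_mult_bilin, of y] that by (simp add: lin_map_def)
  show "lin_map S S (\<lambda>y. x \<otimes>\<^bsub>S\<^esub> y)" if "x \<in> carrier S" for x
    using bilin_right[OF smash_mult_bilin, of x] that by (simp add: lin_map_def)
qed (simp_all add: smash_mult_closed)

end

section \<open>A representation on ordered monomials\<close>

text \<open>Linear operators under composition. Relations verified here extend to ideals of free
  algebras by the universal property, and associativity comes for free.\<close>

definition endo :: "('k::field, ('i \<Rightarrow>\<^sub>0 'k) \<Rightarrow> 'i \<Rightarrow>\<^sub>0 'k) module" where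
  "endo = \<lparr>carrier = {\<phi>. lin_map (free_vs UNIV) (free_vs UNIV) \<phi>}, monoid.mult = (\<circ>), one = (\<lambda>x. x),
     zero = (\<lambda>x. 0), add = (\<lambda>\<phi> \<psi> x. \<phi> x + \<psi> x), module.smult = (\<lambda>c \<phi> x. scale c (\<phi> x))\<rparr>"

lemma endo_simps [simp]: "\<phi> \<in> carrier endo \<longleftrightarrow> (\<forall>x y. \<phi> (x + y) = \<phi> x + \<phi> y) \<and> (\<forall>c x. \<phi> (scale c x) = scale c (\<phi> x))"
  "\<phi> \<otimes>\<^bsub>endo\<^esub> \<psi> = \<phi> \<circ> \<psi>" "\<one>\<^bsub>endo\<^esub> = (\<lambda>x. x)" "\<zero>\<^bsub>endo\<^esub> = (\<lambda>x. 0)" "\<phi> \<oplus>\<^bsub>endo\<^esub> \<psi> = (\<lambda>x. \<phi> x + \<psi> x)"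
  "c \<odot>\<^bsub>endo\<^esub> \<phi> = (\<lambda>x. scale c (\<phi> x))"
  by (auto simp: endo_def lin_map_def)

lemma endo_vs: "vs endo"
proof -
  have "abelian_group (endo :: ('k::field, ('i \<Rightarrow>\<^sub>0 'k) \<Rightarrow> 'i \<Rightarrow>\<^sub>0 'k) module)"
  proof (rule abelian_groupI)
    fix \<phi> :: "('i \<Rightarrow>\<^sub>0 'k) \<Rightarrow> 'i \<Rightarrow>\<^sub>0 'k" assume "\<phi> \<in> carrier endo"
    then show "\<exists>\<psi>\<in>carrier endo. \<psi> \<oplus>\<^bsub>endo\<^esub> \<phi> = \<zero>\<^bsub>endo\<^esub>"
      by (intro bexI[of _ "\<lambda>x. - \<phi> x"]) auto
  qed (auto simp: algebra_simps)
  then interpret abelian_group "endo :: ('k::field, ('i \<Rightarrow>\<^sub>0 'k) \<Rightarrow> 'i \<Rightarrow>\<^sub>0 'k) module" .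
  show ?thesis by standard (auto simp: algebra_simps)
qed

lemma endo_alg: "alg endo"
  by (rule algI[OF endo_vs]) (auto intro!: lin_mapI)

lemma endoD: "\<phi> \<in> carrier endo \<Longrightarrow> \<phi> (x + y) = \<phi> x + \<phi> y" "\<phi> \<in> carrier endo \<Longrightarrow> \<phi> (scale c x) = scale c (\<phi> x)"
  "\<phi> \<in> carrier endo \<Longrightarrow> \<phi> 0 = 0"
  using endo_simps(1)[of \<phi>] by (auto) (metis scale_simps(5))

lemma endo_eqI:
  assumes "\<phi> \<in> carrier endo" "\<psi> \<in> carrier endo" "\<And>i. \<phi> (Poly_Mapping.single i 1) = \<psi> (Poly_Mapping.single i 1)"
  shows "\<phi> = \<psi>"
proof
  fix x
  show "\<phi> x = \<psi> x"
    using free_vs_eqI[of "free_vs UNIV" UNIV \<phi> \<psi> x] free_vs_vs assms by (auto simp: lin_map_def)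
qed

definition lext :: "('i \<Rightarrow> 'j \<Rightarrow>\<^sub>0 'k::field) \<Rightarrow> ('i \<Rightarrow>\<^sub>0 'k) \<Rightarrow> 'j \<Rightarrow>\<^sub>0 'k" where
  "lext = lin_ext (free_vs UNIV)"

lemma lext_simps [simp]: "lext g (x + y) = lext g x + lext g y" "lext g (scale c x) = scale c (lext g x)"
  "lext g (Poly_Mapping.single i c) = scale c (g i)" "lext g 0 = 0"
proof -
  have L: "lin_map (free_vs UNIV) (free_vs UNIV) (lext g)"
    unfolding lext_def by (rule lin_ext_lin_map[OF free_vs_vs]) simp
  show "lext g (x + y) = lext g x + lext g y" "lext g (scale c x) = scale c (lext g x)"
    using lin_map_add[OF L, of x y] lin_map_smult[OF L, of x c] by simp_all
  show "lext g (Poly_Mapping.single i c) = scale c (g i)"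
    unfolding lext_def by (subst lin_ext_single[OF free_vs_vs, of _ UNIV]) simp_all
  show "lext g 0 = 0" unfolding lext_def by (simp add: lin_ext_zero[OF free_vs_vs, of _ UNIV])
qed

type_synonym mon = "nat \<times> nat \<times> nat \<times> nat \<times> nat"

text \<open>The q^2-integer 1 + q^2 + ... + q^{2(n-1)}, in closed form.\<close>

definition gam :: "'k::field \<Rightarrow> nat \<Rightarrow> 'k" where
  "gam q n = (1 - q ^ n * q ^ n) / (1 - q * q)"

text \<open>
  The tuple \<open>(a, b, c, d, z)\<close> stands for \<open>v'\<^sup>a u'\<^sup>b v\<^sup>c u\<^sup>d \<zeta>\<^sup>z\<close>, where \<open>\<zeta>\<close> is a central
  variable of degree 2 in place of \<open>K\<^sup>n\<^sup>s\<close>: the formulas are those of left multiplication in the algebra with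
  relations \<open>r\<^sub>4 = \<alpha>\<zeta>\<close>, \<open>r\<^sub>5 = -q\<^sup>-\<^sup>1\<alpha>\<zeta>\<close> and \<open>r\<^sub>i = 0\<close> otherwise.  The truncated
  exponents \<open>a - 1\<close> and \<open>b - 1\<close> come with a coefficient that vanishes at 0.
\<close>

fun opm :: "'k::field \<Rightarrow> 'k \<Rightarrow> tw_gen \<Rightarrow> mon \<Rightarrow> mon \<Rightarrow>\<^sub>0 'k" where
  "opm q \<alpha> V' (a, b, c, d, z) = Poly_Mapping.single (Suc a, b, c, d, z) 1"
| "opm q \<alpha> U' (a, b, c, d, z) = Poly_Mapping.single (a, Suc b, c, d, z) (q ^ a)"
| "opm q \<alpha> V (a, b, c, d, z) = Poly_Mapping.single (a, b, Suc c, d, z) (q ^ a * q ^ b * q ^ b)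
     + Poly_Mapping.single (Suc a, b - 1, c, Suc d, z) (q ^ a * q ^ b * q ^ c * (1 - q * q) * gam q b)
     + Poly_Mapping.single (a, b - 1, c, d, Suc z) (\<alpha> * q ^ a * gam q b)"
| "opm q \<alpha> U (a, b, c, d, z) = Poly_Mapping.single (a, b, c, Suc d, z) (q ^ a * q ^ a * q ^ b * q ^ c)
     + Poly_Mapping.single (a - 1, b, c, d, Suc z) (- (inverse q * \<alpha> * gam q a))"

definition op :: "'k::field \<Rightarrow> 'k \<Rightarrow> tw_gen \<Rightarrow> (mon \<Rightarrow>\<^sub>0 'k) \<Rightarrow> (mon \<Rightarrow>\<^sub>0 'k)" where
  "op q \<alpha> g = lext (opm q \<alpha> g)"

definition zop :: "(mon \<Rightarrow>\<^sub>0 'k::field) \<Rightarrow> (mon \<Rightarrow>\<^sub>0 'k)" where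
  "zop = lext (\<lambda>(a, b, c, d, z). Poly_Mapping.single (a, b, c, d, Suc z) 1)"

lemma op_simps [simp]: "op q \<alpha> g (x + y) = op q \<alpha> g x + op q \<alpha> g y" "op q \<alpha> g (scale c x) = scale c (op q \<alpha> g x)"
  "op q \<alpha> g (Poly_Mapping.single i c) = scale c (opm q \<alpha> g i)" "op q \<alpha> g 0 = 0"
  and zop_simps [simp]: "zop (x + y) = zop x + zop y" "zop (scale c x) = scale c (zop x)"
  "zop (Poly_Mapping.single (a, b, c', d, z) c) = Poly_Mapping.single (a, b, c', d, Suc z) c"
  by (simp_all add: op_def zop_def)

definition rho :: "'k::field \<Rightarrow> 'k \<Rightarrow> 'k free4 \<Rightarrow> (mon \<Rightarrow>\<^sub>0 'k) \<Rightarrow> (mon \<Rightarrow>\<^sub>0 'k)" where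
  "rho q \<alpha> = free_lift endo (op q \<alpha>)"

lemma op_endo: "op q \<alpha> g \<in> carrier endo"
  by (simp add: op_def)

lemma rho_hom: "alg_hom free_alg endo (rho q \<alpha>)"
  unfolding rho_def by (rule free_lift_hom[where f = "op q \<alpha>", OF endo_alg op_endo])

lemma rho_simps [simp]: "rho q \<alpha> (gen g) = op q \<alpha> g" "rho q \<alpha> (s * t) x = rho q \<alpha> s (rho q \<alpha> t x)"
  "rho q \<alpha> (s + t) x = rho q \<alpha> s x + rho q \<alpha> t x" "rho q \<alpha> (scale c t) x = scale c (rho q \<alpha> t x)"
  "rho q \<alpha> 1 x = x" "rho q \<alpha> t (x + y) = rho q \<alpha> t x + rho q \<alpha> t y" "rho q \<alpha> t (scale c x) = scale c (rho q \<alpha> t x)"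
  "rho q \<alpha> (s - t) x = rho q \<alpha> s x - rho q \<alpha> t x" "rho q \<alpha> 0 x = 0" "rho q \<alpha> t 0 = 0"
proof -
  note h = rho_hom[of q \<alpha>]
  show "rho q \<alpha> (gen g) = op q \<alpha> g"
    unfolding rho_def by (rule free_lift_gen[where f = "op q \<alpha>", OF endo_alg op_endo])
  show "rho q \<alpha> (s * t) x = rho q \<alpha> s (rho q \<alpha> t x)" "rho q \<alpha> (s + t) x = rho q \<alpha> s x + rho q \<alpha> t x"
    "rho q \<alpha> 1 x = x"
    using alg_hom_mult[OF h, of s t] alg_hom_one[OF h] lin_map_add[OF alg_hom_lin[OF h], of s t] by simp_all
  have sc: "rho q \<alpha> (scale c t) x = scale c (rho q \<alpha> t x)" for c t
    using lin_map_smult[OF alg_hom_lin[OF h], of t c] by simp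
  have p: "rho q \<alpha> (s + t) x = rho q \<alpha> s x + rho q \<alpha> t x" for s t
    using lin_map_add[OF alg_hom_lin[OF h], of s t] by simp
  have "rho q \<alpha> t \<in> carrier endo" using lin_map_closed[OF alg_hom_lin[OF h], of t] by simp
  note e = endoD[OF this]
  show "rho q \<alpha> t (x + y) = rho q \<alpha> t x + rho q \<alpha> t y" "rho q \<alpha> t (scale c x) = scale c (rho q \<alpha> t x)" "rho q \<alpha> t 0 = 0"
    by (rule e)+
  show "rho q \<alpha> (scale c t) x = scale c (rho q \<alpha> t x)" by (rule sc)
  show "rho q \<alpha> (s - t) x = rho q \<alpha> s x - rho q \<alpha> t x"
    using p[of s "- t"] sc[of "- 1" t] by (simp add: scale_minus_one)
  show "rho q \<alpha> 0 x = 0" using sc[of 0 0] by simp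
qed

lemma zop_op: "zop (op q \<alpha> g x) = op q \<alpha> g (zop x)"
proof -
  have "zop \<circ> op q \<alpha> g = op q \<alpha> g \<circ> zop"
  proof (rule endo_eqI)
    fix i :: mon
    show "(zop \<circ> op q \<alpha> g) (Poly_Mapping.single i 1) = (op q \<alpha> g \<circ> zop) (Poly_Mapping.single i 1)"
      by (cases i, cases g) simp_all
  qed simp_all
  then show ?thesis by (metis comp_apply)
qed

lemma zop_rho: "zop (rho q \<alpha> t x) = rho q \<alpha> t (zop x)"
  by (induction t arbitrary: x rule: free_alg_induct) (simp_all add: zop_op)

text \<open>A Kronecker delta turns the comparison of coefficients into ring arithmetic, without
  splitting cases over the index.\<close>

definition delta :: "'i \<Rightarrow> 'i \<Rightarrow> 'k::field" where
  "delta i j = (if i = j then 1 else 0)"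

lemma lookup_single_delta: "Poly_Mapping.lookup (Poly_Mapping.single i c) j = c * delta i j"
  by (simp add: lookup_single delta_def when_def)

context quantum begin

lemma gam_eq: "(1 - q * q) * gam q n = 1 - q ^ n * q ^ n"
  using q2 by (simp add: gam_def power2_eq_square)

text \<open>The two recursions split off the constant term or the top term of 1 + q^2 + ... +
  q^{2n}. Vanishing at 0 is what makes the truncated exponents in \<open>opm\<close>
  harmless.\<close>

lemma gam_0 [simp]: "gam q 0 = 0" and gam_Suc: "gam q (Suc n) = q * q * gam q n + 1"
  and gam_Suc': "gam q (Suc n) = gam q n + q ^ n * q ^ n"
  using q2 by (simp_all add: gam_def field_simps power2_eq_square)

text \<open>This computation replaces the resolution of overlaps: the operators satisfy the deformed
  relations exactly. It is done coefficient by coefficient on monomials, with cases on the exponents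
  a and b, which occur truncated.\<close>

lemma rho_rels:
  "rho q \<alpha> (r1 q) x = 0" "rho q \<alpha> (r2 q) x = 0" "rho q \<alpha> (r3 q) x = 0" "rho q \<alpha> (r6 q) x = 0"
  "rho q \<alpha> (r4 q) x = scale \<alpha> (zop x)" "rho q \<alpha> (r5 q) x = scale (- inverse q * \<alpha>) (zop x)"
proof -
  have z: "rho q \<alpha> r = (\<lambda>x. scale c (zop x))"
    if "\<And>a b c' d z. rho q \<alpha> r (Poly_Mapping.single (a, b, c', d, z) 1) = Poly_Mapping.single (a, b, c', d, Suc z) c" for r c
  proof (rule endo_eqI)
    fix i :: mon
    show "rho q \<alpha> r (Poly_Mapping.single i 1) = scale c (zop (Poly_Mapping.single i 1))"
      using that by (cases i) simp
  qed (simp_all add: mult.commute)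
  have zero: "rho q \<alpha> r x = 0" if "\<And>a b c d z. rho q \<alpha> r (Poly_Mapping.single (a, b, c, d, z) 1) = 0" for r
    using z[of r 0] that by simp
  have iq: "q * inverse q = 1" "inverse q * q = 1" "q * (inverse q * y) = y" for y
    using q_nonzero by simp_all
  note simps = lookup_add lookup_minus lookup_single_delta algebra_simps iq power2_eq_square power3_eq_cube
  have "rho q \<alpha> (r1 q) (Poly_Mapping.single (a, b, c, d, z) 1) = 0" for a b c d z
  proof (rule poly_mapping_eqI)
    fix k :: mon
    show "Poly_Mapping.lookup (rho q \<alpha> (r1 q) (Poly_Mapping.single (a, b, c, d, z) 1)) k = Poly_Mapping.lookup (0) k"
      by (cases a; cases b) (simp_all add: r1_def simps gam_Suc')
  qed
  then show "rho q \<alpha> (r1 q) x = 0" by (simp add: zero)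
  have "rho q \<alpha> (r2 q) (Poly_Mapping.single (a, b, c, d, z) 1) = 0" for a b c d z
  proof (rule poly_mapping_eqI)
    fix k :: mon
    show "Poly_Mapping.lookup (rho q \<alpha> (r2 q) (Poly_Mapping.single (a, b, c, d, z) 1)) k = Poly_Mapping.lookup (0) k"
      by (cases a; cases b) (simp_all add: r2_def simps)
  qed
  then show "rho q \<alpha> (r2 q) x = 0" by (simp add: zero)
  have "rho q \<alpha> (r3 q) (Poly_Mapping.single (a, b, c, d, z) 1) = 0" for a b c d z
  proof (rule poly_mapping_eqI)
    fix k :: mon
    show "Poly_Mapping.lookup (rho q \<alpha> (r3 q) (Poly_Mapping.single (a, b, c, d, z) 1)) k = Poly_Mapping.lookup (0) k"
      by (cases a; cases b) (simp_all add: r3_def simps)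
  qed
  then show "rho q \<alpha> (r3 q) x = 0" by (simp add: zero)
  have "rho q \<alpha> (r6 q) (Poly_Mapping.single (a, b, c, d, z) 1) = 0" for a b c d z
  proof (rule poly_mapping_eqI)
    fix k :: mon
    show "Poly_Mapping.lookup (rho q \<alpha> (r6 q) (Poly_Mapping.single (a, b, c, d, z) 1)) k = Poly_Mapping.lookup (0) k"
      by (cases a; cases b) (simp_all add: r6_def simps)
  qed
  then show "rho q \<alpha> (r6 q) x = 0" by (simp add: zero)
  \<comment> \<open>The coefficient at the monomial times \<zeta> is \<alpha> times q^{2a} (gam(b+1)
    - q^2 gam(b)) + (1 - q^2) gam(a) = q^{2a} + (1 - q^{2a}) = 1. The last summand comes from the
    coefficient q - q^3 of v'u and is evaluated by \<open>gam_eq\<close>.\<close>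
  have "rho q \<alpha> (r4 q) (Poly_Mapping.single (a, b, c, d, z) 1) = Poly_Mapping.single (a, b, c, d, Suc z) \<alpha>" for a b c d z
  proof (rule poly_mapping_eqI)
    fix k :: mon
    show "Poly_Mapping.lookup (rho q \<alpha> (r4 q) (Poly_Mapping.single (a, b, c, d, z) 1)) k = Poly_Mapping.lookup (Poly_Mapping.single (a, b, c, d, Suc z) \<alpha>) k"
      using arg_cong[OF gam_eq[of a], of "\<lambda>y. \<alpha> * delta (a, b, c, d, Suc z) k * y"]
      by (cases a; cases b) (simp_all add: r4_def simps gam_Suc)
  qed
  then show "rho q \<alpha> (r4 q) x = scale \<alpha> (zop x)" by (simp add: z)
  \<comment> \<open>Here the coefficient is -q^{-1} \<alpha> (gam(a+1) - q^2 gam(a)) = -q^{-1}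
    \<alpha>.\<close>
  have "rho q \<alpha> (r5 q) (Poly_Mapping.single (a, b, c, d, z) 1) = Poly_Mapping.single (a, b, c, d, Suc z) (- inverse q * \<alpha>)" for a b c d z
  proof (rule poly_mapping_eqI)
    fix k :: mon
    show "Poly_Mapping.lookup (rho q \<alpha> (r5 q) (Poly_Mapping.single (a, b, c, d, z) 1)) k = Poly_Mapping.lookup (Poly_Mapping.single (a, b, c, d, Suc z) (- inverse q * \<alpha>)) k"
      by (cases a; cases b) (simp_all add: r5_def simps gam_Suc)
  qed
  then show "rho q \<alpha> (r5 q) x = scale (- inverse q * \<alpha>) (zop x)" by (simp add: z)
qed

end

lemma poly_mapping_induct [case_names zero add]:
  assumes "P 0" "\<And>k c x. P x \<Longrightarrow> P (Poly_Mapping.single k c + x)"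
  shows "P (x :: 'a \<Rightarrow>\<^sub>0 'k::field)"
  using assms by (intro poly_mapping_single_induct[of x UNIV P]) auto

section \<open>Total degree, specialisations of \<zeta>, and ordered words\<close>

definition vac :: "mon \<Rightarrow>\<^sub>0 'k::field" where
  "vac = Poly_Mapping.single (0, 0, 0, 0, 0) 1"

text \<open>\<zeta> counts twice because it stands on the right-hand side of quadratic relations;
  this makes every generator an operator of degree exactly one.\<close>

fun weight :: "mon \<Rightarrow> nat" where
  "weight (a, b, c, d, z) = a + b + c + d + 2 * z"

text \<open>The specialisation \<zeta> = 0; \<open>flat\<close> below is the specialisation \<zeta>
  = 1. Since \<open>normal_word\<close> ignores the exponent of \<zeta>, \<open>sig\<close> factors
  through the latter.\<close>

definition const_part :: "(mon \<Rightarrow>\<^sub>0 'k::field) \<Rightarrow> (mon \<Rightarrow>\<^sub>0 'k)" where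
  "const_part = lext (\<lambda>(a, b, c, d, z). if z = 0 then Poly_Mapping.single (a, b, c, d, 0) 1 else 0)"

definition flat :: "(mon \<Rightarrow>\<^sub>0 'k::field) \<Rightarrow> (mon \<Rightarrow>\<^sub>0 'k)" where
  "flat = lext (\<lambda>(a, b, c, d, z). Poly_Mapping.single (a, b, c, d, 0) 1)"

fun normal_word :: "mon \<Rightarrow> 'k::field free4" where
  "normal_word (a, b, c, d, z) = gen V' ^ a * (gen U' ^ b * (gen V ^ c * gen U ^ d))"

definition sig :: "(mon \<Rightarrow>\<^sub>0 'k::field) \<Rightarrow> 'k free4" where
  "sig = lext normal_word"

lemma sig_simps [simp]: "sig (x + y) = sig x + sig y" "sig (scale c x) = scale c (sig x)"
  "sig (Poly_Mapping.single i c) = scale c (normal_word i)" "sig 0 = 0"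
  by (simp_all add: sig_def)

text \<open>In \<open>opm\<close> every term containing \<alpha> raises the exponent of \<zeta>, so
  putting \<zeta> = 0 has the same effect as putting \<alpha> = 0.\<close>

lemma const_part_op: "const_part (op q \<alpha> g x) = op q 0 g (const_part x)"
proof -
  have "const_part \<circ> op q \<alpha> g = op q 0 g \<circ> const_part"
  proof (rule endo_eqI)
    fix i :: mon
    show "(const_part \<circ> op q \<alpha> g) (Poly_Mapping.single i 1) = (op q 0 g \<circ> const_part) (Poly_Mapping.single i 1)"
      by (cases i, cases g) (simp_all add: const_part_def)
  qed (simp_all add: const_part_def)
  then show ?thesis by (metis comp_apply)
qed

lemma const_part_rho: "const_part (rho q \<alpha> t x) = rho q 0 t (const_part x)"
  by (induction t arbitrary: x rule: free_alg_induct)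
    (simp_all add: const_part_op, simp_all add: const_part_def)

lemma const_part_vac [simp]: "const_part vac = vac"
  by (simp add: const_part_def vac_def)

context quantum begin

text \<open>At a = 0 or b = 0 the truncated exponent would spoil the count, but then the coefficient
  contains \<open>gam q 0\<close> and the term is absent; hence the case distinction.\<close>

lemma keys_opm: "Poly_Mapping.keys (opm q \<alpha> g i) \<subseteq> {j. weight j = Suc (weight i)}"
proof -
  obtain a b c d z where i: "i = (a, b, c, d, z)" by (cases i)
  show ?thesis unfolding i
    by (cases g; cases a; cases b) (auto dest!: keys_add[THEN subsetD] split: if_splits)
qed

lemma keys_op:
  assumes "Poly_Mapping.keys x \<subseteq> {i. weight i = m}"
  shows "Poly_Mapping.keys (op q \<alpha> g x) \<subseteq> {i. weight i = Suc m}"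
  using assms
proof (induction rule: poly_mapping_single_induct)
  case zero
  then show ?case by (simp add: op_def)
next
  case (add k c x)
  have "Poly_Mapping.keys (scale c (opm q \<alpha> g k) + op q \<alpha> g x) \<subseteq>
      Poly_Mapping.keys (opm q \<alpha> g k) \<union> Poly_Mapping.keys (op q \<alpha> g x)"
    using keys_add[of "scale c (opm q \<alpha> g k)" "op q \<alpha> g x"] keys_scale[of c "opm q \<alpha> g k"] by auto
  then show ?case using add keys_opm[of \<alpha> g k] by auto
qed

lemma keys_rho_word: "Poly_Mapping.keys (rho q \<alpha> (Poly_Mapping.single w 1) vac) \<subseteq> {i. weight i = length w}"
proof (induction w)
  case Nil
  then show ?case by (simp add: single_Nil vac_def)
next
  case (Cons g w)
  then show ?case using keys_op by (simp add: single_Cons)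
qed

text \<open>Read from the right, each generator meets only monomials in which the letters to the
  left of its own place are still missing. All powers of q are then 1 and all corrections carry
  \<open>gam q 0\<close>, so the result is the same for every \<alpha>.\<close>

lemma rho_normal_word: "rho q \<alpha> (normal_word (a, b, c, d, z)) vac = Poly_Mapping.single (a, b, c, d, 0) 1"
proof -
  have 1: "rho q \<alpha> (gen U ^ d) vac = Poly_Mapping.single (0, 0, 0, d, 0) 1"
    by (induction d) (simp_all add: vac_def)
  have 2: "rho q \<alpha> (gen V ^ c) (Poly_Mapping.single (0, 0, 0, d, 0) 1) = Poly_Mapping.single (0, 0, c, d, 0) 1"
    by (induction c) simp_all
  have 3: "rho q \<alpha> (gen U' ^ b) (Poly_Mapping.single (0, 0, c, d, 0) 1) = Poly_Mapping.single (0, b, c, d, 0) 1"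
    by (induction b) simp_all
  have 4: "rho q \<alpha> (gen V' ^ a) (Poly_Mapping.single (0, b, c, d, 0) 1) = Poly_Mapping.single (a, b, c, d, 0) 1"
    by (induction a) simp_all
  show ?thesis by (simp add: 1 2 3 4)
qed

lemma rho_sig: "rho q \<alpha> (sig s) vac = flat s"
proof (induction s rule: poly_mapping_induct)
  case (add k c x)
  then show ?case by (cases k) (simp add: rho_normal_word flat_def del: normal_word.simps)
qed (simp_all add: flat_def)

lemma sig_flat: "sig (flat s) = sig s"
proof (induction s rule: poly_mapping_induct)
  case (add k c x)
  then show ?case by (cases k) (simp add: flat_def)
qed (simp_all add: flat_def)

subsection \<open>Straightening\<close>

abbreviation "rel_ideal \<equiv> genideal free_alg (tw_rels q)"

definition cong (infix \<open>\<approx>\<close> 50) where "x \<approx> y \<longleftrightarrow> x - y \<in> rel_ideal"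

lemma rel_ideal: "ideal rel_ideal free_alg"
  by (rule genideal_free)

lemmas rel_subspace = alg.ideal_subspace[OF free_alg_alg rel_ideal]

lemma rel_ideal_closed: "x \<in> rel_ideal \<Longrightarrow> y \<in> rel_ideal \<Longrightarrow> x + y \<in> rel_ideal"
  "x \<in> rel_ideal \<Longrightarrow> scale c x \<in> rel_ideal" "0 \<in> rel_ideal"
  "x \<in> rel_ideal \<Longrightarrow> t * x \<in> rel_ideal" "x \<in> rel_ideal \<Longrightarrow> x * t \<in> rel_ideal"
  using subspaceD[OF rel_subspace, simplified] ideal.I_l_closed[OF rel_ideal, of x t] ideal.I_r_closed[OF rel_ideal, of x t]
  by simp_all

lemma rel_ideal_base: "r \<in> tw_rels q \<Longrightarrow> r \<in> rel_ideal"
  using ring.genideal_self[of "free_alg :: ('k, _) module" "tw_rels q"] alg.axioms(2)[OF free_alg_alg] by auto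

lemma cong_refl [simp]: "x \<approx> x"
  by (simp add: cong_def rel_ideal_closed)

lemma cong_trans [trans]: "x \<approx> y \<Longrightarrow> y \<approx> z \<Longrightarrow> x \<approx> z"
  unfolding cong_def using rel_ideal_closed(1)[of "x - y" "y - z"] by simp

lemma cong_add: "x \<approx> x' \<Longrightarrow> y \<approx> y' \<Longrightarrow> x + y \<approx> x' + y'"
  unfolding cong_def using rel_ideal_closed(1)[of "x - x'" "y - y'"] by (simp add: algebra_simps)

lemma cong_scale: "x \<approx> y \<Longrightarrow> scale c x \<approx> scale c y"
  unfolding cong_def using rel_ideal_closed(2)[of "x - y" c] by simp

lemma cong_left: "x \<approx> y \<Longrightarrow> t * x \<approx> t * y"
  unfolding cong_def using rel_ideal_closed(4)[of "x - y" t] by (simp add: algebra_simps)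

lemma cong_right: "x \<approx> y \<Longrightarrow> x * t \<approx> y * t"
  unfolding cong_def using rel_ideal_closed(5)[of "x - y" t] by (simp add: algebra_simps)

lemma cong_rels: "gen U * gen V \<approx> scale q (gen V * gen U)" "gen U' * gen V' \<approx> scale q (gen V' * gen U')"
  "gen U * gen U' \<approx> scale q (gen U' * gen U)" "gen U * gen V' \<approx> scale (q\<^sup>2) (gen V' * gen U)"
  "gen V * gen V' \<approx> scale q (gen V' * gen V)"
  "gen V * gen U' \<approx> scale (q\<^sup>2) (gen U' * gen V) + scale (q - q ^ 3) (gen V' * gen U)"
  using rel_ideal_base unfolding cong_def tw_rels_def r1_def r2_def r3_def r4_def r5_def r6_def
  by (simp_all add: diff_diff_eq del: scale_simps(2))

lemma cong_power: assumes "x * y \<approx> scale c (y * x)" shows "x * y ^ n \<approx> scale (c ^ n) (y ^ n * x)"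
proof (induction n)
  case (Suc n)
  have "x * y ^ Suc n = (x * y) * y ^ n" by (simp add: mult.assoc)
  also have "\<dots> \<approx> scale c (y * x) * y ^ n" by (rule cong_right[OF assms])
  also have "\<dots> = scale c (y * (x * y ^ n))" by (simp add: scale_mult_left mult.assoc)
  also have "\<dots> \<approx> scale c (y * scale (c ^ n) (y ^ n * x))" by (intro cong_scale cong_left Suc)
  also have "\<dots> = scale (c ^ Suc n) (y ^ Suc n * x)" by (simp add: scale_mult_right mult.assoc)
  finally show ?case .
qed simp

text \<open>The coefficient of the correction term is left existential: straightening only has to
  produce some combination of ordered words, and the representation later determines which
  one.\<close>

lemma cong_V_U': "\<exists>d. gen V * gen U' ^ b \<approx> scale ((q\<^sup>2) ^ b) (gen U' ^ b * gen V) + scale d (gen V' * (gen U' ^ (b - 1) * gen U))"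
proof (induction b)
  case 0
  show ?case by (rule exI[of _ 0]) simp
next
  case (Suc b)
  then obtain d where d: "gen V * gen U' ^ b \<approx> scale ((q\<^sup>2) ^ b) (gen U' ^ b * gen V) + scale d (gen V' * (gen U' ^ (b - 1) * gen U))" by blast
  have "gen V * gen U' ^ Suc b = (gen V * gen U') * gen U' ^ b" by (simp add: mult.assoc)
  also have "\<dots> \<approx> (scale (q\<^sup>2) (gen U' * gen V) + scale (q - q ^ 3) (gen V' * gen U)) * gen U' ^ b"
    by (rule cong_right[OF cong_rels(6)])
  also have "\<dots> = scale (q\<^sup>2) (gen U' * (gen V * gen U' ^ b)) + scale (q - q ^ 3) (gen V' * (gen U * gen U' ^ b))"
    by (simp add: scale_mult_left mult.assoc distrib_right del: scale_simps(2))
  also have "\<dots> \<approx> scale (q\<^sup>2) (gen U' * (scale ((q\<^sup>2) ^ b) (gen U' ^ b * gen V) + scale d (gen V' * (gen U' ^ (b - 1) * gen U))))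
      + scale (q - q ^ 3) (gen V' * scale (q ^ b) (gen U' ^ b * gen U))"
    by (intro cong_add cong_scale cong_left d cong_power cong_rels)
  also have "\<dots> = scale ((q\<^sup>2) ^ Suc b) (gen U' ^ Suc b * gen V) + (scale (q\<^sup>2 * d) ((gen U' * gen V') * (gen U' ^ (b - 1) * gen U))
      + scale ((q - q ^ 3) * q ^ b) (gen V' * (gen U' ^ b * gen U)))"
    by (simp add: scale_mult_left scale_mult_right mult.assoc distrib_left add.assoc del: scale_simps(2))
  also have "\<dots> \<approx> scale ((q\<^sup>2) ^ Suc b) (gen U' ^ Suc b * gen V) + (scale (q\<^sup>2 * d) (scale q (gen V' * gen U') * (gen U' ^ (b - 1) * gen U))
      + scale ((q - q ^ 3) * q ^ b) (gen V' * (gen U' ^ b * gen U)))"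
    by (intro cong_add cong_scale cong_refl cong_right cong_rels)
  finally have *: "gen V * gen U' ^ Suc b \<approx> scale ((q\<^sup>2) ^ Suc b) (gen U' ^ Suc b * gen V) + (scale (q\<^sup>2 * d) (scale q (gen V' * gen U') * (gen U' ^ (b - 1) * gen U))
      + scale ((q - q ^ 3) * q ^ b) (gen V' * (gen U' ^ b * gen U)))" .
  show ?case
  \<comment> \<open>The correction terms merge by absorbing one u' into the power with exponent b -
    1. For b = 0 this exponent is truncated and the merging fails, so the relation \<open>r4\<close>
    is used directly.\<close>
  proof (cases b)
    case 0
    show ?thesis
      using cong_rels(6) by (intro exI[of _ "q - q ^ 3"]) (simp add: 0 del: scale_simps(2))
  next
    case (Suc b')
    have "scale (q\<^sup>2 * d) (scale q (gen V' * gen U') * (gen U' ^ (b - 1) * gen U)) + scale ((q - q ^ 3) * q ^ b) (gen V' * (gen U' ^ b * gen U))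
      = scale (q\<^sup>2 * d * q + (q - q ^ 3) * q ^ b) (gen V' * (gen U' ^ (Suc b - 1) * gen U))"
      by (simp add: Suc scale_mult_left scale_mult_right mult.assoc)
    with * show ?thesis by (intro exI[of _ "q\<^sup>2 * d * q + (q - q ^ 3) * q ^ b"]) (simp only:)
  qed
qed

definition normal_span where "normal_span = {t. \<exists>s. t \<approx> sig s}"

lemma normal_spanI: "y \<in> normal_span \<Longrightarrow> x \<approx> y \<Longrightarrow> x \<in> normal_span"
  unfolding normal_span_def using cong_trans by blast

lemma normal_word_span: "normal_word i \<in> normal_span"
  unfolding normal_span_def by (auto intro: exI[of _ "Poly_Mapping.single i 1"])

lemma normal_span_add: assumes "x \<in> normal_span" "y \<in> normal_span" shows "x + y \<in> normal_span"
proof -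
  obtain s t where "x \<approx> sig s" "y \<approx> sig t" using assms by (auto simp: normal_span_def)
  then have "x + y \<approx> sig (s + t)" by (simp add: cong_add)
  then show ?thesis unfolding normal_span_def by blast
qed

lemma normal_span_scale: assumes "x \<in> normal_span" shows "scale c x \<in> normal_span"
proof -
  obtain s where "x \<approx> sig s" using assms by (auto simp: normal_span_def)
  then have "scale c x \<approx> sig (scale c s)" by (simp add: cong_scale)
  then show ?thesis unfolding normal_span_def by blast
qed

text \<open>A generator is pushed to the right through the blocks until it reaches its own. Only v
  splits on the way, into a term that stays v and one in which a u' has been traded for v' and v for
  u; the latter u is then pushed on.\<close>

lemma gen_normal_word: "gen g * normal_word i \<in> normal_span"
proof -
  obtain a b c d z where i: "i = (a, b, c, d, z)" by (cases i)
  note nw = normal_word_span normal_span_scale[OF normal_word_span]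
  have move: "x * (y ^ n * t) \<approx> scale (r ^ n) (y ^ n * (x * t))" if "x * y \<approx> scale r (y * x)" for x y t r n
    using cong_right[OF cong_power[OF that, of n], of t] by (simp add: mult.assoc scale_mult_left)
  show ?thesis
  proof (cases g)
    case V'
    then show ?thesis using nw(1)[of "(Suc a, b, c, d, z)"] by (simp add: i mult.assoc)
  next
    case U'
    show ?thesis
      by (rule normal_spanI[OF nw(2)[of "q ^ a" "(a, Suc b, c, d, z)"]])
        (use move[OF cong_rels(2), of a] in \<open>simp add: i U' mult.assoc\<close>)
  next
    case U
    have "gen U * normal_word i = gen U * (gen V' ^ a * (gen U' ^ b * (gen V ^ c * gen U ^ d)))" by (simp add: i)
    also have "\<dots> \<approx> scale ((q\<^sup>2) ^ a) (gen V' ^ a * (gen U * (gen U' ^ b * (gen V ^ c * gen U ^ d))))"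
      by (rule move[OF cong_rels(4)])
    also have "\<dots> \<approx> scale ((q\<^sup>2) ^ a) (gen V' ^ a * (scale (q ^ b) (gen U' ^ b * (gen U * (gen V ^ c * gen U ^ d)))))"
      by (intro cong_scale cong_left move cong_rels)
    also have "\<dots> \<approx> scale ((q\<^sup>2) ^ a) (gen V' ^ a * (scale (q ^ b) (gen U' ^ b * (scale (q ^ c) (gen V ^ c * (gen U * gen U ^ d))))))"
      by (intro cong_scale cong_left move cong_rels)
    also have "\<dots> = scale ((q\<^sup>2) ^ a * q ^ b * q ^ c) (normal_word (a, b, c, Suc d, z))"
      by (simp add: scale_mult_right mult.assoc)
    finally show ?thesis unfolding U by (rule normal_spanI[OF nw(2)])
  next
    case V
    have pc: "gen V' ^ a * (gen V' * t) = gen V' * (gen V' ^ a * t)" for t :: "'k free4"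
      by (simp add: power_commutes flip: mult.assoc)
    obtain \<delta> where \<delta>: "gen V * gen U' ^ b \<approx> scale ((q\<^sup>2) ^ b) (gen U' ^ b * gen V) + scale \<delta> (gen V' * (gen U' ^ (b - 1) * gen U))"
      using cong_V_U' by blast
    have "gen V * normal_word i = gen V * (gen V' ^ a * (gen U' ^ b * (gen V ^ c * gen U ^ d)))" by (simp add: i)
    also have "\<dots> \<approx> scale (q ^ a) (gen V' ^ a * (gen V * (gen U' ^ b * (gen V ^ c * gen U ^ d))))"
      by (rule move[OF cong_rels(5)])
    also have "\<dots> = scale (q ^ a) (gen V' ^ a * ((gen V * gen U' ^ b) * (gen V ^ c * gen U ^ d)))"
      by (simp add: mult.assoc)
    also have "\<dots> \<approx> scale (q ^ a) (gen V' ^ a * ((scale ((q\<^sup>2) ^ b) (gen U' ^ b * gen V) + scale \<delta> (gen V' * (gen U' ^ (b - 1) * gen U))) * (gen V ^ c * gen U ^ d)))"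
      by (intro cong_scale cong_left cong_right \<delta>)
    also have "\<dots> = scale (q ^ a * (q\<^sup>2) ^ b) (normal_word (a, b, Suc c, d, z))
        + scale (q ^ a * \<delta>) (gen V' ^ a * (gen V' * (gen U' ^ (b - 1) * (gen U * (gen V ^ c * gen U ^ d)))))"
      by (simp add: scale_mult_left scale_mult_right mult.assoc distrib_left distrib_right)
    also have "\<dots> \<approx> scale (q ^ a * (q\<^sup>2) ^ b) (normal_word (a, b, Suc c, d, z))
        + scale (q ^ a * \<delta>) (gen V' ^ a * (gen V' * (gen U' ^ (b - 1) * (scale (q ^ c) (gen V ^ c * (gen U * gen U ^ d))))))"
      by (intro cong_add cong_refl cong_scale cong_left move cong_rels)
    also have "\<dots> = scale (q ^ a * (q\<^sup>2) ^ b) (normal_word (a, b, Suc c, d, z))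
        + scale (q ^ a * \<delta> * q ^ c) (normal_word (Suc a, b - 1, c, Suc d, z))"
      by (simp add: scale_mult_right mult.assoc pc)
    finally show ?thesis unfolding V by (rule normal_spanI[OF normal_span_add[OF nw(2) nw(2)]])
  qed
qed

lemma gen_normal_span: assumes "x \<in> normal_span" shows "gen g * x \<in> normal_span"
proof -
  obtain s where s: "x \<approx> sig s" using assms by (auto simp: normal_span_def)
  have "gen g * sig s \<in> normal_span"
  proof (induction s rule: poly_mapping_induct)
    case zero
    then show ?case using normal_span_scale[OF normal_word_span, of 0] by simp
  next
    case (add k c x)
    then show ?case
      by (simp add: distrib_left scale_mult_right normal_span_add normal_span_scale gen_normal_word)
  qed
  then show ?thesis using normal_spanI cong_left[OF s] by blast
qed

lemma normal_span_UNIV: "t \<in> normal_span"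
proof (rule free_alg_subspace_UNIV)
  show "subspace free_alg normal_span"
    using normal_span_scale[OF normal_word_span, of 0] normal_span_add normal_span_scale
    by (intro vs.subspaceI[OF free_alg_vs]) simp_all
  show "Poly_Mapping.single w 1 \<in> normal_span" for w
  proof (induction w)
    case Nil
    then show ?case using normal_word_span[of "(0, 0, 0, 0, 0)"] by (simp add: single_Nil)
  qed (simp add: single_Cons gen_normal_span)
qed

lemma rho_rel_ideal: assumes "i \<in> rel_ideal" shows "rho q 0 i x = 0"
proof -
  have "rel_ideal \<subseteq> {x \<in> carrier free_alg. rho q 0 x = \<zero>\<^bsub>endo\<^esub>}"
    by (rule genideal_free_minimal[OF alg_hom_kernel[OF free_alg_alg endo_alg rho_hom]])
      (auto simp: tw_rels_def fun_eq_iff rho_rels)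
  then show ?thesis using assms by auto
qed

text \<open>Straightening yields some s with t congruent to \<open>sig s\<close>. Undeformed
  operators kill the ideal, so applying both sides to \<open>vac\<close> recovers s up to exponents
  of \<zeta>, which \<open>sig\<close> ignores. The normal form is therefore unique and linear in
  t.\<close>

lemma straighten: "t - sig (rho q 0 t vac) \<in> rel_ideal"
proof -
  obtain s where s: "t - sig s \<in> rel_ideal" using normal_span_UNIV[of t] by (auto simp: normal_span_def cong_def)
  have "rho q 0 t vac = flat s" using rho_rel_ideal[OF s, of vac] by (simp add: rho_sig)
  then show ?thesis using s by (simp add: sig_flat)
qed

end

section \<open>The twisted tensor square of the quantum plane\<close>

fun primed :: "plane_gen \<Rightarrow> tw_gen" where "primed gu = U'" | "primed gv = V'"
fun unprimed :: "plane_gen \<Rightarrow> tw_gen" where "unprimed gu = U" | "unprimed gv = V"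

definition incl :: "(plane_gen \<Rightarrow> tw_gen) \<Rightarrow> (plane_gen list \<Rightarrow>\<^sub>0 'k::field) \<Rightarrow> 'k free4" where
  "incl j = free_lift free_alg (\<lambda>g. gen (j g))"

lemma incl_hom: "alg_hom free_alg free_alg (incl j :: _ \<Rightarrow> 'k::field free4)"
  unfolding incl_def by (rule free_lift_hom[OF free_alg_alg]) simp

lemma incl_simps [simp]:
  fixes x y :: "plane_gen list \<Rightarrow>\<^sub>0 'k::field"
  shows "incl j (gen g) = (gen (j g) :: 'k free4)" "incl j (x * y) = incl j x * incl j y" "incl j 1 = (1 :: 'k free4)"
  "incl j (x + y) = incl j x + incl j y" "incl j (scale c x) = scale c (incl j x)" "incl j (x - y) = incl j x - incl j y"
proof -
  show "incl j (gen g) = (gen (j g) :: 'k free4)" unfolding incl_def by (rule free_lift_gen[OF free_alg_alg]) simp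
  show "incl j (x * y) = incl j x * incl j y" "incl j 1 = (1 :: 'k free4)" "incl j (x + y) = incl j x + incl j y"
    "incl j (scale c x) = scale c (incl j x)"
    using incl_hom[of j, where 'k = 'k] by (simp_all add: alg_hom_def lin_map_def)
  show "incl j (x - y) = incl j x - incl j y"
    using lin_map_minus[OF free_alg_vs free_alg_vs alg_hom_lin[OF incl_hom[of j]], of x y] by simp
qed

lemma incl_power [simp]: "incl j (x ^ n) = incl j x ^ n"
  by (induction n) simp_all

section \<open>The quantum plane and its tensor square as operators on ordered monomials\<close>

context quantum begin

abbreviation "A \<equiv> qplane q"
abbreviation "AA \<equiv> tensor A A"
abbreviation "pcls \<equiv> cls (qplane_rels q)"

sublocale A: alg A unfolding qplane_def by (rule presented_alg)
sublocale AA: vs AA by (rule tensor_vs[OF A.vs_axioms A.vs_axioms])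

lemma pcls_simps: "pcls (x * y) = pcls x \<otimes>\<^bsub>A\<^esub> pcls y" "pcls (x + y) = pcls x \<oplus>\<^bsub>A\<^esub> pcls y"
  "pcls 1 = \<one>\<^bsub>A\<^esub>" "pcls (scale c x) = c \<odot>\<^bsub>A\<^esub> pcls x" "pcls (gen g) = qpg q g"
  by (simp_all add: qplane_def qpg_def cls_simps)

lemma pcls_closed [simp]: "pcls x \<in> carrier A" "qpg q g \<in> carrier A"
  by (simp_all add: qplane_def qpg_def)

lemma A_carrier: "carrier A = range pcls"
  by (simp add: qplane_def presented_carrier)

lemmas A_induct [consumes 1, case_names one gen add smult mult] =
  presented_induct[of _ "qplane_rels q", folded qplane_def qpg_def]

text \<open>The trailing factor \<open>t\<close> drives the induction: one v is split off the power
  and absorbed into it.\<close>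

lemma pcls_uv: "pcls (gen gu * gen gv ^ a * t) = pcls (scale (q ^ a) (gen gv ^ a * gen gu * t))"
proof (induction a arbitrary: t)
  case (Suc a)
  have "pcls (gen gu * gen gv - scale q (gen gv * gen gu)) = pcls 0"
    using cls_rel[of "gen gu * gen gv - scale q (gen gv * gen gu)" "qplane_rels q"] by (simp add: qplane_rels_def cls_simps)
  then have "gen gu * gen gv - scale q (gen gv * gen gu) \<in> genideal free_alg (qplane_rels q)" by (simp add: cls_eq_iff)
  then have r: "pcls (gen gu * gen gv) = pcls (scale q (gen gv * gen gu))" by (simp add: cls_eq_iff)
  have "pcls (gen gu * gen gv ^ Suc a * t) = pcls (gen gu * gen gv ^ a * (gen gv * t))"
    by (simp add: mult.assoc power_Suc2 del: power_Suc)
  also have "\<dots> = pcls (scale (q ^ a) (gen gv ^ a * (gen gu * gen gv) * t))" using Suc[of "gen gv * t"] by (simp add: mult.assoc)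
  also have "\<dots> = pcls (scale (q ^ a) (gen gv ^ a * (scale q (gen gv * gen gu)) * t))"
    by (simp add: pcls_simps r[unfolded pcls_simps])
  also have "\<dots> = pcls (scale (q ^ Suc a) (gen gv ^ Suc a * gen gu * t))"
    by (simp add: scale_mult_left scale_mult_right mult.assoc power_Suc2 mult.commute[of q] del: power_Suc)
  finally show ?case .
qed simp

text \<open>Only generation is established here; the independence that is needed comes from the
  representation, through \<open>realize_omega\<close>.\<close>

lemma A_spanned: "carrier A = lspan A {pcls (gen gv ^ a * gen gu ^ b) | a b. True}" (is "_ = lspan A ?B")
proof -
  have B: "?B \<subseteq> carrier A" by auto
  have sp: "subspace A (lspan A ?B)" by (rule A.lspan_subspace[OF B])
  note L = lin_map_comp[OF alg_hom_lin[OF cls_hom[of "qplane_rels q", folded qplane_def]]]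
  have gen: "qpg q g \<otimes>\<^bsub>A\<^esub> X \<in> lspan A ?B" if "X \<in> lspan A ?B" for g X
    using that B
  proof (induction rule: A.lspan_induct)
    case (base X)
    then obtain a b where X: "X = pcls (gen gv ^ a * gen gu ^ b)" by blast
    show ?case
    proof (cases g)
      case gu
      have "qpg q g \<otimes>\<^bsub>A\<^esub> X = (q ^ a) \<odot>\<^bsub>A\<^esub> pcls (gen gv ^ a * gen gu ^ Suc b)"
        using pcls_uv[of a "gen gu ^ b"] by (simp add: gu X mult.assoc flip: pcls_simps)
      moreover have "pcls (gen gv ^ a * gen gu ^ Suc b) \<in> lspan A ?B" by (rule A.lspan_base) blast
      ultimately show ?thesis by (simp only: subspaceD(5)[OF sp])
    next
      case gv
      have "qpg q g \<otimes>\<^bsub>A\<^esub> X = pcls (gen gv ^ Suc a * gen gu ^ b)"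
        by (simp add: gv X mult.assoc flip: pcls_simps)
      then show ?thesis by (intro A.lspan_base) blast
    qed
  qed (use subspaceD[OF sp] in \<open>auto simp: A.r_distr A.smult_mult_right\<close>)
  have "pcls t \<in> lspan A ?B" for t
  proof -
    have "t \<in> {t \<in> carrier free_alg. pcls t \<in> lspan A ?B}"
    proof (rule free_alg_subspace_UNIV)
      show "subspace free_alg {t \<in> carrier free_alg. pcls t \<in> lspan A ?B}"
        by (rule vs.subspace_vimage[OF free_alg_vs A.vs_axioms alg_hom_lin[OF cls_hom[of "qplane_rels q", folded qplane_def]] sp])
      have "pcls (Poly_Mapping.single w 1) \<in> lspan A ?B" for w
      proof (induction w)
        case Nil
        have "pcls (gen gv ^ 0 * gen gu ^ 0) \<in> lspan A ?B" by (rule A.lspan_base) blast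
        then show ?case by (simp add: single_Nil)
      next
        case (Cons g w)
        then show ?case using gen[OF Cons, of g] by (simp add: single_Cons pcls_simps)
      qed
      then show "Poly_Mapping.single w 1 \<in> {t \<in> carrier free_alg. pcls t \<in> lspan A ?B}" for w by simp
    qed
    then show ?thesis by simp
  qed
  then show ?thesis using subspaceD(1)[OF sp] by (auto simp: A_carrier)
qed

definition rep :: "(plane_gen \<Rightarrow> tw_gen) \<Rightarrow> 'k plane \<Rightarrow> (mon \<Rightarrow>\<^sub>0 'k) \<Rightarrow> mon \<Rightarrow>\<^sub>0 'k" where
  "rep j = descend (free_lift endo (\<lambda>g. op q 0 (j g)))"

lemma free_lift_incl: "free_lift endo (\<lambda>g. op q 0 (j g)) t = rho q 0 (incl j t)"
proof (rule alg_hom_free_eqI[OF endo_alg free_lift_hom[OF endo_alg op_endo]])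
  show "alg_hom free_alg endo (\<lambda>t. rho q 0 (incl j t))"
    using alg_hom_mult[OF rho_hom[of q 0]] alg_hom_one[OF rho_hom[of q 0]]
      lin_map_comp[OF alg_hom_lin[OF incl_hom[of j, where 'k = 'k]] alg_hom_lin[OF rho_hom[of q 0]]]
    by (simp add: alg_hom_def)
  show "free_lift endo (\<lambda>g. op q 0 (j g)) (gen x) = rho q 0 (incl j (gen x))" for x
    using free_lift_gen[where f = "\<lambda>g. op q 0 (j g)", OF endo_alg op_endo] by simp
qed

lemma rep_rel: "j = primed \<or> j = unprimed \<Longrightarrow> r \<in> qplane_rels q \<Longrightarrow> free_lift endo (\<lambda>g. op q 0 (j g)) r = \<zero>\<^bsub>endo\<^esub>"
  using rho_rels(1,2)[of 0] unfolding free_lift_incl qplane_rels_def r1_def r2_def by (auto simp: fun_eq_iff)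

lemma rep_pcls: "j = primed \<or> j = unprimed \<Longrightarrow> rep j (pcls t) = rho q 0 (incl j t)"
  unfolding rep_def free_lift_incl[symmetric]
  by (rule presented_lift_cls[OF endo_alg op_endo rep_rel])

lemma rep_hom: "j = primed \<or> j = unprimed \<Longrightarrow> alg_hom A endo (rep j)"
  unfolding rep_def qplane_def
  by (rule presented_lift_hom[OF endo_alg op_endo rep_rel])

lemma rep_gen: "rep primed (qpg q g) = op q 0 (primed g)" "rep unprimed (qpg q g) = op q 0 (unprimed g)"
  by (simp_all add: rep_pcls flip: pcls_simps)

lemma rep_one: "rep primed \<one>\<^bsub>A\<^esub> = (\<lambda>x. x)" "rep unprimed \<one>\<^bsub>A\<^esub> = (\<lambda>x. x)"
  using alg_hom_one[OF rep_hom] by auto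

sublocale E: alg "endo :: ('k, (mon \<Rightarrow>\<^sub>0 'k) \<Rightarrow> mon \<Rightarrow>\<^sub>0 'k) module" by (rule endo_alg)

lemma rep_closed: "a \<in> carrier A \<Longrightarrow> rep primed a \<in> carrier endo" "a \<in> carrier A \<Longrightarrow> rep unprimed a \<in> carrier endo"
  using lin_map_closed[OF alg_hom_lin[OF rep_hom]] by blast+

text \<open>Left multiplication by the product a'a in the undeformed algebra of ordered monomials.
  This embedding is the device by which identities in A' tensor A are checked.\<close>

definition omega :: "(('k plane \<times> 'k plane) \<Rightarrow>\<^sub>0 'k) set \<Rightarrow> (mon \<Rightarrow>\<^sub>0 'k) \<Rightarrow> mon \<Rightarrow>\<^sub>0 'k" where
  "omega = tlift endo (\<lambda>a' a. rep primed a' \<otimes>\<^bsub>endo\<^esub> rep unprimed a)"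

lemma omega_bilin: "bilin A A endo (\<lambda>a' a. rep primed a' \<otimes>\<^bsub>endo\<^esub> rep unprimed a)"
  by (intro bilinI lin_map_comp[OF alg_hom_lin[OF rep_hom] E.mult_left_lin] lin_map_comp[OF alg_hom_lin[OF rep_hom] E.mult_right_lin]
      rep_closed) auto

lemma omega_lin: "lin_map AA endo omega"
  unfolding omega_def by (rule tlift_lin[OF A.vs_axioms A.vs_axioms E.vs_axioms omega_bilin])

lemma omega_pure: "a' \<in> carrier A \<Longrightarrow> a \<in> carrier A \<Longrightarrow> omega (pure A A a' a) = rep primed a' \<otimes>\<^bsub>endo\<^esub> rep unprimed a"
  unfolding omega_def by (rule tlift_pure[OF A.vs_axioms A.vs_axioms E.vs_axioms omega_bilin])

lemmas omega_closed = lin_map_closed[OF omega_lin]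

lemmas apure_closed [simp] = pure_closed[OF A.vs_axioms A.vs_axioms]
lemmas apure_lin = pure_lin_left[OF A.vs_axioms A.vs_axioms] pure_lin_right[OF A.vs_axioms A.vs_axioms]
lemmas AA_eqI = tensor_eqI[OF A.vs_axioms A.vs_axioms]
lemmas AA_induct [consumes 1, case_names pure add] = tensor_induct[OF A.vs_axioms A.vs_axioms]

definition realize :: "(mon \<Rightarrow>\<^sub>0 'k) \<Rightarrow> (('k plane \<times> 'k plane) \<Rightarrow>\<^sub>0 'k) set" where
  "realize = lin_ext AA (\<lambda>(a, b, c, d, z). pure A A (pcls (gen gv ^ a * gen gu ^ b)) (pcls (gen gv ^ c * gen gu ^ d)))"

lemma realize_fun: "(\<lambda>(a, b, c, d, z). pure A A (pcls (gen gv ^ a * gen gu ^ b)) (pcls (gen gv ^ c * gen gu ^ d))) \<in> UNIV \<rightarrow> carrier AA"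
  by auto

lemma realize_lin: "lin_map (free_vs UNIV) AA realize"
  unfolding realize_def by (rule lin_ext_lin_map[OF AA.vs_axioms realize_fun])

lemma realize_single: "realize (Poly_Mapping.single (a, b, c, d, z) 1) =
    pure A A (pcls (gen gv ^ a * gen gu ^ b)) (pcls (gen gv ^ c * gen gu ^ d))"
  unfolding realize_def by (subst lin_ext_single[OF AA.vs_axioms realize_fun]) auto

lemma omega_vac_lin: "lin_map AA (free_vs UNIV) (\<lambda>X. omega X vac)"
  by (rule lin_mapI) (simp_all add: lin_map_add[OF omega_lin] lin_map_smult[OF omega_lin])

text \<open>On a tensor of ordered monomials, applying the operator to \<open>vac\<close> returns
  that very monomial, by \<open>rho_normal_word\<close>. These tensors span, one factor at a time,
  so \<open>omega\<close> has a linear left inverse and is injective.\<close>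

lemma realize_omega: assumes "X \<in> carrier AA" shows "realize (omega X vac) = X"
proof -
  note L = lin_map_comp[OF omega_vac_lin realize_lin]
  let ?B = "{pcls (gen gv ^ a * gen gu ^ b) | a b. True}"
  have B: "?B \<subseteq> carrier A" by auto
  have base: "realize (omega (pure A A x y) vac) = pure A A x y" if x: "x \<in> ?B" and y: "y \<in> ?B" for x y
  proof -
    obtain a b c d where xy: "x = pcls (gen gv ^ a * gen gu ^ b)" "y = pcls (gen gv ^ c * gen gu ^ d)"
      using x y by blast
    have "omega (pure A A x y) vac = rho q 0 (normal_word (a, b, c, d, 0)) vac"
      by (simp add: xy omega_pure rep_pcls)
    then show ?thesis by (simp add: rho_normal_word realize_single xy del: normal_word.simps)
  qed
  have right: "realize (omega (pure A A x y) vac) = pure A A x y" if x: "x \<in> ?B" and y: "y \<in> carrier A" for x y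
  proof (rule lin_map_eq_on_lspan[OF A.vs_axioms AA.vs_axioms _ _ B base[OF x]])
    have x': "x \<in> carrier A" using x by auto
    show "lin_map A AA (\<lambda>y. realize (omega (pure A A x y) vac))" by (rule lin_map_comp[OF apure_lin(2)[OF x'] L])
    show "lin_map A AA (\<lambda>y. pure A A x y)" by (rule apure_lin(2)[OF x'])
    show "y \<in> lspan A ?B" using y A_spanned by simp
  qed
  have "realize (omega (pure A A x y) vac) = pure A A x y" if x: "x \<in> carrier A" and y: "y \<in> carrier A" for x y
  proof (rule lin_map_eq_on_lspan[OF A.vs_axioms AA.vs_axioms _ _ B right[OF _ y]])
    show "lin_map A AA (\<lambda>x. realize (omega (pure A A x y) vac))" by (rule lin_map_comp[OF apure_lin(1)[OF y] L])
    show "lin_map A AA (\<lambda>x. pure A A x y)" by (rule apure_lin(1)[OF y])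
    show "x \<in> lspan A ?B" using x A_spanned by simp
  qed
  then show ?thesis by (intro AA_eqI[OF AA.vs_axioms L lin_map_id _ assms]) 
qed

lemma omega_inj: "X \<in> carrier AA \<Longrightarrow> Y \<in> carrier AA \<Longrightarrow> omega X = omega Y \<Longrightarrow> X = Y"
  by (metis realize_omega)

end

section \<open>The twisting map as the exchange of operators\<close>

locale twisted = quantum q for q :: "'k::field" +
  fixes \<tau> :: "(('k plane \<times> 'k plane) \<Rightarrow>\<^sub>0 'k) set \<Rightarrow> (('k plane \<times> 'k plane) \<Rightarrow>\<^sub>0 'k) set"
  assumes twisting: "twisting_map (qplane q) (qplane q) \<tau>" and tau_gens: "tau_on_gens q \<tau>"
begin

lemma tau_lin: "lin_map AA AA \<tau>"
  and tau_left: "a \<in> carrier A \<Longrightarrow> \<tau> (pure A A a \<one>\<^bsub>A\<^esub>) = pure A A \<one>\<^bsub>A\<^esub> a"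
  and tau_right: "a \<in> carrier A \<Longrightarrow> \<tau> (pure A A \<one>\<^bsub>A\<^esub> a) = pure A A a \<one>\<^bsub>A\<^esub>"
  and tau_mult: "a \<in> carrier A \<Longrightarrow> b \<in> carrier A \<Longrightarrow> c \<in> carrier A \<Longrightarrow> d \<in> carrier A \<Longrightarrow>
    \<tau> (pure A A (a \<otimes>\<^bsub>A\<^esub> b) (c \<otimes>\<^bsub>A\<^esub> d)) =
      tlift AA (\<lambda>c' b'. twist_mult A A \<tau> (\<tau> (pure A A a c')) (\<tau> (pure A A b' d))) (\<tau> (pure A A b c))"
  using twisting unfolding twisting_map_def by blast+

lemmas tau_closed [simp] = lin_map_closed[OF tau_lin]

text \<open>A' acts from the left on the first factor and A from the right on the second. In these
  terms the twisted product of a' tensor a and b' tensor b is a' \<tau>(a tensor b') b.\<close>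

definition "sandwich a b = tlift AA (\<lambda>c' c. pure A A (a \<otimes>\<^bsub>A\<^esub> c') (c \<otimes>\<^bsub>A\<^esub> b))"

lemma sandwich_bilin: "a \<in> carrier A \<Longrightarrow> b \<in> carrier A \<Longrightarrow> bilin A A AA (\<lambda>c' c. pure A A (a \<otimes>\<^bsub>A\<^esub> c') (c \<otimes>\<^bsub>A\<^esub> b))"
  by (auto intro!: bilinI lin_map_comp[OF A.mult_left_lin apure_lin(1)] lin_map_comp[OF A.mult_right_lin apure_lin(2)])

lemma sandwich_lin: "a \<in> carrier A \<Longrightarrow> b \<in> carrier A \<Longrightarrow> lin_map AA AA (sandwich a b)"
  unfolding sandwich_def by (rule tlift_lin[OF A.vs_axioms A.vs_axioms AA.vs_axioms sandwich_bilin])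

lemma sandwich_pure: "a \<in> carrier A \<Longrightarrow> b \<in> carrier A \<Longrightarrow> c' \<in> carrier A \<Longrightarrow> c \<in> carrier A \<Longrightarrow>
    sandwich a b (pure A A c' c) = pure A A (a \<otimes>\<^bsub>A\<^esub> c') (c \<otimes>\<^bsub>A\<^esub> b)"
  unfolding sandwich_def by (rule tlift_pure[OF A.vs_axioms A.vs_axioms AA.vs_axioms sandwich_bilin])

lemma sandwich_lin_left: "t \<in> carrier AA \<Longrightarrow> b \<in> carrier A \<Longrightarrow> lin_map A AA (\<lambda>a. sandwich a b t)"
  unfolding sandwich_def
  by (rule tlift_param_lin[OF A.vs_axioms A.vs_axioms AA.vs_axioms A.vs_axioms])
    (auto intro!: sandwich_bilin lin_map_comp[OF A.mult_right_lin apure_lin(1)])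

lemma sandwich_lin_right: "t \<in> carrier AA \<Longrightarrow> a \<in> carrier A \<Longrightarrow> lin_map A AA (\<lambda>b. sandwich a b t)"
  unfolding sandwich_def
  by (rule tlift_param_lin[OF A.vs_axioms A.vs_axioms AA.vs_axioms A.vs_axioms])
    (auto intro!: sandwich_bilin lin_map_comp[OF A.mult_left_lin apure_lin(2)])

lemma omega_sandwich:
  assumes "a \<in> carrier A" "b \<in> carrier A" "t \<in> carrier AA"
  shows "omega (sandwich a b t) = rep primed a \<otimes>\<^bsub>endo\<^esub> omega t \<otimes>\<^bsub>endo\<^esub> rep unprimed b"
proof (rule AA_eqI[OF E.vs_axioms lin_map_comp[OF sandwich_lin omega_lin] _ _ assms(3), OF assms(1,2)])
  show "lin_map AA endo (\<lambda>t. rep primed a \<otimes>\<^bsub>endo\<^esub> omega t \<otimes>\<^bsub>endo\<^esub> rep unprimed b)"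
    by (intro lin_map_comp[OF lin_map_comp[OF omega_lin E.mult_left_lin] E.mult_right_lin] rep_closed assms)
  show "omega (sandwich a b (pure A A c' c)) = rep primed a \<otimes>\<^bsub>endo\<^esub> omega (pure A A c' c) \<otimes>\<^bsub>endo\<^esub> rep unprimed b"
    if "c' \<in> carrier A" "c \<in> carrier A" for c' c
    using that assms rep_closed
    by (simp add: sandwich_pure omega_pure alg_hom_mult[OF rep_hom] comp_assoc del: endo_simps(1))
qed

abbreviation "M \<equiv> twist_mult A A \<tau>"

lemma M_eq: "M X Y = tlift AA (\<lambda>a' a. tlift AA (\<lambda>b' b. sandwich a' b (\<tau> (pure A A a b'))) Y) X"
  by (simp add: twist_mult_def sandwich_def)

lemma M_aux:
  "a' \<in> carrier A \<Longrightarrow> a \<in> carrier A \<Longrightarrow> bilin A A AA (\<lambda>b' b. sandwich a' b (\<tau> (pure A A a b')))"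
  "b' \<in> carrier A \<Longrightarrow> b \<in> carrier A \<Longrightarrow> bilin A A AA (\<lambda>a' a. sandwich a' b (\<tau> (pure A A a b')))"
  by (auto intro!: bilinI lin_map_comp[OF lin_map_comp[OF apure_lin(1) tau_lin] sandwich_lin]
      lin_map_comp[OF lin_map_comp[OF apure_lin(2) tau_lin] sandwich_lin] sandwich_lin_left sandwich_lin_right)

lemma M_pure: "a' \<in> carrier A \<Longrightarrow> a \<in> carrier A \<Longrightarrow> b' \<in> carrier A \<Longrightarrow> b \<in> carrier A \<Longrightarrow>
    M (pure A A a' a) (pure A A b' b) = sandwich a' b (\<tau> (pure A A a b'))"
  unfolding M_eq by (rule tlift_tlift_pure[OF A.vs_axioms A.vs_axioms A.vs_axioms A.vs_axioms AA.vs_axioms M_aux])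

lemma M_bilin: "bilin AA AA AA M"
  using tlift_tlift_bilin[OF A.vs_axioms A.vs_axioms A.vs_axioms A.vs_axioms AA.vs_axioms M_aux]
  unfolding M_eq[symmetric] by (simp add: bilin_def)

lemmas M_closed = bilin_closed[OF M_bilin]

text \<open>This and \<open>omega_M_primed\<close> are the cases of multiplicativity in which only
  \<tau>(c tensor 1) or \<tau>(1 tensor c) occurs. They are available before \<tau> is known in
  general and are used to find it.\<close>

lemma omega_M_unprimed:
  assumes "X \<in> carrier AA" "b \<in> carrier A"
  shows "omega (M X (pure A A \<one>\<^bsub>A\<^esub> b)) = omega X \<otimes>\<^bsub>endo\<^esub> rep unprimed b"
proof (rule AA_eqI[OF E.vs_axioms lin_map_comp[OF bilin_left[OF M_bilin] omega_lin] _ _ assms(1)])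
  show "lin_map AA endo (\<lambda>X. omega X \<otimes>\<^bsub>endo\<^esub> rep unprimed b)"
    by (intro lin_map_comp[OF omega_lin E.mult_right_lin] rep_closed assms)
  show "omega (M (pure A A c' c) (pure A A \<one>\<^bsub>A\<^esub> b)) = omega (pure A A c' c) \<otimes>\<^bsub>endo\<^esub> rep unprimed b"
    if "c' \<in> carrier A" "c \<in> carrier A" for c' c
    using that assms by (simp add: M_pure tau_left omega_sandwich omega_pure rep_one comp_assoc comp_def del: endo_simps(1))
qed (use assms in simp)

lemma omega_M_primed:
  assumes "Y \<in> carrier AA" "a \<in> carrier A"
  shows "omega (M (pure A A a \<one>\<^bsub>A\<^esub>) Y) = rep primed a \<otimes>\<^bsub>endo\<^esub> omega Y"
proof (rule AA_eqI[OF E.vs_axioms lin_map_comp[OF bilin_right[OF M_bilin] omega_lin] _ _ assms(1)])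
  show "lin_map AA endo (\<lambda>Y. rep primed a \<otimes>\<^bsub>endo\<^esub> omega Y)"
    by (intro lin_map_comp[OF omega_lin E.mult_left_lin] rep_closed assms)
  show "omega (M (pure A A a \<one>\<^bsub>A\<^esub>) (pure A A c' c)) = rep primed a \<otimes>\<^bsub>endo\<^esub> omega (pure A A c' c)"
    if "c' \<in> carrier A" "c \<in> carrier A" for c' c
    using that assms by (simp add: M_pure tau_right omega_sandwich omega_pure rep_one comp_assoc comp_def del: endo_simps(1))
qed (use assms in simp)

lemma omega_tlift:
  assumes "bilin A A AA g" "t \<in> carrier AA"
    "\<And>c b. c \<in> carrier A \<Longrightarrow> b \<in> carrier A \<Longrightarrow> omega (g c b) = l c b" 
  shows "omega (tlift AA g t) = tlift endo l t"
proof -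
  have "omega (tlift AA g t) = tlift endo (\<lambda>c b. omega (g c b)) t"
    by (rule tlift_comp[OF A.vs_axioms A.vs_axioms AA.vs_axioms assms(1) E.vs_axioms omega_lin assms(2)])
  also have "\<dots> = tlift endo l t"
    by (rule tlift_cong[OF A.vs_axioms A.vs_axioms E.vs_axioms bilin_comp[OF assms(1) omega_lin] assms(3)[symmetric] assms(2), symmetric])
  finally show ?thesis .
qed

lemma tau_mult_bilin:
  assumes "a \<in> carrier A" "d \<in> carrier A"
  shows "bilin A A AA (\<lambda>c' b'. M (\<tau> (pure A A a c')) (\<tau> (pure A A b' d)))"
  using assms
  by (auto intro!: bilinI lin_map_comp[OF lin_map_comp[OF apure_lin(1) tau_lin] bilin_right[OF M_bilin]]
      lin_map_comp[OF lin_map_comp[OF apure_lin(2) tau_lin] bilin_left[OF M_bilin]])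

text \<open>The twisting axiom with last argument 1: the second factor of its right-hand side
  becomes \<tau>(b' tensor 1) = 1 tensor b', so \<open>omega_M_unprimed\<close> applies.\<close>

lemma omega_tau_mult_left:
  assumes "a \<in> carrier A" "b \<in> carrier A" "c \<in> carrier A"
    and a: "\<And>c. c \<in> carrier A \<Longrightarrow> omega (\<tau> (pure A A a c)) = rep unprimed a \<otimes>\<^bsub>endo\<^esub> rep primed c"
    and b: "omega (\<tau> (pure A A b c)) = rep unprimed b \<otimes>\<^bsub>endo\<^esub> rep primed c"
  shows "omega (\<tau> (pure A A (a \<otimes>\<^bsub>A\<^esub> b) c)) = rep unprimed (a \<otimes>\<^bsub>A\<^esub> b) \<otimes>\<^bsub>endo\<^esub> rep primed c"
proof -
  let ?t = "\<tau> (pure A A b c)"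
  have t: "?t \<in> carrier AA" using assms by simp
  have "omega (\<tau> (pure A A (a \<otimes>\<^bsub>A\<^esub> b) (c \<otimes>\<^bsub>A\<^esub> \<one>\<^bsub>A\<^esub>))) =
      tlift endo (\<lambda>c' b'. rep unprimed a \<otimes>\<^bsub>endo\<^esub> (rep primed c' \<otimes>\<^bsub>endo\<^esub> rep unprimed b')) ?t"
    unfolding tau_mult[OF assms(1-3) A.one_closed]
    by (rule omega_tlift[OF tau_mult_bilin t])
      (use assms in \<open>simp_all add: tau_left omega_M_unprimed a comp_assoc\<close>)
  also have "\<dots> = rep unprimed a \<otimes>\<^bsub>endo\<^esub> omega ?t"
    unfolding omega_def
    by (rule tlift_comp[OF A.vs_axioms A.vs_axioms E.vs_axioms omega_bilin E.vs_axioms E.mult_left_lin[OF rep_closed(2)[OF assms(1)]] t, symmetric])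
  finally show ?thesis using assms(1-3) by (simp add: b alg_hom_mult[OF rep_hom] comp_assoc)
qed

text \<open>The twisting axiom with first argument 1: the first factor of its right-hand side
  becomes \<tau>(1 tensor c') = c' tensor 1, so \<open>omega_M_primed\<close> applies.\<close>

lemma omega_tau_mult_right:
  assumes "a \<in> carrier A" "c \<in> carrier A" "d \<in> carrier A"
  shows "omega (\<tau> (pure A A a (c \<otimes>\<^bsub>A\<^esub> d))) =
    tlift endo (\<lambda>c' b'. rep primed c' \<otimes>\<^bsub>endo\<^esub> omega (\<tau> (pure A A b' d))) (\<tau> (pure A A a c))"
proof -
  have "omega (\<tau> (pure A A (\<one>\<^bsub>A\<^esub> \<otimes>\<^bsub>A\<^esub> a) (c \<otimes>\<^bsub>A\<^esub> d))) =
    tlift endo (\<lambda>c' b'. rep primed c' \<otimes>\<^bsub>endo\<^esub> omega (\<tau> (pure A A b' d))) (\<tau> (pure A A a c))"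
    unfolding tau_mult[OF A.one_closed assms]
    by (rule omega_tlift[OF tau_mult_bilin]) (use assms in \<open>simp_all add: tau_right omega_M_primed\<close>)
  then show ?thesis using assms by simp
qed

lemma omega_tau_right_bilin: "d \<in> carrier A \<Longrightarrow> bilin A A endo (\<lambda>c' b'. rep primed c' \<otimes>\<^bsub>endo\<^esub> omega (\<tau> (pure A A b' d)))"
  by (auto intro!: bilinI lin_map_comp[OF alg_hom_lin[OF rep_hom] E.mult_right_lin]
    lin_map_comp[OF lin_map_comp[OF lin_map_comp[OF apure_lin(1) tau_lin] omega_lin] E.mult_left_lin]
    omega_closed rep_closed simp del: endo_simps)

lemma op_rels: "op q 0 U (op q 0 U' x) = scale q (op q 0 U' (op q 0 U x))"
  "op q 0 U (op q 0 V' x) = scale (q\<^sup>2) (op q 0 V' (op q 0 U x))"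
  "op q 0 V (op q 0 V' x) = scale q (op q 0 V' (op q 0 V x))"
  "op q 0 V (op q 0 U' x) = scale (q\<^sup>2) (op q 0 U' (op q 0 V x)) + scale (q - q ^ 3) (op q 0 V' (op q 0 U x))"
  using rho_rels(3,4,5,6)[of 0 x] by (simp_all add: r3_def r4_def r5_def r6_def diff_eq_eq del: scale_simps(2))

text \<open>A generator of A is moved past a word of A' letter by letter. The prescribed values of
  \<tau> on generators have the same coefficients as the commutation rules \<open>op_rels\<close> of
  the operators.\<close>

lemma omega_tau_gen: "omega (\<tau> (pure A A (qpg q g) (pcls t))) = rep unprimed (qpg q g) \<otimes>\<^bsub>endo\<^esub> rep primed (pcls t)"
proof -
  have word: "omega (\<tau> (pure A A (qpg q g) (pcls (Poly_Mapping.single w 1)))) =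
      rep unprimed (qpg q g) \<otimes>\<^bsub>endo\<^esub> rep primed (pcls (Poly_Mapping.single w 1))" for w g
  \<comment> \<open>The generator must vary, since passing v over u' also produces a term with
    u.\<close>
  proof (induction w arbitrary: g)
    case Nil
    then show ?case by (simp add: single_Nil pcls_simps tau_left omega_pure rep_one comp_def)
  next
    case (Cons x w)
    let ?d = "pcls (Poly_Mapping.single w 1)"
    let ?l = "\<lambda>c' b'. rep primed c' \<otimes>\<^bsub>endo\<^esub> omega (\<tau> (pure A A b' ?d))"
    note bl = omega_tau_right_bilin[OF pcls_closed(1), of "Poly_Mapping.single w 1"]
    note L = tlift_lin[OF A.vs_axioms A.vs_axioms E.vs_axioms bl]
    define \<Lambda> where "\<Lambda> = tlift endo ?l"
    note s = lin_map_add[OF L, folded \<Lambda>_def] lin_map_smult[OF L, folded \<Lambda>_def]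
      tlift_pure[OF A.vs_axioms A.vs_axioms E.vs_axioms bl, folded \<Lambda>_def]
    have "omega (\<tau> (pure A A (qpg q g) (qpg q x \<otimes>\<^bsub>A\<^esub> ?d))) = \<Lambda> (\<tau> (pure A A (qpg q g) (qpg q x)))"
      unfolding \<Lambda>_def by (rule omega_tau_mult_right) simp_all
    also have "\<dots> = op q 0 (unprimed g) \<circ> op q 0 (primed x) \<circ> rep primed ?d"
      using tau_gens unfolding tau_on_gens_def Let_def
      by (cases g; cases x) (simp_all add: s Cons rep_gen fun_eq_iff op_rels del: scale_simps(2))
    finally show ?case
      by (simp add: single_Cons pcls_simps alg_hom_mult[OF rep_hom] rep_gen comp_assoc)
  qed
  note cl = alg_hom_lin[OF cls_hom[of "qplane_rels q", folded qplane_def]]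
  show ?thesis
    by (rule free_alg_eqI[OF E.vs_axioms
        lin_map_comp[OF cl lin_map_comp[OF lin_map_comp[OF apure_lin(2) tau_lin] omega_lin]]
        lin_map_comp[OF cl lin_map_comp[OF alg_hom_lin[OF rep_hom] E.mult_left_lin]] word])
      (auto intro: rep_closed simp del: endo_simps)
qed

text \<open>In the operator picture \<tau> only rewrites the composite of a after c in the order A'
  before A. From this, multiplicativity of \<open>omega\<close> follows on pure tensors.\<close>

lemma omega_tau:
  assumes "a \<in> carrier A" "c \<in> carrier A"
  shows "omega (\<tau> (pure A A a c)) = rep unprimed a \<otimes>\<^bsub>endo\<^esub> rep primed c"
  using assms
proof (induction arbitrary: c rule: A_induct)
  case one
  then show ?case by (simp add: tau_right omega_pure rep_one comp_def)
next
  case (gen g)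
  then show ?case using omega_tau_gen by (auto simp: A_carrier)
next
  case (add x y)
  then show ?case
    by (simp add: pure_add_left[OF A.vs_axioms A.vs_axioms] lin_map_add[OF tau_lin] lin_map_add[OF omega_lin]
        lin_map_add[OF alg_hom_lin[OF rep_hom]] comp_def)
next
  case (smult k x)
  then show ?case
    by (simp add: pure_smult_left[OF A.vs_axioms A.vs_axioms] lin_map_smult[OF tau_lin] lin_map_smult[OF omega_lin]
        lin_map_smult[OF alg_hom_lin[OF rep_hom]] comp_def)
next
  case (mult x y)
  then show ?case by (intro omega_tau_mult_left) auto
qed

lemma omega_M:
  assumes "X \<in> carrier AA" "Y \<in> carrier AA"
  shows "omega (M X Y) = omega X \<otimes>\<^bsub>endo\<^esub> omega Y"
  using assms(1)
proof (induction rule: AA_induct)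
  case (pure a' a)
  note a = this
  show ?case using assms(2)
  proof (induction rule: AA_induct)
    case (pure b' b)
    then show ?case using a by (simp add: M_pure omega_sandwich omega_tau omega_pure comp_assoc)
  next
    case (add x y)
    then show ?case using a omega_closed[of "pure A A a' a"]
      by (simp add: bilin_add_right[OF M_bilin] lin_map_add[OF omega_lin] M_closed comp_def fun_eq_iff)
  qed
next
  case (add x y)
  then show ?case using assms
    by (simp add: bilin_add_left[OF M_bilin] lin_map_add[OF omega_lin] M_closed comp_def)
qed

abbreviation "TW \<equiv> twist_alg A A \<tau>"

lemma TW_simps [simp]: "carrier TW = carrier AA" "x \<otimes>\<^bsub>TW\<^esub> y = M x y" "x \<oplus>\<^bsub>TW\<^esub> y = x \<oplus>\<^bsub>AA\<^esub> y"
  "\<one>\<^bsub>TW\<^esub> = pure A A \<one>\<^bsub>A\<^esub> \<one>\<^bsub>A\<^esub>" "\<zero>\<^bsub>TW\<^esub> = \<zero>\<^bsub>AA\<^esub>" "c \<odot>\<^bsub>TW\<^esub> x = c \<odot>\<^bsub>AA\<^esub> x"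
  by (simp_all add: twist_alg_def)

lemma omega_one: "omega (pure A A \<one>\<^bsub>A\<^esub> \<one>\<^bsub>A\<^esub>) = (\<lambda>x. x)"
  by (simp add: omega_pure rep_one comp_def)

text \<open>\<open>omega\<close> is injective and takes the twisted product to composition, so
  associativity and the unit laws are inherited from \<open>endo\<close>.\<close>

lemma TW_alg: "alg TW"
proof (rule algI)
  show "vs TW" by (rule vs_cong[OF AA.vs_axioms]) (simp_all add: twist_alg_def)
  fix X Y Z assume "X \<in> carrier TW" "Y \<in> carrier TW" "Z \<in> carrier TW"
  then show "X \<otimes>\<^bsub>TW\<^esub> Y \<otimes>\<^bsub>TW\<^esub> Z = X \<otimes>\<^bsub>TW\<^esub> (Y \<otimes>\<^bsub>TW\<^esub> Z)"
    by (intro omega_inj) (simp_all add: M_closed omega_M comp_assoc)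
next
  fix X assume "X \<in> carrier TW"
  then show "\<one>\<^bsub>TW\<^esub> \<otimes>\<^bsub>TW\<^esub> X = X" "X \<otimes>\<^bsub>TW\<^esub> \<one>\<^bsub>TW\<^esub> = X"
    by (rule_tac omega_inj; simp add: M_closed omega_M omega_one comp_def)+
  show "lin_map TW TW (\<lambda>Y. X \<otimes>\<^bsub>TW\<^esub> Y)" "lin_map TW TW (\<lambda>Y. Y \<otimes>\<^bsub>TW\<^esub> X)"
    using bilin_left[OF M_bilin, of X] bilin_right[OF M_bilin, of X] \<open>X \<in> carrier TW\<close> by (simp_all add: lin_map_def)
qed (simp_all add: M_closed)

sublocale TW: alg TW by (rule TW_alg)

lemma omega_hom: "alg_hom TW endo omega"
  using omega_lin by (simp add: alg_hom_def lin_map_def omega_M omega_one)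

section \<open>The presentation of the twisted product by generators and relations\<close>

definition "proj = free_lift TW (tw_gens q)"

lemma tw_gens_closed: "tw_gens q g \<in> carrier TW"
  by (cases g) simp_all

lemma proj_hom: "alg_hom free_alg TW proj"
  unfolding proj_def by (rule free_lift_hom[where f = "tw_gens q", OF TW_alg tw_gens_closed])

lemma proj_lin: "lin_map free_alg AA proj"
  using alg_hom_lin[OF proj_hom] by (simp add: lin_map_def)

lemma proj_gen: "proj (gen g) = tw_gens q g"
  unfolding proj_def by (rule free_lift_gen[where f = "tw_gens q", OF TW_alg tw_gens_closed])

lemma proj_closed [simp]: "proj t \<in> carrier AA"
  using lin_map_closed[OF proj_lin] by simp

lemma proj_mult: "proj (s * t) = M (proj s) (proj t)"
  using alg_hom_mult[OF proj_hom, of s t] by simp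

lemma omega_proj: "omega (proj t) = rho q 0 t"
proof (rule alg_hom_free_eqI[OF endo_alg _ rho_hom])
  show "alg_hom free_alg endo (\<lambda>t. omega (proj t))"
    using alg_hom_mult[OF proj_hom] alg_hom_one[OF proj_hom] lin_map_comp[OF alg_hom_lin[OF proj_hom] alg_hom_lin[OF omega_hom]]
    by (simp add: alg_hom_def omega_M omega_one)
  show "omega (proj (gen g)) = rho q 0 (gen g)" for g
    by (cases g) (simp_all add: proj_gen omega_pure rep_gen rep_one comp_def)
qed

text \<open>The image in A' tensor A can be read off from the normal form alone; this is how degrees
  in A' tensor A are later compared with word lengths.\<close>

lemma proj_realize: "proj t = realize (rho q 0 t vac)"
  using realize_omega[of "proj t"] by (simp add: omega_proj)

lemma proj_incl: "proj (incl primed x * incl unprimed y) = pure A A (pcls x) (pcls y)"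
  by (rule omega_inj) (simp_all add: omega_proj omega_pure rep_pcls comp_def fun_eq_iff)

text \<open>Equal images give equal operators, so the difference has normal form zero and lies in
  the ideal by \<open>straighten\<close>. Conversely the undeformed operators kill the ideal and
  \<open>omega\<close> is injective.\<close>

lemma proj_eq_iff: "proj s = proj t \<longleftrightarrow> s - t \<in> rel_ideal"
proof
  assume "proj s = proj t"
  then have "rho q 0 s = rho q 0 t" using omega_proj by metis
  then have "rho q 0 (s - t) vac = 0" by simp
  then show "s - t \<in> rel_ideal" using straighten[of "s - t"] by (simp del: rho_simps)
next
  assume i: "s - t \<in> rel_ideal"
  show "proj s = proj t"
    by (rule omega_inj) (use rho_rel_ideal[OF i] in \<open>simp_all add: omega_proj fun_eq_iff\<close>)
qed

lemma proj_surj: "range proj = carrier AA"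
proof
  show "carrier AA \<subseteq> range proj"
  proof
    fix X assume "X \<in> carrier AA"
    then show "X \<in> range proj"
    proof (induction rule: AA_induct)
      case (pure a b)
      then obtain x y where "a = pcls x" "b = pcls y" by (auto simp: A_carrier)
      then show ?case using proj_incl[of x y] by (metis rangeI)
    next
      case (add x y)
      then obtain s t where "x = proj s" "y = proj t" by blast
      then show ?case using lin_map_add[OF proj_lin, of s t] by (metis UNIV_I free_alg_simps(1,3) rangeI)
    qed
  qed
qed auto

lemma TW_presentation: "has_presentation TW (tw_gens q) (tw_rels q)"
proof -
  have "\<exists>\<phi>\<in>alg_iso (presented (tw_rels q)) TW. \<forall>x\<in>carrier free_alg. \<phi> (cls (tw_rels q) x) = proj x"
    by (rule alg_iso_of_common_kernel[OF alg.axioms(2)[OF free_alg_alg] free_alg_vs cls_hom _ proj_hom])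
      (simp_all only: free_alg_simps presented_carrier TW_simps proj_surj proj_eq_iff cls_eq_iff)
  then obtain \<phi> where "\<phi> \<in> alg_iso (presented (tw_rels q)) TW" "\<And>x. \<phi> (cls (tw_rels q) x) = proj x" by auto
  then show ?thesis unfolding has_presentation_def using proj_gen by metis
qed

end

section \<open>A criterion for PBW deformations\<close>

lemma lin_map_finsum:
  assumes "vs M" "vs N" "lin_map M N g" "finite I" "x \<in> I \<rightarrow> carrier M"
  shows "g (\<Oplus>\<^bsub>M\<^esub>i\<in>I. x i) = (\<Oplus>\<^bsub>N\<^esub>i\<in>I. g (x i))"
proof -
  interpret M: vs M by fact
  interpret N: vs N by fact
  show ?thesis using assms(4,5)
  proof (induction I)
    case empty
    then show ?case by (simp add: lin_map_zero[OF assms(1-3)])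
  next
    case (insert i I)
    then have "x \<in> I \<rightarrow> carrier M" "x i \<in> carrier M" "(\<lambda>i. g (x i)) \<in> I \<rightarrow> carrier N" "g (x i) \<in> carrier N"
      using lin_map_closed[OF assms(3)] by (auto simp: Pi_iff)
    then show ?case using insert by (simp add: lin_map_add[OF assms(3)] M.finsum_closed)
  qed
qed

lemma lin_map_sum:
  assumes "vs M" "vs N" "finite I" "\<And>i. i \<in> I \<Longrightarrow> lin_map M N (g i)"
  shows "lin_map M N (\<lambda>x. \<Oplus>\<^bsub>N\<^esub>i\<in>I. g i x)"
proof -
  interpret N: vs N by fact
  show ?thesis using assms(3,4)
  proof (induction I)
    case empty
    then show ?case using lin_map_zero_map[OF assms(2)] by simp
  next
    case (insert i I)
    have "lin_map M N (\<lambda>x. g i x \<oplus>\<^bsub>N\<^esub> (\<Oplus>\<^bsub>N\<^esub>i\<in>I. g i x))"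
      using insert by (intro lin_map_plus[OF assms(2)]) auto
    then show ?case
      by (rule lin_map_cong[OF assms(1)])
        (use insert lin_map_closed[OF insert(4)] in \<open>auto intro!: N.finsum_insert simp: Pi_iff\<close>)
  qed
qed

lemma (in vs) subspace_finsum:
  assumes "subspace M N" "finite I" "x \<in> I \<rightarrow> N" shows "(\<Oplus>i\<in>I. x i) \<in> N"
  using assms(2,3)
proof (induction I)
  case (insert i I)
  then have "x \<in> I \<rightarrow> carrier M" "x i \<in> carrier M" "x i \<in> N" using subspaceD(1)[OF assms(1)] by auto
  then show ?case using insert subspaceD(4)[OF assms(1)] by simp
qed (simp add: subspaceD(2)[OF assms(1)])

text \<open>The direct sum decomposition is given by its projections \<open>comp m\<close>, so that
  homogeneous parts depend linearly on the element. \<open>comp_inj\<close> and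
  \<open>comp_finite\<close> say that an element is the finite sum of its parts.\<close>

locale graded_alg = alg A for A :: "('k::field, 'a, 'm) module_scheme" (structure) +
  fixes G :: "nat \<Rightarrow> 'a set" and comp :: "nat \<Rightarrow> 'a \<Rightarrow> 'a"
  assumes comp_lin: "lin_map A A (comp m)"
    and G_subspace: "subspace A (G m)"
    and comp_mem: "X \<in> carrier A \<Longrightarrow> comp m X \<in> G m"
    and comp_G: "X \<in> G m \<Longrightarrow> comp i X = (if i = m then X else \<zero>)"
    and comp_finite: "X \<in> carrier A \<Longrightarrow> finite {m. comp m X \<noteq> \<zero>}"
    and comp_inj: "X \<in> carrier A \<Longrightarrow> (\<And>m. comp m X = \<zero>) \<Longrightarrow> X = \<zero>"
    and one_G: "\<one> \<in> G 0"
    and mult_G: "X \<in> G i \<Longrightarrow> Y \<in> G j \<Longrightarrow> X \<otimes> Y \<in> G (i + j)"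
begin

lemma G_carrier: "X \<in> G m \<Longrightarrow> X \<in> carrier A"
  using subspaceD(1)[OF G_subspace] by blast

lemmas comp_closed [simp] = lin_map_closed[OF comp_lin]
lemmas comp_add = lin_map_add[OF comp_lin] and comp_smult = lin_map_smult[OF comp_lin]
lemmas comp_zero [simp] = lin_map_zero[OF vs_axioms vs_axioms comp_lin]
lemmas comp_minus = lin_map_minus[OF vs_axioms vs_axioms comp_lin]

lemma comp_comp: "X \<in> carrier A \<Longrightarrow> comp i (comp m X) = (if i = m then comp m X else \<zero>)"
  by (rule comp_G[OF comp_mem])

lemma comp_finsum:
  assumes "finite I" "\<And>i. i \<in> I \<Longrightarrow> x i \<in> G i"
  shows "comp m (\<Oplus>i\<in>I. x i) = (if m \<in> I then x m else \<zero>)"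
proof -
  have x: "x \<in> I \<rightarrow> carrier A" using assms(2) G_carrier by blast
  have "comp m (\<Oplus>i\<in>I. x i) = (\<Oplus>i\<in>I. comp m (x i))"
    by (rule lin_map_finsum[OF vs_axioms vs_axioms comp_lin assms(1) x])
  also have "\<dots> = (\<Oplus>i\<in>I. if m = i then x i else \<zero>)"
    using x by (intro add.finprod_cong') (auto simp: comp_G[OF assms(2)])
  also have "\<dots> = (if m \<in> I then x m else \<zero>)"
    using finsum_singleton[of m I x] assms(1) x by (cases "m \<in> I") (auto intro!: add.finprod_one_eqI)
  finally show ?thesis .
qed

lemma decompose:
  assumes "X \<in> carrier A" "finite I" "{m. comp m X \<noteq> \<zero>} \<subseteq> I"
  shows "X = (\<Oplus>i\<in>I. comp i X)"
proof -
  let ?S = "\<Oplus>i\<in>I. comp i X"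
  have S: "?S \<in> carrier A" using assms(1) by (intro finsum_closed) auto
  have "comp m (X \<ominus> ?S) = \<zero>" for m
  proof -
    have "comp m X = \<zero>" if "m \<notin> I" using assms(3) that by blast
    then have "comp m ?S = comp m X"
      using comp_finsum[OF assms(2) comp_mem[OF assms(1)], of m] by (cases "m \<in> I") simp_all
    then show ?thesis using assms(1) S by (simp add: comp_minus minus_zero_iff)
  qed
  then have "X \<ominus> ?S = \<zero>" by (rule comp_inj[rotated]) (simp add: assms(1) S)
  then show ?thesis by (rule iffD1[OF minus_zero_iff[OF assms(1) S]])
qed

lemma carrier_span: "carrier A = lspan A (\<Union>m. G m)"
proof -
  have sub: "(\<Union>m. G m) \<subseteq> carrier A" using G_carrier by blast
  have "X \<in> lspan A (\<Union>m. G m)" if X: "X \<in> carrier A" for X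
  proof -
    have "(\<Oplus>i\<in>{m. comp m X \<noteq> \<zero>}. comp i X) \<in> lspan A (\<Union>m. G m)"
      by (rule subspace_finsum[OF lspan_subspace[OF sub] comp_finite[OF X]])
        (use comp_mem[OF X] lspan_base in blast)
    then show ?thesis using decompose[OF X comp_finite[OF X]] by simp
  qed
  then show ?thesis using lspan_closed[OF sub] by blast
qed

text \<open>Both sides are bilinear and homogeneous elements span, so only the product of two
  homogeneous elements has to be examined; there at most one summand survives.\<close>

lemma comp_mult:
  assumes "X \<in> carrier A" "Y \<in> carrier A"
  shows "comp m (X \<otimes> Y) = (\<Oplus>i\<in>{..m}. comp i X \<otimes> comp (m - i) Y)"
proof -
  have sub: "(\<Union>m. G m) \<subseteq> carrier A" using G_carrier by blast
  have l: "lin_map A A (\<lambda>X. comp m (X \<otimes> Y))" "lin_map A A (\<lambda>X. \<Oplus>i\<in>{..m}. comp i X \<otimes> comp (m - i) Y)"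
    if "Y \<in> carrier A" for Y
    using that by (auto intro!: lin_map_sum[OF vs_axioms vs_axioms] lin_map_comp[OF comp_lin mult_right_lin]
        lin_map_comp[OF mult_right_lin comp_lin])
  have r: "lin_map A A (\<lambda>Y. comp m (X \<otimes> Y))" "lin_map A A (\<lambda>Y. \<Oplus>i\<in>{..m}. comp i X \<otimes> comp (m - i) Y)"
    if "X \<in> carrier A" for X
    using that by (auto intro!: lin_map_sum[OF vs_axioms vs_axioms] lin_map_comp[OF comp_lin mult_left_lin]
        lin_map_comp[OF mult_left_lin comp_lin])
  have base: "comp m (X \<otimes> Y) = (\<Oplus>i\<in>{..m}. comp i X \<otimes> comp (m - i) Y)" if X: "X \<in> G a" and Y: "Y \<in> G b" for X Y a b
  proof (cases "m = a + b")
    case True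
    have "(\<Oplus>i\<in>{..m}. comp i X \<otimes> comp (m - i) Y) = (\<Oplus>i\<in>{..m}. if a = i then X \<otimes> Y else \<zero>)"
      using X Y G_carrier[OF X] G_carrier[OF Y] True
      by (intro add.finprod_cong') (auto simp: comp_G[OF X] comp_G[OF Y])
    also have "\<dots> = X \<otimes> Y"
      using finsum_singleton[of a "{..m}" "\<lambda>_. X \<otimes> Y"] G_carrier[OF X] G_carrier[OF Y] True by auto
    finally show ?thesis using comp_G[OF mult_G[OF X Y]] True by simp
  next
    case False
    have "(\<Oplus>i\<in>{..m}. comp i X \<otimes> comp (m - i) Y) = \<zero>"
      using X Y G_carrier[OF X] G_carrier[OF Y] False
      by (intro add.finprod_one_eqI) (auto simp: comp_G[OF X] comp_G[OF Y])
    then show ?thesis using comp_G[OF mult_G[OF X Y]] False by simp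
  qed
  have "comp m (X \<otimes> Y) = (\<Oplus>i\<in>{..m}. comp i X \<otimes> comp (m - i) Y)" if X: "X \<in> (\<Union>m. G m)" for X
  proof (rule lin_map_eq_on_lspan[OF vs_axioms vs_axioms _ _ sub, where f = "\<lambda>Y. comp m (X \<otimes> Y)"
        and g = "\<lambda>Y. \<Oplus>i\<in>{..m}. comp i X \<otimes> comp (m - i) Y"])
    have "X \<in> carrier A" using X sub by blast
    then show "lin_map A A (\<lambda>Y. comp m (X \<otimes> Y))" "lin_map A A (\<lambda>Y. \<Oplus>i\<in>{..m}. comp i X \<otimes> comp (m - i) Y)"
      by (rule r)+
    show "Y \<in> lspan A (\<Union>m. G m)" using assms(2) carrier_span by simp
  qed (use X base in blast)
  then show ?thesis
    by (rule lin_map_eq_on_lspan[OF vs_axioms vs_axioms l[OF assms(2)] sub, where x = X])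
      (use assms(1) carrier_span in simp_all)
qed

text \<open>The bound is strict: \<open>below (Suc m)\<close> gives the m-th filtration step and
  \<open>below m\<close> its predecessor. As \<open>below 0\<close> is zero, the step m = 0 needs no
  special treatment.\<close>

definition below :: "nat \<Rightarrow> 'a set" where
  "below m = {X \<in> carrier A. \<forall>i\<ge>m. comp i X = \<zero>}"

lemma below_subspace: "subspace A (below m)"
  by (rule subspaceI) (auto simp: below_def comp_add comp_smult)

lemma below_0: "below 0 = {\<zero>}"
  unfolding below_def using comp_inj by auto

lemma below_Suc: "below (Suc m) = lspan A (\<Union>i\<le>m. G i)"
proof
  have sub: "(\<Union>i\<le>m. G i) \<subseteq> carrier A" using G_carrier by blast
  show "lspan A (\<Union>i\<le>m. G i) \<subseteq> below (Suc m)"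
    by (rule lspan_minimal[OF below_subspace]) (auto simp: below_def comp_G G_carrier)
  show "below (Suc m) \<subseteq> lspan A (\<Union>i\<le>m. G i)"
  proof
    fix X assume X: "X \<in> below (Suc m)"
    then have "X = (\<Oplus>i\<in>{..m}. comp i X)"
      by (intro decompose) (auto simp: below_def not_less_eq_eq[symmetric])
    also have "\<dots> \<in> lspan A (\<Union>i\<le>m. G i)"
      by (rule subspace_finsum[OF lspan_subspace[OF sub]])
        (use X comp_mem[of X] in \<open>auto simp: below_def intro!: lspan_base\<close>)
    finally show "X \<in> lspan A (\<Union>i\<le>m. G i)" .
  qed
qed

text \<open>The degrees of the factors are at most i - 1 and j - 1, so those of the product are at
  most i + j - 2. This is why i + j may exceed m by one.\<close>

lemma below_mult:
  assumes "X \<in> below i" "Y \<in> below j" "i + j \<le> Suc m" shows "X \<otimes> Y \<in> below m"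
proof -
  have XY: "X \<in> carrier A" "Y \<in> carrier A" using assms by (auto simp: below_def)
  have "comp l (X \<otimes> Y) = \<zero>" if l: "l \<ge> m" for l
    unfolding comp_mult[OF XY]
  proof (rule add.finprod_one_eqI)
    fix a assume "a \<in> {..l}"
    then have "a \<ge> i \<or> l - a \<ge> j" using assms(3) l by auto
    then show "comp a X \<otimes> comp (l - a) Y = \<zero>" using assms(1,2) XY by (auto simp: below_def)
  qed
  then show ?thesis using XY by (auto simp: below_def)
qed

lemma G_below: "X \<in> G m \<Longrightarrow> X \<in> below (Suc m)"
  by (auto simp: below_def comp_G G_carrier)

section \<open>The associated graded algebra of a quotient of a graded algebra\<close>

context
  fixes J assumes J: "ideal J A"
begin

private abbreviation "D \<equiv> quot A J"
private abbreviation "c X \<equiv> J +> X"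
private abbreviation "Fil \<equiv> quot_filtration A G J"
private abbreviation "Dm m \<equiv> D\<lparr>carrier := Fil m\<rparr>"
private abbreviation "GR \<equiv> assoc_graded D Fil"

private lemma J_sub: "subspace A J" by (rule ideal_subspace[OF J])

interpretation D: alg D by (rule quot_alg[OF J])

private lemmas c_hom = quot_hom[OF J]
private lemmas c_lin = alg_hom_lin[OF c_hom]
private lemmas c_closed = lin_map_closed[OF c_lin]
private lemmas c_add = lin_map_add[OF c_lin] and c_smult = lin_map_smult[OF c_lin] and c_mult = alg_hom_mult[OF c_hom]
  and c_minus = lin_map_minus[OF vs_axioms D.vs_axioms c_lin]

private lemma Fil_eq: "Fil m = c ` below (Suc m)"
  by (simp add: quot_filtration_def below_Suc)

private lemma filt_pred_eq: "filt_pred D Fil m = c ` below m"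
  by (cases m) (simp_all add: filt_pred_def Fil_eq below_0 quot_zero[OF vs_axioms J_sub])

private lemma below_mono: "below m \<subseteq> below (Suc m)"
  by (auto simp: below_def)

private lemma Fil_sub: "subspace D (Fil m)"
  unfolding Fil_eq by (rule subspace_image[OF vs_axioms D.vs_axioms c_lin below_subspace])

private lemma Dm_vs: "vs (Dm m)"
  by (rule subspace_vs[OF D.vs_axioms Fil_sub])

private lemma pred_sub: "subspace (Dm m) (c ` below m)"
proof -
  have s: "subspace D (c ` below m)" by (rule subspace_image[OF vs_axioms D.vs_axioms c_lin below_subspace])
  show ?thesis
    by (rule vs.subspaceI[OF Dm_vs]) (use subspaceD[OF s] below_mono[of m] in \<open>auto simp: Fil_eq\<close>)
qed

private abbreviation "P m \<equiv> gr_piece D Fil m"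

private lemma P_eq: "P m = quot (Dm m) (c ` below m)"
  by (simp add: gr_piece_def filt_pred_eq)

private lemma P_vs: "vs (P m)"
  unfolding P_eq by (rule quot_vs[OF Dm_vs pred_sub])

text \<open>The class in F_m / F_{m-1} of the image of X. The coset is formed in the whole quotient
  \<open>D\<close>, as in the product and the unit of \<open>assoc_graded\<close>; by
  \<open>symb_eq\<close> it is the same set as the coset formed inside F_m.\<close>

private definition "symb m X = (c ` below m) +>\<^bsub>D\<^esub> c X"

private lemma symb_eq: "symb m X = (c ` below m) +>\<^bsub>Dm m\<^esub> c X"
  by (simp add: symb_def a_r_coset_def r_coset_def)

private lemma P_carrier: "carrier (P m) = symb m ` below (Suc m)"
  unfolding P_eq quot_carrier[OF Dm_vs pred_sub] by (auto simp: symb_eq Fil_eq)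

private lemma symb_closed: "X \<in> below (Suc m) \<Longrightarrow> symb m X \<in> carrier (P m)"
  by (simp add: P_carrier)

private lemma below_closed: "X \<in> below m \<Longrightarrow> X \<in> carrier A"
  by (simp add: below_def)

private lemma symb_add: "X \<in> below (Suc m) \<Longrightarrow> Y \<in> below (Suc m) \<Longrightarrow> symb m (X \<oplus> Y) = symb m X \<oplus>\<^bsub>P m\<^esub> symb m Y"
  using quot_add[OF Dm_vs pred_sub, of "c X" m "c Y"]
  unfolding P_eq symb_eq by (simp add: Fil_eq c_add below_closed)

private lemma symb_smult: "X \<in> below (Suc m) \<Longrightarrow> symb m (k \<odot> X) = k \<odot>\<^bsub>P m\<^esub> symb m X"
  using quot_smult[OF Dm_vs pred_sub, of "c X" m k]
  unfolding P_eq symb_eq by (simp add: Fil_eq c_smult below_closed)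

private lemma symb_zero: "symb m \<zero> = \<zero>\<^bsub>P m\<^esub>"
  using quot_zero[OF Dm_vs pred_sub, of m] unfolding P_eq symb_eq by (simp add: quot_zero[OF vs_axioms J_sub])

private lemma symb_eq_iff:
  assumes "X \<in> below (Suc m)" "Y \<in> below (Suc m)"
  shows "symb m X = symb m Y \<longleftrightarrow> (\<exists>W\<in>below m. X \<ominus> Y \<ominus> W \<in> J)"
proof -
  have XY: "X \<in> carrier A" "Y \<in> carrier A" "c X \<in> Fil m" "c Y \<in> Fil m"
    using assms by (auto simp: below_def Fil_eq)
  have "symb m X = symb m Y \<longleftrightarrow> c X \<ominus>\<^bsub>Dm m\<^esub> c Y \<in> c ` below m"
    unfolding symb_eq using coset_eq_iff[OF Dm_vs pred_sub, of "c X" m "c Y"] XY by simp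
  also have "c X \<ominus>\<^bsub>Dm m\<^esub> c Y = c (X \<ominus> Y)"
    using XY c_closed by (simp add: c_minus vs.minus_eq_smult[OF Dm_vs] D.minus_eq_smult)
  also have "c (X \<ominus> Y) \<in> c ` below m \<longleftrightarrow> (\<exists>W\<in>below m. X \<ominus> Y \<ominus> W \<in> J)"
    using coset_eq_iff[OF vs_axioms J_sub, of "X \<ominus> Y"] XY below_closed by (auto simp: image_iff)
  finally show ?thesis .
qed

text \<open>The product of cosets is a union over representatives. Changing these by elements of
  lower filtration adds W W', W Y and X W', all of which fall into \<open>below m\<close>, so every
  set in the union is the same coset.\<close>

private lemma symb_mult:
  assumes "X \<in> below (Suc i)" "Y \<in> below (Suc j)" "i + j = m"
  shows "rcoset_mult D (filt_pred D Fil m) (symb i X) (symb j Y) = symb m (X \<otimes> Y)"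
proof -
  note XY = below_closed[OF assms(1)] below_closed[OF assms(2)]
  have eq: "(c ` below m) +>\<^bsub>D\<^esub> (a \<otimes>\<^bsub>D\<^esub> b) = symb m (X \<otimes> Y)" if a: "a \<in> symb i X" and b: "b \<in> symb j Y" for a b
  proof -
    obtain W W' where W: "W \<in> below i" "W' \<in> below j" "a = c W \<oplus>\<^bsub>D\<^esub> c X" "b = c W' \<oplus>\<^bsub>D\<^esub> c Y"
      using a b unfolding symb_def a_r_coset_def'[of D] by blast
    note W' = below_closed[OF W(1)] below_closed[OF W(2)]
    have ab: "a \<otimes>\<^bsub>D\<^esub> b = c ((W \<oplus> X) \<otimes> (W' \<oplus> Y))"
      using W W' XY by (simp add: c_add c_mult)
    have 1: "W \<otimes> W' \<in> below m" "W \<otimes> Y \<in> below m" "X \<otimes> W' \<in> below m" "X \<otimes> Y \<in> below (Suc m)"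
      using below_mult[OF W(1,2), of m] below_mult[OF W(1) assms(2), of m] below_mult[OF assms(1) W(2), of m]
        below_mult[OF assms(1,2), of "Suc m"] assms(3) by simp_all
    let ?V = "W \<otimes> W' \<oplus> W \<otimes> Y \<oplus> X \<otimes> W'"
    have V: "?V \<in> below m" using 1 subspaceD(4)[OF below_subspace] by simp
    have e: "(W \<oplus> X) \<otimes> (W' \<oplus> Y) = ?V \<oplus> X \<otimes> Y" using W' XY by (simp add: l_distr r_distr a_ac)
    have V': "?V \<in> below (Suc m)" using V below_mono by blast
    have "symb m ((W \<oplus> X) \<otimes> (W' \<oplus> Y)) = symb m (X \<otimes> Y)"
    proof (subst symb_eq_iff)
      show "(W \<oplus> X) \<otimes> (W' \<oplus> Y) \<in> below (Suc m)" unfolding e by (rule subspaceD(4)[OF below_subspace V' 1(4)])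
      have "?V \<oplus> X \<otimes> Y \<ominus> X \<otimes> Y \<ominus> ?V = \<zero>"
        using below_closed[OF V] XY by (simp add: a_minus_def a_assoc r_neg del: W')
      then show "\<exists>W''\<in>below m. (W \<oplus> X) \<otimes> (W' \<oplus> Y) \<ominus> X \<otimes> Y \<ominus> W'' \<in> J"
        unfolding e using V subspaceD(2)[OF J_sub] by metis
    qed (rule 1)
    then show ?thesis by (simp add: ab symb_def)
  qed
  have c: "c X \<in> symb i X" "c Y \<in> symb j Y"
    using coset_self[OF Dm_vs pred_sub, of "c X" i] coset_self[OF Dm_vs pred_sub, of "c Y" j] assms
    by (simp_all add: symb_eq Fil_eq)
  have "(\<Union>b\<in>symb j Y. (c ` below m) +>\<^bsub>D\<^esub> (a \<otimes>\<^bsub>D\<^esub> b)) = symb m (X \<otimes> Y)" if "a \<in> symb i X" for a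
    by (rule UN_constant_eq[OF c(2)]) (use eq that in blast)
  then show ?thesis unfolding rcoset_mult_def filt_pred_eq
    by (intro UN_constant_eq[OF c(1)]) blast
qed

text \<open>Maps the original graded algebra onto the associated graded algebra of its quotient:
  each homogeneous part goes to its class in the piece of the same degree.\<close>

private definition "theta X = (\<lambda>m. symb m (comp m X))"

private lemma comp_below: "X \<in> carrier A \<Longrightarrow> comp m X \<in> below (Suc m)"
  by (rule G_below[OF comp_mem])

private lemma GR_simps: "carrier GR = {x. (\<forall>m. x m \<in> carrier (P m)) \<and> finite {m. x m \<noteq> \<zero>\<^bsub>P m\<^esub>}}"
  "x \<oplus>\<^bsub>GR\<^esub> y = (\<lambda>m. x m \<oplus>\<^bsub>P m\<^esub> y m)" "k \<odot>\<^bsub>GR\<^esub> x = (\<lambda>m. k \<odot>\<^bsub>P m\<^esub> x m)"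
  "x \<otimes>\<^bsub>GR\<^esub> y = (\<lambda>m. \<Oplus>\<^bsub>P m\<^esub>i\<in>{..m}. rcoset_mult D (filt_pred D Fil m) (x i) (y (m - i)))"
  "\<one>\<^bsub>GR\<^esub> = (\<lambda>m. if m = 0 then filt_pred D Fil 0 +>\<^bsub>D\<^esub> \<one>\<^bsub>D\<^esub> else \<zero>\<^bsub>P m\<^esub>)"
  by (simp_all add: assoc_graded_def)

private lemma theta_hom: "alg_hom A GR theta"
  unfolding alg_hom_def
proof (intro conjI ballI)
  show "lin_map A GR theta"
  proof (rule lin_mapI)
    fix X assume X: "X \<in> carrier A"
    have "{m. theta X m \<noteq> \<zero>\<^bsub>P m\<^esub>} \<subseteq> {m. comp m X \<noteq> \<zero>}" by (auto simp: theta_def symb_zero)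
    then show "theta X \<in> carrier GR"
      using X finite_subset[OF _ comp_finite[OF X]] by (auto simp: GR_simps theta_def intro!: symb_closed comp_below)
    show "theta (k \<odot> X) = k \<odot>\<^bsub>GR\<^esub> theta X" for k
      using X by (simp add: GR_simps theta_def comp_smult symb_smult comp_below)
    fix Y assume "Y \<in> carrier A"
    then show "theta (X \<oplus> Y) = theta X \<oplus>\<^bsub>GR\<^esub> theta Y"
      using X by (simp add: GR_simps theta_def comp_add symb_add comp_below)
  qed
  show "theta \<one> = \<one>\<^bsub>GR\<^esub>"
  proof
    fix m show "theta \<one> m = \<one>\<^bsub>GR\<^esub> m"
      by (simp add: GR_simps theta_def comp_G[OF one_G] symb_zero) (simp add: symb_def filt_pred_eq alg_hom_one[OF c_hom])
  qed
  fix X Y assume X: "X \<in> carrier A" and Y: "Y \<in> carrier A"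
  show "theta (X \<otimes> Y) = theta X \<otimes>\<^bsub>GR\<^esub> theta Y"
  proof
    fix m
    \<comment> \<open>\<open>symb m\<close> is linear only on the filtration step, so the sum is
      first rewritten as a sum in the algebra with restricted carrier.\<close>
    let ?B = "A\<lparr>carrier := below (Suc m)\<rparr>"
    have sl: "lin_map ?B (P m) (symb m)" by (rule lin_mapI) (simp_all add: symb_closed symb_add symb_smult)
    have z: "comp i X \<otimes> comp (m - i) Y \<in> below (Suc m)" if "i \<le> m" for i
      using mult_G[OF comp_mem[OF X] comp_mem[OF Y], of i "m - i"] that by (intro G_below) simp
    have fs: "(\<Oplus>i\<in>{..m}. comp i X \<otimes> comp (m - i) Y) = (\<Oplus>\<^bsub>?B\<^esub>i\<in>{..m}. comp i X \<otimes> comp (m - i) Y)"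
    proof -
      have "(\<lambda>x. x) (\<Oplus>\<^bsub>?B\<^esub>i\<in>{..m}. comp i X \<otimes> comp (m - i) Y) = (\<Oplus>i\<in>{..m}. (\<lambda>x. x) (comp i X \<otimes> comp (m - i) Y))"
        by (rule lin_map_finsum[OF subspace_vs[OF vs_axioms below_subspace] vs_axioms])
          (auto intro!: lin_mapI z simp: below_closed)
      then show ?thesis by simp
    qed
    have "theta (X \<otimes> Y) m = symb m (\<Oplus>\<^bsub>?B\<^esub>i\<in>{..m}. comp i X \<otimes> comp (m - i) Y)"
      by (simp add: theta_def comp_mult[OF X Y] fs)
    also have "\<dots> = (\<Oplus>\<^bsub>P m\<^esub>i\<in>{..m}. symb m (comp i X \<otimes> comp (m - i) Y))"
      by (rule lin_map_finsum[OF subspace_vs[OF vs_axioms below_subspace] P_vs sl]) (auto intro!: z)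
    also have "\<dots> = (theta X \<otimes>\<^bsub>GR\<^esub> theta Y) m"
    proof -
      interpret P: vs "P m" by (rule P_vs)
      show ?thesis unfolding GR_simps theta_def
        by (rule P.add.finprod_cong')
          (auto simp: symb_mult[OF comp_below[OF X] comp_below[OF Y]] intro!: symb_closed z)
    qed
    finally show "theta (X \<otimes> Y) m = (theta X \<otimes>\<^bsub>GR\<^esub> theta Y) m" .
  qed
qed

private lemma theta_surj: "theta ` carrier A = carrier GR"
proof
  show "theta ` carrier A \<subseteq> carrier GR" using lin_map_closed[OF alg_hom_lin[OF theta_hom]] by blast
  show "carrier GR \<subseteq> theta ` carrier A"
  proof
    fix x assume x: "x \<in> carrier GR"
    then have "\<forall>m. \<exists>X\<in>below (Suc m). x m = symb m X" by (auto simp: GR_simps P_carrier image_iff)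
    then obtain X where X: "\<And>m. X m \<in> below (Suc m)" "\<And>m. x m = symb m (X m)" by metis
    \<comment> \<open>A representative of a class in degree m may be replaced by its part of degree
      m, since the two differ by parts of lower degree.\<close>
    have rep: "symb m (comp m (X m)) = x m" for m
    proof -
      note Xm = below_closed[OF X(1)[of m]]
      let ?W = "comp m (X m) \<ominus> X m"
      have "comp i ?W = \<zero>" if "i \<ge> m" for i
        using X(1)[of m] Xm that
        by (cases "i = m") (simp_all add: below_def comp_minus comp_comp minus_zero_iff)
      then have "?W \<in> below m" using Xm by (simp add: below_def)
      moreover have "?W \<ominus> ?W = \<zero>" using Xm minus_zero_iff[of ?W ?W] by simp
      then have "?W \<ominus> ?W \<in> J" using subspaceD(2)[OF J_sub] by metis
      ultimately show ?thesis unfolding X(2)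
        by (subst symb_eq_iff[OF comp_below[OF Xm] X(1)]) blast
    qed
    let ?I = "{m. x m \<noteq> \<zero>\<^bsub>P m\<^esub>}"
    have I: "finite ?I" using x by (simp add: GR_simps)
    let ?Y = "\<Oplus>i\<in>?I. comp i (X i)"
    have "theta ?Y m = x m" for m
      unfolding theta_def comp_finsum[OF I comp_mem[OF below_closed[OF X(1)]]]
      using rep[of m] by (auto simp: symb_zero)
    then have "theta ?Y = x" by blast
    moreover have "?Y \<in> carrier A" using below_closed[OF X(1)] by (intro finsum_closed) auto
    ultimately show "x \<in> theta ` carrier A" by (rule image_eqI[OF HOL.sym])
  qed
qed

text \<open>\<open>ker\<close> says that \<pi> kills a homogeneous element exactly when it is the
  leading part of an element of \<open>J\<close>, and \<open>graded\<close> that the kernel of \<pi>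
  is homogeneous. Together they make the kernels of \<open>theta\<close> and \<pi> equal.\<close>

theorem pbw_criterion:
  fixes C :: "('k, 'c, 'n) module_scheme"
  assumes C: "vs C" and hom: "alg_hom A C \<pi>" and surj: "\<pi> ` carrier A = carrier C"
    and graded: "\<And>X m. X \<in> carrier A \<Longrightarrow> \<pi> X = \<zero>\<^bsub>C\<^esub> \<Longrightarrow> \<pi> (comp m X) = \<zero>\<^bsub>C\<^esub>"
    and ker: "\<And>m X. X \<in> G m \<Longrightarrow> \<pi> X = \<zero>\<^bsub>C\<^esub> \<longleftrightarrow> (\<exists>W\<in>below m. X \<ominus> W \<in> J)"
  shows "pbw_deformation (quot A J) (quot_filtration A G J) C (\<lambda>m. \<pi> ` G m)"
proof -
  interpret C: vs C by fact
  note lin = alg_hom_lin[OF hom]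
  have "theta X = theta Y \<longleftrightarrow> \<pi> X = \<pi> Y" if X: "X \<in> carrier A" and Y: "Y \<in> carrier A" for X Y
  proof -
    have "theta X = theta Y \<longleftrightarrow> (\<forall>m. \<exists>W\<in>below m. comp m X \<ominus> comp m Y \<ominus> W \<in> J)"
      by (simp add: theta_def fun_eq_iff symb_eq_iff[OF comp_below[OF X] comp_below[OF Y]])
    also have "\<dots> \<longleftrightarrow> (\<forall>m. \<pi> (comp m (X \<ominus> Y)) = \<zero>\<^bsub>C\<^esub>)"
      using ker[OF comp_mem[of "X \<ominus> Y"]] X Y by (simp add: comp_minus)
    also have "\<dots> \<longleftrightarrow> \<pi> (X \<ominus> Y) = \<zero>\<^bsub>C\<^esub>"
    proof
      assume a: "\<forall>m. \<pi> (comp m (X \<ominus> Y)) = \<zero>\<^bsub>C\<^esub>"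
      have XY: "X \<ominus> Y \<in> carrier A" using X Y by simp
      have "\<pi> (X \<ominus> Y) = \<pi> (\<Oplus>i\<in>{m. comp m (X \<ominus> Y) \<noteq> \<zero>}. comp i (X \<ominus> Y))"
        using decompose[OF XY comp_finite[OF XY]] by simp
      also have "\<dots> = (\<Oplus>\<^bsub>C\<^esub>i\<in>{m. comp m (X \<ominus> Y) \<noteq> \<zero>}. \<pi> (comp i (X \<ominus> Y)))"
        using XY by (intro lin_map_finsum[OF vs_axioms C lin comp_finite]) auto
      also have "\<dots> = \<zero>\<^bsub>C\<^esub>" using a by (intro C.add.finprod_one_eqI) simp
      finally show "\<pi> (X \<ominus> Y) = \<zero>\<^bsub>C\<^esub>" .
    qed (use graded[of "X \<ominus> Y"] X Y in simp)
    also have "\<dots> \<longleftrightarrow> \<pi> X = \<pi> Y"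
      using lin_map_minus[OF vs_axioms C lin X Y] C.minus_zero_iff[OF lin_map_closed[OF lin X] lin_map_closed[OF lin Y]] by simp
    finally show ?thesis .
  qed
  from alg_iso_of_common_kernel[OF ring_axioms vs_axioms theta_hom theta_surj hom surj this]
  obtain \<phi> where \<phi>: "\<phi> \<in> alg_iso GR C" "\<And>X. X \<in> carrier A \<Longrightarrow> \<phi> (theta X) = \<pi> X" by auto
  have "gr_grading D Fil m = theta ` G m" for m
  proof
    show "theta ` G m \<subseteq> gr_grading D Fil m"
      using theta_surj G_carrier by (auto simp: gr_grading_def) (auto simp: theta_def comp_G symb_zero)
    show "gr_grading D Fil m \<subseteq> theta ` G m"
    proof
      fix x assume x: "x \<in> gr_grading D Fil m"
      then have "x \<in> theta ` carrier A" using theta_surj by (simp add: gr_grading_def)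
      then obtain X where X: "X \<in> carrier A" "x = theta X" by blast
      have "theta (comp m X) i = x i" for i
        using x X by (cases "i = m") (auto simp: gr_grading_def theta_def comp_comp symb_zero)
      then have "x = theta (comp m X)" by auto
      then show "x \<in> theta ` G m" using comp_mem[OF X(1)] by blast
    qed
  qed
  then have "\<phi> ` gr_grading D Fil m = \<pi> ` G m" for m
    using \<phi>(2) G_carrier by (auto simp: image_image)
  then show ?thesis using \<phi>(1) by (auto simp: pbw_deformation_def graded_iso_def)
qed

end

end

section \<open>Equivariance\<close>

text \<open>The values are noncommutative polynomials, so one formula describes the action on the
  quantum plane and, through \<open>incl\<close>, on both pairs of generators of the free
  algebra.\<close>

fun plane_act :: "'k::field \<Rightarrow> uq_gen \<Rightarrow> plane_gen \<Rightarrow> plane_gen list \<Rightarrow>\<^sub>0 'k" where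
  "plane_act q gE gu = 0" | "plane_act q gE gv = gen gu"
| "plane_act q gF gu = gen gv" | "plane_act q gF gv = 0"
| "plane_act q gK gu = scale q (gen gu)" | "plane_act q gK gv = scale (inverse q) (gen gv)"
| "plane_act q gKinv gu = scale (inverse q) (gen gu)" | "plane_act q gKinv gv = scale q (gen gv)"

lemma incl_zero [simp]: "incl j 0 = (0 :: 'k::field free4)"
  using incl_simps(5)[of j 0 0] by simp

lemma gen_gen: "gen x * gen y = Poly_Mapping.single [x, y] (1 :: 'k::field)"
  by (simp add: gen_def mult_single plus_list_def)

text \<open>The scalar part of \<kappa>. Among the r_i the word vu' occurs only in r_4 and uv' only
  in r_5, so reading off these two coefficients gives a map that is linear on the whole free algebra
  and has the prescribed values.\<close>

definition kap :: "'k::field \<Rightarrow> 'k \<Rightarrow> 'k free4 \<Rightarrow> 'k" where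
  "kap q \<alpha> t = \<alpha> * (Poly_Mapping.lookup t [V, U'] - inverse q * Poly_Mapping.lookup t [U, V'])"

lemma kap_linear: "kap q \<alpha> (s + t) = kap q \<alpha> s + kap q \<alpha> t" "kap q \<alpha> (scale c t) = c * kap q \<alpha> t" "kap q \<alpha> 0 = 0"
  by (simp_all add: kap_def lookup_add lookup_scale algebra_simps)

lemma kap_rels: "kap q \<alpha> (r1 q) = 0" "kap q \<alpha> (r2 q) = 0" "kap q \<alpha> (r3 q) = 0" "kap q \<alpha> (r6 q) = 0"
  "kap q \<alpha> (r4 q) = \<alpha>" "kap q \<alpha> (r5 q) = - inverse q * \<alpha>"
  by (simp_all add: kap_def r1_def r2_def r3_def r4_def r5_def r6_def gen_gen lookup_add lookup_minus
      lookup_single when_def del: scale_simps(2))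

locale equivariant = twisted q \<tau>
    + T: uq_module q "free_alg :: ('k, tw_gen list \<Rightarrow>\<^sub>0 'k) module" actT
    + P: uq_module q "qplane q" act
  for q :: "'k::field" and \<tau> and actT and act +
  assumes std_act: "std_action q (qplane q) act (qpg q gu) (qpg q gv)"
    and std_actT: "std_action q (free_alg :: ('k, tw_gen list \<Rightarrow>\<^sub>0 'k) module) actT (gen U) (gen V)"
    and std_actT': "std_action q (free_alg :: ('k, tw_gen list \<Rightarrow>\<^sub>0 'k) module) actT (gen U') (gen V')"
begin

lemmas actT_prod = T.act_gen_prod[simplified] and actT_unit = T.act_gen_unit[simplified]

lemma actT_linear: "h \<in> carrier H \<Longrightarrow> actT h (x + y) = actT h x + actT h y"
  "h \<in> carrier H \<Longrightarrow> actT h (scale c x) = scale c (actT h x)"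
  "h \<in> carrier H \<Longrightarrow> actT h (x - y) = actT h x - actT h y" "h \<in> carrier H \<Longrightarrow> actT h 0 = 0"
proof -
  assume h: "h \<in> carrier H"
  show "actT h (x + y) = actT h x + actT h y" "actT h (scale c x) = scale c (actT h x)"
    using lin_map_add[OF T.act_lin[OF h], of x y] lin_map_smult[OF T.act_lin[OF h], of x c] by simp_all
  show "actT h (x - y) = actT h x - actT h y" "actT h 0 = 0"
    using lin_map_minus[OF free_alg_vs free_alg_vs T.act_lin[OF h], of x y] lin_map_zero[OF free_alg_vs free_alg_vs T.act_lin[OF h]]
    by simp_all
qed

lemma actT_gen: "j = primed \<or> j = unprimed \<Longrightarrow> actT (uqg q x) (gen (j g)) = incl j (plane_act q x g)"
  using std_actT std_actT' unfolding std_action_def by (cases x; cases g) auto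

lemma pcls_zero: "pcls 0 = \<zero>\<^bsub>A\<^esub>"
  by (simp add: qplane_def cls_simps)

lemma act_gen: "act (uqg q x) (qpg q g) = pcls (plane_act q x g)"
  using std_act unfolding std_action_def by (cases x; cases g) (simp_all add: pcls_simps pcls_zero)

text \<open>No action is given on the free algebra on u and v. The common element t' serves instead:
  one word-level computation describes the action in the large free algebra and in the quantum plane
  at once.\<close>

lemma incl_act_gen:
  assumes j: "j = primed \<or> j = unprimed"
  shows "\<exists>t'. actT (uqg q x) (incl j t) = incl j t' \<and> act (uqg q x) (pcls t) = pcls t'"
proof (induction t arbitrary: x rule: free_alg_induct)
  case one
  have "actT (uqg q x) (incl j 1) = incl j (if x = gK \<or> x = gKinv then 1 else 0) \<and>
      act (uqg q x) (pcls 1) = pcls (if x = gK \<or> x = gKinv then 1 else 0)"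
    by (cases x) (simp_all add: actT_unit P.act_gen_unit pcls_simps pcls_zero)
  then show ?case by (rule exI)
next
  case (gen g)
  show ?case using actT_gen[OF j, of x g] act_gen[of x g] by (auto simp: pcls_simps)
next
  case (add s t)
  obtain s' t' where "actT (uqg q x) (incl j s) = incl j s'" "act (uqg q x) (pcls s) = pcls s'"
    "actT (uqg q x) (incl j t) = incl j t'" "act (uqg q x) (pcls t) = pcls t'"
    using add by meson
  then show ?case by (intro exI[of _ "s' + t'"]) (simp add: actT_linear pcls_simps lin_map_add[OF P.act_lin])
next
  case (scale c t)
  obtain t' where "actT (uqg q x) (incl j t) = incl j t'" "act (uqg q x) (pcls t) = pcls t'" using scale by meson
  then show ?case by (intro exI[of _ "scale c t'"]) (simp add: actT_linear pcls_simps lin_map_smult[OF P.act_lin])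
next
  case (mult s t)
  \<comment> \<open>Results are chosen for all generators simultaneously, since the coproducts of E
    and F also involve K and K^{-1}.\<close>
  obtain S1 T1 where "\<And>x. actT (uqg q x) (incl j s) = incl j (S1 x)" "\<And>x. act (uqg q x) (pcls s) = pcls (S1 x)"
    "\<And>x. actT (uqg q x) (incl j t) = incl j (T1 x)" "\<And>x. act (uqg q x) (pcls t) = pcls (T1 x)"
    using mult by metis
  note * = this
  show ?case
  proof (cases x)
    case gK
    then show ?thesis by (intro exI[of _ "S1 gK * T1 gK"]) (simp add: * actT_prod P.act_gen_prod pcls_simps)
  next
    case gKinv
    then show ?thesis by (intro exI[of _ "S1 gKinv * T1 gKinv"]) (simp add: * actT_prod P.act_gen_prod pcls_simps)
  next
    case gE
    then show ?thesis by (intro exI[of _ "S1 gE * t + S1 gK * T1 gE"]) (simp add: * actT_prod P.act_gen_prod pcls_simps)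
  next
    case gF
    then show ?thesis by (intro exI[of _ "S1 gF * T1 gKinv + s * T1 gF"]) (simp add: * actT_prod P.act_gen_prod pcls_simps)
  qed
qed

lemma incl_act:
  assumes j: "j = primed \<or> j = unprimed" and "h \<in> carrier H"
  shows "\<exists>t'. actT h (incl j t) = incl j t' \<and> act h (pcls t) = pcls t'"
  using assms(2)
proof (induction arbitrary: t rule: H_induct)
  case one
  then show ?case using T.act_one[of "incl j t"] P.act_one[of "pcls t"] by auto
next
  case (gen g)
  then show ?case by (rule incl_act_gen[OF j])
next
  case (add x y)
  obtain s' t' where "actT x (incl j t) = incl j s'" "act x (pcls t) = pcls s'"
    "actT y (incl j t) = incl j t'" "act y (pcls t) = pcls t'"
    using add by meson
  then show ?case using add(1,2) lin_map_add[OF T.act_lin_left, of "incl j t" x y] lin_map_add[OF P.act_lin_left, of "pcls t" x y]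
    by (intro exI[of _ "s' + t'"]) (simp add: pcls_simps)
next
  case (smult c x)
  obtain t' where "actT x (incl j t) = incl j t'" "act x (pcls t) = pcls t'"
    using smult by meson
  then show ?case using smult(1) lin_map_smult[OF T.act_lin_left, of "incl j t" x c] lin_map_smult[OF P.act_lin_left, of "pcls t" x c]
    by (intro exI[of _ "scale c t'"]) (simp add: pcls_simps)
next
  case (mult x y)
  obtain t' where t': "actT y (incl j t) = incl j t'" "act y (pcls t) = pcls t'" using mult by meson
  obtain t'' where "actT x (incl j t') = incl j t''" "act x (pcls t') = pcls t''" using mult by meson
  then show ?case using mult(1,2) t' by (intro exI[of _ t'']) (simp add: T.act_mult P.act_mult)
qed

section \<open>The diagonal action on A' tensor A\<close>

abbreviation "tact \<equiv> tensor_act (Uq q) A A act act"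

lemma tact_bilin_H: "x \<in> carrier A \<Longrightarrow> y \<in> carrier A \<Longrightarrow> bilin H H AA (\<lambda>h1 h2. pure A A (act h1 x) (act h2 y))"
  and tact_bilin_A: "h1 \<in> carrier H \<Longrightarrow> h2 \<in> carrier H \<Longrightarrow> bilin A A AA (\<lambda>x y. pure A A (act h1 x) (act h2 y))"
  by (auto intro!: bilinI lin_map_comp[OF P.act_lin_left apure_lin(1)] lin_map_comp[OF P.act_lin_left apure_lin(2)]
      lin_map_comp[OF P.act_lin apure_lin(1)] lin_map_comp[OF P.act_lin apure_lin(2)])

lemma tact_lin: "h \<in> carrier H \<Longrightarrow> lin_map AA AA (tact h)"
  using bilin_left[OF tlift_tlift_bilin[OF A.vs_axioms A.vs_axioms H.vs_axioms H.vs_axioms AA.vs_axioms tact_bilin_H tact_bilin_A], of "\<Delta> h"]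
  by (simp add: tensor_act_def[abs_def])

lemma tact_lin_left: "X \<in> carrier AA \<Longrightarrow> lin_map H AA (\<lambda>h. tact h X)"
  using lin_map_comp[OF comult_lin bilin_right[OF tlift_tlift_bilin[OF A.vs_axioms A.vs_axioms H.vs_axioms H.vs_axioms AA.vs_axioms tact_bilin_H tact_bilin_A], of X]]
  by (simp add: tensor_act_def[abs_def])

lemma tact_pure: "h \<in> carrier H \<Longrightarrow> x \<in> carrier A \<Longrightarrow> y \<in> carrier A \<Longrightarrow>
    tact h (pure A A x y) = tlift AA (\<lambda>h1 h2. pure A A (act h1 x) (act h2 y)) (\<Delta> h)"
  using tlift_tlift_left[OF A.vs_axioms A.vs_axioms H.vs_axioms H.vs_axioms AA.vs_axioms tact_bilin_H tact_bilin_A, of x y "\<Delta> h"]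
  by (simp add: tensor_act_def)

text \<open>On a primed polynomial times an unprimed one, both actions expand over \<Delta>(h) in
  the same way, and \<open>incl_act\<close> keeps every term of this shape.\<close>

lemma proj_act_incl:
  assumes h: "h \<in> carrier H"
  shows "proj (actT h (incl primed x * incl unprimed y)) = tact h (proj (incl primed x * incl unprimed y))"
proof -
  note bl = T.act_prod_bilin[simplified, of "incl primed x" "incl unprimed y"]
  have "proj (actT h (incl primed x * incl unprimed y)) =
      proj (tlift free_alg (\<lambda>h1 h2. actT h1 (incl primed x) * actT h2 (incl unprimed y)) (\<Delta> h))"
    using T.act_prod[OF h, of "incl primed x" "incl unprimed y"] by simp
  also have "\<dots> = tlift AA (\<lambda>h1 h2. proj (actT h1 (incl primed x) * actT h2 (incl unprimed y))) (\<Delta> h)"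
    by (rule tlift_comp[OF H.vs_axioms H.vs_axioms free_alg_vs bl AA.vs_axioms proj_lin comult_closed[OF h]])
  also have "\<dots> = tlift AA (\<lambda>h1 h2. pure A A (act h1 (pcls x)) (act h2 (pcls y))) (\<Delta> h)"
  proof (rule tlift_cong[OF H.vs_axioms H.vs_axioms AA.vs_axioms tact_bilin_H[OF pcls_closed(1) pcls_closed(1)] _ comult_closed[OF h]])
    fix h1 h2 assume "h1 \<in> carrier H" "h2 \<in> carrier H"
    then obtain x' y' where "actT h1 (incl primed x) = incl primed x'" "act h1 (pcls x) = pcls x'"
       "actT h2 (incl unprimed y) = incl unprimed y'" "act h2 (pcls y) = pcls y'"
      using incl_act[of primed h1 x] incl_act[of unprimed h2 y] by blast
    then show "proj (actT h1 (incl primed x) * actT h2 (incl unprimed y)) = pure A A (act h1 (pcls x)) (act h2 (pcls y))"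
      by (simp add: proj_incl)
  qed
  also have "\<dots> = tact h (proj (incl primed x * incl unprimed y))"
    using h by (simp add: proj_incl tact_pure)
  finally show ?thesis .
qed

section \<open>The action on the relations and on the ideal they generate\<close>

abbreviation "rel_span \<equiv> lspan free_alg (tw_rels q)"

text \<open>All terms are words of length two, so coefficients can be compared. The values at E.r_6
  and F.r_3 are the ones that tie \<kappa>(r_5) to \<kappa>(r_4).\<close>

lemma act_rels:
  "actT k1 (r1 q) = r1 q" "actT k1 (r2 q) = r2 q" "actT k1 (r3 q) = scale (q * q) (r3 q)" "actT k1 (r4 q) = r4 q"
  "actT k1 (r5 q) = r5 q" "actT k1 (r6 q) = scale (inverse q * inverse q) (r6 q)"
  "actT k' (r1 q) = r1 q" "actT k' (r2 q) = r2 q" "actT k' (r3 q) = scale (inverse q * inverse q) (r3 q)" "actT k' (r4 q) = r4 q"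
  "actT k' (r5 q) = r5 q" "actT k' (r6 q) = scale (q * q) (r6 q)"
  "actT e (r1 q) = 0" "actT e (r2 q) = 0" "actT e (r3 q) = 0" "actT e (r4 q) = r3 q" "actT e (r5 q) = scale q (r3 q)"
  "actT e (r6 q) = scale (inverse q) (r4 q) + r5 q"
  "actT f (r1 q) = 0" "actT f (r2 q) = 0" "actT f (r3 q) = scale (inverse q) (r4 q) + r5 q" "actT f (r4 q) = r6 q"
  "actT f (r5 q) = scale q (r6 q)" "actT f (r6 q) = 0"
proof -
  note st = std_actT[unfolded std_action_def] std_actT'[unfolded std_action_def]
  note defs = r1_def r2_def r3_def r4_def r5_def r6_def
  have iq: "q * inverse q = 1" "inverse q * q = 1" "q * (inverse q * y) = y" "inverse q * (q * y) = y" for y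
    using q_nonzero by simp_all
  note s = actT_linear actT_prod scale_mult_left scale_mult_right st
  note t = gen_gen lookup_add lookup_minus lookup_scale
    lookup_single_delta algebra_simps iq power2_eq_square power3_eq_cube
  show "actT k1 (r1 q) = r1 q" "actT k1 (r2 q) = r2 q" "actT k1 (r3 q) = scale (q * q) (r3 q)" "actT k1 (r4 q) = r4 q"
    "actT k1 (r5 q) = r5 q" "actT k1 (r6 q) = scale (inverse q * inverse q) (r6 q)"
    "actT k' (r1 q) = r1 q" "actT k' (r2 q) = r2 q" "actT k' (r3 q) = scale (inverse q * inverse q) (r3 q)" "actT k' (r4 q) = r4 q"
    "actT k' (r5 q) = r5 q" "actT k' (r6 q) = scale (q * q) (r6 q)"
    by (rule poly_mapping_eqI; simp only: defs; simp add: s; simp add: t)+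
  show "actT e (r1 q) = 0" "actT e (r2 q) = 0" "actT e (r3 q) = 0" "actT e (r4 q) = r3 q" "actT e (r5 q) = scale q (r3 q)"
    "actT e (r6 q) = scale (inverse q) (r4 q) + r5 q"
    by (rule poly_mapping_eqI; simp only: defs; simp add: s; simp add: t)+
  show "actT f (r1 q) = 0" "actT f (r2 q) = 0" "actT f (r3 q) = scale (inverse q) (r4 q) + r5 q" "actT f (r4 q) = r6 q"
    "actT f (r5 q) = scale q (r6 q)" "actT f (r6 q) = 0"
    by (rule poly_mapping_eqI; simp only: defs; simp add: s; simp add: t)+
qed

lemma rel_span_subspace: "subspace free_alg rel_span"
  by (rule vs.lspan_subspace[OF free_alg_vs]) simp

lemma rel_span_closed: "x \<in> rel_span \<Longrightarrow> y \<in> rel_span \<Longrightarrow> x + y \<in> rel_span" "x \<in> rel_span \<Longrightarrow> scale c x \<in> rel_span"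
  "0 \<in> rel_span" "r \<in> tw_rels q \<Longrightarrow> r \<in> rel_span"
  using subspaceD[OF rel_span_subspace, simplified] vs.lspan_base[OF free_alg_vs] by auto

text \<open>Equivariance with respect to the trivial action on scalars. The only critical case is
  q^{-1} r_4 + r_5, which \<open>kap\<close> sends to q^{-1} \<alpha> - q^{-1} \<alpha> = 0.\<close>

lemma rel_span_act:
  assumes "r \<in> rel_span"
  shows "actT (uqg q x) r \<in> rel_span \<and> kap q \<alpha> (actT (uqg q x) r) = uq_counit_gen x * kap q \<alpha> r"
  using assms
proof (induction rule: vs.lspan_induct[OF free_alg_vs, consumes 1, case_names sub base zero add smult])
  case (base r)
  have m: "r1 q \<in> rel_span" "r2 q \<in> rel_span" "r3 q \<in> rel_span" "r4 q \<in> rel_span" "r5 q \<in> rel_span" "r6 q \<in> rel_span"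
    by (rule rel_span_closed(4); simp add: tw_rels_def)+
  show ?case
  proof (cases x)
    case gK
    then show ?thesis using base[unfolded tw_rels_def] m by (auto simp: act_rels kap_linear kap_rels intro!: rel_span_closed(1-3))
  next
    case gKinv
    then show ?thesis using base[unfolded tw_rels_def] m by (auto simp: act_rels kap_linear kap_rels intro!: rel_span_closed(1-3))
  next
    case gE
    then show ?thesis using base[unfolded tw_rels_def] m by (auto simp: act_rels kap_linear kap_rels intro!: rel_span_closed(1-3))
  next
    case gF
    then show ?thesis using base[unfolded tw_rels_def] m by (auto simp: act_rels kap_linear kap_rels intro!: rel_span_closed(1-3))
  qed
qed (auto simp: actT_linear kap_linear algebra_simps intro: rel_span_closed)

lemma rel_span_ideal: "r \<in> rel_span \<Longrightarrow> r \<in> rel_ideal"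
  using vs.lspan_minimal[OF free_alg_vs rel_subspace] rel_ideal_base by blast

text \<open>E and F act on products through K and K^{-1} as well, so closure under all four
  generators is carried along in one set, which is then seen to be an ideal.\<close>

lemma rel_ideal_act_gen: assumes "i \<in> rel_ideal" shows "actT (uqg q x) i \<in> rel_ideal"
proof -
  let ?N = "{i \<in> rel_ideal. \<forall>x. actT (uqg q x) i \<in> rel_ideal}"
  have "ideal ?N free_alg"
  proof (rule alg.subspace_idealI[OF free_alg_alg])
    show "subspace free_alg ?N"
      by (rule vs.subspaceI[OF free_alg_vs]) (auto simp: actT_linear rel_ideal_closed)
    fix a t assume a: "a \<in> ?N" "t \<in> carrier (free_alg :: ('k, tw_gen list \<Rightarrow>\<^sub>0 'k) module)"
    show "t \<otimes>\<^bsub>free_alg\<^esub> a \<in> ?N"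
    proof (simp, intro conjI allI)
      show "t * a \<in> rel_ideal" using a rel_ideal_closed by simp
      show "actT (uqg q x) (t * a) \<in> rel_ideal" for x
        using a by (cases x) (simp_all add: actT_prod rel_ideal_closed)
    qed
    show "a \<otimes>\<^bsub>free_alg\<^esub> t \<in> ?N"
    proof (simp, intro conjI allI)
      show "a * t \<in> rel_ideal" using a rel_ideal_closed by simp
      show "actT (uqg q x) (a * t) \<in> rel_ideal" for x
        using a by (cases x) (simp_all add: actT_prod rel_ideal_closed)
    qed
  qed
  moreover have "tw_rels q \<subseteq> ?N" using rel_span_act rel_span_ideal rel_span_closed(4) by blast
  ultimately show ?thesis using genideal_free_minimal[of ?N "tw_rels q"] assms by blast
qed

lemma rel_ideal_act: "h \<in> carrier H \<Longrightarrow> i \<in> rel_ideal \<Longrightarrow> actT h i \<in> rel_ideal"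
proof (induction arbitrary: i rule: H_induct)
  case one
  then show ?case using T.act_one[of i] by simp
next
  case (add x y)
  then show ?case using lin_map_add[OF T.act_lin_left, of i x y] by (simp add: rel_ideal_closed)
next
  case (smult c x)
  then show ?case using lin_map_smult[OF T.act_lin_left, of i x c] by (simp add: rel_ideal_closed)
next
  case (mult x y)
  then show ?case by (simp add: T.act_mult)
qed (rule rel_ideal_act_gen)

text \<open>Modulo the ideal, which is stable under the action, t may be replaced by its normal
  form; ordered words are primed words times unprimed words, so \<open>proj_act_incl\<close>
  applies.\<close>

lemma proj_act:
  assumes h: "h \<in> carrier H" shows "proj (actT h t) = tact h (proj t)"
proof -
  let ?s = "rho q 0 t vac"
  note lin = lin_map_comp[OF T.act_lin[OF h] proj_lin] lin_map_comp[OF proj_lin tact_lin[OF h]]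
  have sig: "proj (actT h (sig s)) = tact h (proj (sig s))" for s
  proof (induction s rule: poly_mapping_induct)
    case zero
    then show ?case using lin_map_zero[OF free_alg_vs AA.vs_axioms lin(1)] lin_map_zero[OF free_alg_vs AA.vs_axioms lin(2)] by simp
  next
    case (add k c x)
    obtain a b c' d z where k: "k = (a, b, c', d, z)" by (cases k)
    have "proj (actT h (normal_word k)) = tact h (proj (normal_word k))"
      using proj_act_incl[OF h, of "gen gv ^ a * gen gu ^ b" "gen gv ^ c' * gen gu ^ d"] by (simp add: k mult.assoc)
    then show ?case
      using add lin_map_add[OF lin(1), of "scale c (normal_word k)" "sig x"] lin_map_add[OF lin(2), of "scale c (normal_word k)" "sig x"]
        lin_map_smult[OF lin(1), of "normal_word k" c] lin_map_smult[OF lin(2), of "normal_word k" c]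
      by simp
  qed
  have "proj t = proj (sig ?s)" using straighten[of t] by (simp add: proj_eq_iff del: rho_simps)
  moreover have "proj (actT h t) = proj (actT h (sig ?s))"
    using rel_ideal_act[OF h straighten[of t]] by (simp add: proj_eq_iff actT_linear[OF h] del: rho_simps)
  ultimately show ?thesis using sig[of ?s] by (simp del: rho_simps)
qed

end

section \<open>Gradings\<close>

definition cpt :: "nat \<Rightarrow> ('x list \<Rightarrow>\<^sub>0 'k::field) \<Rightarrow> 'x list \<Rightarrow>\<^sub>0 'k" where
  "cpt m = lext (\<lambda>w. if length w = m then Poly_Mapping.single w 1 else 0)"

lemma cpt_simps [simp]: "cpt m (x + y) = cpt m x + cpt m y" "cpt m (scale c x) = scale c (cpt m x)" "cpt m 0 = 0"
  by (simp_all add: cpt_def)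

lemma cpt_lin: "lin_map free_alg free_alg (cpt m)"
  by (rule lin_mapI) simp_all

lemma cpt_minus [simp]: "cpt m (x - y) = cpt m x - cpt m y"
  using lin_map_minus[OF free_alg_vs free_alg_vs cpt_lin, of x y] by simp

lemma free_hom_subspace: "subspace free_alg (free_hom m)"
  by (rule vs.subspaceI[OF free_alg_vs]) (use keys_add keys_scale in \<open>fastforce simp: free_hom_def\<close>)+

lemma free_hom_simps: "x \<in> free_hom m \<Longrightarrow> y \<in> free_hom m \<Longrightarrow> x + y \<in> free_hom m"
  "x \<in> free_hom m \<Longrightarrow> scale c x \<in> free_hom m" "0 \<in> free_hom m" "x \<in> free_hom m \<Longrightarrow> y \<in> free_hom m \<Longrightarrow> x - y \<in> free_hom m"
  using subspaceD[OF free_hom_subspace] by simp_all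

lemma free_hom_single: "Poly_Mapping.single w c \<in> free_hom (length w)"
  by (simp add: free_hom_def)

lemma free_hom_gen: "gen g \<in> free_hom 1"
  by (simp add: free_hom_def gen_def)

lemma free_hom_one: "1 \<in> free_hom 0"
  using free_hom_single[of "[]" 1] by (simp add: single_Nil)

lemma free_hom_induct [consumes 1, case_names zero add]:
  assumes "x \<in> free_hom m" "P 0"
    "\<And>w c x. length w = m \<Longrightarrow> x \<in> free_hom m \<Longrightarrow> P x \<Longrightarrow> P (Poly_Mapping.single w c + x)"
  shows "P x"
proof -
  have "Poly_Mapping.keys x \<subseteq> {w. length w = m}" using assms(1) by (auto simp: free_hom_def)
  then show ?thesis
    by (induction rule: poly_mapping_single_induct) (auto intro!: assms(2,3) simp: free_hom_def)
qed

lemma cpt_free_hom: "x \<in> free_hom m \<Longrightarrow> cpt i x = (if i = m then x else 0)"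
  by (induction rule: free_hom_induct) (auto simp: cpt_def)

lemma free_hom_mult: "x \<in> free_hom i \<Longrightarrow> y \<in> free_hom j \<Longrightarrow> x * y \<in> free_hom (i + j)"
proof (induction rule: free_hom_induct)
  case zero
  then show ?case by (simp add: free_hom_simps)
next
  case (add v c x)
  from add(4) have "Poly_Mapping.single v c * y \<in> free_hom (i + j)"
  proof (induction rule: free_hom_induct)
    case zero
    then show ?case by (simp add: free_hom_simps)
  next
    case (add w d y)
    have "Poly_Mapping.single v c * Poly_Mapping.single w d \<in> free_hom (i + j)"
      using \<open>length v = i\<close> add(1) by (simp add: mult_single plus_list_def free_hom_def)
    then show ?case using add by (simp add: distrib_left free_hom_simps)
  qed
  then show ?case using add by (simp add: distrib_right free_hom_simps)
qed

lemma free_hom_power: "x \<in> free_hom 1 \<Longrightarrow> x ^ n \<in> free_hom n"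
  by (induction n) (use free_hom_mult[of x 1] in \<open>auto simp: free_hom_one\<close>)

lemma cpt_mem: "cpt m x \<in> free_hom m"
  by (induction x rule: poly_mapping_induct)
    (auto simp: cpt_def free_hom_simps free_hom_single)

lemma cpt_finite: "finite {m. cpt m x \<noteq> 0}"
proof (induction x rule: poly_mapping_induct)
  case (add k c x)
  have "{m. cpt m (Poly_Mapping.single k c + x) \<noteq> 0} \<subseteq> insert (length k) {m. cpt m x \<noteq> 0}"
    by (auto simp: cpt_def)
  then show ?case using add finite_subset by blast
qed simp

lemma cpt_inj: assumes "\<And>m. cpt m x = 0" shows "x = 0"
proof (rule poly_mapping_eqI)
  fix w
  have "Poly_Mapping.lookup (cpt (length w) x) w = Poly_Mapping.lookup x w"
    by (induction x rule: poly_mapping_induct) (auto simp: cpt_def lookup_add lookup_single when_def)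
  then show "Poly_Mapping.lookup x w = Poly_Mapping.lookup 0 w" using assms by simp
qed

lemma incl_free_hom: "x \<in> free_hom m \<Longrightarrow> (incl j x :: 'k::field free4) \<in> free_hom m"
proof (induction rule: free_hom_induct)
  case (add w c x)
  have "(incl j (Poly_Mapping.single w 1) :: 'k free4) \<in> free_hom (length w)" for w
  proof (induction w)
    case (Cons g w)
    then show ?case using free_hom_mult[OF free_hom_gen[of "j g"] Cons] by (simp add: single_Cons)
  qed (simp add: single_Nil free_hom_one)
  then have "scale c (incl j (Poly_Mapping.single w 1) :: 'k free4) \<in> free_hom m" using add(1) free_hom_simps by blast
  then have "(incl j (scale c (Poly_Mapping.single w 1)) :: 'k free4) \<in> free_hom m" by (simp only: incl_simps)
  then show ?case using add by (simp add: free_hom_simps)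
qed (simp add: free_hom_simps)

lemma tw_rels_free_hom:
  fixes q :: "'k::field"
  shows "r \<in> tw_rels q \<Longrightarrow> r \<in> free_hom 2"
proof -
  have g: "gen x * gen y \<in> (free_hom 2 :: 'k free4 set)" for x y
    using free_hom_mult[OF free_hom_gen[of x] free_hom_gen[of y]] by (simp add: numeral_2_eq_2)
  show "r \<in> tw_rels q \<Longrightarrow> r \<in> free_hom 2"
    unfolding tw_rels_def r1_def r2_def r3_def r4_def r5_def r6_def by (auto intro!: g free_hom_simps)
qed

lemma const_part_rho_vac: "const_part (rho q \<alpha> t vac) = rho q 0 t vac"
  by (simp only: const_part_rho const_part_vac)

context twisted begin

lemma keys_rho: "t \<in> free_hom m \<Longrightarrow> Poly_Mapping.keys (rho q \<alpha> t vac) \<subseteq> {i. weight i = m}"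
proof (induction rule: free_hom_induct)
  case (add w c x)
  have "Poly_Mapping.single w c = scale c (Poly_Mapping.single w 1)" by simp
  then have e: "rho q \<alpha> (Poly_Mapping.single w c + x) vac = scale c (rho q \<alpha> (Poly_Mapping.single w 1) vac) + rho q \<alpha> x vac"
    by (metis rho_simps(3,4))
  show ?case unfolding e
    using add keys_rho_word[of \<alpha> w] keys_add[of "scale c (rho q \<alpha> (Poly_Mapping.single w 1) vac)" "rho q \<alpha> x vac"]
      keys_scale[of c "rho q \<alpha> (Poly_Mapping.single w 1) vac"] by blast
qed simp

abbreviation "AA_grading \<equiv> tensor_grading A A (qplane_grading q) (qplane_grading q)"

lemma AA_grading_subspace: "subspace AA (AA_grading m)"
  unfolding tensor_grading_def
  by (rule AA.lspan_subspace) (auto simp: qplane_grading_def)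

lemma AA_grading_pure: "x \<in> free_hom i \<Longrightarrow> y \<in> free_hom j \<Longrightarrow> i + j = m \<Longrightarrow> pure A A (pcls x) (pcls y) \<in> AA_grading m"
  unfolding tensor_grading_def qplane_grading_def by (rule AA.lspan_base) blast

text \<open>After \<zeta> = 0 only monomials without \<zeta> remain, and for these the weight is the
  degree in the two quantum planes.\<close>

lemma realize_const_part:
  assumes "Poly_Mapping.keys x \<subseteq> {i. weight i = m}"
  shows "realize (const_part x) \<in> AA_grading m"
  using assms
proof (induction rule: poly_mapping_single_induct)
  case zero
  then show ?case
    using lin_map_zero[OF free_vs_vs AA.vs_axioms realize_lin] subspaceD(2)[OF AA_grading_subspace]
    by (simp add: const_part_def)
next
  case (add k c x)
  obtain a b c' d z where k: "k = (a, b, c', d, z)" by (cases k)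
  have "realize (const_part (Poly_Mapping.single k 1)) \<in> AA_grading m"
  proof (cases "z = 0")
    case True
    then show ?thesis using add(1)
      by (auto simp: k const_part_def realize_single intro!: AA_grading_pure[of _ "a + b" _ "c' + d"] free_hom_mult free_hom_power free_hom_gen)
  next
    case False
    then show ?thesis
      using lin_map_zero[OF free_vs_vs AA.vs_axioms realize_lin] subspaceD(2)[OF AA_grading_subspace]
      by (simp add: k const_part_def)
  qed
  moreover have "const_part (Poly_Mapping.single k c + x) = scale c (const_part (Poly_Mapping.single k 1)) + const_part x"
    by (simp add: const_part_def)
  ultimately show ?case
    using add lin_map_add[OF realize_lin, of "scale c (const_part (Poly_Mapping.single k 1))" "const_part x"]
      lin_map_smult[OF realize_lin, of "const_part (Poly_Mapping.single k 1)" c] subspaceD(4,5)[OF AA_grading_subspace]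
    by simp
qed

lemma proj_free_hom: "proj ` free_hom m = AA_grading m"
proof
  show "proj ` free_hom m \<subseteq> AA_grading m"
  proof
    fix X assume "X \<in> proj ` free_hom m"
    then obtain t where t: "t \<in> free_hom m" "X = proj t" by blast
    then have "X = realize (const_part (rho q 0 t vac))" by (simp only: const_part_rho_vac proj_realize)
    then show "X \<in> AA_grading m" using realize_const_part[OF keys_rho[OF t(1)]] by simp
  qed
  have "pure A A a b \<in> proj ` free_hom m" if ab: "a \<in> qplane_grading q i" "b \<in> qplane_grading q j" "i + j = m" for a b i j
  proof -
    obtain x y where "x \<in> free_hom i" "a = pcls x" "y \<in> free_hom j" "b = pcls y"
      using ab by (auto simp: qplane_grading_def)
    then have "pure A A a b = proj (incl primed x * incl unprimed y)" "incl primed x * incl unprimed y \<in> free_hom m"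
      using free_hom_mult[OF incl_free_hom incl_free_hom, of x i y j primed unprimed] ab(3)
      by (simp_all add: proj_incl)
    then show ?thesis by (rule image_eqI)
  qed
  then show "AA_grading m \<subseteq> proj ` free_hom m"
    unfolding tensor_grading_def
    by (intro AA.lspan_minimal subspace_image[OF free_alg_vs AA.vs_axioms proj_lin free_hom_subspace]) blast
qed

end

section \<open>The smash product of the free algebra with the quantum group as a graded
  algebra\<close>

context equivariant begin

abbreviation "TH \<equiv> tensor (free_alg :: ('k, tw_gen list \<Rightarrow>\<^sub>0 'k) module) H"
abbreviation "tp \<equiv> pure (free_alg :: ('k, tw_gen list \<Rightarrow>\<^sub>0 'k) module) H"
abbreviation "SM \<equiv> smash (free_alg :: ('k, tw_gen list \<Rightarrow>\<^sub>0 'k) module) (Uq q) actT"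
abbreviation "grading \<equiv> smash_grading (free_alg :: ('k, tw_gen list \<Rightarrow>\<^sub>0 'k) module) (Uq q) free_hom"

lemma tp_simps: "h \<in> carrier H \<Longrightarrow> tp (x + y) h = tp x h \<oplus>\<^bsub>TH\<^esub> tp y h"
  "h \<in> carrier H \<Longrightarrow> tp (scale c x) h = c \<odot>\<^bsub>TH\<^esub> tp x h"
  "h \<in> carrier H \<Longrightarrow> g \<in> carrier H \<Longrightarrow> tp x (h \<oplus>\<^bsub>H\<^esub> g) = tp x h \<oplus>\<^bsub>TH\<^esub> tp x g"
  "h \<in> carrier H \<Longrightarrow> tp x (c \<odot>\<^bsub>H\<^esub> h) = c \<odot>\<^bsub>TH\<^esub> tp x h"
  "h \<in> carrier H \<Longrightarrow> tp (x - y) h = tp x h \<ominus>\<^bsub>TH\<^esub> tp y h" "h \<in> carrier H \<Longrightarrow> tp 0 h = \<zero>\<^bsub>TH\<^esub>"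
  using pure_add_left[OF free_alg_vs H.vs_axioms, of x y h] pure_smult_left[OF free_alg_vs H.vs_axioms, of x h c]
    pure_add_right[OF free_alg_vs H.vs_axioms, of x h g] pure_smult_right[OF free_alg_vs H.vs_axioms, of x h c]
    lin_map_minus[OF free_alg_vs T.RH.vs_axioms T.rpure_lin(1), of h x y] T.rpure_zero[of h]
  by simp_all

lemma tp_closed [simp]: "h \<in> carrier H \<Longrightarrow> tp x h \<in> carrier TH"
  by simp

lemma grading_eq: "grading m = lspan TH {tp a h | a h. a \<in> free_hom m \<and> h \<in> carrier H}"
  by (simp add: smash_grading_def tensor_Uq)

lemma grading_subspace: "subspace TH (grading m)"
  unfolding grading_eq by (rule T.RH.lspan_subspace) auto

lemma grading_tp: "a \<in> free_hom m \<Longrightarrow> h \<in> carrier H \<Longrightarrow> tp a h \<in> grading m"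
  unfolding grading_eq by (rule T.RH.lspan_base) auto

lemma grading_eqI:
  assumes "vs N" "lin_map TH N g" "lin_map TH N g'"
    "\<And>a h. a \<in> free_hom m \<Longrightarrow> h \<in> carrier H \<Longrightarrow> g (tp a h) = g' (tp a h)" "X \<in> grading m"
  shows "g X = g' X"
  by (rule lin_map_eq_on_lspan[OF T.RH.vs_axioms assms(1-3) _ _ assms(5)[unfolded grading_eq]]) (auto simp: assms(4))

lemma grading_subsetI:
  assumes "subspace TH K" "\<And>a h. a \<in> free_hom m \<Longrightarrow> h \<in> carrier H \<Longrightarrow> tp a h \<in> K"
  shows "grading m \<subseteq> K"
  unfolding grading_eq by (rule T.RH.lspan_minimal[OF assms(1)]) (use assms(2) in auto)

definition "hcomp m = tlift TH (\<lambda>b h. tp (cpt m b) h)"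

lemma comp_bilin: "bilin free_alg H TH (\<lambda>b h. tp (cpt m b) h)"
  by (rule bilinI) (auto intro: lin_map_comp[OF cpt_lin T.rpure_lin(1)] T.rpure_lin(2))

lemma comp_lin: "lin_map TH TH (hcomp m)"
  unfolding hcomp_def by (rule tlift_lin[OF free_alg_vs H.vs_axioms T.RH.vs_axioms comp_bilin])

lemma comp_tp: "h \<in> carrier H \<Longrightarrow> hcomp m (tp b h) = tp (cpt m b) h"
  unfolding hcomp_def by (rule tlift_pure[OF free_alg_vs H.vs_axioms T.RH.vs_axioms comp_bilin]) simp_all

lemma free_hom_act_gen: "b \<in> free_hom m \<Longrightarrow> actT (uqg q x) b \<in> free_hom m"
proof (induction rule: free_hom_induct)
  case (add w c b)
  have word: "actT (uqg q x) (Poly_Mapping.single w 1) \<in> free_hom (length w)" for w x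
  proof (induction w arbitrary: x)
    case Nil
    show ?case by (cases x) (simp_all add: single_Nil actT_unit free_hom_one free_hom_simps)
  next
    case (Cons g w)
    have g: "actT (uqg q x) (gen g) \<in> free_hom 1" for x
      using std_actT std_actT' unfolding std_action_def
      by (cases x; cases g) (simp_all add: free_hom_gen free_hom_simps del: One_nat_def)
    show ?case
      using free_hom_mult[OF g Cons] free_hom_mult[OF free_hom_gen[of g] Cons]
        free_hom_mult[OF g free_hom_single[of w 1]]
      by (cases x) (auto simp: single_Cons actT_prod intro!: free_hom_simps)
  qed
  have "actT (uqg q x) (scale c (Poly_Mapping.single w 1)) \<in> free_hom m"
    using word[of x w] add(1) free_hom_simps(2) by (simp only: actT_linear uqg_closed)
  then show ?case using add by (simp add: actT_linear free_hom_simps)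
qed (simp add: actT_linear free_hom_simps)

lemma grading_hact: "h \<in> carrier H \<Longrightarrow> Y \<in> grading m \<Longrightarrow> T.hact h Y \<in> grading m"
proof (induction arbitrary: Y rule: H_induct)
  case one
  then show ?case using subspaceD(3)[OF grading_subspace one] by (simp add: T.hact_one)
next
  case (gen x)
  have "grading m \<subseteq> {Y \<in> carrier TH. T.hact (uqg q x) Y \<in> grading m}"
  proof (rule grading_subsetI[OF T.RH.subspace_vimage[OF T.RH.vs_axioms T.hact_lin grading_subspace]])
    fix a h assume ah: "a \<in> (free_hom m :: 'k free4 set)" "h \<in> carrier H"
    show "tp a h \<in> {Y \<in> carrier TH. T.hact (uqg q x) Y \<in> grading m}"
      using ah free_hom_act_gen[OF ah(1)]
      by (cases x) (auto simp: T.hact_gen_pure intro!: grading_tp subspaceD(4)[OF grading_subspace])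
  qed simp
  then show ?case using gen by blast
next
  case (add x y)
  then show ?case
    using subspaceD(3)[OF grading_subspace, of Y] by (auto simp: lin_map_add[OF T.hact_lin_left] intro!: subspaceD(4)[OF grading_subspace])
next
  case (smult c x)
  then show ?case
    using subspaceD(3)[OF grading_subspace, of Y] by (auto simp: lin_map_smult[OF T.hact_lin_left] intro!: subspaceD(5)[OF grading_subspace])
next
  case (mult x y)
  then show ?case using subspaceD(3)[OF grading_subspace, of Y] by (simp add: T.hact_mult)
qed

lemma grading_rop: assumes "a \<in> free_hom i" "Y \<in> grading j" shows "T.rop a Y \<in> grading (i + j)"
proof -
  have "grading j \<subseteq> {Y \<in> carrier TH. T.rop a Y \<in> grading (i + j)}"
    by (rule grading_subsetI[OF T.RH.subspace_vimage[OF T.RH.vs_axioms T.rop_lin grading_subspace]])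
      (use assms(1) in \<open>auto simp: T.rop_pure intro!: grading_tp free_hom_mult\<close>)
  then show ?thesis using assms(2) by blast
qed

lemma grading_mult:
  assumes "X \<in> grading i" "Y \<in> grading j" shows "X \<otimes>\<^bsub>SM\<^esub> Y \<in> grading (i + j)"
proof -
  note Y = subspaceD(3)[OF grading_subspace assms(2)]
  have "grading i \<subseteq> {X \<in> carrier TH. X \<otimes>\<^bsub>SM\<^esub> Y \<in> grading (i + j)}"
    by (rule grading_subsetI[OF T.RH.subspace_vimage[OF T.RH.vs_axioms bilin_left[OF T.smash_mult_bilin Y] grading_subspace]])
      (auto simp: T.smash_mult_pure Y intro!: grading_rop grading_hact assms(2))
  then show ?thesis using assms(1) by blast
qed

sublocale gr: graded_alg SM grading hcomp
proof (intro graded_alg.intro T.smash_alg graded_alg_axioms.intro)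
  show "lin_map SM SM (hcomp m)" for m using comp_lin by (simp add: lin_map_def)
  show "subspace SM (grading m)" for m
    by (rule vs.subspaceI[OF alg.axioms(1)[OF T.smash_alg]]) (use subspaceD[OF grading_subspace[of m]] in auto)
  show comp_mem: "hcomp m X \<in> grading m" if "X \<in> carrier SM" for m X
  proof -
    have "X \<in> {X \<in> carrier TH. hcomp m X \<in> grading m}"
      by (rule tensor_subspace_induct[OF free_alg_vs H.vs_axioms T.RH.subspace_vimage[OF T.RH.vs_axioms comp_lin grading_subspace]])
        (use that in \<open>auto simp: comp_tp intro!: grading_tp cpt_mem\<close>)
    then show ?thesis by simp
  qed
  show "hcomp i X = (if i = m then X else \<zero>\<^bsub>SM\<^esub>)" if "X \<in> grading m" for X m i
  proof (rule grading_eqI[OF T.RH.vs_axioms comp_lin _ _ that, of "\<lambda>X. if i = m then X else \<zero>\<^bsub>SM\<^esub>"])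
    show "lin_map TH TH (\<lambda>X. if i = m then X else \<zero>\<^bsub>SM\<^esub>)"
      using lin_map_id lin_map_zero_map[OF T.RH.vs_axioms] by (cases "i = m") simp_all
  qed (simp add: comp_tp cpt_free_hom tp_simps)
  show "finite {m. hcomp m X \<noteq> \<zero>\<^bsub>SM\<^esub>}" if "X \<in> carrier SM" for X
  proof -
    have "X \<in> carrier TH" using that by simp
    then show ?thesis
    proof (induction rule: T.RH_induct)
      case (pure a h)
      then have "{m. hcomp m (tp a h) \<noteq> \<zero>\<^bsub>SM\<^esub>} \<subseteq> {m. cpt m a \<noteq> 0}" by (auto simp: comp_tp tp_simps)
      then show ?case using cpt_finite finite_subset by blast
    next
      case (add x y)
      then have "{m. hcomp m (x \<oplus>\<^bsub>TH\<^esub> y) \<noteq> \<zero>\<^bsub>SM\<^esub>} \<subseteq> {m. hcomp m x \<noteq> \<zero>\<^bsub>SM\<^esub>} \<union> {m. hcomp m y \<noteq> \<zero>\<^bsub>SM\<^esub>}"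
        by (auto simp: lin_map_add[OF comp_lin])
      then show ?case using add finite_subset by (metis finite_UnI)
    qed
  qed
  show "X = \<zero>\<^bsub>SM\<^esub>" if X: "X \<in> carrier SM" and z: "\<And>m. hcomp m X = \<zero>\<^bsub>SM\<^esub>" for X
  proof -
    have X': "X \<in> carrier TH" using X by simp
    \<comment> \<open>An element is the sum of its parts over every sufficiently large finite index
      set. Quantifying over all larger sets lets the decompositions of two summands be added without
      matching their supports.\<close>
    then have "\<exists>I. finite I \<and> (\<forall>J. finite J \<longrightarrow> I \<subseteq> J \<longrightarrow> X = (\<Oplus>\<^bsub>TH\<^esub>i\<in>J. hcomp i X))"
    proof (induction rule: T.RH_induct)
      case (pure a h)
      let ?I = "{m. cpt m a \<noteq> 0}"
      have "tp a h = (\<Oplus>\<^bsub>TH\<^esub>i\<in>J. hcomp i (tp a h))" if J: "finite J" "?I \<subseteq> J" for J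
      proof -
        have s: "finsum free_alg (\<lambda>i. cpt i a) J = (\<Sum>i\<in>J. cpt i a)"
          using J(1)
        proof (induction J)
          case (insert i J)
          then show ?case
            using abelian_monoid.finsum_insert[of "free_alg :: ('k, _) module" J i "\<lambda>i. cpt i a"]
              vs.axioms(1)[OF free_alg_vs] by (simp add: abelian_group.axioms)
        next
          case empty
          show ?case using abelian_monoid.finsum_empty[of "free_alg :: ('k, _) module"] vs.axioms(1)[OF free_alg_vs]
            by (simp add: abelian_group.axioms)
        qed
        have "cpt m (a - (\<Sum>i\<in>J. cpt i a)) = 0" for m
        proof -
          have "cpt m (\<Sum>i\<in>J. cpt i a) = (\<Sum>i\<in>J. cpt m (cpt i a))"
            using J(1) by (induction J) auto
          also have "\<dots> = (\<Sum>i\<in>J. if m = i then cpt i a else 0)"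
            by (intro sum.cong refl) (simp add: cpt_free_hom[OF cpt_mem])
          also have "\<dots> = cpt m a" using J by auto
          finally show ?thesis by simp
        qed
        then have "a = (\<Sum>i\<in>J. cpt i a)" using cpt_inj by (metis eq_iff_diff_eq_0)
        then have "tp a h = tp (finsum free_alg (\<lambda>i. cpt i a) J) h" using s by simp
        also have "\<dots> = (\<Oplus>\<^bsub>TH\<^esub>i\<in>J. tp (cpt i a) h)"
          by (rule lin_map_finsum[OF free_alg_vs T.RH.vs_axioms T.rpure_lin(1)[OF pure(2)] J(1)]) simp
        also have "\<dots> = (\<Oplus>\<^bsub>TH\<^esub>i\<in>J. hcomp i (tp a h))" using pure by (simp add: comp_tp)
        finally show ?thesis .
      qed
      then show ?case using cpt_finite[of a] by blast
    next
      case (add x y)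
      obtain I where I: "finite I" "\<And>J. finite J \<Longrightarrow> I \<subseteq> J \<Longrightarrow> x = (\<Oplus>\<^bsub>TH\<^esub>i\<in>J. hcomp i x)"
        using add(3) by auto
      obtain I' where I': "finite I'" "\<And>J. finite J \<Longrightarrow> I' \<subseteq> J \<Longrightarrow> y = (\<Oplus>\<^bsub>TH\<^esub>i\<in>J. hcomp i y)"
        using add(4) by auto
      have step: "x \<oplus>\<^bsub>TH\<^esub> y = (\<Oplus>\<^bsub>TH\<^esub>i\<in>J. hcomp i (x \<oplus>\<^bsub>TH\<^esub> y))" if J: "finite J" "I \<union> I' \<subseteq> J" for J
      proof -
        have "(\<Oplus>\<^bsub>TH\<^esub>i\<in>J. hcomp i (x \<oplus>\<^bsub>TH\<^esub> y)) = (\<Oplus>\<^bsub>TH\<^esub>i\<in>J. hcomp i x \<oplus>\<^bsub>TH\<^esub> hcomp i y)"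
          using add(1,2) lin_map_closed[OF comp_lin]
          by (intro T.RH.add.finprod_cong') (auto simp: lin_map_add[OF comp_lin])
        also have "\<dots> = (\<Oplus>\<^bsub>TH\<^esub>i\<in>J. hcomp i x) \<oplus>\<^bsub>TH\<^esub> (\<Oplus>\<^bsub>TH\<^esub>i\<in>J. hcomp i y)"
          using add(1,2) lin_map_closed[OF comp_lin] by (intro T.RH.finsum_addf) auto
        also have "\<dots> = x \<oplus>\<^bsub>TH\<^esub> y" using I(2)[of J, THEN HOL.sym] I'(2)[of J, THEN HOL.sym] J by simp
        finally show ?thesis by (rule HOL.sym)
      qed
      show ?case by (intro exI[of _ "I \<union> I'"] conjI allI impI finite_UnI I(1) I'(1) step)
    qed
    then obtain I where I: "finite I" "\<forall>J. finite J \<longrightarrow> I \<subseteq> J \<longrightarrow> X = (\<Oplus>\<^bsub>TH\<^esub>i\<in>J. hcomp i X)"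
      by (elim exE conjE)
    have "(\<Oplus>\<^bsub>TH\<^esub>i\<in>I. hcomp i X) = \<zero>\<^bsub>SM\<^esub>" using z by (simp add: T.RH.finsum_zero)
    then show ?thesis by (rule trans[OF I(2)[rule_format, OF I(1) subset_refl]])
  qed
  show "\<one>\<^bsub>SM\<^esub> \<in> grading 0" by (simp add: grading_tp free_hom_one)
  show "X \<otimes>\<^bsub>SM\<^esub> Y \<in> grading (i + j)" if "X \<in> grading i" "Y \<in> grading j" for X Y i j
    by (rule grading_mult[OF that])
qed

end

section \<open>The deformation\<close>

lemma (in quantum) rho_rel_span:
  assumes "r \<in> lspan free_alg (tw_rels q)"
  shows "rho q \<alpha> r x = scale (kap q \<alpha> r) (zop x)"
  using assms
  by (induction rule: vs.lspan_induct[OF free_alg_vs, consumes 1, case_names sub base zero add smult])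
    (auto simp: tw_rels_def rho_rels kap_rels kap_linear)

text \<open>\<open>Z\<close> abstracts K^{ns}. \<open>Z_act\<close> combines that it is grouplike
  and that it acts trivially on the free algebra: \<Delta>(Z) acts on T tensor H as left
  multiplication by Z on the second factor.\<close>

locale deformed = equivariant q \<tau> actT act
  for q :: "'k::field" and \<tau> and actT and act +
  fixes \<alpha> :: 'k and Z :: "'k uq"
  assumes Z_closed [simp]: "Z \<in> carrier H"
    and Z_central: "h \<in> carrier H \<Longrightarrow> Z \<otimes>\<^bsub>H\<^esub> h = h \<otimes>\<^bsub>H\<^esub> Z"
    and Z_act: "h \<in> carrier H \<Longrightarrow> T.hact Z (tp b h) = tp b (Z \<otimes>\<^bsub>H\<^esub> h)"
begin

abbreviation "kp \<equiv> kap q \<alpha>"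

text \<open>The element a (r - \<kappa>(r)) b tensor h, with Z already moved past b: by
  \<open>Z_act\<close>, (1 tensor Z)(b tensor h) = b tensor Zh.\<close>

definition "relator a r b h = tp (a * r * b) h \<oplus>\<^bsub>TH\<^esub> (- kp r) \<odot>\<^bsub>TH\<^esub> tp (a * b) (Z \<otimes>\<^bsub>H\<^esub> h)"

lemma relator_closed [simp]: "h \<in> carrier H \<Longrightarrow> relator a r b h \<in> carrier TH"
  by (simp add: relator_def)

lemma Z_left_commute: "h \<in> carrier H \<Longrightarrow> g \<in> carrier H \<Longrightarrow> g \<otimes>\<^bsub>H\<^esub> (Z \<otimes>\<^bsub>H\<^esub> h) = Z \<otimes>\<^bsub>H\<^esub> (g \<otimes>\<^bsub>H\<^esub> h)"
  by (simp add: Z_central[of g] flip: H.m_assoc)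

abbreviation "relators \<equiv> {relator a r b h | a r b h. r \<in> rel_span \<and> h \<in> carrier H}"

definition "def_span = lspan TH relators"

lemma relators_closed: "relators \<subseteq> carrier TH"
  by auto

lemma def_span_subspace: "subspace TH def_span"
  unfolding def_span_def by (rule T.RH.lspan_subspace[OF relators_closed])

lemma relator_mem: "r \<in> rel_span \<Longrightarrow> h \<in> carrier H \<Longrightarrow> relator a r b h \<in> def_span"
  unfolding def_span_def by (rule T.RH.lspan_base) blast

lemma def_span_subsetI:
  assumes "subspace TH K" "\<And>a r b h. r \<in> rel_span \<Longrightarrow> h \<in> carrier H \<Longrightarrow> relator a r b h \<in> K"
  shows "def_span \<subseteq> K"
  unfolding def_span_def by (rule T.RH.lspan_minimal[OF assms(1)]) (use assms(2) in blast)

lemmas hact_tp = T.hact_gen_pure[simplified]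

text \<open>A generator distributes over the four places a, r, b, h through its iterated coproduct.
  Each summand is again a relator because the scalar in \<kappa>(x.r) is \<epsilon>(x) times the one
  in \<kappa>(r) and Z is central: E.r and F.r carry the scalar 0, while K.r and K^{-1}.r keep that
  of r.\<close>

lemma hact_relator:
  assumes r: "r \<in> rel_span" and h: "h \<in> carrier H"
  shows "T.hact (uqg q x) (relator a r b h) \<in> def_span"
proof -
  note ra = rel_span_act[OF r, of _ \<alpha>]
  note lin = lin_map_add[OF T.hact_lin] lin_map_smult[OF T.hact_lin]
  note simps = relator_def lin hact_tp Z_left_commute actT_prod tp_simps h ra distrib_left distrib_right mult.assoc
    T.RH.smult_right T.RH.a_ac
  note mem = subspaceD(4)[OF def_span_subspace] relator_mem
  show ?thesis
  proof (cases x)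
    case gK
    have "T.hact k1 (relator a r b h) = relator (actT k1 a) (actT k1 r) (actT k1 b) (k1 \<otimes>\<^bsub>H\<^esub> h)"
      by (simp add: simps)
    then show ?thesis using ra[of gK] h by (simp add: gK mem)
  next
    case gKinv
    have "T.hact k' (relator a r b h) = relator (actT k' a) (actT k' r) (actT k' b) (k' \<otimes>\<^bsub>H\<^esub> h)"
      by (simp add: simps)
    then show ?thesis using ra[of gKinv] h by (simp add: gKinv mem)
  next
    case gE
    have "T.hact e (relator a r b h) = relator (actT e a) r b h \<oplus>\<^bsub>TH\<^esub> (relator (actT k1 a) (actT e r) b h \<oplus>\<^bsub>TH\<^esub>
        (relator (actT k1 a) (actT k1 r) (actT e b) h \<oplus>\<^bsub>TH\<^esub> relator (actT k1 a) (actT k1 r) (actT k1 b) (e \<otimes>\<^bsub>H\<^esub> h)))"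
      by (simp add: simps)
    then show ?thesis using ra[of gE] ra[of gK] r h by (simp add: gE mem)
  next
    case gF
    have "T.hact f (relator a r b h) = relator (actT f a) (actT k' r) (actT k' b) (k' \<otimes>\<^bsub>H\<^esub> h) \<oplus>\<^bsub>TH\<^esub>
        (relator a (actT f r) (actT k' b) (k' \<otimes>\<^bsub>H\<^esub> h) \<oplus>\<^bsub>TH\<^esub>
        (relator a r (actT f b) (k' \<otimes>\<^bsub>H\<^esub> h) \<oplus>\<^bsub>TH\<^esub> relator a r b (f \<otimes>\<^bsub>H\<^esub> h)))"
      by (simp add: simps)
    then show ?thesis using ra[of gF] ra[of gKinv] r h by (simp add: gF mem)
  qed
qed

lemma hact_def_span: "h \<in> carrier H \<Longrightarrow> Y \<in> def_span \<Longrightarrow> T.hact h Y \<in> def_span"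
proof (induction arbitrary: Y rule: H_induct)
  case one
  then show ?case using subspaceD(3)[OF def_span_subspace one] by (simp add: T.hact_one)
next
  case (gen x)
  have "def_span \<subseteq> {Y \<in> carrier TH. T.hact (uqg q x) Y \<in> def_span}"
    by (rule def_span_subsetI[OF T.RH.subspace_vimage[OF T.RH.vs_axioms T.hact_lin def_span_subspace]])
      (auto simp: hact_relator)
  then show ?case using gen by blast
next
  case (add x y)
  then show ?case
    using subspaceD(3)[OF def_span_subspace, of Y] by (auto simp: lin_map_add[OF T.hact_lin_left] intro!: subspaceD(4)[OF def_span_subspace])
next
  case (smult c x)
  then show ?case
    using subspaceD(3)[OF def_span_subspace, of Y] by (auto simp: lin_map_smult[OF T.hact_lin_left] intro!: subspaceD(5)[OF def_span_subspace])
next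
  case (mult x y)
  then show ?case using subspaceD(3)[OF def_span_subspace, of Y] by (simp add: T.hact_mult)
qed

lemma rop_def_span: assumes "Y \<in> def_span" shows "T.rop a Y \<in> def_span"
proof -
  have rop: "T.rop a (relator c r b h) = relator (a * c) r b h" if "h \<in> carrier H" for c r b h
    using that by (simp add: relator_def T.rop_simps mult.assoc)
  have "def_span \<subseteq> {Y \<in> carrier TH. T.rop a Y \<in> def_span}"
    by (rule def_span_subsetI[OF T.RH.subspace_vimage[OF T.RH.vs_axioms T.rop_lin def_span_subspace]])
      (simp_all add: rop relator_mem)
  then show ?thesis using assms by blast
qed

lemma relator_mult:
  assumes "r \<in> rel_span" "h \<in> carrier H" "Y \<in> carrier TH"
  shows "relator a r b h \<otimes>\<^bsub>SM\<^esub> Y \<in> def_span"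
proof -
  \<comment> \<open>Left multiplication by the relator after h has been absorbed into the right
    factor. On c tensor g, \<open>Z_act\<close> moves Z past c, and the result is the relator with b
    replaced by bc.\<close>
  let ?g = "\<lambda>W. T.rop (a * r * b) W \<oplus>\<^bsub>TH\<^esub> (- kp r) \<odot>\<^bsub>TH\<^esub> T.rop (a * b) (T.hact Z W)"
  have lin: "lin_map TH TH ?g"
    by (intro lin_map_plus[OF T.RH.vs_axioms] lin_map_scale[OF T.RH.vs_axioms] T.rop_lin lin_map_comp[OF T.hact_lin T.rop_lin]) simp_all
  have "relator a r b h \<otimes>\<^bsub>SM\<^esub> Y = ?g (T.hact h Y)"
    using assms by (simp add: relator_def T.smash_mult_simps T.hact_mult)
  moreover have "W \<in> {W \<in> carrier TH. ?g W \<in> def_span}" if W: "W \<in> carrier TH" for W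
  proof (rule tensor_subspace_induct[OF free_alg_vs H.vs_axioms T.RH.subspace_vimage[OF T.RH.vs_axioms lin def_span_subspace] _ W])
    fix c g assume "g \<in> carrier H"
    then have "?g (tp c g) = relator a r (b * c) g" by (simp add: T.rop_simps Z_act relator_def mult.assoc)
    then show "tp c g \<in> {W \<in> carrier TH. ?g W \<in> def_span}"
      using relator_mem[OF assms(1) \<open>g \<in> carrier H\<close>] \<open>g \<in> carrier H\<close> by simp
  qed
  ultimately show ?thesis using assms by simp
qed

lemma def_span_ideal: "ideal def_span SM"
proof (rule alg.subspace_idealI[OF T.smash_alg])
  show "subspace SM def_span"
    by (rule vs.subspaceI[OF alg.axioms(1)[OF T.smash_alg]]) (use subspaceD[OF def_span_subspace] in auto)
  fix Y X assume Y: "Y \<in> def_span" and X: "X \<in> carrier SM"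
  note Y' = subspaceD(3)[OF def_span_subspace Y]
  have "X \<in> {X \<in> carrier TH. X \<otimes>\<^bsub>SM\<^esub> Y \<in> def_span}"
    by (rule tensor_subspace_induct[OF free_alg_vs H.vs_axioms
          T.RH.subspace_vimage[OF T.RH.vs_axioms bilin_left[OF T.smash_mult_bilin Y'] def_span_subspace]])
      (use X in \<open>auto simp: T.smash_mult_pure Y' intro!: rop_def_span hact_def_span Y\<close>)
  then show "X \<otimes>\<^bsub>SM\<^esub> Y \<in> def_span" by simp
  have "def_span \<subseteq> {Y \<in> carrier TH. Y \<otimes>\<^bsub>SM\<^esub> X \<in> def_span}"
    by (rule def_span_subsetI[OF T.RH.subspace_vimage[OF T.RH.vs_axioms bilin_left[OF T.smash_mult_bilin] def_span_subspace]])
      (use X in \<open>auto simp: relator_mult\<close>)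
  then show "Y \<otimes>\<^bsub>SM\<^esub> X \<in> def_span" using Y by blast
qed

section \<open>The deformation ideal\<close>

definition "kappa r = kp r \<odot>\<^bsub>H\<^esub> Z"

abbreviation "J \<equiv> deform_ideal (Uq q) actT (tw_rels q) kappa"

lemma J_gen: "tp r \<one>\<^bsub>H\<^esub> \<ominus>\<^bsub>SM\<^esub> tp 1 (kappa r) = relator 1 r 1 \<one>\<^bsub>H\<^esub>"
  using gr.minus_eq_smult[of "tp r \<one>\<^bsub>H\<^esub>" "tp 1 (kappa r)"]
  by (simp add: relator_def kappa_def tp_simps T.RH.smult_smult)

lemma J_eq: "J = genideal SM ((\<lambda>r. relator 1 r 1 \<one>\<^bsub>H\<^esub>) ` tw_rels q)"
  by (simp add: deform_ideal_def tensor_Uq J_gen)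

lemma J_subset: "J \<subseteq> def_span"
  unfolding J_eq
  by (rule ring.genideal_minimal[OF alg.axioms(2)[OF T.smash_alg] def_span_ideal])
    (auto intro!: relator_mem rel_span_closed(4))

lemma J_ideal: "ideal J SM"
  unfolding J_eq by (rule ring.genideal_ideal[OF alg.axioms(2)[OF T.smash_alg]]) auto

text \<open>Obtained from the generator r tensor 1 - 1 tensor \<kappa>(r) by multiplying with a
  tensor 1 on the left and b tensor h on the right.\<close>

lemma relator_J: assumes "r \<in> tw_rels q" "h \<in> carrier H" shows "relator a r b h \<in> J"
proof -
  have "(\<lambda>r. relator 1 r 1 \<one>\<^bsub>H\<^esub>) ` tw_rels q \<subseteq> carrier SM" by auto
  from ring.genideal_self[OF alg.axioms(2)[OF T.smash_alg] this] have "relator 1 r 1 \<one>\<^bsub>H\<^esub> \<in> J"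
    unfolding J_eq using assms(1) by blast
  then have "tp a \<one>\<^bsub>H\<^esub> \<otimes>\<^bsub>SM\<^esub> relator 1 r 1 \<one>\<^bsub>H\<^esub> \<otimes>\<^bsub>SM\<^esub> tp b h \<in> J"
    using assms by (intro ideal.I_r_closed[OF J_ideal] ideal.I_l_closed[OF J_ideal]) simp_all
  also have "tp a \<one>\<^bsub>H\<^esub> \<otimes>\<^bsub>SM\<^esub> relator 1 r 1 \<one>\<^bsub>H\<^esub> = relator a r 1 \<one>\<^bsub>H\<^esub>"
    by (simp add: relator_def T.smash_mult_pure T.hact_one T.rop_simps)
  also have "relator a r 1 \<one>\<^bsub>H\<^esub> \<otimes>\<^bsub>SM\<^esub> tp b h = relator a r b h"
    using assms by (simp add: relator_def T.smash_mult_simps T.hact_one Z_act T.rop_simps)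
  finally show ?thesis .
qed

section \<open>Linear maps detecting the leading part\<close>

abbreviation "XH \<equiv> tensor AA H"
abbreviation "xp \<equiv> pure AA H"

sublocale XH: vs XH by (rule tensor_vs[OF AA.vs_axioms H.vs_axioms])

lemmas xp_lin = pure_lin_left[OF AA.vs_axioms H.vs_axioms] pure_lin_right[OF AA.vs_axioms H.vs_axioms]
lemmas xp_closed [simp] = pure_closed[OF AA.vs_axioms H.vs_axioms]
lemmas xp_zero = lin_map_zero[OF AA.vs_axioms XH.vs_axioms xp_lin(1)]

text \<open>The degree \<open>m\<close> part of \<open>realize\<close>, with the central variable \<open>\<zeta>\<close>, which does not count for the
  degree, specialised to \<open>Z\<close>.\<close>

definition "psi m h = lin_ext XH (\<lambda>(a, b, c, d, z :: nat). if a + b + c + d = m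
    then xp (realize (Poly_Mapping.single (a, b, c, d, 0) 1)) (Z [^]\<^bsub>H\<^esub> z \<otimes>\<^bsub>H\<^esub> h) else \<zero>\<^bsub>XH\<^esub>)"

lemma realize_closed [simp]: "realize x \<in> carrier AA"
  using lin_map_closed[OF realize_lin, of x] by simp

lemma psi_fun: "h \<in> carrier H \<Longrightarrow> (\<lambda>(a, b, c, d, z :: nat). if a + b + c + d = m
    then xp (realize (Poly_Mapping.single (a, b, c, d, 0) 1)) (Z [^]\<^bsub>H\<^esub> z \<otimes>\<^bsub>H\<^esub> h) else \<zero>\<^bsub>XH\<^esub>) \<in> UNIV \<rightarrow> carrier XH"
  by auto

lemma psi_lin: "h \<in> carrier H \<Longrightarrow> lin_map (free_vs UNIV) XH (psi m h)"
  unfolding psi_def by (rule lin_ext_lin_map[OF XH.vs_axioms psi_fun])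

lemma psi_add: "h \<in> carrier H \<Longrightarrow> psi m h (x + y) = psi m h x \<oplus>\<^bsub>XH\<^esub> psi m h y"
  and psi_scale: "h \<in> carrier H \<Longrightarrow> psi m h (scale c x) = c \<odot>\<^bsub>XH\<^esub> psi m h x"
  and psi_closed [simp]: "h \<in> carrier H \<Longrightarrow> psi m h x \<in> carrier XH"
  and psi_zero: "h \<in> carrier H \<Longrightarrow> psi m h 0 = \<zero>\<^bsub>XH\<^esub>"
  using lin_map_add[OF psi_lin, of h x y m] lin_map_smult[OF psi_lin, of h x m c] lin_map_closed[OF psi_lin, of h x m]
    lin_map_zero[OF free_vs_vs XH.vs_axioms psi_lin, of h m] by simp_all

lemma psi_single: "h \<in> carrier H \<Longrightarrow> psi m h (Poly_Mapping.single (a, b, c, d, z) 1) =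
    (if a + b + c + d = m then xp (realize (Poly_Mapping.single (a, b, c, d, 0) 1)) (Z [^]\<^bsub>H\<^esub> z \<otimes>\<^bsub>H\<^esub> h) else \<zero>\<^bsub>XH\<^esub>)"
  unfolding psi_def by (subst lin_ext_single[OF XH.vs_axioms psi_fun]) auto

lemma single_add_scale: "Poly_Mapping.single k c + x = scale c (Poly_Mapping.single k 1) + x"
  by simp

lemma psi_lin_left: "lin_map H XH (\<lambda>h. psi m h x)"
proof (induction x rule: poly_mapping_induct)
  case zero
  show ?case by (rule lin_map_cong[OF H.vs_axioms lin_map_zero_map[OF XH.vs_axioms]]) (simp add: psi_zero)
next
  case (add k c x)
  obtain a b c' d z where k: "k = (a, b, c', d, z)" by (cases k)
  have s: "lin_map H XH (\<lambda>h. psi m h (Poly_Mapping.single k 1))"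
  proof (cases "a + b + c' + d = m")
    case True
    have "lin_map H XH (\<lambda>h. xp (realize (Poly_Mapping.single (a, b, c', d, 0) 1)) (Z [^]\<^bsub>H\<^esub> z \<otimes>\<^bsub>H\<^esub> h))"
      by (rule lin_map_comp[OF H.mult_left_lin xp_lin(2)]) simp_all
    then show ?thesis by (rule lin_map_cong[OF H.vs_axioms]) (use True in \<open>simp add: k psi_single\<close>)
  next
    case False
    show ?thesis by (rule lin_map_cong[OF H.vs_axioms lin_map_zero_map[OF XH.vs_axioms]]) (use False in \<open>simp add: k psi_single\<close>)
  qed
  show ?case
    unfolding single_add_scale
    by (rule lin_map_cong[OF H.vs_axioms lin_map_plus[OF XH.vs_axioms lin_map_scale[OF XH.vs_axioms s] add]])
      (simp only: psi_add psi_scale)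
qed

lemma psi_zop: "h \<in> carrier H \<Longrightarrow> psi m h (zop x) = psi m (Z \<otimes>\<^bsub>H\<^esub> h) x"
proof (induction x rule: poly_mapping_induct)
  case zero
  then show ?case by (simp add: psi_zero zop_def)
next
  case (add k c x)
  obtain a b c' d z where k: "k = (a, b, c', d, z)" by (cases k)
  have "psi m h (zop (Poly_Mapping.single k 1)) = psi m (Z \<otimes>\<^bsub>H\<^esub> h) (Poly_Mapping.single k 1)"
    using add(2) by (simp add: k psi_single H.m_assoc)
  then show ?case unfolding single_add_scale using add by (simp only: zop_simps psi_add psi_scale H.m_closed Z_closed)
qed

text \<open>A monomial of weight l has degree at most l in v', u', v, u, hence no part of degree m >
  l.\<close>

lemma psi_lower:
  assumes "Poly_Mapping.keys x \<subseteq> {i. weight i = l}" "l < m" "h \<in> carrier H" shows "psi m h x = \<zero>\<^bsub>XH\<^esub>"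
  using assms(1)
proof (induction rule: poly_mapping_single_induct)
  case (add k c x)
  obtain a b c' d z where k: "k = (a, b, c', d, z)" by (cases k)
  have "psi m h (Poly_Mapping.single k 1) = \<zero>\<^bsub>XH\<^esub>" using add(1) assms(2,3) by (auto simp: k psi_single)
  then show ?case unfolding single_add_scale using add assms(3) by (simp only: psi_add psi_scale) simp
qed (simp add: psi_zero assms)

text \<open>Weight m together with degree m in v', u', v, u leaves no room for \<zeta>.\<close>

lemma psi_top:
  assumes "Poly_Mapping.keys x \<subseteq> {i. weight i = m}" "h \<in> carrier H"
  shows "psi m h x = xp (realize (const_part x)) h"
  using assms(1)
proof (induction rule: poly_mapping_single_induct)
  case zero
  then show ?case using lin_map_zero[OF free_vs_vs AA.vs_axioms realize_lin]
    by (simp add: psi_zero assms const_part_def xp_zero)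
next
  case (add k c x)
  obtain a b c' d z where k: "k = (a, b, c', d, z)" by (cases k)
  have L: "lin_map (free_vs UNIV) XH (\<lambda>x. xp (realize (const_part x)) h)"
    by (rule lin_map_comp[OF lin_map_comp[OF _ realize_lin] xp_lin(1)[OF assms(2)]])
      (rule lin_mapI; simp add: const_part_def)
  have "psi m h (Poly_Mapping.single k 1) = xp (realize (const_part (Poly_Mapping.single k 1))) h"
    using add(1) assms(2) lin_map_zero[OF free_vs_vs AA.vs_axioms realize_lin]
    by (cases "z = 0") (auto simp: k psi_single const_part_def xp_zero)
  then show ?case unfolding single_add_scale
    using add assms(2) lin_map_add[OF L, of "scale c (Poly_Mapping.single k 1)" x] lin_map_smult[OF L, of "Poly_Mapping.single k 1" c]
    by (simp only: psi_add psi_scale) simp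
qed

text \<open>The deformed action on the empty monomial, restricted to degree m. By the following
  lemmas it vanishes on J and on everything of degree below m, and it is the undeformed projection
  in degree m.\<close>

definition "phi m = tlift XH (\<lambda>b h. psi m h (rho q \<alpha> b vac))"

lemma phi_bilin: "bilin free_alg H XH (\<lambda>b h. psi m h (rho q \<alpha> b vac))"
proof (rule bilinI)
  fix h assume h: "h \<in> carrier H"
  show "lin_map free_alg XH (\<lambda>b. psi m h (rho q \<alpha> b vac))"
    by (rule lin_map_comp[OF _ psi_lin[OF h]]) (rule lin_mapI; simp)
qed (rule psi_lin_left)

lemma phi_lin: "lin_map TH XH (phi m)"
  unfolding phi_def by (rule tlift_lin[OF free_alg_vs H.vs_axioms XH.vs_axioms phi_bilin])

lemma phi_tp: "h \<in> carrier H \<Longrightarrow> phi m (tp b h) = psi m h (rho q \<alpha> b vac)"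
  unfolding phi_def by (rule tlift_pure[OF free_alg_vs H.vs_axioms XH.vs_axioms phi_bilin]) simp_all

text \<open>\<open>rho\<close> sends r to \<open>kp r\<close> times multiplication by \<zeta>, which
  commutes with all operators; once \<zeta> is replaced by Z, the two terms of the relator
  cancel.\<close>

lemma phi_relator:
  assumes "r \<in> rel_span" "h \<in> carrier H" shows "phi m (relator a r b h) = \<zero>\<^bsub>XH\<^esub>"
proof -
  have "rho q \<alpha> (a * r * b) vac = scale (kp r) (zop (rho q \<alpha> (a * b) vac))"
    by (simp add: rho_rel_span[OF assms(1)] zop_rho)
  then have "phi m (relator a r b h) = kp r \<odot>\<^bsub>XH\<^esub> psi m (Z \<otimes>\<^bsub>H\<^esub> h) (rho q \<alpha> (a * b) vac)
      \<oplus>\<^bsub>XH\<^esub> (- kp r) \<odot>\<^bsub>XH\<^esub> psi m (Z \<otimes>\<^bsub>H\<^esub> h) (rho q \<alpha> (a * b) vac)"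
    using assms(2) by (simp add: relator_def lin_map_add[OF phi_lin] lin_map_smult[OF phi_lin] phi_tp psi_scale psi_zop del: rho_simps)
  also have "\<dots> = (kp r + - kp r) \<odot>\<^bsub>XH\<^esub> psi m (Z \<otimes>\<^bsub>H\<^esub> h) (rho q \<alpha> (a * b) vac)"
    using assms(2) by (simp only: XH.smult_left psi_closed H.m_closed Z_closed)
  also have "\<dots> = \<zero>\<^bsub>XH\<^esub>" using assms(2) by (simp del: rho_simps)
  finally show ?thesis .
qed

lemma phi_J: assumes "j \<in> J" shows "phi m j = \<zero>\<^bsub>XH\<^esub>"
proof -
  have "def_span \<subseteq> {X \<in> carrier TH. phi m X \<in> {\<zero>\<^bsub>XH\<^esub>}}"
    by (rule def_span_subsetI[OF T.RH.subspace_vimage[OF XH.vs_axioms phi_lin XH.subspace_zero]])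
      (simp_all add: phi_relator)
  then show ?thesis using J_subset assms by auto
qed

definition "smash_proj = tlift XH (\<lambda>b h. xp (proj b) h)"

lemma smash_proj_bilin: "bilin free_alg H XH (\<lambda>b h. xp (proj b) h)"
  by (rule bilinI) (auto intro: lin_map_comp[OF proj_lin xp_lin(1)] xp_lin(2))

lemma smash_proj_lin: "lin_map TH XH smash_proj"
  unfolding smash_proj_def by (rule tlift_lin[OF free_alg_vs H.vs_axioms XH.vs_axioms smash_proj_bilin])

lemma smash_proj_tp: "h \<in> carrier H \<Longrightarrow> smash_proj (tp b h) = xp (proj b) h"
  unfolding smash_proj_def by (rule tlift_pure[OF free_alg_vs H.vs_axioms XH.vs_axioms smash_proj_bilin]) simp_all

lemma phi_grading_top: "X \<in> grading m \<Longrightarrow> phi m X = smash_proj X"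
proof (rule grading_eqI[OF XH.vs_axioms phi_lin smash_proj_lin])
  fix a h assume a: "a \<in> (free_hom m :: 'k free4 set)" and h: "h \<in> carrier H"
  show "phi m (tp a h) = smash_proj (tp a h)"
    unfolding phi_tp[OF h] smash_proj_tp[OF h] psi_top[OF keys_rho[OF a] h] const_part_rho_vac proj_realize ..
qed

lemma phi_grading_lower: "X \<in> grading l \<Longrightarrow> l < m \<Longrightarrow> phi m X = \<zero>\<^bsub>XH\<^esub>"
  by (rule grading_eqI[OF XH.vs_axioms phi_lin lin_map_zero_map[OF XH.vs_axioms], of l])
    (simp_all add: phi_tp psi_lower[OF keys_rho])

lemma phi_below: assumes "W \<in> gr.below m" shows "phi m W = \<zero>\<^bsub>XH\<^esub>"
proof (cases m)
  case 0
  then show ?thesis using assms gr.below_0 lin_map_zero[OF T.RH.vs_axioms XH.vs_axioms phi_lin] by simp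
next
  case (Suc l)
  have lin: "lin_map SM XH (phi m)" using phi_lin by (simp add: lin_map_def)
  have "W \<in> lspan SM (\<Union>i\<le>l. grading i)" using assms gr.below_Suc Suc by simp
  then show ?thesis
    by (rule lin_map_eq_on_lspan[OF alg.axioms(1)[OF T.smash_alg] XH.vs_axioms lin lin_map_zero_map[OF XH.vs_axioms], rotated -1])
      (use Suc gr.G_carrier in \<open>auto simp: phi_grading_lower\<close>)
qed

text \<open>This is the nontrivial half of the PBW property: no new relations appear in the associated graded algebra.\<close>

lemma smash_proj_zero_if:
  assumes X: "X \<in> grading m" and W: "W \<in> gr.below m" and J: "X \<ominus>\<^bsub>SM\<^esub> W \<in> J"
  shows "smash_proj X = \<zero>\<^bsub>XH\<^esub>"
proof -
  have lin: "lin_map SM XH (phi m)" using phi_lin by (simp add: lin_map_def)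
  have cl: "X \<in> carrier SM" "W \<in> carrier SM" using gr.G_carrier[OF X] W by (auto simp: gr.below_def)
  have "phi m X = phi m W"
    using phi_J[OF J, of m] lin_map_minus[OF alg.axioms(1)[OF T.smash_alg] XH.vs_axioms lin cl]
      XH.minus_zero_iff[OF lin_map_closed[OF lin cl(1)] lin_map_closed[OF lin cl(2)]] by simp
  then show ?thesis using phi_grading_top[OF X] phi_below[OF W] by simp
qed

end

section \<open>Homogeneity of the ideal of the undeformed relations\<close>

context quantum begin

text \<open>Describes the ideal by homogeneous elements that span it linearly, so that degree
  components and deformed counterparts need to be considered only for single products of a word, a
  relation and a word.\<close>

lemma rel_ideal_span:
  "rel_ideal = lspan free_alg {Poly_Mapping.single v 1 * r * Poly_Mapping.single w 1 | v r w. r \<in> tw_rels q}" (is "_ = ?L")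
proof
  interpret F: alg "free_alg :: ('k, tw_gen list \<Rightarrow>\<^sub>0 'k) module" by (rule free_alg_alg)
  let ?S = "{Poly_Mapping.single v 1 * r * Poly_Mapping.single w 1 | v r w. r \<in> tw_rels q}"
  have sp: "subspace free_alg ?L" by (rule F.lspan_subspace) simp
  have base: "x \<in> ?S \<Longrightarrow> x \<in> ?L" for x by (rule F.lspan_base)
  have "ideal ?L free_alg"
  proof (rule F.subspace_idealI[OF sp])
    fix a t assume a: "a \<in> ?L"
    have wl: "Poly_Mapping.single v 1 * a \<in> ?L" for v
    proof -
      have "?L \<subseteq> {a \<in> carrier free_alg. Poly_Mapping.single v 1 * a \<in> ?L}"
      proof (rule F.lspan_minimal)
        show "subspace free_alg {a \<in> carrier free_alg. Poly_Mapping.single v 1 * a \<in> ?L}"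
          using F.subspace_vimage[OF F.vs_axioms F.mult_left_lin[of "Poly_Mapping.single v 1"] sp] by simp
        show "?S \<subseteq> {a \<in> carrier free_alg. Poly_Mapping.single v 1 * a \<in> ?L}"
        proof
          fix x assume "x \<in> ?S"
          then obtain u r w where "x = Poly_Mapping.single u 1 * r * Poly_Mapping.single w 1" "r \<in> tw_rels q" by blast
          then have "Poly_Mapping.single v 1 * x = Poly_Mapping.single (v @ u) 1 * r * Poly_Mapping.single w 1"
            by (simp add: mult.assoc single_append)
          then show "x \<in> {a \<in> carrier free_alg. Poly_Mapping.single v 1 * a \<in> ?L}"
            using base \<open>r \<in> tw_rels q\<close> by auto
        qed
      qed
      then show ?thesis using a by auto
    qed
    have wr: "a * Poly_Mapping.single v 1 \<in> ?L" for v
    proof -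
      have "?L \<subseteq> {a \<in> carrier free_alg. a * Poly_Mapping.single v 1 \<in> ?L}"
      proof (rule F.lspan_minimal)
        show "subspace free_alg {a \<in> carrier free_alg. a * Poly_Mapping.single v 1 \<in> ?L}"
          using F.subspace_vimage[OF F.vs_axioms F.mult_right_lin[of "Poly_Mapping.single v 1"] sp] by simp
        show "?S \<subseteq> {a \<in> carrier free_alg. a * Poly_Mapping.single v 1 \<in> ?L}"
        proof
          fix x assume "x \<in> ?S"
          then obtain u r w where "x = Poly_Mapping.single u 1 * r * Poly_Mapping.single w 1" "r \<in> tw_rels q" by blast
          then have "x * Poly_Mapping.single v 1 = Poly_Mapping.single u 1 * r * Poly_Mapping.single (w @ v) 1"
            by (simp add: mult.assoc single_append)
          then show "x \<in> {a \<in> carrier free_alg. a * Poly_Mapping.single v 1 \<in> ?L}"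
            using base \<open>r \<in> tw_rels q\<close> by auto
        qed
      qed
      then show ?thesis using a by auto
    qed
    have "t \<in> {t \<in> carrier free_alg. t * a \<in> ?L}"
      by (rule free_alg_subspace_UNIV)
        (use F.subspace_vimage[OF F.vs_axioms F.mult_right_lin[of a] sp] wl in simp_all)
    then show "t \<otimes>\<^bsub>free_alg\<^esub> a \<in> ?L" by simp
    have "t \<in> {t \<in> carrier free_alg. a * t \<in> ?L}"
      by (rule free_alg_subspace_UNIV)
        (use F.subspace_vimage[OF F.vs_axioms F.mult_left_lin[of a] sp] wr in simp_all)
    then show "a \<otimes>\<^bsub>free_alg\<^esub> t \<in> ?L" by simp
  qed
  moreover have "tw_rels q \<subseteq> ?L"
  proof
    fix r assume "r \<in> tw_rels q"
    then have "Poly_Mapping.single [] 1 * r * Poly_Mapping.single [] 1 \<in> ?L" by (intro base) blast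
    then show "r \<in> ?L" by (simp add: single_Nil)
  qed
  ultimately show "rel_ideal \<subseteq> ?L" by (rule genideal_free_minimal)
  show "?L \<subseteq> rel_ideal"
    by (rule F.lspan_minimal[OF rel_subspace]) (auto intro: rel_ideal_closed rel_ideal_base)
qed

lemma relation_free_hom: "r \<in> tw_rels q \<Longrightarrow> Poly_Mapping.single v 1 * r * Poly_Mapping.single w 1 \<in> free_hom (length v + 2 + length w)"
  by (intro free_hom_mult free_hom_single tw_rels_free_hom)

lemma cpt_rel_ideal: assumes "i \<in> rel_ideal" shows "cpt m i \<in> rel_ideal"
proof -
  interpret F: alg "free_alg :: ('k, tw_gen list \<Rightarrow>\<^sub>0 'k) module" by (rule free_alg_alg)
  have "rel_ideal \<subseteq> {i \<in> carrier free_alg. cpt m i \<in> rel_ideal}"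
    unfolding rel_ideal_span
  proof (rule F.lspan_minimal[OF F.subspace_vimage[OF F.vs_axioms cpt_lin rel_subspace[unfolded rel_ideal_span]]], rule subsetI)
    let ?S = "{Poly_Mapping.single v 1 * r * Poly_Mapping.single w 1 | v r w. r \<in> tw_rels q}"
    fix x assume x: "x \<in> ?S"
    then obtain v r w where "x = Poly_Mapping.single v 1 * r * Poly_Mapping.single w 1" "r \<in> tw_rels q" by blast
    then have "cpt m x = (if m = length v + 2 + length w then x else 0)" by (simp add: cpt_free_hom[OF relation_free_hom])
    then show "x \<in> {i \<in> carrier free_alg. cpt m i \<in> lspan free_alg ?S}"
      using F.lspan_base[of x ?S] x subspaceD(2)[OF rel_subspace[unfolded rel_ideal_span]] by auto
  qed
  then show ?thesis using assms by blast
qed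

end

section \<open>The undeformed relations are leading parts of elements of the deformation
  ideal\<close>

context deformed begin

definition "approx m = {X \<in> carrier TH. \<exists>W\<in>gr.below m. X \<ominus>\<^bsub>SM\<^esub> W \<in> J}"

lemma approx_subspace: "subspace TH (approx m)"
proof -
  note b = subspaceD[OF gr.below_subspace[of m], simplified] and j = subspaceD[OF gr.ideal_subspace[OF J_ideal], simplified]
  note me = gr.minus_eq_smult[simplified]
  show ?thesis
  proof (rule T.RH.subspaceI)
    show "approx m \<subseteq> carrier TH" by (auto simp: approx_def)
    show "\<zero>\<^bsub>TH\<^esub> \<in> approx m" unfolding approx_def using b(2) j(2) by (auto intro!: bexI[OF _ b(2)] simp: me)
    fix X c assume "X \<in> approx m"
    then obtain W where X: "X \<in> carrier TH" "W \<in> gr.below m" "X \<ominus>\<^bsub>SM\<^esub> W \<in> J" by (auto simp: approx_def)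
    note W = b(3)[OF X(2)]
    have "c \<odot>\<^bsub>TH\<^esub> X \<ominus>\<^bsub>SM\<^esub> c \<odot>\<^bsub>TH\<^esub> W = c \<odot>\<^bsub>TH\<^esub> (X \<ominus>\<^bsub>SM\<^esub> W)"
      using X W by (simp add: me T.RH.smult_right T.RH.smult_smult)
    then show "c \<odot>\<^bsub>TH\<^esub> X \<in> approx m"
      unfolding approx_def using X W b(5)[OF X(2)] j(5)[OF X(3)] by (auto intro!: bexI[of _ "c \<odot>\<^bsub>TH\<^esub> W"])
    fix Y assume "Y \<in> approx m"
    then obtain W' where Y: "Y \<in> carrier TH" "W' \<in> gr.below m" "Y \<ominus>\<^bsub>SM\<^esub> W' \<in> J" by (auto simp: approx_def)
    note W' = b(3)[OF Y(2)]
    have "(X \<oplus>\<^bsub>TH\<^esub> Y) \<ominus>\<^bsub>SM\<^esub> (W \<oplus>\<^bsub>TH\<^esub> W') = (X \<ominus>\<^bsub>SM\<^esub> W) \<oplus>\<^bsub>TH\<^esub> (Y \<ominus>\<^bsub>SM\<^esub> W')"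
      using X Y W W' by (simp add: me T.RH.smult_right T.RH.a_ac)
    then show "X \<oplus>\<^bsub>TH\<^esub> Y \<in> approx m"
      unfolding approx_def using X Y W W' b(4)[OF X(2) Y(2)] j(4)[OF X(3) Y(3)] by (auto intro!: bexI[of _ "W \<oplus>\<^bsub>TH\<^esub> W'"])
  qed
qed

lemma approx_J: "X \<in> J \<Longrightarrow> X \<in> approx m"
  using subspaceD(2)[OF gr.below_subspace[of m]] subspaceD(3)[OF gr.ideal_subspace[OF J_ideal], of X]
  by (auto simp: approx_def gr.minus_eq_smult[simplified] intro!: bexI[of _ "\<zero>\<^bsub>TH\<^esub>"])

lemma approx_below: "X \<in> gr.below m \<Longrightarrow> X \<in> approx m"
  using subspaceD(3)[OF gr.below_subspace, of X m] subspaceD(2)[OF gr.ideal_subspace[OF J_ideal]]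
    gr.minus_zero_iff[of X X] by (auto simp: approx_def intro!: bexI[of _ X])

lemma grading_below: "X \<in> grading l \<Longrightarrow> l < m \<Longrightarrow> X \<in> gr.below m"
  using gr.G_carrier[of X l] by (auto simp: gr.below_def gr.comp_G)

text \<open>A product v r w tensor h is a relator, which lies in J, plus a multiple of vw tensor Zh,
  whose degree is lower by two.\<close>

lemma tp_rel_ideal_approx:
  assumes "i \<in> rel_ideal" "h \<in> carrier H" shows "tp (cpt m i) h \<in> approx m"
proof -
  have "rel_ideal \<subseteq> {i \<in> carrier free_alg. tp (cpt m i) h \<in> approx m}"
    unfolding rel_ideal_span
  proof (rule vs.lspan_minimal[OF free_alg_vs vs.subspace_vimage[OF free_alg_vs T.RH.vs_axioms lin_map_comp[OF cpt_lin T.rpure_lin(1)[OF assms(2)]] approx_subspace]], rule subsetI)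
    fix x assume "x \<in> {Poly_Mapping.single v 1 * r * Poly_Mapping.single w 1 | v r w. r \<in> tw_rels q}"
    then obtain v r w where x: "x = Poly_Mapping.single v 1 * r * Poly_Mapping.single w 1" and r: "r \<in> tw_rels q" by blast
    let ?v = "Poly_Mapping.single v (1::'k)" and ?w = "Poly_Mapping.single w (1::'k)"
    show "x \<in> {i \<in> carrier free_alg. tp (cpt m i) h \<in> approx m}"
    proof (cases "m = length v + 2 + length w")
      case True
      have c: "tp (?v * ?w) (Z \<otimes>\<^bsub>H\<^esub> h) \<in> gr.below m"
        using assms(2) True by (intro grading_below[OF grading_tp[OF free_hom_mult[OF free_hom_single free_hom_single]]]) simp_all
      have "tp x h = relator ?v r ?w h \<oplus>\<^bsub>TH\<^esub> kp r \<odot>\<^bsub>TH\<^esub> tp (?v * ?w) (Z \<otimes>\<^bsub>H\<^esub> h)"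
        using assms(2) by (simp add: relator_def x T.RH.a_assoc flip: T.RH.smult_left)
      also have "\<dots> \<in> approx m"
        using subspaceD(4,5)[OF approx_subspace] approx_J[OF relator_J[OF r assms(2)]] approx_below[OF c] by simp
      finally show ?thesis using True by (simp add: x cpt_free_hom[OF relation_free_hom[OF r]])
    next
      case False
      then show ?thesis
        using subspaceD(2)[OF approx_subspace, of m] assms(2) by (simp add: x cpt_free_hom[OF relation_free_hom[OF r]] tp_simps)
    qed
  qed
  then show ?thesis using assms by blast
qed

text \<open>Chooses ordered representatives: \<open>omega r vac\<close> holds the coordinates of r
  with respect to ordered monomials. Linearity in r lets this choice pass through the tensor product
  with H.\<close>

definition "lift = tlift TH (\<lambda>r h. tp (sig (omega r vac)) h)"

lemma lift_aux: "bilin AA H TH (\<lambda>r h. tp (sig (omega r vac)) h)"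
proof (rule bilinI)
  fix h assume h: "h \<in> carrier H"
  show "lin_map AA TH (\<lambda>r. tp (sig (omega r vac)) h)"
    by (rule lin_map_comp[OF lin_map_comp[OF omega_vac_lin] T.rpure_lin(1)[OF h]]) (rule lin_mapI; simp)
qed (simp add: T.rpure_lin(2))

lemma lift_lin: "lin_map XH TH lift"
  unfolding lift_def by (rule tlift_lin[OF AA.vs_axioms H.vs_axioms T.RH.vs_axioms lift_aux])

lemma lift_xp: "r \<in> carrier AA \<Longrightarrow> h \<in> carrier H \<Longrightarrow> lift (xp r h) = tp (sig (omega r vac)) h"
  unfolding lift_def by (rule tlift_pure[OF AA.vs_axioms H.vs_axioms T.RH.vs_axioms lift_aux])

text \<open>Subtracting the degree m part of the lifted projection avoids any description of the
  kernel of the projection tensored with H.\<close>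

lemma smash_proj_zero_only_if:
  assumes X: "X \<in> grading m" and z: "smash_proj X = \<zero>\<^bsub>XH\<^esub>"
  shows "\<exists>W\<in>gr.below m. X \<ominus>\<^bsub>SM\<^esub> W \<in> J"
proof -
  \<comment> \<open>On a tensor h it is the degree m part of an element of the ideal, by
    \<open>straighten\<close>, tensor h; on X itself the subtracted term vanishes because it depends
    only on \<open>smash_proj X\<close>.\<close>
  let ?g = "\<lambda>X. X \<ominus>\<^bsub>TH\<^esub> hcomp m (lift (smash_proj X))"
  have lin: "lin_map TH TH ?g"
    by (intro lin_map_diff[OF T.RH.vs_axioms T.RH.vs_axioms lin_map_id] lin_map_comp[OF lin_map_comp[OF smash_proj_lin lift_lin] comp_lin])
  have "grading m \<subseteq> {X \<in> carrier TH. ?g X \<in> approx m}"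
  proof (rule grading_subsetI[OF T.RH.subspace_vimage[OF T.RH.vs_axioms lin approx_subspace]])
    fix a h assume a: "a \<in> (free_hom m :: 'k free4 set)" and h: "h \<in> carrier H"
    have "?g (tp a h) = tp (cpt m (a - sig (rho q 0 a vac))) h"
      using h by (simp add: smash_proj_tp lift_xp omega_proj comp_tp tp_simps cpt_free_hom[OF a] del: rho_simps)
    then show "tp a h \<in> {X \<in> carrier TH. ?g X \<in> approx m}"
      using tp_rel_ideal_approx[OF straighten h] h by simp
  qed
  then have "?g X \<in> approx m" using X by blast
  moreover have "?g X = X"
    using gr.G_carrier[OF X] lin_map_zero[OF XH.vs_axioms T.RH.vs_axioms lin_map_comp[OF lift_lin comp_lin]]
    by (simp add: z T.RH.minus_eq_smult)
  ultimately show ?thesis by (simp add: approx_def)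
qed

text \<open>The right-hand side depends only on \<open>smash_proj X\<close>, so the kernel of the
  projection is closed under taking homogeneous parts. The reason is that the undeformed ideal is
  homogeneous.\<close>

lemma smash_proj_hcomp:
  assumes "X \<in> carrier TH" shows "smash_proj (hcomp m X) = smash_proj (hcomp m (lift (smash_proj X)))"
proof (rule tensor_eqI[OF free_alg_vs H.vs_axioms XH.vs_axioms lin_map_comp[OF comp_lin smash_proj_lin]
      lin_map_comp[OF lin_map_comp[OF lin_map_comp[OF smash_proj_lin lift_lin] comp_lin] smash_proj_lin] _ assms])
  fix a :: "'k free4" and h assume h: "h \<in> carrier H"
  have "proj (cpt m a) = proj (cpt m (sig (rho q 0 a vac)))"
    using cpt_rel_ideal[OF straighten[of a], of m] by (simp add: proj_eq_iff del: rho_simps)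
  then show "smash_proj (hcomp m (tp a h)) = smash_proj (hcomp m (lift (smash_proj (tp a h))))"
    using h by (simp add: smash_proj_tp lift_xp omega_proj comp_tp del: rho_simps)
qed

section \<open>The undeformed smash product as a graded quotient\<close>

abbreviation "TS \<equiv> smash TW (Uq q) tact"

lemma TW_tensor: "tensor TW (Uq q) = XH" "pure TW (Uq q) = xp"
proof -
  have c: "carrier TW = carrier AA" "add TW = add AA" "module.smult TW = module.smult AA"
    by (simp_all add: twist_alg_def)
  show "tensor TW (Uq q) = XH" "pure TW (Uq q) = xp"
    by (rule tensor_cong; simp add: c Uq_def module.extend_def hopf.fields_def)+
qed

lemma TS_simps [simp]: "carrier TS = carrier XH" "x \<oplus>\<^bsub>TS\<^esub> y = x \<oplus>\<^bsub>XH\<^esub> y" "\<zero>\<^bsub>TS\<^esub> = \<zero>\<^bsub>XH\<^esub>"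
  "c \<odot>\<^bsub>TS\<^esub> x = c \<odot>\<^bsub>XH\<^esub> x" "\<one>\<^bsub>TS\<^esub> = xp (pure A A \<one>\<^bsub>A\<^esub> \<one>\<^bsub>A\<^esub>) \<one>\<^bsub>H\<^esub>"
  by (simp_all add: smash_def TW_tensor)

lemma TS_vs: "vs TS"
  by (rule vs_cong[OF XH.vs_axioms]) (simp_all add: smash_def TW_tensor)

text \<open>The locale \<open>uq_module\<close> is not instantiated for the twisted algebra, so the
  product is evaluated directly from the nested lifts in \<open>smash\<close>.\<close>

abbreviation "ts_mult x h y g \<equiv> tlift XH (\<lambda>h1 h2. xp (M x (tact h1 y)) (h2 \<otimes>\<^bsub>H\<^esub> g)) (\<Delta> h)"

lemma TS_mult_eq: "X \<otimes>\<^bsub>TS\<^esub> Y = tlift XH (\<lambda>x h. tlift XH (\<lambda>y g. ts_mult x h y g) Y) X"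
  by (simp add: smash_def TW_tensor)

lemma tact_closed [simp]: "h \<in> carrier H \<Longrightarrow> X \<in> carrier AA \<Longrightarrow> tact h X \<in> carrier AA"
  by (rule lin_map_closed[OF tact_lin])

lemma ts_inner: "x \<in> carrier AA \<Longrightarrow> y \<in> carrier AA \<Longrightarrow> g \<in> carrier H \<Longrightarrow>
    bilin H H XH (\<lambda>h1 h2. xp (M x (tact h1 y)) (h2 \<otimes>\<^bsub>H\<^esub> g))"
  by (auto intro!: bilinI lin_map_comp[OF lin_map_comp[OF tact_lin_left bilin_right[OF M_bilin]] xp_lin(1)]
      lin_map_comp[OF H.mult_right_lin xp_lin(2)] M_closed)

lemma ts_mult_bilin_right:
  assumes "x \<in> carrier AA" "h \<in> carrier H" shows "bilin AA H XH (\<lambda>y g. ts_mult x h y g)"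
proof (rule bilinI)
  fix g assume g: "g \<in> carrier H"
  show "lin_map AA XH (\<lambda>y. ts_mult x h y g)"
    by (rule tlift_param_lin[OF H.vs_axioms H.vs_axioms XH.vs_axioms AA.vs_axioms ts_inner[OF assms(1) _ g] _ comult_closed[OF assms(2)]])
      (auto intro!: lin_map_comp[OF lin_map_comp[OF tact_lin bilin_right[OF M_bilin]] xp_lin(1)] tact_closed assms g)
next
  fix y assume y: "y \<in> carrier AA"
  show "lin_map H XH (\<lambda>g. ts_mult x h y g)"
    by (rule tlift_param_lin[OF H.vs_axioms H.vs_axioms XH.vs_axioms H.vs_axioms ts_inner[OF assms(1) y] _ comult_closed[OF assms(2)]])
      (auto intro!: lin_map_comp[OF H.mult_left_lin xp_lin(2)] M_closed tact_closed assms y)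
qed

lemma ts_mult_bilin_left:
  assumes "y \<in> carrier AA" "g \<in> carrier H" shows "bilin AA H XH (\<lambda>x h. ts_mult x h y g)"
proof (rule bilinI)
  fix h assume h: "h \<in> carrier H"
  show "lin_map AA XH (\<lambda>x. ts_mult x h y g)"
    by (rule tlift_param_lin[OF H.vs_axioms H.vs_axioms XH.vs_axioms AA.vs_axioms ts_inner[OF _ assms] _ comult_closed[OF h]])
      (auto intro!: lin_map_comp[OF bilin_left[OF M_bilin] xp_lin(1)] tact_closed assms)
next
  fix x assume x: "x \<in> carrier AA"
  show "lin_map H XH (\<lambda>h. ts_mult x h y g)"
    by (rule lin_map_comp[OF comult_lin tlift_lin[OF H.vs_axioms H.vs_axioms XH.vs_axioms ts_inner[OF x assms]]])
qed

lemmas TS_aux = AA.vs_axioms H.vs_axioms AA.vs_axioms H.vs_axioms XH.vs_axioms ts_mult_bilin_right ts_mult_bilin_left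

lemma TS_mult_bilin: "bilin XH XH XH (\<lambda>X Y. X \<otimes>\<^bsub>TS\<^esub> Y)"
  unfolding TS_mult_eq by (rule tlift_tlift_bilin[OF TS_aux])

lemma TS_mult_pure: "x \<in> carrier AA \<Longrightarrow> h \<in> carrier H \<Longrightarrow> y \<in> carrier AA \<Longrightarrow> g \<in> carrier H \<Longrightarrow>
    xp x h \<otimes>\<^bsub>TS\<^esub> xp y g = ts_mult x h y g"
  unfolding TS_mult_eq by (rule tlift_tlift_pure[OF TS_aux])

lemma smash_proj_closed [simp]: "X \<in> carrier TH \<Longrightarrow> smash_proj X \<in> carrier XH"
  by (rule lin_map_closed[OF smash_proj_lin])

lemma hact_tp_tlift: "b \<in> UNIV \<Longrightarrow> h \<in> carrier H \<Longrightarrow> g \<in> carrier H \<Longrightarrow>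
    T.hact h (tp b g) = tlift TH (\<lambda>h1 h2. tp (actT h1 b) (h2 \<otimes>\<^bsub>H\<^esub> g)) (\<Delta> h)"
  unfolding T.hop_def
  using tlift_tlift_left[OF free_alg_vs H.vs_axioms H.vs_axioms H.vs_axioms T.RH.vs_axioms T.hop_bilin_H T.hop_bilin_R, of b g "\<Delta> h"]
  by simp

text \<open>The projection can be moved inside the sum over \<Delta>(h), where it respects products
  by \<open>proj_mult\<close> and the action by \<open>proj_act\<close>.\<close>

lemma smash_proj_mult_tp:
  assumes h: "h \<in> carrier H" and g: "g \<in> carrier H"
  shows "smash_proj (tp a h \<otimes>\<^bsub>SM\<^esub> tp b g) = smash_proj (tp a h) \<otimes>\<^bsub>TS\<^esub> smash_proj (tp b g)"
proof -
  have b: "bilin H H TH (\<lambda>h1 h2. tp (actT h1 b) (h2 \<otimes>\<^bsub>H\<^esub> g))" using T.hop_bilin_H[of b g] g by simp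
  have "smash_proj (tp a h \<otimes>\<^bsub>SM\<^esub> tp b g) = smash_proj (T.rop a (tlift TH (\<lambda>h1 h2. tp (actT h1 b) (h2 \<otimes>\<^bsub>H\<^esub> g)) (\<Delta> h)))"
    using h g by (simp add: T.smash_mult_pure hact_tp_tlift)
  also have "\<dots> = tlift XH (\<lambda>h1 h2. smash_proj (T.rop a (tp (actT h1 b) (h2 \<otimes>\<^bsub>H\<^esub> g)))) (\<Delta> h)"
    using h by (intro tlift_comp[OF H.vs_axioms H.vs_axioms T.RH.vs_axioms b XH.vs_axioms lin_map_comp[OF T.rop_lin smash_proj_lin]]) simp_all
  also have "\<dots> = ts_mult (proj a) h (proj b) g"
    using h g by (intro tlift_cong[OF H.vs_axioms H.vs_axioms XH.vs_axioms ts_inner]) (simp_all add: T.rop_pure smash_proj_tp proj_mult proj_act)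
  finally show ?thesis using h g by (simp add: smash_proj_tp TS_mult_pure)
qed

lemma smash_proj_hom: "alg_hom SM TS smash_proj"
  unfolding alg_hom_def
proof (intro conjI ballI)
  show "lin_map SM TS smash_proj" using smash_proj_lin by (simp add: lin_map_def)
  show "smash_proj \<one>\<^bsub>SM\<^esub> = \<one>\<^bsub>TS\<^esub>" using alg_hom_one[OF proj_hom] by (simp add: smash_proj_tp)
  fix X Y assume "X \<in> carrier SM" "Y \<in> carrier SM"
  then have X: "X \<in> carrier TH" and Y: "Y \<in> carrier TH" by simp_all
  note sa = lin_map_add[OF smash_proj_lin] T.smash_mult_closed bilin_add_left[OF T.smash_mult_bilin] bilin_add_right[OF T.smash_mult_bilin]
    bilin_add_left[OF TS_mult_bilin] bilin_add_right[OF TS_mult_bilin]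
  from X show "smash_proj (X \<otimes>\<^bsub>SM\<^esub> Y) = smash_proj X \<otimes>\<^bsub>TS\<^esub> smash_proj Y"
  proof (induction rule: T.RH_induct)
    case (pure a h)
    note h = pure(2)
    from Y show ?case
    proof (induction rule: T.RH_induct)
      case (pure b g)
      then show ?case using h by (simp add: smash_proj_mult_tp)
    qed (use h in \<open>simp add: sa\<close>)
  qed (use Y in \<open>simp add: sa\<close>)
qed

lemma smash_proj_surj: "smash_proj ` carrier SM = carrier TS"
proof
  show "smash_proj ` carrier SM \<subseteq> carrier TS" by auto
  have "X \<in> smash_proj ` carrier TH" if "X \<in> carrier XH" for X
  proof (rule tensor_subspace_induct[OF AA.vs_axioms H.vs_axioms _ _ that])
    show "subspace XH (smash_proj ` carrier TH)"
      by (rule subspace_image[OF T.RH.vs_axioms XH.vs_axioms smash_proj_lin T.RH.subspace_carrier])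
    fix x h assume "x \<in> carrier AA" and h: "h \<in> carrier H"
    then obtain t where "x = proj t" using proj_surj by blast
    then have "xp x h = smash_proj (tp t h)" using h by (simp add: smash_proj_tp)
    then show "xp x h \<in> smash_proj ` carrier TH" by (rule image_eqI) (rule tp_closed[OF h])
  qed
  then show "carrier TS \<subseteq> smash_proj ` carrier SM" by auto
qed

lemma smash_proj_grading: "smash_proj ` grading m = smash_grading TW (Uq q) AA_grading m"
proof -
  have "smash_proj ` grading m = lspan XH (smash_proj ` {tp a h | a h. a \<in> free_hom m \<and> h \<in> carrier H})"
    unfolding grading_eq by (rule lspan_image[OF T.RH.vs_axioms XH.vs_axioms smash_proj_lin]) auto
  also have "smash_proj ` {tp a h | a h. a \<in> free_hom m \<and> h \<in> carrier H} = {xp x h | x h. x \<in> AA_grading m \<and> h \<in> carrier H}"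
    unfolding proj_free_hom[symmetric]
  proof (rule equalityI; rule subsetI)
    fix X assume "X \<in> smash_proj ` {tp a h | a h. a \<in> free_hom m \<and> h \<in> carrier H}"
    then show "X \<in> {xp x h | x h. x \<in> proj ` free_hom m \<and> h \<in> carrier H}" by (auto simp: smash_proj_tp) blast
  next
    fix X assume "X \<in> {xp x h | x h. x \<in> proj ` free_hom m \<and> h \<in> carrier H}"
    then obtain t h where "X = xp (proj t) h" "t \<in> free_hom m" "h \<in> carrier H" by blast
    then show "X \<in> smash_proj ` {tp a h | a h. a \<in> free_hom m \<and> h \<in> carrier H}"
      by (intro image_eqI[of _ _ "tp t h"]) (auto simp: smash_proj_tp)
  qed
  finally show ?thesis by (simp add: smash_grading_def TW_tensor)
qed

theorem deformation_pbw:
  "pbw_deformation (deform (Uq q) actT (tw_rels q) kappa) (deform_filtration (Uq q) actT (tw_rels q) kappa)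
    TS (smash_grading TW (Uq q) AA_grading)"
proof -
  have "pbw_deformation (quot SM J) (quot_filtration SM grading J) TS (\<lambda>m. smash_proj ` grading m)"
  proof (rule gr.pbw_criterion[OF J_ideal TS_vs smash_proj_hom smash_proj_surj])
    fix X m assume X: "X \<in> carrier SM" "smash_proj X = \<zero>\<^bsub>TS\<^esub>"
    then show "smash_proj (hcomp m X) = \<zero>\<^bsub>TS\<^esub>"
      using lin_map_zero[OF XH.vs_axioms XH.vs_axioms lin_map_comp[OF lin_map_comp[OF lift_lin comp_lin] smash_proj_lin]]
      by (simp add: smash_proj_hcomp)
  next
    fix m X assume X: "X \<in> grading m"
    show "smash_proj X = \<zero>\<^bsub>TS\<^esub> \<longleftrightarrow> (\<exists>W\<in>gr.below m. X \<ominus>\<^bsub>SM\<^esub> W \<in> J)"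
      using smash_proj_zero_if[OF X] smash_proj_zero_only_if[OF X] by auto
  qed
  then show ?thesis by (simp only: smash_proj_grading deform_def deform_filtration_def)
qed

lemma kappa_lin: "lin_map (free_alg\<lparr>carrier := rel_span\<rparr>) (Uq q) kappa"
  by (rule lin_mapI) (simp_all add: kappa_def kap_linear H.smult_left H.smult_smult)

end

section \<open>The elements K^{ns}: centrality and trivial action\<close>

lemma (in quantum) inverse_pow:
  assumes "x \<in> carrier H" "y \<in> carrier H" "x \<otimes>\<^bsub>H\<^esub> y = \<one>\<^bsub>H\<^esub>"
  shows "x [^]\<^bsub>H\<^esub> (m::nat) \<otimes>\<^bsub>H\<^esub> y [^]\<^bsub>H\<^esub> m = \<one>\<^bsub>H\<^esub>"
proof (induction m)
  case (Suc m)
  have "x [^]\<^bsub>H\<^esub> Suc m \<otimes>\<^bsub>H\<^esub> y [^]\<^bsub>H\<^esub> Suc m = x [^]\<^bsub>H\<^esub> m \<otimes>\<^bsub>H\<^esub> (x \<otimes>\<^bsub>H\<^esub> y) \<otimes>\<^bsub>H\<^esub> y [^]\<^bsub>H\<^esub> m"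
    unfolding H.nat_pow_Suc2[OF assms(2)] unfolding H.nat_pow_Suc using assms(1,2) by (simp add: H.m_assoc)
  then show ?case using assms Suc by simp
qed simp

text \<open>Reduces integer exponents to natural powers of K^n or of K^{-n}; in the negative case
  the inverse in \<open>Uq\<close> is identified with a power of the generator K^{-1}.\<close>

lemma (in quantum) Uq_int_pow:
  "k1 [^]\<^bsub>Uq q\<^esub> (int n * s) = (if s < 0 then (k' [^]\<^bsub>H\<^esub> n) [^]\<^bsub>H\<^esub> nat (- s) else (k1 [^]\<^bsub>H\<^esub> n) [^]\<^bsub>H\<^esub> nat s)"
proof -
  interpret Q: alg "Uq q" by (rule Uq_alg)
  have pow: "x [^]\<^bsub>Uq q\<^esub> m = x [^]\<^bsub>H\<^esub> m" for x and m :: nat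
    by (induction m) simp_all
  have neg: "k1 [^]\<^bsub>Uq q\<^esub> (- int m) = k' [^]\<^bsub>H\<^esub> m" for m
  proof (cases m)
    case (Suc l)
    then have "k1 [^]\<^bsub>Uq q\<^esub> (- int m) = inv\<^bsub>Uq q\<^esub> (k1 [^]\<^bsub>H\<^esub> m)"
      by (simp add: int_pow_def2 pow nat_add_distrib)
    also have "\<dots> = k' [^]\<^bsub>H\<^esub> m"
      by (rule Q.inv_unique'[symmetric])
        (use inverse_pow[of k1 k' m] inverse_pow[of k' k1 m] in \<open>simp_all add: uq_relations\<close>)
    finally show ?thesis .
  qed (simp add: int_pow_def2 pow)
  show ?thesis
  proof (cases "s < 0")
    case False
    then have "int n * s = int (n * nat s)" by simp
    then have "k1 [^]\<^bsub>Uq q\<^esub> (int n * s) = k1 [^]\<^bsub>Uq q\<^esub> (n * nat s)" by (simp only: int_pow_int)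
    then show ?thesis using False by (simp only: pow H.nat_pow_pow[OF uqg_closed] if_False)
  next
    case True
    let ?m = "n * nat (- s)"
    have "int n * s = - int ?m" using True by simp
    then have "k1 [^]\<^bsub>Uq q\<^esub> (int n * s) = k1 [^]\<^bsub>Uq q\<^esub> (- int ?m)" by (simp only:)
    also have "\<dots> = k' [^]\<^bsub>H\<^esub> ?m" by (rule neg)
    finally show ?thesis using True by (simp only: H.nat_pow_pow[OF uqg_closed] if_True)
  qed
qed

context equivariant begin

text \<open>The conditions that \<open>deformed\<close> imposes on \<open>Z\<close>. They are stable
  under products, so only K^n and K^{-n} have to be examined.\<close>

definition "trivially_acting = {X \<in> carrier H. (\<forall>h\<in>carrier H. X \<otimes>\<^bsub>H\<^esub> h = h \<otimes>\<^bsub>H\<^esub> X) \<and>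
    (\<forall>b. \<forall>h\<in>carrier H. T.hact X (tp b h) = tp b (X \<otimes>\<^bsub>H\<^esub> h))}"

lemma trivially_acting_mult:
  assumes "X \<in> trivially_acting" "Y \<in> trivially_acting" shows "X \<otimes>\<^bsub>H\<^esub> Y \<in> trivially_acting"
proof -
  have X: "X \<in> carrier H" "\<And>h. h \<in> carrier H \<Longrightarrow> X \<otimes>\<^bsub>H\<^esub> h = h \<otimes>\<^bsub>H\<^esub> X"
    "\<And>b h. h \<in> carrier H \<Longrightarrow> T.hact X (tp b h) = tp b (X \<otimes>\<^bsub>H\<^esub> h)"
    and Y: "Y \<in> carrier H" "\<And>h. h \<in> carrier H \<Longrightarrow> Y \<otimes>\<^bsub>H\<^esub> h = h \<otimes>\<^bsub>H\<^esub> Y"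
    "\<And>b h. h \<in> carrier H \<Longrightarrow> T.hact Y (tp b h) = tp b (Y \<otimes>\<^bsub>H\<^esub> h)"
    using assms by (auto simp: trivially_acting_def)
  have "X \<otimes>\<^bsub>H\<^esub> Y \<otimes>\<^bsub>H\<^esub> h = h \<otimes>\<^bsub>H\<^esub> (X \<otimes>\<^bsub>H\<^esub> Y)" if h: "h \<in> carrier H" for h
    using X(1,2) Y(1,2) h H.m_assoc by metis
  moreover have "T.hact (X \<otimes>\<^bsub>H\<^esub> Y) (tp b h) = tp b (X \<otimes>\<^bsub>H\<^esub> Y \<otimes>\<^bsub>H\<^esub> h)" if h: "h \<in> carrier H" for b h
    using X(1,3) Y(1,3) h by (simp add: T.hact_mult H.m_assoc)
  ultimately show ?thesis using X(1) Y(1) by (simp add: trivially_acting_def)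
qed

lemma trivially_acting_pow: "X \<in> trivially_acting \<Longrightarrow> X [^]\<^bsub>H\<^esub> (m::nat) \<in> trivially_acting"
  by (induction m) (simp_all add: trivially_acting_mult, simp add: trivially_acting_def T.hact_one)

lemma skew_pow:
  assumes "X \<in> carrier H" "g \<in> carrier H" "X \<otimes>\<^bsub>H\<^esub> g = c \<odot>\<^bsub>H\<^esub> (g \<otimes>\<^bsub>H\<^esub> X)"
  shows "X [^]\<^bsub>H\<^esub> (m::nat) \<otimes>\<^bsub>H\<^esub> g = c ^ m \<odot>\<^bsub>H\<^esub> (g \<otimes>\<^bsub>H\<^esub> X [^]\<^bsub>H\<^esub> m)"
proof (induction m)
  case (Suc m)
  have "X [^]\<^bsub>H\<^esub> Suc m \<otimes>\<^bsub>H\<^esub> g = c \<odot>\<^bsub>H\<^esub> (X [^]\<^bsub>H\<^esub> m \<otimes>\<^bsub>H\<^esub> g \<otimes>\<^bsub>H\<^esub> X)"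
    using assms by (simp add: H.m_assoc H.smult_mult_right)
  also have "\<dots> = c ^ Suc m \<odot>\<^bsub>H\<^esub> (g \<otimes>\<^bsub>H\<^esub> X [^]\<^bsub>H\<^esub> Suc m)"
    using assms Suc by (simp add: H.m_assoc H.smult_mult_left H.smult_smult)
  finally show ?case .
qed (use assms in simp)

text \<open>X stands for K or K^{-1}: it commutes with the generators of H, and acts on those of the
  free algebra, up to factors c with c^n = 1. The n-th power of X turns these factors into
  1.\<close>

lemma pow_trivially_acting:
  assumes X: "X \<in> carrier H"
    and comm: "\<And>g. \<exists>c. c ^ n = 1 \<and> X \<otimes>\<^bsub>H\<^esub> uqg q g = c \<odot>\<^bsub>H\<^esub> (uqg q g \<otimes>\<^bsub>H\<^esub> X)"
    and unit: "actT X 1 = 1" and prod: "\<And>s t. actT X (s * t) = actT X s * actT X t"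
    and gen: "\<And>g. \<exists>c. c ^ n = 1 \<and> actT X (gen g) = scale c (gen g)"
    and pure: "\<And>b h. h \<in> carrier H \<Longrightarrow> T.hact X (tp b h) = tp (actT X b) (X \<otimes>\<^bsub>H\<^esub> h)"
  shows "X [^]\<^bsub>H\<^esub> n \<in> trivially_acting"
proof -
  have Xm: "X [^]\<^bsub>H\<^esub> m \<in> carrier H" for m :: nat using X by simp
  have central: "X [^]\<^bsub>H\<^esub> n \<otimes>\<^bsub>H\<^esub> h = h \<otimes>\<^bsub>H\<^esub> X [^]\<^bsub>H\<^esub> n" if "h \<in> carrier H" for h
    using that
  proof (induction rule: H_induct)
    case (gen g)
    obtain c where "c ^ n = 1" "X \<otimes>\<^bsub>H\<^esub> uqg q g = c \<odot>\<^bsub>H\<^esub> (uqg q g \<otimes>\<^bsub>H\<^esub> X)" using comm by blast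
    then show ?case using skew_pow[OF X, of "uqg q g" c n] Xm by simp
  next
    case (mult x y)
    then show ?case using Xm[of n] H.m_assoc by metis
  qed (use Xm in \<open>simp_all add: H.l_distr H.r_distr H.smult_mult_left H.smult_mult_right\<close>)
  have am: "actT (X [^]\<^bsub>H\<^esub> Suc m) t = actT (X [^]\<^bsub>H\<^esub> m) (actT X t)" for m t
    using X by (simp add: T.act_mult)
  have a0: "actT (X [^]\<^bsub>H\<^esub> (0::nat)) t = t" for t
    using T.act_one by simp
  have units: "actT (X [^]\<^bsub>H\<^esub> m) 1 = 1" for m :: nat
    by (induction m) (simp_all only: a0 am unit)
  have prods: "actT (X [^]\<^bsub>H\<^esub> m) (s * t) = actT (X [^]\<^bsub>H\<^esub> m) s * actT (X [^]\<^bsub>H\<^esub> m) t" for m :: nat and s t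
    by (induction m arbitrary: s t) (simp_all only: a0 am prod)
  have gens: "actT (X [^]\<^bsub>H\<^esub> m) (gen g) = scale (c ^ m) (gen g)" if "actT X (gen g) = scale c (gen g)" for m :: nat and g c
    by (induction m) (simp_all only: a0 am that actT_linear[OF Xm], simp_all)
  have fixed: "actT (X [^]\<^bsub>H\<^esub> n) t = t" for t
  proof (induction t rule: free_alg_induct)
    fix g
    obtain c where "c ^ n = 1" "actT X (gen g) = scale c (gen g)" using gen by blast
    then show "actT (X [^]\<^bsub>H\<^esub> n) (gen g) = gen g" using gens[of g c n] by simp
  qed (simp_all only: units prods actT_linear[OF Xm])
  have "T.hact (X [^]\<^bsub>H\<^esub> m) (tp b h) = tp (actT (X [^]\<^bsub>H\<^esub> m) b) (X [^]\<^bsub>H\<^esub> m \<otimes>\<^bsub>H\<^esub> h)" if "h \<in> carrier H" for m :: nat and b h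
    using that
  proof (induction m arbitrary: b h)
    case 0
    then show ?case using T.hact_one[of "tp b h"] a0[of b] by simp
  next
    case (Suc m)
    then show ?case using X Xm pure am[of m b] by (simp add: T.hact_mult H.m_assoc)
  qed
  then show ?thesis using Xm central by (simp add: trivially_acting_def fixed)
qed

lemma K_pow_trivially_acting:
  assumes "q ^ n = 1" shows "k1 [^]\<^bsub>H\<^esub> n \<in> trivially_acting" "k' [^]\<^bsub>H\<^esub> n \<in> trivially_acting"
proof -
  have q: "inverse q ^ n = 1" "(q\<^sup>2) ^ n = 1" "inverse (q\<^sup>2) ^ n = 1"
    using assms by (simp_all add: power_inverse flip: power_mult) (simp_all add: mult.commute[of 2] power_mult)
  have inv: "k' \<otimes>\<^bsub>H\<^esub> e = inverse (q\<^sup>2) \<odot>\<^bsub>H\<^esub> (e \<otimes>\<^bsub>H\<^esub> k')" "k' \<otimes>\<^bsub>H\<^esub> f = q\<^sup>2 \<odot>\<^bsub>H\<^esub> (f \<otimes>\<^bsub>H\<^esub> k')"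
    using q_nonzero by (simp_all add: uq_commute H.smult_smult)
  have gens: "\<exists>c. c ^ n = 1 \<and> actT k1 (gen g) = scale c (gen g)" "\<exists>c. c ^ n = 1 \<and> actT k' (gen g) = scale c (gen g)" for g
    using std_actT std_actT' assms q(1) unfolding std_action_def by (cases g; auto)+
  show "k1 [^]\<^bsub>H\<^esub> n \<in> trivially_acting"
  proof (rule pow_trivially_acting)
    fix g show "\<exists>c. c ^ n = 1 \<and> k1 \<otimes>\<^bsub>H\<^esub> uqg q g = c \<odot>\<^bsub>H\<^esub> (uqg q g \<otimes>\<^bsub>H\<^esub> k1)"
      using uq_commute(1,3) q by (cases g) (auto simp: uq_relations intro: exI[of _ 1])
  qed (simp_all add: actT_unit actT_prod gens T.hact_gen_pure)
  show "k' [^]\<^bsub>H\<^esub> n \<in> trivially_acting"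
  proof (rule pow_trivially_acting)
    fix g show "\<exists>c. c ^ n = 1 \<and> k' \<otimes>\<^bsub>H\<^esub> uqg q g = c \<odot>\<^bsub>H\<^esub> (uqg q g \<otimes>\<^bsub>H\<^esub> k')"
      using inv q by (cases g) (auto simp: uq_relations intro: exI[of _ 1])
  qed (simp_all add: actT_unit actT_prod gens T.hact_gen_pure)
qed

end

theorem proposition3p6:
  fixes q :: "'k::{alg_closed_field, field_char_0}"
    and n :: nat
    and act :: "'k uq \<Rightarrow> 'k plane \<Rightarrow> 'k plane"
    and actT :: "'k uq \<Rightarrow> 'k free4 \<Rightarrow> 'k free4"
    and \<tau> :: "(('k plane \<times> 'k plane) \<Rightarrow>\<^sub>0 'k) set \<Rightarrow> (('k plane \<times> 'k plane) \<Rightarrow>\<^sub>0 'k) set"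
  defines "A \<equiv> qplane q"
    and "R \<equiv> twist_alg (qplane q) (qplane q) \<tau>"
    and "H \<equiv> Uq q"
  assumes "n \<ge> 3"
    and "q ^ n = 1" and "\<And>m. 0 < m \<Longrightarrow> m < n \<Longrightarrow> q ^ m \<noteq> 1"
    and "module_algebra H A act" and "std_action q A act (qpg q gu) (qpg q gv)"
    and "module_algebra H free_alg actT"
    and "std_action q free_alg actT (gen U) (gen V)"
    and "std_action q free_alg actT (gen U') (gen V')"
    and "twisting_map A A \<tau>" and "tau_on_gens q \<tau>"
  shows "has_presentation R (tw_gens q) (tw_rels q) \<and>
    (\<forall>(\<alpha>::'k) (s::int). \<exists>\<kappa>.
       lin_map (free_alg\<lparr>carrier := lspan free_alg (tw_rels q)\<rparr>) H \<kappa> \<and>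
       \<kappa> (r4 q) = \<alpha> \<odot>\<^bsub>H\<^esub> (uqg q gK [^]\<^bsub>H\<^esub> (int n * s)) \<and>
       \<kappa> (r5 q) = (- inverse q * \<alpha>) \<odot>\<^bsub>H\<^esub> (uqg q gK [^]\<^bsub>H\<^esub> (int n * s)) \<and>
       \<kappa> (r1 q) = \<zero>\<^bsub>H\<^esub> \<and> \<kappa> (r2 q) = \<zero>\<^bsub>H\<^esub> \<and> \<kappa> (r3 q) = \<zero>\<^bsub>H\<^esub> \<and> \<kappa> (r6 q) = \<zero>\<^bsub>H\<^esub> \<and>
       pbw_deformation
         (deform H actT (tw_rels q) \<kappa>)
         (deform_filtration H actT (tw_rels q) \<kappa>)
         (smash R H (tensor_act H A A act act))
         (smash_grading R H (tensor_grading A A (qplane_grading q) (qplane_grading q))))"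
proof -
  have q0: "q \<noteq> 0" using assms(4,5) by (auto simp: power_0_left)
  \<comment> \<open>This is where n >= 3 enters: the exponent 2 lies below the order of q.\<close>
  have q2: "q\<^sup>2 \<noteq> 1" using assms(4) assms(6)[of 2] by simp
  interpret quantum q by (rule quantum.intro[OF q0 q2])
  have mT: "uq_module q free_alg actT"
    by (intro uq_module.intro free_alg_alg quantum_axioms uq_module_axioms.intro) (use assms(9) in \<open>simp add: H_def\<close>)
  have mP: "uq_module q (qplane q) act"
    by (intro uq_module.intro A.alg_axioms quantum_axioms uq_module_axioms.intro) (use assms(7) in \<open>simp add: H_def A_def\<close>)
  interpret equivariant q \<tau> actT act
    by (intro equivariant.intro twisted.intro quantum_axioms twisted_axioms.intro equivariant_axioms.intro mT mP)
      (use assms in \<open>simp_all add: A_def\<close>)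
  show ?thesis
  proof (intro conjI allI)
    show "has_presentation R (tw_gens q) (tw_rels q)" unfolding R_def by (rule TW_presentation)
    fix \<alpha> :: 'k and s :: int
    define Z where "Z = k1 [^]\<^bsub>Uq q\<^esub> (int n * s)"
    have "Z \<in> trivially_acting"
      \<comment> \<open>For either sign of s, the element is a natural power of K^n or of
        K^{-n}.\<close>
      unfolding Z_def Uq_int_pow using K_pow_trivially_acting[OF assms(5)] by (simp only: trivially_acting_pow split: if_split) simp
    then interpret deformed q \<tau> actT act \<alpha> Z
      by unfold_locales (simp_all add: trivially_acting_def)
    show "\<exists>\<kappa>.
       lin_map (free_alg\<lparr>carrier := lspan free_alg (tw_rels q)\<rparr>) H \<kappa> \<and>
       \<kappa> (r4 q) = \<alpha> \<odot>\<^bsub>H\<^esub> (uqg q gK [^]\<^bsub>H\<^esub> (int n * s)) \<and>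
       \<kappa> (r5 q) = (- inverse q * \<alpha>) \<odot>\<^bsub>H\<^esub> (uqg q gK [^]\<^bsub>H\<^esub> (int n * s)) \<and>
       \<kappa> (r1 q) = \<zero>\<^bsub>H\<^esub> \<and> \<kappa> (r2 q) = \<zero>\<^bsub>H\<^esub> \<and> \<kappa> (r3 q) = \<zero>\<^bsub>H\<^esub> \<and> \<kappa> (r6 q) = \<zero>\<^bsub>H\<^esub> \<and>
       pbw_deformation (deform H actT (tw_rels q) \<kappa>) (deform_filtration H actT (tw_rels q) \<kappa>)
         (smash R H (tensor_act H A A act act))
         (smash_grading R H (tensor_grading A A (qplane_grading q) (qplane_grading q)))"
      using kappa_lin deformation_pbw
      by (intro exI[of _ kappa]) (simp add: kappa_def kap_rels H_def A_def R_def Z_def[symmetric])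
  qed
qed

end
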